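(* Let $(M,\omega)$ be a connected symplectic manifold and let $X_0,X_1,Y_0,Y_1\subset M$ be compact sets with $X_0\cap X_1=Y_0\cap Y_1=\emptyset$. Let $\widehat{X}_i=X_i\times\mathbb{S}^1$, $\widehat{Y}_i=Y_i\times\mathbb{S}^1$ be the $\mathbb{S}^1$-stabilizations in $M\times T^*\mathbb{S}^1$. Then $$1/pb_4^+(X_0,X_1,Y_0,Y_1)=\bar{\kappa}_{aut}\le\bar{\kappa}\le1/pb_4^+(\widehat{X}_0,\widehat{X}_1,\widehat{Y}_0,\widehat{Y}_1).$$ In particular, if $pb_4^+(\widehat{X}_0,\widehat{X}_1,\widehat{Y}_0,\widehat{Y}_1)=:1/\kappa>0$, then the pair $(Y_0,Y_1)$ $\kappa$-interlinks the pair $(X_0,X_1)$, and if $pb_4^+(X_0,X_1,Y_0,Y_1)=:1/\kappa>0$, then the pair $(Y_0,Y_1)$ autonomously $\kappa$-interlinks the pair $(X_0,X_1)$.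
   Context: Notation: $\mathbb{S}^1=\mathbb{R}/\mathbb{Z}$. $\mathrm{sgrad}\,G$ is defined by $i_{\mathrm{sgrad}\,G}\omega=-dG$ and $\{F,G\}:=\omega(\mathrm{sgrad}\,G,\mathrm{sgrad}\,F)=dF(\mathrm{sgrad}\,G)$. $T^*\mathbb{S}^1=\mathbb{R}(r)\times\mathbb{S}^1(\theta)$ carries $dr\wedge d\theta$; $M\times T^*\mathbb{S}^1$ carries the product symplectic form; $X\times\mathbb{S}^1$ is the product of $X$ with the zero section $\{r=0\}$. Poisson bracket invariant: $pb_4^+(X_0,X_1,Y_0,Y_1):=\inf\max_M\{F,G\}$, the infimum over all smooth compactly supported $F,G:M\to\mathbb{R}$ with $F|_{X_0}\le0$, $F|_{X_1}\ge1$, $G|_{Y_0}\le0$, $G|_{Y_1}\ge1$ (and with $M\times T^*\mathbb{S}^1$ in place of $M$ for the stabilized sets). Convention: $1/0=+\infty$. A (time-periodic, smooth) Hamiltonian $G:M\times\mathbb{S}^1\to\mathbb{R}$ is complete if the flow of $\mathrm{sgrad}\,G_t$, $G_t=G(\cdot,t)$, is defined everywhere for all times. A chord of $G$ from $X_0$ to $X_1$ is a piece of an integral trajectory of $\mathrm{sgrad}\,G_t$ over a time interval $[t_0,t_1]$, $t_0<t_1$, lying in $X_0$ at time $t_0$ and in $X_1$ at time $t_1$; its time-length is $t_1-t_0$. $G$ $\Delta$-separates $Y_0$ and $Y_1$ if $\Delta:=\min_{Y_1\times\mathbb{S}^1}G-\max_{Y_0\times\mathbb{S}^1}G>0$. For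 $\kappa>0$, $(Y_0,Y_1)$ $\kappa$-interlinks $(X_0,X_1)$ if every complete (time-periodic) Hamiltonian on $M$ which $\Delta$-separates $Y_0$ and $Y_1$ admits a chord from $X_0$ to $X_1$ of time-length $\le\kappa/\Delta$; it autonomously $\kappa$-interlinks $(X_0,X_1)$ if this property holds for complete autonomous (time-independent) Hamiltonians on $M$. $\bar{\kappa}$ (resp. $\bar{\kappa}_{aut}$) is the infimum of all $\kappa>0$ such that $(Y_0,Y_1)$ $\kappa$-interlinks (resp. autonomously $\kappa$-interlinks) $(X_0,X_1)$, set to $+\infty$ if there is no such $\kappa$. *)

theory Defs
  imports "HOL-Analysis.Analysis"
begin

section \<open>Smooth maps between Euclidean spaces\<close>

fun Ck_on :: "nat \<Rightarrow> 'e::euclidean_space set \<Rightarrow> ('e \<Rightarrow> 'f::euclidean_space) \<Rightarrow> bool" where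
  "Ck_on 0 S f \<longleftrightarrow> continuous_on S f"
| "Ck_on (Suc k) S f \<longleftrightarrow>
     (\<forall>x\<in>S. f differentiable (at x)) \<and> (\<forall>v. Ck_on k S (\<lambda>x. frechet_derivative f (at x) v))"

text \<open>Only used for open \<open>S\<close>.\<close>
definition smooth_on :: "'e::euclidean_space set \<Rightarrow> ('e \<Rightarrow> 'f::euclidean_space) \<Rightarrow> bool" where
  "smooth_on S f \<longleftrightarrow> (\<forall>k. Ck_on k S f)"


section \<open>Smooth manifolds\<close>

text \<open>A manifold is given by a topology on its set of points and an atlas, a family of charts
  \<open>mchart M i\<close> with domains \<open>mdom M i\<close>, for \<open>i \<in> mindex M\<close>. The values of \<open>mchart M i\<close> outside
  \<open>mdom M i\<close> are irrelevant.\<close>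

record ('i, 'a, 'e) mfd =
  mtop :: "'a topology"
  mindex :: "'i set"
  mdom :: "'i \<Rightarrow> 'a set"
  mchart :: "'i \<Rightarrow> 'a \<Rightarrow> 'e"

abbreviation mpoints :: "('i, 'a, 'e, 'm) mfd_scheme \<Rightarrow> 'a set" where
  "mpoints M \<equiv> topspace (mtop M)"

definition mrange :: "('i, 'a, 'e, 'm) mfd_scheme \<Rightarrow> 'i \<Rightarrow> 'e set" where
  "mrange M i = mchart M i ` mdom M i"

definition mparam :: "('i, 'a, 'e, 'm) mfd_scheme \<Rightarrow> 'i \<Rightarrow> 'e \<Rightarrow> 'a" where
  "mparam M i = inv_into (mdom M i) (mchart M i)"

definition transition :: "('i, 'a, 'e, 'm) mfd_scheme \<Rightarrow> 'i \<Rightarrow> 'i \<Rightarrow> 'e \<Rightarrow> 'e" where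
  "transition M i j = mchart M j \<circ> mparam M i"

definition smooth_manifold :: "('i, 'a, 'e::euclidean_space, 'm) mfd_scheme \<Rightarrow> bool" where
  "smooth_manifold M \<longleftrightarrow>
     mpoints M \<noteq> {} \<and> Hausdorff_space (mtop M) \<and> second_countable (mtop M) \<and>
     (\<Union>i\<in>mindex M. mdom M i) = mpoints M \<and>
     (\<forall>i\<in>mindex M. openin (mtop M) (mdom M i) \<and> open (mrange M i) \<and>
        homeomorphic_map (subtopology (mtop M) (mdom M i)) (top_of_set (mrange M i)) (mchart M i)) \<and>
     (\<forall>i\<in>mindex M. \<forall>j\<in>mindex M.
        smooth_on (mchart M i ` (mdom M i \<inter> mdom M j)) (transition M i j))"

definition smooth_function ::
  "('i, 'a, 'e::euclidean_space, 'm) mfd_scheme \<Rightarrow> ('a \<Rightarrow> real) \<Rightarrow> bool" where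
  "smooth_function M f \<longleftrightarrow> (\<forall>i\<in>mindex M. smooth_on (mrange M i) (f \<circ> mparam M i))"

definition compactly_supported ::
  "('i, 'a, 'e, 'm) mfd_scheme \<Rightarrow> ('a \<Rightarrow> real) \<Rightarrow> bool" where
  "compactly_supported M f \<longleftrightarrow> (\<exists>K. compactin (mtop M) K \<and> (\<forall>p\<in>mpoints M - K. f p = 0))"

definition prod_mfd ::
  "('i, 'a, 'e, 'm) mfd_scheme \<Rightarrow> ('j, 'b, 'f, 'n) mfd_scheme
   \<Rightarrow> ('i \<times> 'j, 'a \<times> 'b, 'e \<times> 'f) mfd" where
  "prod_mfd M N =
     \<lparr>mtop = prod_topology (mtop M) (mtop N),
      mindex = mindex M \<times> mindex N,
      mdom = (\<lambda>(i, j). mdom M i \<times> mdom N j),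
      mchart = (\<lambda>(i, j). map_prod (mchart M i) (mchart N j))\<rparr>"


section \<open>Symplectic manifolds\<close>

text \<open>\<open>sform M i x u v\<close> is the value of the 2-form at the point with coordinates \<open>x\<close> in the chart
  \<open>i\<close>, on the tangent vectors with coordinate vectors \<open>u\<close> and \<open>v\<close>.\<close>

record ('i, 'a, 'e) sympl = "('i, 'a, 'e) mfd" +
  sform :: "'i \<Rightarrow> 'e \<Rightarrow> 'e \<Rightarrow> 'e \<Rightarrow> real"

definition two_form :: "('i, 'a, 'e::euclidean_space, 'm) sympl_scheme \<Rightarrow> bool" where
  "two_form M \<longleftrightarrow>
     (\<forall>i\<in>mindex M. \<forall>x\<in>mrange M i. bilinear (sform M i x) \<and> (\<forall>u. sform M i x u u = 0)) \<and>
     (\<forall>i\<in>mindex M. \<forall>u v. smooth_on (mrange M i) (\<lambda>x. sform M i x u v)) \<and>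
     (\<forall>i\<in>mindex M. \<forall>j\<in>mindex M. \<forall>p\<in>mdom M i \<inter> mdom M j. \<forall>u v.
        let D = frechet_derivative (transition M i j) (at (mchart M i p))
        in sform M i (mchart M i p) u v = sform M j (mchart M j p) (D u) (D v))"

text \<open>The exterior derivative evaluated on the coordinate (hence commuting) vector fields
  \<open>u\<close>, \<open>v\<close>, \<open>w\<close>.\<close>
definition closed_form :: "('i, 'a, 'e::euclidean_space, 'm) sympl_scheme \<Rightarrow> bool" where
  "closed_form M \<longleftrightarrow>
     (\<forall>i\<in>mindex M. \<forall>x\<in>mrange M i. \<forall>u v w.
        frechet_derivative (\<lambda>y. sform M i y v w) (at x) u
      + frechet_derivative (\<lambda>y. sform M i y w u) (at x) v
      + frechet_derivative (\<lambda>y. sform M i y u v) (at x) w = 0)"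

definition nondegenerate_form :: "('i, 'a, 'e::euclidean_space, 'm) sympl_scheme \<Rightarrow> bool" where
  "nondegenerate_form M \<longleftrightarrow>
     (\<forall>i\<in>mindex M. \<forall>x\<in>mrange M i. \<forall>u. (\<forall>v. sform M i x u v = 0) \<longrightarrow> u = 0)"

definition symplectic_manifold :: "('i, 'a, 'e::euclidean_space, 'm) sympl_scheme \<Rightarrow> bool" where
  "symplectic_manifold M \<longleftrightarrow>
     smooth_manifold M \<and> two_form M \<and> closed_form M \<and> nondegenerate_form M"

definition prod_sympl ::
  "('i, 'a, 'e, 'm) sympl_scheme \<Rightarrow> ('j, 'b, 'f, 'n) sympl_scheme
   \<Rightarrow> ('i \<times> 'j, 'a \<times> 'b, 'e \<times> 'f) sympl" where
  "prod_sympl M N = mfd.extend (prod_mfd M N)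
     \<lparr>sform = (\<lambda>(i, j) (x, y) (u, u') (v, v'). sform M i x u v + sform N j y u' v')\<rparr>"


section \<open>Hamiltonian vector fields and Poisson brackets\<close>

definition dcoord ::
  "('i, 'a, 'e::euclidean_space, 'm) mfd_scheme \<Rightarrow> ('a \<Rightarrow> real) \<Rightarrow> 'i \<Rightarrow> 'a \<Rightarrow> 'e \<Rightarrow> real" where
  "dcoord M G i p = frechet_derivative (G \<circ> mparam M i) (at (mchart M i p))"

text \<open>The coordinate vector, in the chart \<open>i\<close>, of the vector \<open>sgrad G\<close> at the point \<open>p\<close>.\<close>
definition sgrad ::
  "('i, 'a, 'e::euclidean_space, 'm) sympl_scheme \<Rightarrow> ('a \<Rightarrow> real) \<Rightarrow> 'i \<Rightarrow> 'a \<Rightarrow> 'e" where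
  "sgrad M G i p = (THE u. \<forall>v. sform M i (mchart M i p) u v = - dcoord M G i p v)"

text \<open>The bracket is computed in an arbitrary chart around \<open>p\<close>.\<close>
definition poisson ::
  "('i, 'a, 'e::euclidean_space, 'm) sympl_scheme \<Rightarrow> ('a \<Rightarrow> real) \<Rightarrow> ('a \<Rightarrow> real) \<Rightarrow> 'a \<Rightarrow> real" where
  "poisson M F G p =
     (let i = (SOME i. i \<in> mindex M \<and> p \<in> mdom M i)
      in sform M i (mchart M i p) (sgrad M G i p) (sgrad M F i p))"


text \<open>For smooth functions, \<open>sgrad\<close> satisfies its defining equation, transforms as a vector
  field, and the bracket does not depend on the chart.\<close>

lemma smooth_on_differentiable: "smooth_on S f \<Longrightarrow> x \<in> S \<Longrightarrow> f differentiable (at x)"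
  unfolding smooth_on_def by (drule spec[of _ "Suc 0"]) auto

lemma sgrad_unique:
  fixes M :: "('i, 'a, 'e::euclidean_space, 'm) sympl_scheme"
  assumes M: "symplectic_manifold M" and i: "i \<in> mindex M" and p: "p \<in> mdom M i"
    and G: "smooth_function M G"
  shows "(\<forall>v. sform M i (mchart M i p) u v = - dcoord M G i p v) \<longleftrightarrow> u = sgrad M G i p"
proof -
  let ?x = "mchart M i p"
  let ?B = "sform M i ?x"
  have x: "?x \<in> mrange M i" using p by (simp add: mrange_def)
  have bl: "bilinear ?B" and nd: "\<And>u. (\<forall>v. ?B u v = 0) \<Longrightarrow> u = 0"
    using M i x by (auto simp: symplectic_manifold_def two_form_def nondegenerate_form_def)
  have lr: "linear (?B u)" and ll: "linear (\<lambda>u. ?B u v)" for u v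
    using bl by (auto simp: bilinear_def)
  have "(G \<circ> mparam M i) differentiable (at ?x)"
    using G i x by (auto simp: smooth_function_def intro: smooth_on_differentiable)
  then have ld: "linear (dcoord M G i p)"
    unfolding dcoord_def by (rule linear_frechet_derivative)
  have ex: "\<exists>u. \<forall>v. ?B u v = - dcoord M G i p v"
  proof -
    define L where "L u = (\<Sum>b\<in>Basis. ?B u b *\<^sub>R b)" for u
    have Lb: "L u \<bullet> b = ?B u b" if "b \<in> Basis" for u b
      using that by (simp add: L_def inner_sum_left_Basis)
    have lin: "linear L"
      by (rule linearI) (simp_all add: L_def linear_add[OF ll] linear_scale[OF ll]
        scaleR_add_left sum.distrib scaleR_sum_right)
    have ext: "f = g" if "linear f" "linear g" "\<And>b. b \<in> Basis \<Longrightarrow> f b = g b" for f g :: "'e \<Rightarrow> real"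
      using that by (metis linear_eq_stdbasis)
    have "inj L"
    proof (subst linear_injective_0[OF lin], intro allI impI)
      fix u assume "L u = 0"
      then have "?B u b = 0" if "b \<in> Basis" for b using Lb[OF that, of u] by simp
      then have "?B u = (\<lambda>_. 0)" by (intro ext lr linear_zero) auto
      then show "u = 0" using nd by metis
    qed
    then have "surj L" using linear_injective_imp_surjective[OF lin] by blast
    then obtain u where u: "L u = (\<Sum>b\<in>Basis. (- dcoord M G i p b) *\<^sub>R b)" by (metis surjD)
    have "?B u b = - dcoord M G i p b" if "b \<in> Basis" for b
      using Lb[OF that, of u] that unfolding u by (simp del: scaleR_minus_left)
    then have "?B u = (\<lambda>v. - dcoord M G i p v)"
      by (intro ext lr linear_compose_neg ld) auto
    then show ?thesis by metis
  qed
  have un: "u = u'" if "\<forall>v. ?B u v = - dcoord M G i p v" "\<forall>v. ?B u' v = - dcoord M G i p v" for u u'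
  proof -
    have "?B (u - u') v = 0" for v
      using that linear_diff[OF ll[of v], of u u'] by simp
    then have "u - u' = 0" using nd by blast
    then show ?thesis by simp
  qed
  have "\<exists>!u. \<forall>v. ?B u v = - dcoord M G i p v" using ex un by blast
  from theI'[OF this] have "\<forall>v. ?B (sgrad M G i p) v = - dcoord M G i p v"
    unfolding sgrad_def .
  then show ?thesis using un by blast
qed

lemma mparam_mchart:
  assumes "smooth_manifold M" "i \<in> mindex M" "p \<in> mdom M i"
  shows "mparam M i (mchart M i p) = p"
proof -
  have h: "homeomorphic_map (subtopology (mtop M) (mdom M i)) (top_of_set (mrange M i)) (mchart M i)"
    and o: "openin (mtop M) (mdom M i)"
    using assms by (auto simp: smooth_manifold_def)
  have "inj_on (mchart M i) (mdom M i)"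
    using homeomorphic_imp_injective_map[OF h] openin_subset[OF o]
    by (simp add: topspace_subtopology inf.absorb2)
  then show ?thesis using assms(3) by (simp add: mparam_def)
qed

lemma open_overlap:
  assumes "smooth_manifold M" "i \<in> mindex M" "j \<in> mindex M"
  shows "open (mchart M i ` (mdom M i \<inter> mdom M j))"
proof -
  have h: "homeomorphic_map (subtopology (mtop M) (mdom M i)) (top_of_set (mrange M i)) (mchart M i)"
    and o: "openin (mtop M) (mdom M j)" and r: "open (mrange M i)"
    using assms by (auto simp: smooth_manifold_def)
  have "openin (subtopology (mtop M) (mdom M i)) (mdom M i \<inter> mdom M j)"
    using o by (auto simp: openin_subtopology)
  then have "openin (top_of_set (mrange M i)) (mchart M i ` (mdom M i \<inter> mdom M j))"
    using h homeomorphic_imp_open_map open_map_def by blast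
  then show ?thesis using r openin_open_trans by blast
qed

lemma transition_derivative:
  fixes M :: "('i, 'a, 'e::euclidean_space, 'm) mfd_scheme"
  assumes M: "smooth_manifold M" and i: "i \<in> mindex M" and j: "j \<in> mindex M"
    and p: "p \<in> mdom M i \<inter> mdom M j"
  shows "(transition M i j has_derivative frechet_derivative (transition M i j) (at (mchart M i p)))
    (at (mchart M i p))"
proof -
  have "smooth_on (mchart M i ` (mdom M i \<inter> mdom M j)) (transition M i j)"
    using M i j by (simp add: smooth_manifold_def)
  then have "transition M i j differentiable (at (mchart M i p))"
    using p by (intro smooth_on_differentiable) auto
  then show ?thesis by (simp add: frechet_derivative_works)
qed

lemma transition_chart:
  assumes "smooth_manifold M" "i \<in> mindex M" "q \<in> mdom M i"
  shows "transition M i j (mchart M i q) = mchart M j q"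
  using mparam_mchart[OF assms] by (simp add: transition_def)

lemma transition_derivative_inverse:
  fixes M :: "('i, 'a, 'e::euclidean_space, 'm) mfd_scheme"
  assumes M: "smooth_manifold M" and i: "i \<in> mindex M" and j: "j \<in> mindex M"
    and p: "p \<in> mdom M i \<inter> mdom M j"
  shows "frechet_derivative (transition M j i) (at (mchart M j p))
     (frechet_derivative (transition M i j) (at (mchart M i p)) v) = v"
proof -
  let ?D = "frechet_derivative (transition M i j) (at (mchart M i p))"
  let ?E = "frechet_derivative (transition M j i) (at (mchart M j p))"
  have y: "transition M i j (mchart M i p) = mchart M j p"
    using transition_chart[OF M i] p by auto
  have "(transition M j i \<circ> transition M i j has_derivative ?E \<circ> ?D) (at (mchart M i p))"
    using transition_derivative[OF M i j p] transition_derivative[OF M j i, of p] p y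
    by (intro diff_chain_at) auto
  moreover have "(transition M j i \<circ> transition M i j) z = z"
    if "z \<in> mchart M i ` (mdom M i \<inter> mdom M j)" for z
    using that transition_chart[OF M i] transition_chart[OF M j] by auto
  ultimately have "((\<lambda>z. z) has_derivative ?E \<circ> ?D) (at (mchart M i p))"
    using open_overlap[OF M i j] p
    by (elim has_derivative_transform_within_open) auto
  then have "?E \<circ> ?D = (\<lambda>z. z)"
    using has_derivative_ident has_derivative_unique by blast
  then show ?thesis by (metis comp_apply)
qed

lemma dcoord_transition:
  fixes M :: "('i, 'a, 'e::euclidean_space, 'm) mfd_scheme"
  assumes M: "smooth_manifold M" and i: "i \<in> mindex M" and j: "j \<in> mindex M"
    and p: "p \<in> mdom M i \<inter> mdom M j" and G: "smooth_function M G"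
  shows "dcoord M G i p v
    = dcoord M G j p (frechet_derivative (transition M i j) (at (mchart M i p)) v)"
proof -
  let ?D = "frechet_derivative (transition M i j) (at (mchart M i p))"
  have y: "transition M i j (mchart M i p) = mchart M j p"
    using transition_chart[OF M i] p by auto
  have "(G \<circ> mparam M j) differentiable (at (mchart M j p))"
    using G j p by (auto simp: smooth_function_def mrange_def intro: smooth_on_differentiable)
  then have "((G \<circ> mparam M j) has_derivative dcoord M G j p) (at (mchart M j p))"
    unfolding dcoord_def by (simp add: frechet_derivative_works)
  then have "((G \<circ> mparam M j) \<circ> transition M i j has_derivative dcoord M G j p \<circ> ?D) (at (mchart M i p))"
    using transition_derivative[OF M i j p] y by (intro diff_chain_at) auto
  moreover have "((G \<circ> mparam M j) \<circ> transition M i j) z = (G \<circ> mparam M i) z"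
    if "z \<in> mchart M i ` (mdom M i \<inter> mdom M j)" for z
    using that transition_chart[OF M i] mparam_mchart[OF M i] mparam_mchart[OF M j] by auto
  ultimately have "((G \<circ> mparam M i) has_derivative dcoord M G j p \<circ> ?D) (at (mchart M i p))"
    using open_overlap[OF M i j] p
    by (elim has_derivative_transform_within_open) auto
  then have "dcoord M G j p \<circ> ?D = dcoord M G i p"
    unfolding dcoord_def by (rule frechet_derivative_at)
  then show ?thesis by (metis comp_apply)
qed

lemma two_form_transition:
  assumes "two_form M" "i \<in> mindex M" "j \<in> mindex M" "p \<in> mdom M i \<inter> mdom M j"
  shows "sform M i (mchart M i p) u v = sform M j (mchart M j p)
    (frechet_derivative (transition M i j) (at (mchart M i p)) u)
    (frechet_derivative (transition M i j) (at (mchart M i p)) v)"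
  using assms unfolding two_form_def Let_def by blast

lemma sgrad_transition:
  fixes M :: "('i, 'a, 'e::euclidean_space, 'm) sympl_scheme"
  assumes M: "symplectic_manifold M" and i: "i \<in> mindex M" and j: "j \<in> mindex M"
    and p: "p \<in> mdom M i \<inter> mdom M j" and G: "smooth_function M G"
  shows "sgrad M G j p = frechet_derivative (transition M i j) (at (mchart M i p)) (sgrad M G i p)"
proof -
  let ?D = "frechet_derivative (transition M i j) (at (mchart M i p))"
  let ?E = "frechet_derivative (transition M j i) (at (mchart M j p))"
  have sm: "smooth_manifold M" and tf: "two_form M" using M by (auto simp: symplectic_manifold_def)
  have DE: "?D (?E w) = w" for w
    using transition_derivative_inverse[OF sm j i, of p w] p by auto
  have inv: "sform M i (mchart M i p) u v = sform M j (mchart M j p) (?D u) (?D v)" for u v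
    using two_form_transition[OF tf i j p] .
  have "sform M j (mchart M j p) (?D (sgrad M G i p)) w = - dcoord M G j p w" for w
    using sgrad_unique[OF M i _ G, of p "sgrad M G i p"] p inv[of "sgrad M G i p" "?E w"]
      dcoord_transition[OF sm i j p G, of "?E w"]
    by (auto simp: DE)
  then have "?D (sgrad M G i p) = sgrad M G j p"
    using sgrad_unique[OF M j _ G, of p "?D (sgrad M G i p)"] p by blast
  then show ?thesis by simp
qed

lemma poisson_chart:
  fixes M :: "('i, 'a, 'e::euclidean_space, 'm) sympl_scheme"
  assumes M: "symplectic_manifold M" and i: "i \<in> mindex M" and p: "p \<in> mdom M i"
    and F: "smooth_function M F" and G: "smooth_function M G"
  shows "poisson M F G p = sform M i (mchart M i p) (sgrad M G i p) (sgrad M F i p)"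
proof -
  define j where "j = (SOME i. i \<in> mindex M \<and> p \<in> mdom M i)"
  have "j \<in> mindex M \<and> p \<in> mdom M j"
    unfolding j_def by (rule someI[of _ i]) (use i p in auto)
  then have j: "j \<in> mindex M" and pj: "p \<in> mdom M i \<inter> mdom M j" using p by auto
  have "two_form M" using M by (simp add: symplectic_manifold_def)
  then show ?thesis
    unfolding poisson_def j_def[symmetric] Let_def
      sgrad_transition[OF M i j pj F] sgrad_transition[OF M i j pj G]
    by (rule two_form_transition[OF _ i j pj, symmetric])
qed


section \<open>The Poisson bracket invariant\<close>

definition pb4_pairs ::
  "('i, 'a, 'e::euclidean_space, 'm) sympl_scheme \<Rightarrow> 'a set \<Rightarrow> 'a set \<Rightarrow> 'a set \<Rightarrow> 'a set
   \<Rightarrow> (('a \<Rightarrow> real) \<times> ('a \<Rightarrow> real)) set" where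
  "pb4_pairs M X0 X1 Y0 Y1 =
     {(F, G).
        smooth_function M F \<and> compactly_supported M F \<and>
        smooth_function M G \<and> compactly_supported M G \<and>
        (\<forall>p\<in>X0. F p \<le> 0) \<and> (\<forall>p\<in>X1. F p \<ge> 1) \<and>
        (\<forall>p\<in>Y0. G p \<le> 0) \<and> (\<forall>p\<in>Y1. G p \<ge> 1)}"

definition pb4_plus ::
  "('i, 'a, 'e::euclidean_space, 'm) sympl_scheme \<Rightarrow> 'a set \<Rightarrow> 'a set \<Rightarrow> 'a set \<Rightarrow> 'a set \<Rightarrow> ereal"
where
  "pb4_plus M X0 X1 Y0 Y1 =
     (INF (F, G)\<in>pb4_pairs M X0 X1 Y0 Y1. SUP p\<in>mpoints M. ereal (poisson M F G p))"


section \<open>The circle and its cotangent bundle\<close>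

quotient_type circle = real / "\<lambda>x y. x - y \<in> \<int>" morphisms rep_circle circ
proof (rule equivpI)
  show "reflp (\<lambda>x y::real. x - y \<in> \<int>)"
    by (simp add: reflp_def)
  show "symp (\<lambda>x y::real. x - y \<in> \<int>)"
    by (metis (lifting) Ints_minus minus_diff_eq sympI)
  show "transp (\<lambda>x y::real. x - y \<in> \<int>)"
  proof (rule transpI)
    fix x y z :: real
    assume "x - y \<in> \<int>" "y - z \<in> \<int>"
    then have "(x - y) + (y - z) \<in> \<int>" by (rule Ints_add)
    then show "x - z \<in> \<int>" by simp
  qed
qed

definition circle_topology :: "circle topology" where
  "circle_topology = topology (\<lambda>U. open (circ -` U))"

lemma openin_circle_topology: "openin circle_topology U \<longleftrightarrow> open (circ -` U)"
proof -
  have "istopology (\<lambda>U. open (circ -` U))"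
    by (auto simp: istopology_def vimage_Int vimage_Union)
  then show ?thesis
    by (simp add: circle_topology_def)
qed

text \<open>The chart with index \<open>a\<close> is the inverse of \<open>circ\<close> on the interval of length 1 centred
  at \<open>a\<close>.\<close>
definition circle_mfd :: "(real, circle, real) mfd" where
  "circle_mfd =
     \<lparr>mtop = circle_topology,
      mindex = UNIV,
      mdom = (\<lambda>a. circ ` {a - 1/2<..<a + 1/2}),
      mchart = (\<lambda>a. inv_into {a - 1/2<..<a + 1/2} circ)\<rparr>"

definition line_mfd :: "(unit, real, real) mfd" where
  "line_mfd = \<lparr>mtop = euclidean, mindex = UNIV, mdom = (\<lambda>_. UNIV), mchart = (\<lambda>_ r. r)\<rparr>"

text \<open>The cotangent bundle of the circle, with coordinates \<open>(r, \<theta>)\<close> and the form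
  \<open>dr \<and> d\<theta>\<close>.\<close>
definition cotangent_circle :: "(unit \<times> real, real \<times> circle, real \<times> real) sympl" where
  "cotangent_circle = mfd.extend (prod_mfd line_mfd circle_mfd)
     \<lparr>sform = (\<lambda>_ _ (r, \<theta>) (r', \<theta>'). r * \<theta>' - r' * \<theta>)\<rparr>"

definition stabilization :: "'a set \<Rightarrow> ('a \<times> (real \<times> circle)) set" where
  "stabilization X = X \<times> ({0} \<times> UNIV)"


section \<open>Hamiltonian dynamics and interlinking\<close>

text \<open>A time-periodic Hamiltonian is a function \<open>G\<close> on \<open>M \<times> S\<^sup>1\<close>; its value at time \<open>t\<close> is the
  function \<open>time_slice G t\<close> on \<open>M\<close>.\<close>

definition time_slice :: "('a \<times> circle \<Rightarrow> real) \<Rightarrow> real \<Rightarrow> 'a \<Rightarrow> real" where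
  "time_slice G t = (\<lambda>p. G (p, circ t))"

definition hamiltonian ::
  "('i, 'a, 'e::euclidean_space, 'm) sympl_scheme \<Rightarrow> ('a \<times> circle \<Rightarrow> real) \<Rightarrow> bool" where
  "hamiltonian M G \<longleftrightarrow> smooth_function (prod_mfd M circle_mfd) G"

definition autonomous ::
  "('i, 'a, 'e, 'm) mfd_scheme \<Rightarrow> ('a \<times> circle \<Rightarrow> real) \<Rightarrow> bool" where
  "autonomous M G \<longleftrightarrow> (\<forall>p\<in>mpoints M. \<forall>s s'. G (p, s) = G (p, s'))"

text \<open>Continuity guarantees that \<open>\<gamma>\<close> stays in the chart domain near each time \<open>t\<close>, so that the
  derivative in the chart is meaningful.\<close>
definition trajectory ::
  "('i, 'a, 'e::euclidean_space, 'm) sympl_scheme \<Rightarrow> ('a \<times> circle \<Rightarrow> real)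
   \<Rightarrow> real set \<Rightarrow> (real \<Rightarrow> 'a) \<Rightarrow> bool" where
  "trajectory M G T \<gamma> \<longleftrightarrow>
     continuous_map (top_of_set T) (mtop M) \<gamma> \<and>
     (\<forall>t\<in>T. \<forall>i\<in>mindex M. \<gamma> t \<in> mdom M i \<longrightarrow>
        ((\<lambda>s. mchart M i (\<gamma> s)) has_vector_derivative sgrad M (time_slice G t) i (\<gamma> t))
          (at t within T))"

definition complete_hamiltonian ::
  "('i, 'a, 'e::euclidean_space, 'm) sympl_scheme \<Rightarrow> ('a \<times> circle \<Rightarrow> real) \<Rightarrow> bool" where
  "complete_hamiltonian M G \<longleftrightarrow>
     hamiltonian M G \<and> (\<forall>t0. \<forall>p\<in>mpoints M. \<exists>\<gamma>. trajectory M G UNIV \<gamma> \<and> \<gamma> t0 = p)"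

definition has_chord ::
  "('i, 'a, 'e::euclidean_space, 'm) sympl_scheme \<Rightarrow> ('a \<times> circle \<Rightarrow> real)
   \<Rightarrow> 'a set \<Rightarrow> 'a set \<Rightarrow> ereal \<Rightarrow> bool" where
  "has_chord M G X0 X1 L \<longleftrightarrow>
     (\<exists>t0 t1 \<gamma>. t0 < t1 \<and> trajectory M G {t0..t1} \<gamma> \<and> \<gamma> t0 \<in> X0 \<and> \<gamma> t1 \<in> X1 \<and>
        ereal (t1 - t0) \<le> L)"

text \<open>For nonempty compact \<open>Y0\<close>, \<open>Y1\<close> and continuous \<open>G\<close> this is the real number
  \<open>min G - max G\<close>, with the minimum over \<open>Y1 \<times> S\<^sup>1\<close> and the maximum over \<open>Y0 \<times> S\<^sup>1\<close>. If \<open>Y0\<close> or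
  \<open>Y1\<close> is empty, it is \<open>\<infinity>\<close>.\<close>
definition separation :: "('a \<times> circle \<Rightarrow> real) \<Rightarrow> 'a set \<Rightarrow> 'a set \<Rightarrow> ereal" where
  "separation G Y0 Y1 = (INF z\<in>Y1 \<times> UNIV. ereal (G z)) - (SUP z\<in>Y0 \<times> UNIV. ereal (G z))"

definition interlinks ::
  "('i, 'a, 'e::euclidean_space, 'm) sympl_scheme \<Rightarrow> real
   \<Rightarrow> 'a set \<Rightarrow> 'a set \<Rightarrow> 'a set \<Rightarrow> 'a set \<Rightarrow> bool" where
  "interlinks M \<kappa> Y0 Y1 X0 X1 \<longleftrightarrow>
     (\<forall>G. complete_hamiltonian M G \<and> separation G Y0 Y1 > 0 \<longrightarrow>
        has_chord M G X0 X1 (ereal \<kappa> / separation G Y0 Y1))"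

definition autonomously_interlinks ::
  "('i, 'a, 'e::euclidean_space, 'm) sympl_scheme \<Rightarrow> real
   \<Rightarrow> 'a set \<Rightarrow> 'a set \<Rightarrow> 'a set \<Rightarrow> 'a set \<Rightarrow> bool" where
  "autonomously_interlinks M \<kappa> Y0 Y1 X0 X1 \<longleftrightarrow>
     (\<forall>G. complete_hamiltonian M G \<and> autonomous M G \<and> separation G Y0 Y1 > 0 \<longrightarrow>
        has_chord M G X0 X1 (ereal \<kappa> / separation G Y0 Y1))"

text \<open>The infimum of the empty set is \<open>\<infinity>\<close> in \<^typ>\<open>ereal\<close>.\<close>
definition kappa_bar ::
  "('i, 'a, 'e::euclidean_space, 'm) sympl_scheme
   \<Rightarrow> 'a set \<Rightarrow> 'a set \<Rightarrow> 'a set \<Rightarrow> 'a set \<Rightarrow> ereal" where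
  "kappa_bar M X0 X1 Y0 Y1 = (INF \<kappa>\<in>{\<kappa>. \<kappa> > 0 \<and> interlinks M \<kappa> Y0 Y1 X0 X1}. ereal \<kappa>)"

definition kappa_bar_aut ::
  "('i, 'a, 'e::euclidean_space, 'm) sympl_scheme
   \<Rightarrow> 'a set \<Rightarrow> 'a set \<Rightarrow> 'a set \<Rightarrow> 'a set \<Rightarrow> ereal" where
  "kappa_bar_aut M X0 X1 Y0 Y1 =
     (INF \<kappa>\<in>{\<kappa>. \<kappa> > 0 \<and> autonomously_interlinks M \<kappa> Y0 Y1 X0 X1}. ereal \<kappa>)"

end

theory Submission
  imports Defs
begin

text \<open>If \<open>{F, G} < 1/T\<close>, then \<open>F\<close> cannot grow from 0 to 1 along a trajectory of \<open>G\<close> within time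
  \<open>T\<close>; so a chord bound forces \<open>pb\<^sub>4\<^sup>+ \<ge> 1/\<kappa>\<close>. Conversely, if a complete autonomous \<open>H\<close> has no chord
  from \<open>X0\<close> to \<open>X1\<close> of length at most \<open>T\<close>, compactness gives a slightly larger \<open>T'\<close> with the same
  property. Let \<open>f\<close> be a cutoff function of \<open>X1\<close> that vanishes on the points reached from \<open>X0\<close> within
  time \<open>T'\<close>. The supremum of \<open>max 0 (f (flow s p) - s/T')\<close> over \<open>0 \<le> s \<le> T'\<close> is a locally Lipschitz function
  that increases along the flow at rate at most \<open>1/T'\<close>, and smoothing it in charts yields \<open>F\<close> with
  \<open>{F, H} < 1/T\<close>. A time-periodic \<open>G\<close> is reduced to the autonomous \<open>r + G(x, \<theta>)\<close> on the
  stabilization, whose chords between stabilized sets project to chords of \<open>G\<close>.\<close>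

section \<open>Calculus of smooth maps\<close>

text \<open>Times and brackets are tied together because \<open>{F, H}\<close> is the derivative of
  \<open>F\<close> along the flow of \<open>H\<close>. The obstacle is regularity. The supremum over
  \<open>s\<close> is only Lipschitz, so its growth bound has to be carried through the smoothing as
  a one-sided estimate of difference quotients. The flow itself is only shown to be Lipschitz in the
  initial point, in a metric made of finitely many smooth functions, so that chart changes along a
  trajectory never matter. The gap between \<open>T\<close> and \<open>T'\<close> pays for every
  loss: the mollification, the partition of unity that glues the charts, and the correction that
  restores \<open>F <= 0\<close> on \<open>X0\<close> and \<open>F >= 1\<close> on
  \<open>X1\<close>. A complete \<open>H\<close> may have unbounded support, but the bracket with a
  compactly supported \<open>F\<close> only sees \<open>H\<close> near the support of
  \<open>F\<close>, so \<open>H\<close> can be cut off elsewhere. In the other direction the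
  compactly supported \<open>G\<close> in the definition of \<open>pb4_plus\<close> are complete and
  may be tested. Failure to \<open>\<kappa>\<close>-interlink yields the strict inequality
  \<open>pb < 1/\<kappa>\<close>; therefore the borderline \<open>\<kappa> = 1/pb\<close> does
  interlink, which is the second half of the theorem.\<close>

lemma Ck_on_subset: "Ck_on k S f \<Longrightarrow> T \<subseteq> S \<Longrightarrow> Ck_on k T f"
  by (induction k arbitrary: f) (auto intro: continuous_on_subset)

lemma frechet_derivative_cong_open:
  assumes "open S" "x \<in> S" "\<And>y. y \<in> S \<Longrightarrow> f y = g y"
  shows "frechet_derivative f (at x) = frechet_derivative g (at x)"
proof -
  have "(f has_derivative D) (at x) \<longleftrightarrow> (g has_derivative D) (at x)" for D
    using has_derivative_transform_within_open[OF _ assms(1,2), of f D UNIV g]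
      has_derivative_transform_within_open[OF _ assms(1,2), of g D UNIV f] assms(3) by auto
  then show ?thesis by (simp add: frechet_derivative_def)
qed

lemma differentiable_cong_open:
  assumes "open S" "x \<in> S" "\<And>y. y \<in> S \<Longrightarrow> f y = g y"
  shows "f differentiable (at x) \<longleftrightarrow> g differentiable (at x)"
    using has_derivative_transform_within_open[OF _ assms(1,2), of f _ UNIV g]
      has_derivative_transform_within_open[OF _ assms(1,2), of g _ UNIV f] assms(3)
    by (auto simp: differentiable_def)

lemma Ck_on_cong:
  assumes "open S" "\<And>x. x \<in> S \<Longrightarrow> f x = g x"
  shows "Ck_on k S f \<longleftrightarrow> Ck_on k S g"
  using assms(2)
proof (induction k arbitrary: f g)
  case 0
  then show ?case by (auto cong: continuous_on_cong)
next
  case (Suc k)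
  have "frechet_derivative f (at x) v = frechet_derivative g (at x) v" if "x \<in> S" for x v
    using frechet_derivative_cong_open[OF assms(1) that Suc.prems] by simp
  then have "Ck_on k S (\<lambda>x. frechet_derivative f (at x) v)
      \<longleftrightarrow> Ck_on k S (\<lambda>x. frechet_derivative g (at x) v)" for v
    by (rule Suc.IH)
  moreover have "f differentiable (at x) \<longleftrightarrow> g differentiable (at x)" if "x \<in> S" for x
    using differentiable_cong_open[OF assms(1) that Suc.prems] by simp
  ultimately show ?case by simp
qed

text \<open>A derivative at a point depends on the function near it only, and the same
  neighbourhoods serve all orders of the induction. Smoothness on a manifold can thus be checked
  where an explicit formula is at hand, such as on one chart overlap.\<close>

lemma Ck_on_local:
  assumes "\<And>x. x \<in> S \<Longrightarrow> \<exists>U. open U \<and> x \<in> U \<and> Ck_on k U f"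
  shows "Ck_on k S f"
  using assms
proof (induction k arbitrary: f)
  case 0
  have "\<exists>U. open U \<and> x \<in> U \<and> continuous_on U f" if "x \<in> S" for x
    using 0 that by auto
  then have "continuous (at x) f" if "x \<in> S" for x
    using that continuous_on_eq_continuous_at by blast
  then show ?case by (simp add: continuous_at_imp_continuous_on)
next
  case (Suc k)
  have "f differentiable (at x)" if "x \<in> S" for x
    using Suc.prems[OF that] by auto
  moreover have "Ck_on k S (\<lambda>x. frechet_derivative f (at x) v)" for v
    by (rule Suc.IH) (use Suc.prems in \<open>auto, blast\<close>)
  ultimately show ?case by simp
qed

lemma Ck_on_SucD: "Ck_on (Suc k) S f \<Longrightarrow> Ck_on k S f"
proof (induction k arbitrary: f)
  case 0
  then show ?case
    by (auto intro!: continuous_at_imp_continuous_on differentiable_imp_continuous_within)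
next
  case (Suc k)
  then show ?case by (metis Ck_on.simps(2))
qed

text \<open>\<open>Ck_on\<close> speaks of the derivative chosen by
  \<open>frechet_derivative\<close>. On an open set any explicit formula \<open>f'\<close> agrees
  with it by uniqueness, so the inductions below can work with formulas.\<close>

lemma Ck_on_SucI:
  assumes "open S" "\<And>x. x \<in> S \<Longrightarrow> (f has_derivative f' x) (at x)"
    "\<And>v. Ck_on k S (\<lambda>x. f' x v)"
  shows "Ck_on (Suc k) S f"
proof -
  have "Ck_on k S (\<lambda>x. frechet_derivative f (at x) v)" for v
  proof -
    have "frechet_derivative f (at x) v = f' x v" if "x \<in> S" for x
      using frechet_derivative_at[OF assms(2)[OF that]] by simp
    then show ?thesis using Ck_on_cong[OF assms(1)] assms(3) by meson
  qed
  then show ?thesis using assms(2) by (auto simp: differentiable_def)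
qed

lemma Ck_on_derivative:
  assumes "Ck_on (Suc k) S f"
  shows "x \<in> S \<Longrightarrow> (f has_derivative frechet_derivative f (at x)) (at x)"
    "Ck_on k S (\<lambda>x. frechet_derivative f (at x) v)"
  using assms frechet_derivative_works by auto

lemma Ck_on_const: "Ck_on k S (\<lambda>x. c)"
  by (induction k arbitrary: c) auto

lemma Ck_on_bounded_linear:
  assumes "open S" "bounded_linear f"
  shows "Ck_on k S f"
proof (cases k)
  case 0
  then show ?thesis using assms linear_continuous_on by auto
next
  case (Suc m)
  show ?thesis unfolding Suc
    by (rule Ck_on_SucI[OF assms(1), of f "\<lambda>_. f"])
      (auto intro: bounded_linear_imp_has_derivative assms Ck_on_const)
qed

lemma Ck_on_add:
  assumes "open S" "Ck_on k S f" "Ck_on k S g"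
  shows "Ck_on k S (\<lambda>x. f x + g x)"
  using assms(2,3)
proof (induction k arbitrary: f g)
  case 0
  then show ?case by (auto intro: continuous_on_add)
next
  case (Suc k)
  show ?case
    by (rule Ck_on_SucI[OF assms(1) has_derivative_add])
      (auto intro: Ck_on_derivative(1) Suc.prems intro!: Suc.IH Suc.prems[THEN Ck_on_derivative(2)]
        simp del: Ck_on.simps)
qed

lemma Ck_on_sum:
  assumes "open S" "\<And>i. i \<in> I \<Longrightarrow> Ck_on k S (f i)"
  shows "Ck_on k S (\<lambda>x. \<Sum>i\<in>I. f i x)"
  using assms(2)
  by (induction I rule: infinite_finite_induct) (simp_all add: Ck_on_add[OF assms(1)] Ck_on_const)

lemma Ck_on_bilinear:
  fixes prod :: "'b::euclidean_space \<Rightarrow> 'c::euclidean_space \<Rightarrow> 'd::euclidean_space"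
    and f :: "'a::euclidean_space \<Rightarrow> 'b" and g :: "'a \<Rightarrow> 'c"
  assumes "bounded_bilinear prod" and "open S" "Ck_on k S f" "Ck_on k S g"
  shows "Ck_on k S (\<lambda>x. prod (f x) (g x))"
  using assms(3,4)
proof (induction k arbitrary: f g)
  case 0
  then show ?case by (auto intro: bounded_bilinear.continuous_on[OF assms(1)])
next
  case (Suc k)
  show ?case
    by (rule Ck_on_SucI[OF assms(2) bounded_bilinear.FDERIV[OF assms(1)]])
      (auto intro!: Ck_on_add[OF assms(2)] Suc.IH intro: Suc.prems[THEN Ck_on_SucD] Suc.prems[THEN Ck_on_derivative(1)]
        Suc.prems[THEN Ck_on_derivative(2)] simp del: Ck_on.simps)
qed

lemmas Ck_on_mult = Ck_on_bilinear[OF bounded_bilinear_mult]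
lemmas Ck_on_scaleR = Ck_on_bilinear[OF bounded_bilinear_scaleR]
lemmas Ck_on_inner = Ck_on_bilinear[OF bounded_bilinear_inner]

text \<open>In the chain rule the derivative of \<open>f\<close> is applied to a direction that
  varies with \<open>x\<close>. Expanding that direction in the basis leaves the functions
  \<open>\<lambda>x. ?F (g x) b\<close> with fixed \<open>b\<close>, and to these the induction
  hypothesis applies.\<close>

lemma Ck_on_compose:
  fixes f :: "'b::euclidean_space \<Rightarrow> 'c::euclidean_space" and g :: "'a::euclidean_space \<Rightarrow> 'b"
  assumes "open S" "g ` S \<subseteq> T" "Ck_on k T f" "Ck_on k S g"
  shows "Ck_on k S (\<lambda>x. f (g x))"
  using assms(3,4)
proof (induction k arbitrary: f)
  case 0
  then show ?case using continuous_on_compose2[OF _ _ assms(2), of f] by simp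
next
  case (Suc k)
  let ?D = "\<lambda>x. frechet_derivative g (at x)"
  let ?F = "\<lambda>y. frechet_derivative f (at y)"
  show ?case
  proof (rule Ck_on_SucI[OF assms(1)])
    fix x assume x: "x \<in> S"
    have f: "(f has_derivative ?F (g x)) (at (g x))"
      using Ck_on_derivative(1)[OF Suc.prems(1)] x assms(2) by auto
    have g: "(g has_derivative ?D x) (at x)"
      using Ck_on_derivative(1)[OF Suc.prems(2)] x by auto
    have "((\<lambda>x. f (g x)) has_derivative (\<lambda>v. ?F (g x) (?D x v))) (at x)"
      using diff_chain_at[OF g f] by (simp add: o_def)
    moreover have F: "?F (g x) w = (\<Sum>b\<in>Basis. (w \<bullet> b) *\<^sub>R ?F (g x) b)" for w
    proof -
      interpret bounded_linear "?F (g x)" using f by (rule has_derivative_bounded_linear)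
      have "?F (g x) w = ?F (g x) (\<Sum>b\<in>Basis. (w \<bullet> b) *\<^sub>R b)" by (simp add: euclidean_representation)
      also have "\<dots> = (\<Sum>b\<in>Basis. (w \<bullet> b) *\<^sub>R ?F (g x) b)" by (simp add: sum scale)
      finally show ?thesis .
    qed
    ultimately show "((\<lambda>x. f (g x)) has_derivative
        (\<lambda>v. \<Sum>b\<in>Basis. (?D x v \<bullet> b) *\<^sub>R ?F (g x) b)) (at x)"
      by (subst (asm) F)
  next
    fix v
    show "Ck_on k S (\<lambda>x. \<Sum>b\<in>Basis. (?D x v \<bullet> b) *\<^sub>R ?F (g x) b)"
    proof (intro Ck_on_sum Ck_on_scaleR Ck_on_inner Ck_on_const assms(1))
      show "Ck_on k S (\<lambda>x. ?F (g x) b)" for b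
        using Suc.IH[OF Ck_on_derivative(2)[OF Suc.prems(1)] Ck_on_SucD[OF Suc.prems(2)]] .
      show "Ck_on k S (\<lambda>x. ?D x v)" by (rule Ck_on_derivative(2)[OF Suc.prems(2)])
    qed
  qed
qed

text \<open>The derivative is a polynomial in \<open>inverse f\<close> and the derivative of
  \<open>f\<close>, so regularity of the same function at order \<open>k\<close> gives order
  \<open>Suc k\<close>.\<close>

lemma Ck_on_inverse:
  fixes f :: "'a::euclidean_space \<Rightarrow> real"
  assumes "open S" "\<And>x. x \<in> S \<Longrightarrow> f x \<noteq> 0" "Ck_on k S f"
  shows "Ck_on k S (\<lambda>x. inverse (f x))"
  using assms(3)
proof (induction k)
  case 0
  then show ?case using assms(2) by (auto intro: continuous_on_inverse)
next
  case (Suc k)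
  have IH: "Ck_on k S (\<lambda>x. inverse (f x))"
    using Suc Ck_on_SucD by blast
  show ?case
  proof (rule Ck_on_SucI[OF assms(1)])
    fix x assume x: "x \<in> S"
    show "((\<lambda>x. inverse (f x)) has_derivative
      (\<lambda>v. (- 1) * (inverse (f x) * frechet_derivative f (at x) v * inverse (f x)))) (at x)"
      using Deriv.has_derivative_inverse[OF _ Ck_on_derivative(1)[OF Suc.prems x]] assms(2)[OF x] by simp
  next
    fix v
    show "Ck_on k S (\<lambda>x. (- 1) * (inverse (f x) * frechet_derivative f (at x) v * inverse (f x)))"
      by (intro Ck_on_mult assms(1) IH Ck_on_derivative(2)[OF Suc.prems] Ck_on_const)
  qed
qed

lemma smooth_on_subset: "smooth_on S f \<Longrightarrow> T \<subseteq> S \<Longrightarrow> smooth_on T f"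
  unfolding smooth_on_def using Ck_on_subset by blast

lemma smooth_on_cong: "open S \<Longrightarrow> (\<And>x. x \<in> S \<Longrightarrow> f x = g x) \<Longrightarrow> smooth_on S f \<longleftrightarrow> smooth_on S g"
  unfolding smooth_on_def by (simp add: Ck_on_cong[of S f g])

lemma smooth_on_local:
  assumes "\<And>x. x \<in> S \<Longrightarrow> \<exists>U. open U \<and> x \<in> U \<and> smooth_on U f"
  shows "smooth_on S f"
  unfolding smooth_on_def
proof (intro allI Ck_on_local)
  fix k x assume "x \<in> S"
  then show "\<exists>U. open U \<and> x \<in> U \<and> Ck_on k U f" using assms unfolding smooth_on_def by blast
qed

lemma smooth_on_continuous: "smooth_on S f \<Longrightarrow> continuous_on S f"
  unfolding smooth_on_def by (drule spec[of _ 0]) simp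

lemma smooth_on_has_derivative:
  "smooth_on S f \<Longrightarrow> x \<in> S \<Longrightarrow> (f has_derivative frechet_derivative f (at x)) (at x)"
  using smooth_on_differentiable frechet_derivative_works by blast

lemma smooth_on_frechet_derivative:
  "smooth_on S f \<Longrightarrow> smooth_on S (\<lambda>x. frechet_derivative f (at x) v)"
  unfolding smooth_on_def
proof
  fix k assume "\<forall>k. Ck_on k S f"
  then have "Ck_on (Suc k) S f" by blast
  then show "Ck_on k S (\<lambda>x. frechet_derivative f (at x) v)" by simp
qed

lemma smooth_on_const: "smooth_on S (\<lambda>x. c)"
  by (simp add: smooth_on_def Ck_on_const)

lemma smooth_on_bounded_linear: "open S \<Longrightarrow> bounded_linear f \<Longrightarrow> smooth_on S f"
  by (simp add: smooth_on_def Ck_on_bounded_linear)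

lemma smooth_on_add: "open S \<Longrightarrow> smooth_on S f \<Longrightarrow> smooth_on S g \<Longrightarrow> smooth_on S (\<lambda>x. f x + g x)"
  unfolding smooth_on_def by (intro allI Ck_on_add) auto

lemma smooth_on_mult:
  fixes f g :: "'a::euclidean_space \<Rightarrow> real"
  shows "open S \<Longrightarrow> smooth_on S f \<Longrightarrow> smooth_on S g \<Longrightarrow> smooth_on S (\<lambda>x. f x * g x)"
  unfolding smooth_on_def by (intro allI Ck_on_mult) auto

lemma smooth_on_inner: "open S \<Longrightarrow> smooth_on S f \<Longrightarrow> smooth_on S g \<Longrightarrow> smooth_on S (\<lambda>x. f x \<bullet> g x)"
  unfolding smooth_on_def by (intro allI Ck_on_inner) auto

lemma smooth_on_diff:
  fixes f g :: "'a::euclidean_space \<Rightarrow> real"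
  assumes S: "open S" and f: "smooth_on S f" and g: "smooth_on S g"
  shows "smooth_on S (\<lambda>x. f x - g x)"
proof -
  have "smooth_on S (\<lambda>x. f x + (- 1) * g x)"
    by (rule smooth_on_add[OF S f smooth_on_mult[OF S smooth_on_const g]])
  then show ?thesis by simp
qed

lemma smooth_on_sum:
  assumes S: "open S" and f: "\<And>i. i \<in> I \<Longrightarrow> smooth_on S (f i)"
  shows "smooth_on S (\<lambda>x. \<Sum>i\<in>I. f i x)"
  unfolding smooth_on_def
proof
  show "Ck_on k S (\<lambda>x. \<Sum>i\<in>I. f i x)" for k
    by (rule Ck_on_sum[OF S]) (use f in \<open>simp add: smooth_on_def\<close>)
qed

lemma smooth_on_compose:
  assumes S: "open S" and "g ` S \<subseteq> T" and f: "smooth_on T f" and g: "smooth_on S g"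
  shows "smooth_on S (\<lambda>x. f (g x))"
  unfolding smooth_on_def
proof
  show "Ck_on k S (\<lambda>x. f (g x))" for k
    by (rule Ck_on_compose[OF assms(1,2)]) (use f g in \<open>simp_all add: smooth_on_def\<close>)
qed

lemma smooth_on_inverse:
  fixes f :: "'a::euclidean_space \<Rightarrow> real"
  assumes S: "open S" and "\<And>x. x \<in> S \<Longrightarrow> f x \<noteq> 0" and f: "smooth_on S f"
  shows "smooth_on S (\<lambda>x. inverse (f x))"
  unfolding smooth_on_def
proof
  show "Ck_on k S (\<lambda>x. inverse (f x))" for k
    by (rule Ck_on_inverse[OF assms(1,2)]) (use f in \<open>simp_all add: smooth_on_def\<close>)
qed

lemma smooth_on_Pair:
  fixes f :: "'a::euclidean_space \<Rightarrow> 'b::euclidean_space" and g :: "'a \<Rightarrow> 'c::euclidean_space"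
  assumes S: "open S" and f: "smooth_on S f" and g: "smooth_on S g"
  shows "smooth_on S (\<lambda>x. (f x, g x))"
proof -
  have 1: "smooth_on S (\<lambda>x. (f x, 0::'c))"
    using smooth_on_compose[OF S _ smooth_on_bounded_linear[OF open_UNIV] f, of "\<lambda>y. (y, 0)"]
    by (simp add: bounded_linear_Pair bounded_linear_ident bounded_linear_zero)
  have 2: "smooth_on S (\<lambda>x. (0::'b, g x))"
    using smooth_on_compose[OF S _ smooth_on_bounded_linear[OF open_UNIV] g, of "\<lambda>y. (0, y)"]
    by (simp add: bounded_linear_Pair bounded_linear_ident bounded_linear_zero)
  show ?thesis using smooth_on_add[OF S 1 2] by simp
qed

section \<open>Smooth bump functions\<close>

text \<open>The family \<open>t \<mapsto> t\<^sup>-\<^sup>n exp(-1/t)\<close> is closed under differentiation up to linear combinations,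
  which makes the induction on the order of differentiability go through.\<close>
definition flat :: "nat \<Rightarrow> real \<Rightarrow> real" where
  "flat n t = (if t > 0 then inverse t ^ n * exp (- inverse t) else 0)"

lemma flat_limit: "((\<lambda>t. flat n t) \<longlongrightarrow> 0) (at_right 0)"
proof -
  have "((\<lambda>x::real. x ^ n / exp x) \<longlongrightarrow> 0) at_top" by (rule tendsto_power_div_exp_0)
  then have "((\<lambda>t::real. inverse t ^ n / exp (inverse t)) \<longlongrightarrow> 0) (at_right 0)"
    by (rule filterlim_compose[OF _ filterlim_inverse_at_top_right])
  moreover have "\<forall>\<^sub>F t in at_right 0. inverse t ^ n / exp (inverse t) = flat n t"
    unfolding eventually_at_filter by (auto simp: flat_def exp_minus field_simps)
  ultimately show ?thesis using Lim_transform_eventually by blast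
qed

text \<open>The delicate point is \<open>0\<close>: there the difference quotient from the right is
  \<open>flat (n + 1)\<close> itself, so \<open>flat_limit\<close> one index higher gives derivative
  \<open>0\<close>, while the quotient from the left vanishes identically.\<close>

lemma flat_deriv: "(flat n has_real_derivative flat (n + 2) t - n * flat (n + 1) t) (at t)"
proof -
  consider "t > 0" | "t < 0" | "t = 0" by linarith
  then show ?thesis
  proof cases
    case 1
    have d: "((\<lambda>t. inverse t ^ n * exp (- inverse t)) has_real_derivative
        flat (n + 2) t - n * flat (n + 1) t) (at t)"
    proof (cases n)
      case 0
      then show ?thesis using 1
        by (auto intro!: derivative_eq_intros simp: flat_def power2_eq_square field_simps)
    next
      case (Suc m)
      show ?thesis unfolding Suc using 1
        by (auto intro!: derivative_eq_intros simp: flat_def power2_eq_square field_simps)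
          (cases m; simp)
    qed
    show ?thesis
      by (rule DERIV_cong_ev[THEN iffD1, OF refl _ refl d])
        (use 1 in \<open>auto simp: flat_def intro!: eventually_mono[OF eventually_nhds_in_open[of "{0<..}"]]\<close>)
  next
    case 2
    have d: "((\<lambda>t. 0) has_real_derivative flat (n + 2) t - n * flat (n + 1) t) (at t)"
      using 2 by (simp add: flat_def)
    show ?thesis
      by (rule DERIV_cong_ev[THEN iffD1, OF refl _ refl d])
        (use 2 in \<open>auto simp: flat_def intro!: eventually_mono[OF eventually_nhds_in_open[of "{..<0}"]]\<close>)
  next
    case 3
    have R: "((\<lambda>h. (flat n h - flat n 0) / (h - 0)) \<longlongrightarrow> 0) (at_right 0)"
    proof -
      have "\<forall>\<^sub>F h in at_right 0. flat (n+1) h = (flat n h - flat n 0) / (h - 0)"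
        unfolding eventually_at_filter by (auto simp: flat_def field_simps)
      then show ?thesis by (rule Lim_transform_eventually[OF flat_limit])
    qed
    have L: "((\<lambda>h. (flat n h - flat n 0) / (h - 0)) \<longlongrightarrow> 0) (at_left 0)"
    proof -
      have "\<forall>\<^sub>F h in at_left 0. 0 = (flat n h - flat n 0) / (h - 0)"
        unfolding eventually_at_filter by (auto simp: flat_def field_simps)
      then show ?thesis by (rule Lim_transform_eventually[OF tendsto_const])
    qed
    have "(flat n has_real_derivative 0) (at 0)"
      unfolding has_field_derivative_iff using filterlim_split_at[OF L R] by simp
    then show ?thesis using 3 by (simp add: flat_def)
  qed
qed

lemma smooth_on_flat: "smooth_on UNIV (flat n)"
proof -
  have "Ck_on k UNIV (flat n)" for k
  proof (induction k arbitrary: n)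
    case 0
    then show ?case using flat_deriv DERIV_isCont continuous_at_imp_continuous_on
      by (metis Ck_on.simps(1))
  next
    case (Suc k)
    show ?case
    proof (rule Ck_on_SucI)
      show "(flat n has_derivative (\<lambda>v. (flat (n + 2) t + (- n) * flat (n + 1) t) * v)) (at t)" for t
        using flat_deriv[of n t] by (simp add: has_field_derivative_def)
      show "Ck_on k UNIV (\<lambda>t. (flat (n + 2) t + (- n) * flat (n + 1) t) * v)" for v
        by (intro Ck_on_mult Ck_on_add Ck_on_const Suc) auto
    qed auto
  qed
  then show ?thesis by (simp add: smooth_on_def)
qed

definition smooth_step :: "real \<Rightarrow> real" where
  "smooth_step t = flat 0 t * inverse (flat 0 t + flat 0 (1 - t))"

lemma smooth_on_smooth_step: "smooth_on UNIV smooth_step"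
proof -
  have "flat 0 t + flat 0 (1 - t) \<noteq> 0" for t
  proof -
    have "flat 0 t + flat 0 (1 - t) > 0"
      by (cases "t > 0"; cases "t < 1") (auto simp: flat_def add_pos_pos)
    then show ?thesis by simp
  qed
  moreover have "smooth_on UNIV (\<lambda>t. flat 0 (1 - t))"
    using smooth_on_compose[OF open_UNIV _ smooth_on_flat smooth_on_diff[OF open_UNIV smooth_on_const
        smooth_on_bounded_linear[OF open_UNIV bounded_linear_ident]]]
    by auto
  ultimately show ?thesis unfolding smooth_step_def
    by (intro smooth_on_mult smooth_on_inverse smooth_on_add smooth_on_flat) auto
qed

lemma smooth_step_0: "t \<le> 0 \<Longrightarrow> smooth_step t = 0"
  by (simp add: smooth_step_def flat_def)

lemma smooth_step_1: "t \<ge> 1 \<Longrightarrow> smooth_step t = 1"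
  by (simp add: smooth_step_def flat_def)

lemma smooth_step_bounds: "0 \<le> smooth_step t" "smooth_step t \<le> 1"
proof -
  have *: "0 \<le> flat 0 s" for s by (simp add: flat_def)
  show "0 \<le> smooth_step t" using * by (simp add: smooth_step_def)
  show "smooth_step t \<le> 1" using *[of t] *[of "1-t"]
    by (cases "flat 0 t + flat 0 (1 - t) = 0")
      (auto simp: smooth_step_def field_simps)
qed

text \<open>The squared norm keeps the function smooth at \<open>a\<close>. The argument of
  \<open>smooth_step\<close> is at least 1 up to radius \<open>r\<close> and at most 0 from radius
  \<open>sqrt 2 * r\<close> on, so the support bound \<open>2 * r\<close> used later is
  generous.\<close>

definition bump :: "'e::euclidean_space \<Rightarrow> real \<Rightarrow> 'e \<Rightarrow> real" where
  "bump a r x = smooth_step (2 - ((x - a) \<bullet> (x - a)) / r\<^sup>2)"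

lemma smooth_on_bump: "smooth_on UNIV (bump a r)"
  unfolding bump_def[abs_def]
proof (rule smooth_on_compose[OF open_UNIV _ smooth_on_smooth_step])
  have id: "smooth_on UNIV (\<lambda>x::'a. x)" by (intro smooth_on_bounded_linear) (auto intro: bounded_linear_ident)
  have "smooth_on UNIV (\<lambda>x. x - a)"
    using smooth_on_add[OF open_UNIV id smooth_on_const[of _ "-a"]] by simp
  then have "smooth_on UNIV (\<lambda>x. (x - a) \<bullet> (x - a) * (1 / r\<^sup>2))"
    by (intro smooth_on_mult smooth_on_inner smooth_on_const) auto
  then show "smooth_on UNIV (\<lambda>x. 2 - (x - a) \<bullet> (x - a) / r\<^sup>2)"
    using smooth_on_diff[OF open_UNIV smooth_on_const[of UNIV 2]] by simp
qed auto

lemma bump_1: "r > 0 \<Longrightarrow> x \<in> cball a r \<Longrightarrow> bump a r x = 1"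
  unfolding bump_def
  by (rule smooth_step_1)
    (simp add: dist_norm norm_minus_commute power2_norm_eq_inner[symmetric] field_simps)

lemma bump_0: assumes "r > 0" "x \<notin> ball a (2 * r)" shows "bump a r x = 0"
  unfolding bump_def
proof (rule smooth_step_0)
  have "(2 * r)\<^sup>2 \<le> (norm (x - a))\<^sup>2"
    by (rule power_mono) (use assms in \<open>auto simp: dist_norm norm_minus_commute\<close>)
  then show "2 - (x - a) \<bullet> (x - a) / r\<^sup>2 \<le> 0"
    using assms(1) zero_le_power2[of r] unfolding power2_norm_eq_inner[symmetric] power_mult_distrib
    by (simp add: pos_le_divide_eq) (use zero_le_power2[of r] in linarith)
qed

lemma bump_bounds: "0 \<le> bump a r x" "bump a r x \<le> 1"
  by (simp_all add: bump_def smooth_step_bounds)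

section \<open>Locally Lipschitz maps\<close>

text \<open>The closed ball must lie inside \<open>S\<close>: this gives a compact convex
  neighbourhood on which functions are bounded and onto which one can project.\<close>

definition loclip_on :: "'e::euclidean_space set \<Rightarrow> ('e \<Rightarrow> 'f::euclidean_space) \<Rightarrow> bool" where
  "loclip_on S f \<longleftrightarrow> (\<forall>x\<in>S. \<exists>r>0. \<exists>L. cball x r \<subseteq> S \<and> L-lipschitz_on (cball x r) f)"

lemma loclip_onE:
  assumes "loclip_on S f" "x \<in> S"
  obtains r L where "r > 0" "cball x r \<subseteq> S" "L > 0" "L-lipschitz_on (cball x r) f"
proof -
  obtain r L where r: "r > 0" "cball x r \<subseteq> S" "L-lipschitz_on (cball x r) f"
    using assms unfolding loclip_on_def by blast
  have "(max L 1)-lipschitz_on (cball x r) f" by (rule lipschitz_on_mono[OF r(3)]) auto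
  then show ?thesis using that[of r "max L 1"] r by auto
qed

lemma loclip_on_continuous: assumes "loclip_on S f" shows "continuous_on S f"
proof -
  have "continuous (at x) f" if x: "x \<in> S" for x
  proof -
    obtain r L where *: "r > 0" "L-lipschitz_on (cball x r) f"
      using loclip_onE[OF assms x] by metis
    have "continuous_on (ball x r) f"
      by (rule continuous_on_subset[OF lipschitz_on_continuous_on[OF *(2)] ball_subset_cball])
    then show ?thesis using *(1) continuous_on_eq_continuous_at open_ball centre_in_ball by blast
  qed
  then show ?thesis by (simp add: continuous_at_imp_continuous_on)
qed

text \<open>On a closed ball the partial derivatives are bounded by compactness, hence so is the
  operator norm of the derivative; convexity of the ball and the mean value inequality do the
  rest.\<close>

lemma C1_imp_loclip:
  fixes f :: "'e::euclidean_space \<Rightarrow> 'f::euclidean_space"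
  assumes "open S" "Ck_on 1 S f"
  shows "loclip_on S f"
  unfolding loclip_on_def
proof
  fix x assume "x \<in> S"
  then obtain r where r: "r > 0" "cball x r \<subseteq> S" using assms(1) open_contains_cball by blast
  let ?D = "\<lambda>y. frechet_derivative f (at y)"
  have d: "(f has_derivative ?D y) (at y)" if "y \<in> cball x r" for y
    using assms(2) r(2) that Ck_on_derivative(1)[of 0 S f y] by auto
  have "\<exists>B. \<forall>y\<in>cball x r. norm (?D y b) \<le> B" for b
  proof -
    have "continuous_on (cball x r) (\<lambda>y. ?D y b)"
      using assms(2) r(2) by (auto intro: continuous_on_subset)
    then have "bounded ((\<lambda>y. ?D y b) ` cball x r)"
      using compact_continuous_image compact_imp_bounded compact_cball by blast
    then show ?thesis by (auto simp: bounded_iff)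
  qed
  then obtain B where B: "\<And>b y. y \<in> cball x r \<Longrightarrow> norm (?D y b) \<le> B b" by metis
  define L where "L = (\<Sum>b\<in>Basis. \<bar>B b\<bar>)"
  have "onorm (?D y) \<le> L" if y: "y \<in> cball x r" for y
  proof (rule onorm_le)
    fix v
    interpret bounded_linear "?D y" using d[OF y] by (rule has_derivative_bounded_linear)
    have "?D y v = ?D y (\<Sum>b\<in>Basis. (v \<bullet> b) *\<^sub>R b)" by (simp add: euclidean_representation)
    also have "\<dots> = (\<Sum>b\<in>Basis. (v \<bullet> b) *\<^sub>R ?D y b)" by (simp add: sum scale)
    also have "norm \<dots> \<le> (\<Sum>b\<in>Basis. norm v * \<bar>B b\<bar>)"
      by (rule sum_norm_le) (use B[OF y] in \<open>auto intro!: mult_mono simp: Basis_le_norm intro: order_trans[OF _ abs_ge_self]\<close>)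
    also have "\<dots> = L * norm v" by (simp add: L_def sum_distrib_left mult.commute)
    finally show "norm (?D y v) \<le> L * norm v" .
  qed
  then have "norm (f y - f z) \<le> L * norm (y - z)" if "y \<in> cball x r" "z \<in> cball x r" for y z
    using differentiable_bound[of "cball x r" f ?D L y z] d has_derivative_at_withinI that by blast
  then have "L-lipschitz_on (cball x r) f"
    by (intro lipschitz_onI) (auto simp: dist_norm L_def sum_nonneg)
  then show "\<exists>r>0. \<exists>L. cball x r \<subseteq> S \<and> L-lipschitz_on (cball x r) f" using r by blast
qed

lemma smooth_imp_loclip: "open S \<Longrightarrow> smooth_on S f \<Longrightarrow> loclip_on S f"
  using C1_imp_loclip[of S f] by (simp add: smooth_on_def del: Ck_on.simps)


lemma loclip_on_mult:
  fixes f g :: "'e::euclidean_space \<Rightarrow> real"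
  assumes "loclip_on S f" "loclip_on S g"
  shows "loclip_on S (\<lambda>x. f x * g x)"
  unfolding loclip_on_def
proof
  fix x assume x: "x \<in> S"
  obtain r L where 1: "r > 0" "cball x r \<subseteq> S" "L > 0" "L-lipschitz_on (cball x r) f"
    using loclip_onE[OF assms(1) x] .
  obtain r' L' where 2: "r' > 0" "cball x r' \<subseteq> S" "L' > 0" "L'-lipschitz_on (cball x r') g"
    using loclip_onE[OF assms(2) x] .
  define q where "q = min r r'"
  have q: "q > 0" "cball x q \<subseteq> S" and f: "L-lipschitz_on (cball x q) f" and g: "L'-lipschitz_on (cball x q) g"
    using 1 2 by (auto simp: q_def intro: lipschitz_on_subset)
  have "bounded (f ` cball x q)" "bounded (g ` cball x q)"
    using compact_continuous_image compact_imp_bounded compact_cball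
      lipschitz_on_continuous_on[OF f] lipschitz_on_continuous_on[OF g] by blast+
  then obtain A B where A: "\<And>y. y \<in> cball x q \<Longrightarrow> \<bar>f y\<bar> \<le> A" and B: "\<And>y. y \<in> cball x q \<Longrightarrow> \<bar>g y\<bar> \<le> B"
    unfolding bounded_iff by (metis imageI real_norm_def)
  have AB: "0 \<le> A" "0 \<le> B" using A[of x] B[of x] q(1) by auto
  have "(A * L' + B * L)-lipschitz_on (cball x q) (\<lambda>x. f x * g x)"
  proof (rule lipschitz_onI)
    fix y z assume yz: "y \<in> cball x q" "z \<in> cball x q"
    have "f y * g y - f z * g z = f y * (g y - g z) + g z * (f y - f z)" by (simp add: algebra_simps)
    also have "\<bar>\<dots>\<bar> \<le> \<bar>f y\<bar> * \<bar>g y - g z\<bar> + \<bar>g z\<bar> * \<bar>f y - f z\<bar>"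
      by (metis abs_mult abs_triangle_ineq)
    also have "\<dots> \<le> A * (L' * dist y z) + B * (L * dist y z)"
      using lipschitz_onD[OF f yz] lipschitz_onD[OF g yz] A[OF yz(1)] B[OF yz(2)] AB
      by (intro add_mono mult_mono) (auto simp: dist_real_def)
    finally show "dist (f y * g y) (f z * g z) \<le> (A * L' + B * L) * dist y z"
      by (simp add: dist_real_def algebra_simps)
  qed (use AB 1 2 in simp)
  then show "\<exists>r>0. \<exists>L. cball x r \<subseteq> S \<and> L-lipschitz_on (cball x r) (\<lambda>x. f x * g x)"
    using q by blast
qed

lemma loclip_on_add:
  assumes "loclip_on S f" "loclip_on S g"
  shows "loclip_on S (\<lambda>x. f x + g x)"
  unfolding loclip_on_def
proof
  fix x assume x: "x \<in> S"
  obtain r L where 1: "r > 0" "cball x r \<subseteq> S" "L > 0" "L-lipschitz_on (cball x r) f"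
    using loclip_onE[OF assms(1) x] .
  obtain r' L' where 2: "r' > 0" "cball x r' \<subseteq> S" "L' > 0" "L'-lipschitz_on (cball x r') g"
    using loclip_onE[OF assms(2) x] .
  have "L-lipschitz_on (cball x (min r r')) f" "L'-lipschitz_on (cball x (min r r')) g"
    using 1 2 by (auto intro: lipschitz_on_subset)
  then have "(L + L')-lipschitz_on (cball x (min r r')) (\<lambda>x. f x + g x)"
    by (rule lipschitz_on_add)
  then show "\<exists>r>0. \<exists>L. cball x r \<subseteq> S \<and> L-lipschitz_on (cball x r) (\<lambda>x. f x + g x)"
    using 1 2 by (intro exI[of _ "min r r'"]) auto
qed

lemma loclip_on_const: "open S \<Longrightarrow> loclip_on S (\<lambda>x. c)"
  unfolding loclip_on_def using lipschitz_on_constant by (metis open_contains_cball)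

lemma loclip_on_sum:
  assumes "open S" "\<And>i. i \<in> I \<Longrightarrow> loclip_on S (f i)"
  shows "loclip_on S (\<lambda>x. \<Sum>i\<in>I. f i x)"
  using assms(2)
  by (induction I rule: infinite_finite_induct) (simp_all add: loclip_on_add loclip_on_const[OF assms(1)])

section \<open>Functions on a manifold\<close>

definition loclip_fun :: "('i, 'a, 'e::euclidean_space, 'm) mfd_scheme \<Rightarrow> ('a \<Rightarrow> real) \<Rightarrow> bool" where
  "loclip_fun M f \<longleftrightarrow> (\<forall>i\<in>mindex M. loclip_on (mrange M i) (f \<circ> mparam M i))"

locale smooth_mfd =
  fixes M :: "('i, 'a, 'e::euclidean_space, 'm) mfd_scheme"
  assumes M: "smooth_manifold M"
begin

lemma Hausdorff: "Hausdorff_space (mtop M)"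
  and nonempty: "mpoints M \<noteq> {}"
  and chart_cover: "(\<Union>i\<in>mindex M. mdom M i) = mpoints M"
  using M by (auto simp: smooth_manifold_def)

lemma chart_exists: "p \<in> mpoints M \<Longrightarrow> \<exists>i\<in>mindex M. p \<in> mdom M i"
  using chart_cover by auto

context
  fixes i assumes i: "i \<in> mindex M"
begin

lemma openin_mdom: "openin (mtop M) (mdom M i)"
  and open_mrange: "open (mrange M i)"
  and chart_homeomorphic:
    "homeomorphic_map (subtopology (mtop M) (mdom M i)) (top_of_set (mrange M i)) (mchart M i)"
  using M i by (auto simp: smooth_manifold_def)

lemma mdom_subset: "mdom M i \<subseteq> mpoints M"
  using openin_mdom openin_subset by blast

lemma mchart_in: "p \<in> mdom M i \<Longrightarrow> mchart M i p \<in> mrange M i"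
  by (simp add: mrange_def)

lemma mparam_in: "x \<in> mrange M i \<Longrightarrow> mparam M i x \<in> mdom M i"
  by (simp add: mrange_def mparam_def inv_into_into)

lemma mparam_points: "x \<in> mrange M i \<Longrightarrow> mparam M i x \<in> mpoints M"
  using mparam_in mdom_subset by blast

lemma mchart_mparam: "x \<in> mrange M i \<Longrightarrow> mchart M i (mparam M i x) = x"
  by (simp add: mrange_def mparam_def f_inv_into_f)

lemma mparam_mchart': "p \<in> mdom M i \<Longrightarrow> mparam M i (mchart M i p) = p"
  by (rule mparam_mchart[OF M i])

lemma continuous_mchart: "continuous_map (subtopology (mtop M) (mdom M i)) euclidean (mchart M i)"
  using homeomorphic_imp_continuous_map[OF chart_homeomorphic] continuous_map_in_subtopology by blast

lemma openin_chart_preimage: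
  assumes "open U"
  shows "openin (mtop M) {p \<in> mdom M i. mchart M i p \<in> U}"
proof -
  have "openin (subtopology (mtop M) (mdom M i))
      {p \<in> topspace (subtopology (mtop M) (mdom M i)). mchart M i p \<in> U}"
    using continuous_mchart assms by (auto simp: continuous_map)
  then show ?thesis
    using openin_trans_full[OF _ openin_mdom] mdom_subset
    by (metis (no_types, lifting) Collect_cong inf.absorb_iff2 topspace_subtopology)
qed

lemma open_param_preimage:
  assumes "openin (mtop M) O'"
  shows "open {x \<in> mrange M i. mparam M i x \<in> O'}"
proof -
  have "openin (subtopology (mtop M) (mdom M i)) (mdom M i \<inter> O')"
    using assms by (auto simp: openin_subtopology)
  then have "openin (top_of_set (mrange M i)) (mchart M i ` (mdom M i \<inter> O'))"
    using chart_homeomorphic homeomorphic_imp_open_map open_map_def by blast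
  then have "open (mchart M i ` (mdom M i \<inter> O'))" using open_mrange openin_open_trans by blast
  moreover have "mchart M i ` (mdom M i \<inter> O') = {x \<in> mrange M i. mparam M i x \<in> O'}"
  proof (intro equalityI subsetI)
    fix x assume "x \<in> {x \<in> mrange M i. mparam M i x \<in> O'}"
    then have "x = mchart M i (mparam M i x)" "mparam M i x \<in> mdom M i \<inter> O'"
      using mchart_mparam mparam_in by auto
    then show "x \<in> mchart M i ` (mdom M i \<inter> O')" by blast
  qed (auto simp: mparam_mchart' mrange_def)
  ultimately show ?thesis by simp
qed

lemma continuous_mparam: "continuous_map (top_of_set (mrange M i)) (mtop M) (mparam M i)"
  unfolding continuous_map
proof (intro conjI allI impI)
  show "mparam M i ` topspace (top_of_set (mrange M i)) \<subseteq> mpoints M" using mparam_points by auto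
  fix U assume "openin (mtop M) U"
  then have "open {x \<in> mrange M i. mparam M i x \<in> U}" by (rule open_param_preimage)
  then show "openin (top_of_set (mrange M i)) {x \<in> topspace (top_of_set (mrange M i)). mparam M i x \<in> U}"
    by (auto intro: open_subset)
qed

lemma compact_param_image:
  assumes "compact Q" "Q \<subseteq> mrange M i"
  shows "compactin (mtop M) (mparam M i ` Q)"
  by (rule image_compactin[OF _ continuous_mparam]) (use assms in \<open>simp add: compactin_subtopology\<close>)

end

lemma transition_smooth:
  "i \<in> mindex M \<Longrightarrow> j \<in> mindex M \<Longrightarrow>
    smooth_on (mchart M i ` (mdom M i \<inter> mdom M j)) (transition M i j)"
  using M by (simp add: smooth_manifold_def)

lemma compactin_closedin: "compactin (mtop M) K \<Longrightarrow> closedin (mtop M) K"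
  using compactin_imp_closedin Hausdorff by blast

lemma chart_ball:
  assumes "openin (mtop M) O'" "p \<in> O'"
  obtains i r where "i \<in> mindex M" "p \<in> mdom M i" "r > 0" "cball (mchart M i p) r \<subseteq> mrange M i"
    "mparam M i ` cball (mchart M i p) r \<subseteq> O'"
proof -
  have "p \<in> mpoints M" using assms openin_subset by blast
  then obtain i where i: "i \<in> mindex M" "p \<in> mdom M i" using chart_exists by blast
  have "mchart M i p \<in> {x \<in> mrange M i. mparam M i x \<in> O'}"
    using i assms(2) mparam_mchart' mchart_in by simp
  then obtain r where "r > 0" "cball (mchart M i p) r \<subseteq> {x \<in> mrange M i. mparam M i x \<in> O'}"
    using open_param_preimage[OF i(1) assms(1)] open_contains_cball by blast
  then show ?thesis using that[OF i, of r] by auto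
qed

lemma smooth_function_continuous_on:
  "smooth_function M f \<Longrightarrow> i \<in> mindex M \<Longrightarrow> continuous_on (mrange M i) (f \<circ> mparam M i)"
  unfolding smooth_function_def using smooth_on_continuous by blast

lemma continuous_map_charts:
  assumes "\<And>i. i \<in> mindex M \<Longrightarrow> continuous_on (mrange M i) (f \<circ> mparam M i)"
  shows "continuous_map (mtop M) euclideanreal f"
  unfolding continuous_map
proof (intro conjI allI impI)
  fix U :: "real set" assume "openin euclideanreal U"
  then have U: "open U" by simp
  show "openin (mtop M) {p \<in> mpoints M. f p \<in> U}"
  proof (subst openin_subopen, intro ballI)
    fix p assume p: "p \<in> {p \<in> mpoints M. f p \<in> U}"
    then obtain i where i: "i \<in> mindex M" "p \<in> mdom M i" using chart_exists by blast
    let ?V = "(f \<circ> mparam M i) -` U \<inter> mrange M i"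
    let ?W = "{q \<in> mdom M i. mchart M i q \<in> ?V}"
    have "open ?V" using continuous_on_open_vimage[OF open_mrange[OF i(1)]] assms[OF i(1)] U by blast
    then have "openin (mtop M) ?W" by (rule openin_chart_preimage[OF i(1)])
    moreover have "p \<in> ?W" using p i mchart_in mparam_mchart' by auto
    moreover have "?W \<subseteq> {p \<in> mpoints M. f p \<in> U}"
      using mparam_mchart'[OF i(1)] mdom_subset[OF i(1)] by auto
    ultimately show "\<exists>T. openin (mtop M) T \<and> p \<in> T \<and> T \<subseteq> {p \<in> mpoints M. f p \<in> U}" by blast
  qed
qed auto

lemma smooth_function_continuous:
  "smooth_function M f \<Longrightarrow> continuous_map (mtop M) euclideanreal f"
  by (intro continuous_map_charts smooth_function_continuous_on)

lemma loclip_fun_continuous: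
  "loclip_fun M f \<Longrightarrow> continuous_map (mtop M) euclideanreal f"
  by (intro continuous_map_charts) (simp add: loclip_fun_def loclip_on_continuous del: comp_apply)

lemma smooth_function_loclip: "smooth_function M f \<Longrightarrow> loclip_fun M f"
  by (simp add: smooth_function_def loclip_fun_def smooth_imp_loclip open_mrange)

lemma smooth_function_const: "smooth_function M (\<lambda>p. c)"
  by (simp add: smooth_function_def o_def smooth_on_const)

lemma smooth_function_add:
  "smooth_function M f \<Longrightarrow> smooth_function M g \<Longrightarrow> smooth_function M (\<lambda>p. f p + g p)"
  by (simp add: smooth_function_def o_def smooth_on_add open_mrange)

lemma smooth_function_mult:
  "smooth_function M f \<Longrightarrow> smooth_function M g \<Longrightarrow> smooth_function M (\<lambda>p. f p * g p)"
  by (simp add: smooth_function_def o_def smooth_on_mult open_mrange)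

lemma smooth_function_diff:
  "smooth_function M f \<Longrightarrow> smooth_function M g \<Longrightarrow> smooth_function M (\<lambda>p. f p - g p)"
  by (simp add: smooth_function_def o_def smooth_on_diff open_mrange)

lemma smooth_function_sum:
  "(\<And>i. i \<in> I \<Longrightarrow> smooth_function M (f i)) \<Longrightarrow> smooth_function M (\<lambda>p. \<Sum>i\<in>I. f i p)"
  by (simp add: smooth_function_def o_def smooth_on_sum open_mrange)

lemma smooth_function_prod:
  "(\<And>i. i \<in> I \<Longrightarrow> smooth_function M (f i)) \<Longrightarrow> smooth_function M (\<lambda>p. \<Prod>i\<in>I. f i p)"
  by (induction I rule: infinite_finite_induct)
    (simp_all add: smooth_function_const smooth_function_mult)

definition from_chart :: "'i \<Rightarrow> ('e \<Rightarrow> real) \<Rightarrow> 'a \<Rightarrow> real" where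
  "from_chart i f p = (if p \<in> mdom M i then f (mchart M i p) else 0)"

text \<open>Near a point of the domain of \<open>i\<close>, a second chart sees \<open>f\<close>
  composed with a transition map. A point outside that domain avoids the image of \<open>Q\<close>,
  which is compact and hence closed in a Hausdorff space, so the function vanishes on a whole
  neighbourhood.\<close>

lemma smooth_from_chart:
  assumes i: "i \<in> mindex M" and f: "smooth_on (mrange M i) f"
    and Q: "compact Q" "Q \<subseteq> mrange M i" and f0: "\<And>x. x \<in> mrange M i - Q \<Longrightarrow> f x = 0"
  shows "smooth_function M (from_chart i f)"
  unfolding smooth_function_def
proof (intro ballI smooth_on_local)
  fix j y assume j: "j \<in> mindex M" and y: "y \<in> mrange M j"
  show "\<exists>U. open U \<and> y \<in> U \<and> smooth_on U (from_chart i f \<circ> mparam M j)"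
  proof (cases "mparam M j y \<in> mdom M i")
    case True
    let ?U = "mchart M j ` (mdom M j \<inter> mdom M i)"
    have U: "open ?U" by (rule open_overlap[OF M j i])
    have "transition M j i ` ?U \<subseteq> mrange M i"
      using transition_chart[OF M j] mchart_in[OF i] by force
    then have "smooth_on ?U (\<lambda>x. f (transition M j i x))"
      by (rule smooth_on_compose[OF U _ f transition_smooth[OF j i]])
    moreover have "f (transition M j i x) = (from_chart i f \<circ> mparam M j) x" if "x \<in> ?U" for x
      using that mparam_mchart'[OF j] by (auto simp: from_chart_def transition_def)
    ultimately have "smooth_on ?U (from_chart i f \<circ> mparam M j)"
      by (rule smooth_on_cong[OF U, THEN iffD1, rotated])
    moreover have "y \<in> ?U" using True mparam_in[OF j y] mchart_mparam[OF j y] by (metis Int_iff image_eqI)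
    ultimately show ?thesis using U by blast
  next
    case False
    have "openin (mtop M) (mpoints M - mparam M i ` Q)"
      using compactin_closedin[OF compact_param_image[OF i Q]] by blast
    then have U: "open {x \<in> mrange M j. mparam M j x \<in> mpoints M - mparam M i ` Q}" (is "open ?U")
      by (rule open_param_preimage[OF j])
    have "(from_chart i f \<circ> mparam M j) x = 0" if "x \<in> ?U" for x
    proof (cases "mparam M j x \<in> mdom M i")
      case True
      then have "mchart M i (mparam M j x) \<in> mrange M i - Q"
        using that mparam_mchart'[OF i True] mchart_in[OF i True] by force
      then show ?thesis using True f0 by (simp add: from_chart_def)
    qed (simp add: from_chart_def)
    then have "smooth_on ?U (from_chart i f \<circ> mparam M j)"
      by (intro smooth_on_cong[OF U, THEN iffD1, OF _ smooth_on_const[of ?U "0::real"]]) auto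
    moreover have "mparam M i ` Q \<subseteq> mdom M i" using mparam_in[OF i] Q(2) by auto
    then have "y \<in> ?U" using False y mparam_points[OF j y] by auto
    ultimately show ?thesis using U by blast
  qed
qed

lemma from_chart_zero:
  assumes "i \<in> mindex M" "\<And>x. x \<in> mrange M i - Q \<Longrightarrow> f x = 0" "p \<notin> mparam M i ` Q"
  shows "from_chart i f p = 0"
proof (cases "p \<in> mdom M i")
  case True
  then have "mchart M i p \<in> mrange M i - Q"
    using assms(3) mparam_mchart'[OF assms(1) True] mchart_in[OF assms(1) True] by force
  then show ?thesis using True assms(2) by (simp add: from_chart_def)
qed (simp add: from_chart_def)

subsection \<open>Cutoff functions\<close>

lemma chart_cutoff:
  assumes i: "i \<in> mindex M" and r: "r > 0" and Q: "cball x (2 * r) \<subseteq> mrange M i"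
  shows "smooth_function M (from_chart i (bump x r))"
    "0 \<le> from_chart i (bump x r) p" "from_chart i (bump x r) p \<le> 1"
    "p \<in> mdom M i \<Longrightarrow> mchart M i p \<in> cball x r \<Longrightarrow> from_chart i (bump x r) p = 1"
    "p \<notin> mparam M i ` cball x (2 * r) \<Longrightarrow> from_chart i (bump x r) p = 0"
proof -
  have z: "bump x r y = 0" if "y \<in> mrange M i - cball x (2 * r)" for y
    by (rule bump_0[OF r]) (use that in auto)
  show "smooth_function M (from_chart i (bump x r))"
    by (rule smooth_from_chart[OF i smooth_on_subset[OF smooth_on_bump] compact_cball Q z]) auto
  show "p \<notin> mparam M i ` cball x (2 * r) \<Longrightarrow> from_chart i (bump x r) p = 0"
    by (rule from_chart_zero[OF i z])
qed (use r in \<open>auto simp: from_chart_def bump_bounds bump_1\<close>)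

lemma openin_chart_ball:
  assumes "i \<in> mindex M"
  shows "openin (mtop M) {p \<in> mdom M i. mchart M i p \<in> ball x r}"
  by (rule openin_chart_preimage[OF assms open_ball])

text \<open>Finitely many chart bumps \<open>b p\<close> cover \<open>C\<close>. The combination
  \<open>1 - (\<Prod>p\<in>P. 1 - b p q)\<close> is 1 as soon as one bump is 1, is 0 where all of
  them vanish, and stays in \<open>[0, 1]\<close> without any normalisation. The open set
  \<open>W\<close> on which it is constant is recorded so that brackets can be compared
  there.\<close>

lemma cutoff_exists:
  assumes C: "compactin (mtop M) C" and O: "openin (mtop M) O'" "C \<subseteq> O'"
  obtains f W K where "smooth_function M f" "\<And>p. 0 \<le> f p" "\<And>p. f p \<le> 1"
    "openin (mtop M) W" "C \<subseteq> W" "W \<subseteq> O'" "\<And>p. p \<in> W \<Longrightarrow> f p = 1"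
    "compactin (mtop M) K" "K \<subseteq> O'" "\<And>p. p \<notin> K \<Longrightarrow> f p = 0"
proof -
  define ok where "ok p i r \<longleftrightarrow> i \<in> mindex M \<and> p \<in> mdom M i \<and> r > 0 \<and>
      cball (mchart M i p) (2 * r) \<subseteq> mrange M i \<and> mparam M i ` cball (mchart M i p) (2 * r) \<subseteq> O'" for p i r
  have "\<exists>i r. ok p i r" if pC: "p \<in> C" for p
  proof -
    obtain i r where "i \<in> mindex M" "p \<in> mdom M i" "r > 0" "cball (mchart M i p) r \<subseteq> mrange M i"
      "mparam M i ` cball (mchart M i p) r \<subseteq> O'"
      by (rule chart_ball[OF O(1)]) (use pC O(2) in auto)
    then have "ok p i (r/2)" by (simp add: ok_def)
    then show ?thesis by blast
  qed
  then obtain I R where ok: "\<And>p. p \<in> C \<Longrightarrow> ok p (I p) (R p)" by metis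
  define V where "V p = {q \<in> mdom M (I p). mchart M (I p) q \<in> ball (mchart M (I p) p) (R p)}" for p
  have V: "openin (mtop M) (V p)" "p \<in> V p" if "p \<in> C" for p
    using ok[OF that] openin_chart_ball by (auto simp: V_def ok_def)
  obtain F where F: "finite F" "F \<subseteq> V ` C" "C \<subseteq> \<Union>F"
    using compactinD[OF C, of "V ` C"] V by (metis (no_types, lifting) UN_I imageE subsetI)
  obtain P where P: "P \<subseteq> C" "finite P" "C \<subseteq> (\<Union>p\<in>P. V p)"
    using finite_subset_image[OF F(1,2)] F(3) by metis
  define b where "b p = from_chart (I p) (bump (mchart M (I p) p) (R p))" for p
  have b: "smooth_function M (b p)" "0 \<le> b p q" "b p q \<le> 1" "q \<in> V p \<Longrightarrow> b p q = 1"
    "q \<notin> mparam M (I p) ` cball (mchart M (I p) p) (2 * R p) \<Longrightarrow> b p q = 0" if "p \<in> P" for p q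
  proof -
    have o: "ok p (I p) (R p)" using ok P(1) that by blast
    note c = chart_cutoff[of "I p" "R p" "mchart M (I p) p"]
    show "smooth_function M (b p)" "0 \<le> b p q" "b p q \<le> 1"
      "q \<notin> mparam M (I p) ` cball (mchart M (I p) p) (2 * R p) \<Longrightarrow> b p q = 0"
      unfolding b_def using o c by (auto simp: ok_def)
    show "q \<in> V p \<Longrightarrow> b p q = 1"
      unfolding b_def by (rule c(4)) (use o in \<open>auto simp: V_def ok_def\<close>)
  qed
  define f where "f q = 1 - (\<Prod>p\<in>P. 1 - b p q)" for q
  define K where "K = (\<Union>p\<in>P. mparam M (I p) ` cball (mchart M (I p) p) (2 * R p))"
  show thesis
  proof (rule that)
    show "smooth_function M f" unfolding f_def
      by (intro smooth_function_diff smooth_function_const smooth_function_prod b(1))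
    show "0 \<le> f q" for q unfolding f_def using prod_le_1[of P "\<lambda>p. 1 - b p q"] b by auto
    show "f q \<le> 1" for q unfolding f_def using prod_nonneg[of P "\<lambda>p. 1 - b p q"] b by auto
    have "openin (mtop M) (\<Union>p\<in>P. V p)" using V(1) P(1) by (intro openin_Union) auto
    then show "openin (mtop M) ((\<Union>p\<in>P. V p) \<inter> O')" using O(1) by blast
    show "C \<subseteq> (\<Union>p\<in>P. V p) \<inter> O'" using P O by blast
    show "f q = 1" if qV: "q \<in> (\<Union>p\<in>P. V p) \<inter> O'" for q
    proof -
      obtain p where "p \<in> P" "q \<in> V p" using qV by blast
      then have "(\<Prod>p\<in>P. 1 - b p q) = 0" using P(2) b(4) by (intro prod_zero) auto
      then show ?thesis by (simp add: f_def)
    qed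
    show "compactin (mtop M) K" unfolding K_def
      by (rule compactin_Union) (use P ok in \<open>auto simp: ok_def intro!: compact_param_image\<close>)
    show "K \<subseteq> O'" using P ok by (force simp: K_def ok_def)
    show "f q = 0" if "q \<notin> K" for q
      using that b(5) by (simp add: f_def K_def)
  qed auto
qed

lemma compact_neighbourhood:
  assumes C: "compactin (mtop M) C"
  obtains W K where "openin (mtop M) W" "compactin (mtop M) K" "C \<subseteq> W" "W \<subseteq> K"
proof -
  have "C \<subseteq> mpoints M" using C compactin_subset_topspace by blast
  then obtain f W K where "openin (mtop M) W" "C \<subseteq> W" "\<And>p. p \<in> W \<Longrightarrow> f p = (1::real)"
    "compactin (mtop M) K" "\<And>p. p \<notin> K \<Longrightarrow> f p = 0"
    using cutoff_exists[OF C openin_topspace] by metis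
  moreover from this have "W \<subseteq> K" using zero_neq_one by (metis subsetI)
  ultimately show ?thesis using that by blast
qed

end

section \<open>Hamiltonian vector fields\<close>

lemma loclip_family:
  assumes "finite A" "\<And>a. a \<in> A \<Longrightarrow> loclip_on S (f a)" "x \<in> S" "open S"
  obtains r L where "r > 0" "cball x r \<subseteq> S" "L > 0" "\<And>a. a \<in> A \<Longrightarrow> L-lipschitz_on (cball x r) (f a)"
proof -
  have "\<exists>r>0. \<exists>L>0. cball x r \<subseteq> S \<and> (\<forall>a\<in>A. L-lipschitz_on (cball x r) (f a))"
    using assms(1,2)
  proof (induction A rule: finite_induct)
    case empty
    then show ?case using assms(3,4) open_contains_cball zero_less_one by (metis empty_iff)
  next
    case (insert a A)
    obtain r L where 1: "r > 0" "L > 0" "cball x r \<subseteq> S" "\<forall>a\<in>A. L-lipschitz_on (cball x r) (f a)"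
      using insert by auto
    obtain r' L' where 2: "r' > 0" "cball x r' \<subseteq> S" "L' > 0" "L'-lipschitz_on (cball x r') (f a)"
      using loclip_onE[OF insert.prems[of a] assms(3)] by blast
    have "(max L L')-lipschitz_on (cball x (min r r')) (f c)" if "c \<in> insert a A" for c
    proof (cases "c = a")
      case True
      then show ?thesis using lipschitz_on_mono[OF 2(4), of "cball x (min r r')" "max L L'"]
        by (simp add: subset_cball)
    next
      case False
      then show ?thesis using that lipschitz_on_mono[of L "cball x r" "f c" "cball x (min r r')" "max L L'"] 1(4)
        by (simp add: subset_cball)
    qed
    then show ?case using 1 2 by (intro exI[of _ "min r r'"] conjI exI[of _ "max L L'"]) auto
  qed
  then show ?thesis using that by blast
qed

lemma loclip_on_cong:
  assumes "loclip_on S f" "\<And>x. x \<in> S \<Longrightarrow> f x = g x"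
  shows "loclip_on S g"
  unfolding loclip_on_def
proof
  fix x assume "x \<in> S"
  then obtain r L where r: "r > 0" "cball x r \<subseteq> S" "L-lipschitz_on (cball x r) f"
    using assms(1) unfolding loclip_on_def by blast
  have "L-lipschitz_on (cball x r) g"
    by (rule lipschitz_on_transform[OF r(3)]) (use r(2) assms(2) in force)
  then show "\<exists>r>0. \<exists>L. cball x r \<subseteq> S \<and> L-lipschitz_on (cball x r) g" using r by blast
qed

lemma loclip_on_inner_const: "loclip_on S f \<Longrightarrow> loclip_on S (\<lambda>x. f x \<bullet> b)"
  unfolding loclip_on_def
proof (intro ballI)
  fix x assume "\<forall>x\<in>S. \<exists>r>0. \<exists>L. cball x r \<subseteq> S \<and> L-lipschitz_on (cball x r) f" "x \<in> S"
  then obtain r L where r: "r > 0" "cball x r \<subseteq> S" "L-lipschitz_on (cball x r) f" by blast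
  have "(L * norm b)-lipschitz_on (cball x r) (\<lambda>x. f x \<bullet> b)"
  proof (rule lipschitz_onI)
    fix y z assume yz: "y \<in> cball x r" "z \<in> cball x r"
    have "dist (f y \<bullet> b) (f z \<bullet> b) = \<bar>(f y - f z) \<bullet> b\<bar>" by (simp add: dist_real_def inner_diff_left)
    also have "\<dots> \<le> norm (f y - f z) * norm b" by (rule Cauchy_Schwarz_ineq2)
    also have "\<dots> \<le> (L * dist y z) * norm b"
      using lipschitz_onD[OF r(3) yz] by (intro mult_right_mono) (auto simp: dist_norm)
    finally show "dist (f y \<bullet> b) (f z \<bullet> b) \<le> L * norm b * dist y z" by (simp add: mult_ac)
  qed (use lipschitz_on_nonneg[OF r(3)] in simp)
  then show "\<exists>r>0. \<exists>L. cball x r \<subseteq> S \<and> L-lipschitz_on (cball x r) (\<lambda>x. f x \<bullet> b)" using r by blast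
qed

lemma bilinear_expand_left:
  assumes "bilinear B"
  shows "B u b = (\<Sum>a\<in>Basis. (u \<bullet> a) * B a b)"
proof -
  have l: "linear (\<lambda>u. B u b)" using assms by (simp add: bilinear_def)
  have "B u b = B (\<Sum>a\<in>Basis. (u \<bullet> a) *\<^sub>R a) b" by (simp add: euclidean_representation)
  also have "\<dots> = (\<Sum>a\<in>Basis. (u \<bullet> a) * B a b)"
    using linear_sum[OF l, of "\<lambda>a. (u \<bullet> a) *\<^sub>R a" Basis] linear_scale[OF l] by simp
  finally show ?thesis .
qed

text \<open>The solution of a nondegenerate linear system inherits local Lipschitz regularity from the
  coefficients, because the norm of a vector is locally uniformly controlled by its image.\<close>
lemma loclip_solve:
  fixes B :: "'e::euclidean_space \<Rightarrow> 'e \<Rightarrow> 'e \<Rightarrow> real"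
  assumes S: "open S" and B: "\<And>x. x \<in> S \<Longrightarrow> bilinear (B x)"
    and nd: "\<And>x u. x \<in> S \<Longrightarrow> (\<forall>v. B x u v = 0) \<Longrightarrow> u = 0"
    and Bl: "\<And>a b. loclip_on S (\<lambda>x. B x a b)"
    and rl: "\<And>b. loclip_on S (\<lambda>x. r x b)"
    and u: "\<And>x v. x \<in> S \<Longrightarrow> B x (u x) v = r x v"
  shows "loclip_on S u"
  unfolding loclip_on_def
proof
  fix x0 assume x0: "x0 \<in> S"
  obtain \<rho> L where \<rho>: "\<rho> > 0" "cball x0 \<rho> \<subseteq> S" "L > 0"
    and LB: "\<And>a b. a \<in> Basis \<Longrightarrow> b \<in> Basis \<Longrightarrow> L-lipschitz_on (cball x0 \<rho>) (\<lambda>x. B x a b)"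
  proof (rule loclip_family[of "Basis \<times> Basis" S "\<lambda>(a,b) x. B x a b", OF _ _ x0 S])
    show "finite (Basis \<times> (Basis :: 'e set))" by simp
    show "loclip_on S (case ab of (a, b) \<Rightarrow> \<lambda>x. B x a b)" for ab using Bl by (cases ab) simp
  qed (use that in auto)
  obtain \<sigma> L' where \<sigma>: "\<sigma> > 0" "cball x0 \<sigma> \<subseteq> S" "L' > 0"
    and Lr: "\<And>b. b \<in> Basis \<Longrightarrow> L'-lipschitz_on (cball x0 \<sigma>) (\<lambda>x. r x b)"
    using loclip_family[of Basis S "\<lambda>b x. r x b", OF _ rl x0 S] by auto
  define q where "q = min \<rho> \<sigma>"
  define Q where "Q = cball x0 q"
  have q: "q > 0" "Q \<subseteq> S" using \<rho> \<sigma> by (auto simp: q_def Q_def)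
  have LB: "L-lipschitz_on Q (\<lambda>x. B x a b)" if "a \<in> Basis" "b \<in> Basis" for a b
    by (rule lipschitz_on_subset[OF LB[OF that]]) (auto simp: Q_def q_def)
  have Lr: "L'-lipschitz_on Q (\<lambda>x. r x b)" if "b \<in> Basis" for b
    by (rule lipschitz_on_subset[OF Lr[OF that]]) (auto simp: Q_def q_def)
  \<comment> \<open>On \<open>Q\<close> this is the \<open>l1\<close> norm of the functional
    \<open>B x w\<close>; written out in coordinates it is visibly continuous in both
    arguments.\<close>
  define N where "N x w = (\<Sum>b\<in>Basis. \<bar>\<Sum>a\<in>Basis. (w \<bullet> a) * B x a b\<bar>)" for x w :: 'e
  have N: "N x w = (\<Sum>b\<in>Basis. \<bar>B x w b\<bar>)" if "x \<in> Q" for x w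
    using bilinear_expand_left[OF B, of x w] that q by (auto simp: N_def)
  have "continuous_on (Q \<times> sphere 0 1) (\<lambda>z. N (fst z) (snd z))"
  proof -
    have "continuous_on (Q \<times> sphere 0 1) (\<lambda>z. B (fst z) a b)" if "a \<in> Basis" "b \<in> Basis" for a b
      by (rule continuous_on_compose2[OF lipschitz_on_continuous_on[OF LB[OF that]]
          continuous_on_fst[OF continuous_on_id]]) auto
    then show ?thesis unfolding N_def by (intro continuous_intros) auto
  qed
  moreover have "compact (Q \<times> sphere (0::'e) 1)" by (simp add: Q_def compact_Times)
  moreover have "Q \<times> sphere (0::'e) 1 \<noteq> {}"
  proof -
    obtain b :: 'e where "b \<in> Basis" by (meson ex_in_conv nonempty_Basis)
    then have "(x0, b) \<in> Q \<times> sphere 0 1" using q(1) by (simp add: Q_def)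
    then show ?thesis by blast
  qed
  ultimately obtain z where z: "z \<in> Q \<times> sphere 0 1"
    and zmin: "\<And>y. y \<in> Q \<times> sphere 0 1 \<Longrightarrow> N (fst z) (snd z) \<le> N (fst y) (snd y)"
    using continuous_attains_inf by meson
  \<comment> \<open>The minimum over the compact set of base points and unit vectors. It is positive
    by nondegeneracy, and by homogeneity it bounds \<open>norm w\<close> by
    \<open>N x w / m\<close>.\<close>
  define m where "m = N (fst z) (snd z)"
  have "m > 0"
  proof (rule ccontr)
    assume "\<not> m > 0"
    moreover have "m \<ge> 0" by (simp add: m_def N_def sum_nonneg)
    ultimately have "(\<Sum>b\<in>Basis. \<bar>B (fst z) (snd z) b\<bar>) = 0" using N[of "fst z" "snd z"] z by (auto simp: m_def)
    then have 0: "B (fst z) (snd z) b = 0" if "b \<in> Basis" for b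
      using that by (simp add: sum_nonneg_eq_0_iff)
    have lin: "linear (B (fst z) (snd z))" using B z q by (auto simp: bilinear_def)
    have "B (fst z) (snd z) v = 0" for v
    proof -
      have "B (fst z) (snd z) v = B (fst z) (snd z) (\<Sum>b\<in>Basis. (v \<bullet> b) *\<^sub>R b)"
        by (simp add: euclidean_representation)
      also have "\<dots> = 0"
        using 0 by (simp add: linear_sum[OF lin] linear_scale[OF lin])
      finally show ?thesis .
    qed
    then have "snd z = 0" using nd[of "fst z" "snd z"] z q by auto
    then show False using z by auto
  qed
  have Nm: "m * norm w \<le> N x w" if x: "x \<in> Q" for x w
  proof (cases "w = 0")
    case False
    have "m \<le> N x (w /\<^sub>R norm w)"
      using zmin[of "(x, w /\<^sub>R norm w)"] x False by (simp add: m_def)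
    also have "N x (w /\<^sub>R norm w) = N x w / norm w"
    proof -
      have "(\<Sum>a\<in>Basis. (w /\<^sub>R norm w) \<bullet> a * B x a b) = (\<Sum>a\<in>Basis. w \<bullet> a * B x a b) / norm w" for b
        by (simp add: sum_divide_distrib divide_inverse sum_distrib_left mult_ac)
      then have "N x (w /\<^sub>R norm w) = (\<Sum>b\<in>Basis. \<bar>(\<Sum>a\<in>Basis. w \<bullet> a * B x a b) / norm w\<bar>)"
        unfolding N_def by (simp only:)
      also have "\<dots> = N x w / norm w" unfolding N_def by (subst (2) sum_divide_distrib) (simp only: abs_divide abs_norm_cancel)
      finally show ?thesis .
    qed
    finally show ?thesis using False by (simp add: field_simps)
  qed (simp add: N_def)
  have "\<exists>C. \<forall>x\<in>Q. \<bar>r x b\<bar> \<le> C" if "b \<in> Basis" for b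
  proof -
    have "bounded ((\<lambda>x. r x b) ` Q)"
      using lipschitz_on_continuous_on[OF Lr[OF that]] compact_continuous_image compact_imp_bounded
        compact_cball unfolding Q_def by blast
    then show ?thesis by (auto simp: bounded_iff)
  qed
  then obtain C where C: "\<And>b x. b \<in> Basis \<Longrightarrow> x \<in> Q \<Longrightarrow> \<bar>r x b\<bar> \<le> C b" by metis
  define K where "K = (\<Sum>b\<in>(Basis::'e set). C b) / m"
  have ub: "norm (u x) \<le> K" if x: "x \<in> Q" for x
  proof -
    have "m * norm (u x) \<le> (\<Sum>b\<in>Basis. \<bar>B x (u x) b\<bar>)" using Nm[OF x, of "u x"] N[OF x] by simp
    also have "\<dots> \<le> (\<Sum>b\<in>Basis. C b)" using u C x q by (intro sum_mono) auto
    finally show ?thesis using \<open>m > 0\<close> by (simp add: K_def field_simps)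
  qed
  have K0: "K \<ge> 0" using order_trans[OF norm_ge_zero ub[of x0]] q by (simp add: Q_def)
  \<comment> \<open>Subtracting the systems at \<open>x\<close> and \<open>y\<close> gives \<open>B
    x (u x - u y) b = (r x b - r y b) - (B x (u y) b - B y (u y) b)\<close>. The first difference
    contributes \<open>L'\<close>, the second \<open>K * L\<close> for each basis vector since
    \<open>norm (u y) \<le> K\<close>; dividing by \<open>m\<close> isolates
    \<open>u x - u y\<close>.\<close>
  define LL where "LL = (\<Sum>b\<in>(Basis::'e set). L' + (\<Sum>a\<in>(Basis::'e set). K * L)) / m"
  have "LL-lipschitz_on Q u"
  proof (rule lipschitz_onI)
    fix x y assume xy: "x \<in> Q" "y \<in> Q"
    have xS: "x \<in> S" "y \<in> S" using xy q by auto
    have "\<bar>B x (u x - u y) b\<bar> \<le> (L' + (\<Sum>a\<in>(Basis::'e set). K * L)) * dist x y" if b: "b \<in> Basis" for b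
    proof -
      have lin: "linear (\<lambda>u. B x u b)" using B[OF xS(1)] by (simp add: bilinear_def)
      have "B x (u x - u y) b = r x b - B x (u y) b" using linear_diff[OF lin] u[OF xS(1)] by simp
      also have "\<dots> = (r x b - r y b) - (B x (u y) b - B y (u y) b)" using u[OF xS(2)] by simp
      also have "B x (u y) b - B y (u y) b = (\<Sum>a\<in>Basis. (u y \<bullet> a) * (B x a b - B y a b))"
        unfolding bilinear_expand_left[OF B[OF xS(1)], of "u y"] bilinear_expand_left[OF B[OF xS(2)], of "u y"]
        by (simp add: sum_subtractf[symmetric] right_diff_distrib)
      finally have "\<bar>B x (u x - u y) b\<bar> \<le> \<bar>r x b - r y b\<bar> + \<bar>\<Sum>a\<in>Basis. (u y \<bullet> a) * (B x a b - B y a b)\<bar>"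
        by linarith
      also have "\<dots> \<le> L' * dist x y + (\<Sum>a\<in>(Basis::'e set). K * (L * dist x y))"
      proof (rule add_mono)
        show "\<bar>r x b - r y b\<bar> \<le> L' * dist x y" using lipschitz_onD[OF Lr[OF b] xy] by (simp add: dist_real_def)
        show "\<bar>\<Sum>a\<in>Basis. (u y \<bullet> a) * (B x a b - B y a b)\<bar> \<le> (\<Sum>a\<in>(Basis::'e set). K * (L * dist x y))"
        proof (rule order_trans[OF sum_abs sum_mono])
          fix a :: 'e assume a: "a \<in> Basis"
          have "\<bar>u y \<bullet> a\<bar> \<le> K" using Basis_le_norm[OF a, of "u y"] ub[OF xy(2)] by linarith
          then show "\<bar>(u y \<bullet> a) * (B x a b - B y a b)\<bar> \<le> K * (L * dist x y)"
            unfolding abs_mult using lipschitz_onD[OF LB[OF a b] xy] K0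
            by (intro mult_mono) (auto simp: dist_real_def)
        qed
      qed
      also have "\<dots> = (L' + (\<Sum>a\<in>(Basis::'e set). K * L)) * dist x y" by (simp add: algebra_simps)
      finally show ?thesis .
    qed
    then have "(\<Sum>b\<in>Basis. \<bar>B x (u x - u y) b\<bar>)
        \<le> (\<Sum>b\<in>(Basis::'e set). (L' + (\<Sum>a\<in>(Basis::'e set). K * L)) * dist x y)"
      by (rule sum_mono)
    then have "m * norm (u x - u y) \<le> (\<Sum>b\<in>(Basis::'e set). (L' + (\<Sum>a\<in>(Basis::'e set). K * L)) * dist x y)"
      using Nm[OF xy(1), of "u x - u y"] N[OF xy(1)] by simp
    also have "\<dots> = m * (LL * dist x y)"
      using \<open>m > 0\<close> by (simp add: LL_def)
    finally show "dist (u x) (u y) \<le> LL * dist x y"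
      using \<open>m > 0\<close> by (simp add: dist_norm)
  qed (use \<open>m > 0\<close> K0 \<rho> \<sigma> in \<open>simp add: LL_def\<close>)
  then show "\<exists>r>0. \<exists>L. cball x0 r \<subseteq> S \<and> L-lipschitz_on (cball x0 r) u" using q Q_def by blast
qed

locale sympl_mfd =
  fixes M :: "('i, 'a, 'e::euclidean_space, 'm) sympl_scheme"
  assumes S: "symplectic_manifold M"

sublocale sympl_mfd \<subseteq> smooth_mfd M
  using S by unfold_locales (simp add: symplectic_manifold_def)

context sympl_mfd
begin

lemma sform_bilinear: "i \<in> mindex M \<Longrightarrow> x \<in> mrange M i \<Longrightarrow> bilinear (sform M i x)"
  and sform_alternating: "i \<in> mindex M \<Longrightarrow> x \<in> mrange M i \<Longrightarrow> sform M i x u u = 0"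
  and sform_smooth: "i \<in> mindex M \<Longrightarrow> smooth_on (mrange M i) (\<lambda>x. sform M i x u v)"
  and sform_nondegenerate:
    "i \<in> mindex M \<Longrightarrow> x \<in> mrange M i \<Longrightarrow> (\<forall>v. sform M i x u v = 0) \<Longrightarrow> u = 0"
  using S by (auto simp: symplectic_manifold_def two_form_def nondegenerate_form_def)

lemma sform_antisym:
  assumes "i \<in> mindex M" "x \<in> mrange M i"
  shows "sform M i x u v = - sform M i x v u"
proof -
  have b: "bilinear (sform M i x)" by (rule sform_bilinear[OF assms])
  have "sform M i x (u + v) (u + v) = 0" by (rule sform_alternating[OF assms])
  then show ?thesis
    using sform_alternating[OF assms, of u] sform_alternating[OF assms, of v]
    by (simp add: bilinear_ladd[OF b] bilinear_radd[OF b])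
qed

lemma sform_sgrad:
  assumes "i \<in> mindex M" "p \<in> mdom M i" "smooth_function M H"
  shows "sform M i (mchart M i p) (sgrad M H i p) v = - dcoord M H i p v"
  using sgrad_unique[OF S assms] by blast

text \<open>The sign in the defining equation of \<open>sgrad F\<close> and the one from
  antisymmetry cancel, leaving the derivative of \<open>F\<close> in the direction
  \<open>sgrad H\<close>.\<close>

lemma poisson_eq:
  assumes "i \<in> mindex M" "p \<in> mdom M i" "smooth_function M F" "smooth_function M H"
  shows "poisson M F H p = dcoord M F i p (sgrad M H i p)"
  using poisson_chart[OF S assms] sform_sgrad[OF assms(1,2,3)]
    sform_antisym[OF assms(1) mchart_in[OF assms(1,2)], of "sgrad M H i p"] by simp

lemma sgrad_eq_zero:
  assumes "i \<in> mindex M" "p \<in> mdom M i" "smooth_function M H" "\<And>v. dcoord M H i p v = 0"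
  shows "sgrad M H i p = 0"
proof (rule sform_nondegenerate[OF assms(1) mchart_in[OF assms(1,2)]])
  show "\<forall>v. sform M i (mchart M i p) (sgrad M H i p) v = 0" using sform_sgrad[OF assms(1-3)] assms(4) by simp
qed

lemma has_derivative_dcoord:
  assumes "i \<in> mindex M" "p \<in> mdom M i" "smooth_function M F"
  shows "(F \<circ> mparam M i has_derivative dcoord M F i p) (at (mchart M i p))"
  unfolding dcoord_def
  using assms mchart_in by (auto simp: smooth_function_def intro!: smooth_on_has_derivative)

lemma dcoord_unique:
  assumes "(F \<circ> mparam M i has_derivative D) (at (mchart M i p))"
  shows "dcoord M F i p = D"
  unfolding dcoord_def using frechet_derivative_at[OF assms] by simp

lemma dcoord_cong:
  assumes "openin (mtop M) O'" "p \<in> O'" "\<And>q. q \<in> O' \<Longrightarrow> F q = G q" "i \<in> mindex M" "p \<in> mdom M i"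
  shows "dcoord M F i p = dcoord M G i p"
  unfolding dcoord_def
  by (rule frechet_derivative_cong_open[OF open_param_preimage[OF assms(4,1)]])
    (use assms mparam_mchart' mchart_in in auto)

lemma sgrad_cong:
  assumes "openin (mtop M) O'" "p \<in> O'" "\<And>q. q \<in> O' \<Longrightarrow> F q = G q" "i \<in> mindex M" "p \<in> mdom M i"
  shows "sgrad M F i p = sgrad M G i p"
  by (simp add: sgrad_def dcoord_cong[OF assms])

lemma dcoord_const: "dcoord M (\<lambda>p. c) i p = (\<lambda>v. 0)"
  by (rule dcoord_unique) (simp add: o_def)

lemma dcoord_add:
  assumes "i \<in> mindex M" "p \<in> mdom M i" "smooth_function M F" "smooth_function M G"
  shows "dcoord M (\<lambda>p. F p + G p) i p = (\<lambda>v. dcoord M F i p v + dcoord M G i p v)"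
  by (rule dcoord_unique)
    (use has_derivative_add[OF has_derivative_dcoord[OF assms(1-3)] has_derivative_dcoord[OF assms(1,2,4)]]
      in \<open>simp add: o_def\<close>)

lemma dcoord_mult:
  assumes "i \<in> mindex M" "p \<in> mdom M i" "smooth_function M F" "smooth_function M G"
  shows "dcoord M (\<lambda>p. F p * G p) i p = (\<lambda>v. F p * dcoord M G i p v + dcoord M F i p v * G p)"
  by (rule dcoord_unique)
    (use has_derivative_mult[OF has_derivative_dcoord[OF assms(1-3)] has_derivative_dcoord[OF assms(1,2,4)]]
      mparam_mchart'[OF assms(1,2)] in \<open>simp add: o_def\<close>)

context
  fixes H assumes H: "smooth_function M H"
begin

lemma poisson_const: "p \<in> mpoints M \<Longrightarrow> poisson M (\<lambda>p. c) H p = 0"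
  using chart_exists poisson_eq[OF _ _ smooth_function_const H] dcoord_const by metis

lemma poisson_add:
  assumes "p \<in> mpoints M" "smooth_function M F" "smooth_function M G"
  shows "poisson M (\<lambda>p. F p + G p) H p = poisson M F H p + poisson M G H p"
proof -
  obtain i where i: "i \<in> mindex M" "p \<in> mdom M i" using chart_exists[OF assms(1)] by blast
  show ?thesis
    by (simp add: poisson_eq[OF i _ H] assms smooth_function_add dcoord_add[OF i assms(2,3)])
qed

lemma poisson_mult:
  assumes "p \<in> mpoints M" "smooth_function M F" "smooth_function M G"
  shows "poisson M (\<lambda>p. F p * G p) H p = F p * poisson M G H p + poisson M F H p * G p"
proof -
  obtain i where i: "i \<in> mindex M" "p \<in> mdom M i" using chart_exists[OF assms(1)] by blast
  show ?thesis
    by (simp add: poisson_eq[OF i _ H] assms smooth_function_mult dcoord_mult[OF i assms(2,3)])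
qed

lemma poisson_cmult:
  assumes "p \<in> mpoints M" "smooth_function M F"
  shows "poisson M (\<lambda>p. c * F p) H p = c * poisson M F H p"
  using poisson_mult[OF assms(1) smooth_function_const assms(2), of c] poisson_const[OF assms(1)] by simp

lemma poisson_sum:
  assumes "p \<in> mpoints M" "finite I" "\<And>i. i \<in> I \<Longrightarrow> smooth_function M (F i)"
  shows "poisson M (\<lambda>p. \<Sum>i\<in>I. F i p) H p = (\<Sum>i\<in>I. poisson M (F i) H p)"
  using assms(2,3)
proof (induction I rule: finite_induct)
  case empty
  then show ?case using poisson_const[OF assms(1)] by simp
next
  case (insert j I)
  then show ?case
    using poisson_add[OF assms(1), of "F j" "\<lambda>p. \<Sum>i\<in>I. F i p"] smooth_function_sum[of I F] by simp
qed

text \<open>Picard iteration and Gronwall's inequality consume exactly this regularity. It comes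
  from \<open>loclip_solve\<close> applied to the defining equation of \<open>sgrad\<close>, with
  the partial derivatives of \<open>H\<close> on the right-hand side.\<close>

lemma sgrad_loclip:
  assumes i: "i \<in> mindex M"
  shows "loclip_on (mrange M i) (\<lambda>x. sgrad M H i (mparam M i x))"
proof (rule loclip_solve[OF open_mrange[OF i] sform_bilinear[OF i] sform_nondegenerate[OF i]])
  show "loclip_on (mrange M i) (\<lambda>x. sform M i x a b)" for a b
    by (rule smooth_imp_loclip[OF open_mrange[OF i] sform_smooth[OF i]])
  have "smooth_on (mrange M i) (\<lambda>x. (- 1) * frechet_derivative (H \<circ> mparam M i) (at x) b)" for b
    using H i by (intro smooth_on_mult smooth_on_const smooth_on_frechet_derivative open_mrange)
      (auto simp: smooth_function_def)
  then show "loclip_on (mrange M i) (\<lambda>x. (- 1) * frechet_derivative (H \<circ> mparam M i) (at x) b)" for b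
    by (intro smooth_imp_loclip open_mrange i)
  show "sform M i x (sgrad M H i (mparam M i x)) v = (- 1) * frechet_derivative (H \<circ> mparam M i) (at x) v"
    if "x \<in> mrange M i" for x v
    using sform_sgrad[OF i mparam_in[OF i that] H, of v] mchart_mparam[OF i that] by (simp add: dcoord_def)
qed

text \<open>In a chart the bracket is the sum of components of \<open>sgrad H\<close> times partial
  derivatives of \<open>F\<close>. It serves \<open>gronwall\<close>, where brackets are the
  velocities of test functions, and it yields boundedness of brackets on compact sets.\<close>

lemma poisson_loclip:
  assumes F: "smooth_function M F"
  shows "loclip_fun M (poisson M F H)"
  unfolding loclip_fun_def
proof
  fix i assume i: "i \<in> mindex M"
  let ?D = "\<lambda>x. frechet_derivative (F \<circ> mparam M i) (at x)"
  let ?v = "\<lambda>x. sgrad M H i (mparam M i x)"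
  have Fs: "smooth_on (mrange M i) (F \<circ> mparam M i)" using F i by (simp add: smooth_function_def)
  have "loclip_on (mrange M i) (\<lambda>x. \<Sum>b\<in>Basis. (?v x \<bullet> b) * ?D x b)"
    by (intro loclip_on_sum loclip_on_mult loclip_on_inner_const sgrad_loclip i open_mrange
        smooth_imp_loclip smooth_on_frechet_derivative Fs)
  moreover have "(\<Sum>b\<in>Basis. (?v x \<bullet> b) * ?D x b) = (poisson M F H \<circ> mparam M i) x" if x: "x \<in> mrange M i" for x
  proof -
    have lin: "linear (?D x)"
      using smooth_on_has_derivative[OF Fs x] has_derivative_linear by blast
    have "(poisson M F H \<circ> mparam M i) x = ?D x (?v x)"
      using poisson_eq[OF i mparam_in[OF i x] F H] mchart_mparam[OF i x] by (simp add: dcoord_def)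
    also have "\<dots> = ?D x (\<Sum>b\<in>Basis. (?v x \<bullet> b) *\<^sub>R b)" by (simp add: euclidean_representation)
    also have "\<dots> = (\<Sum>b\<in>Basis. (?v x \<bullet> b) * ?D x b)" by (simp add: linear_sum[OF lin] linear_scale[OF lin])
    finally show ?thesis by simp
  qed
  ultimately show "loclip_on (mrange M i) (poisson M F H \<circ> mparam M i)"
    by (rule loclip_on_cong)
qed

text \<open>By continuity the curve stays in one chart for nearby times, where the chain rule and
  \<open>poisson_eq\<close> apply. From here on trajectories can be studied through real-valued
  functions, whatever charts they cross.\<close>

lemma trajectory_derivative:
  assumes tr: "trajectory M (H \<circ> fst) T \<gamma>" and t: "t \<in> T" and F: "smooth_function M F"
  shows "((\<lambda>s. F (\<gamma> s)) has_real_derivative poisson M F H (\<gamma> t)) (at t within T)"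
proof -
  have c: "continuous_map (top_of_set T) (mtop M) \<gamma>" using tr by (simp add: trajectory_def)
  then have "\<gamma> t \<in> mpoints M" using t continuous_map_image_subset_topspace by fastforce
  then obtain i where i: "i \<in> mindex M" "\<gamma> t \<in> mdom M i" using chart_exists by blast
  let ?\<phi> = "\<lambda>s. mchart M i (\<gamma> s)"
  have "openin (top_of_set T) {s \<in> T. \<gamma> s \<in> mdom M i}"
    using c openin_mdom[OF i(1)] by (auto simp: continuous_map)
  then obtain e where e: "e > 0" "\<And>s. s \<in> T \<Longrightarrow> dist s t < e \<Longrightarrow> \<gamma> s \<in> mdom M i"
    using t i(2) unfolding openin_euclidean_subtopology_iff by blast
  have "(?\<phi> has_vector_derivative sgrad M H i (\<gamma> t)) (at t within T)"
    using tr t i by (simp add: trajectory_def time_slice_def o_def)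
  then have "(?\<phi> has_derivative (\<lambda>h. h *\<^sub>R sgrad M H i (\<gamma> t))) (at t within T)"
    by (simp add: has_vector_derivative_def)
  then have "((F \<circ> mparam M i) \<circ> ?\<phi> has_derivative dcoord M F i (\<gamma> t) \<circ> (\<lambda>h. h *\<^sub>R sgrad M H i (\<gamma> t))) (at t within T)"
    using diff_chain_within has_derivative_at_withinI[OF has_derivative_dcoord[OF i F]] by blast
  then have "((\<lambda>s. F (\<gamma> s)) has_derivative dcoord M F i (\<gamma> t) \<circ> (\<lambda>h. h *\<^sub>R sgrad M H i (\<gamma> t))) (at t within T)"
    by (rule has_derivative_transform_within[OF _ e(1) t]) (use e(2) mparam_mchart'[OF i(1)] in auto)
  moreover have "linear (dcoord M F i (\<gamma> t))"
    using has_derivative_linear[OF has_derivative_dcoord[OF i F]] .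
  then have "dcoord M F i (\<gamma> t) \<circ> (\<lambda>h. h *\<^sub>R sgrad M H i (\<gamma> t)) = (\<lambda>h. poisson M F H (\<gamma> t) * h)"
    by (auto simp: linear_scale poisson_eq[OF i F H])
  ultimately show ?thesis by (simp add: has_field_derivative_def)
qed

end

lemma poisson_cong:
  assumes "openin (mtop M) O'" "p \<in> O'" "\<And>q. q \<in> O' \<Longrightarrow> F q = F' q" "\<And>q. q \<in> O' \<Longrightarrow> G q = G' q"
    "smooth_function M F" "smooth_function M F'" "smooth_function M G" "smooth_function M G'"
  shows "poisson M F G p = poisson M F' G' p"
proof -
  have "p \<in> mpoints M" using assms openin_subset by blast
  then obtain i where i: "i \<in> mindex M" "p \<in> mdom M i" using chart_exists by blast
  show ?thesis
    by (simp add: poisson_eq[OF i] assms(5-8) dcoord_cong[OF assms(1-3) i]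
        sgrad_cong[OF assms(1,2,4) i])
qed

end

section \<open>Uniqueness and Lipschitz dependence of trajectories\<close>

text \<open>A finite subcover leaves finitely many local constants; the sum of their absolute values
  lies above each of them and makes sense even for the empty cover.\<close>

lemma compactin_uniform:
  assumes "compactin X K"
    and loc: "\<And>z. z \<in> K \<Longrightarrow> \<exists>W C. openin X W \<and> z \<in> W \<and> (\<forall>y\<in>W. Q y C)"
    and mono: "\<And>y C D. Q y C \<Longrightarrow> C \<le> D \<Longrightarrow> Q y D"
  shows "\<exists>C::real. \<forall>y\<in>K. Q y C"
proof -
  obtain W C where W: "\<And>z. z \<in> K \<Longrightarrow> openin X (W z)" "\<And>z. z \<in> K \<Longrightarrow> z \<in> W z"
    and C: "\<And>z y. z \<in> K \<Longrightarrow> y \<in> W z \<Longrightarrow> Q y (C z)" using loc by metis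
  have "\<exists>F. finite F \<and> F \<subseteq> W ` K \<and> K \<subseteq> \<Union>F"
    using compactinD[OF assms(1), of "W ` K"] W by (metis (no_types, lifting) UN_I imageE subsetI)
  then obtain P where P: "P \<subseteq> K" "finite P" "K \<subseteq> (\<Union>p\<in>P. W p)"
    using finite_subset_image by metis
  have "Q y (\<Sum>p\<in>P. \<bar>C p\<bar>)" if y: "y \<in> K" for y
  proof -
    obtain p where p: "p \<in> P" "y \<in> W p" using P y by blast
    have "C p \<le> (\<Sum>p\<in>P. \<bar>C p\<bar>)"
      using member_le_sum[of p P "\<lambda>p. \<bar>C p\<bar>"] p P(2) by auto
    then show ?thesis using mono C p P(1) by blast
  qed
  then show ?thesis by blast
qed

definition sqdist :: "('a \<Rightarrow> real) set \<Rightarrow> 'a \<Rightarrow> 'a \<Rightarrow> real" where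
  "sqdist \<Psi> p q = (\<Sum>\<psi>\<in>\<Psi>. (\<psi> p - \<psi> q)\<^sup>2)"

lemma sqdist_nonneg: "0 \<le> sqdist \<Psi> p q"
  by (simp add: sqdist_def sum_nonneg)

lemma sqdist_self [simp]: "sqdist \<Psi> p p = 0"
  by (simp add: sqdist_def)

lemma sqdist_triangle: "sqdist \<Psi> p r \<le> 2 * sqdist \<Psi> p q + 2 * sqdist \<Psi> q r"
proof -
  \<comment> \<open>The right-hand side minus the left-hand side is
    \<open>(a - 2 * b + c)\<^sup>2\<close>.\<close>
  have "(a - c)\<^sup>2 \<le> 2 * (a - b)\<^sup>2 + 2 * (b - c)\<^sup>2" for a b c :: real
    using zero_le_power2[of "a - 2 * b + c"] by (simp add: power2_eq_square algebra_simps)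
  then show ?thesis unfolding sqdist_def sum_distrib_left sum.distrib[symmetric] by (intro sum_mono)
qed

lemma sqdist_member: "finite \<Psi> \<Longrightarrow> \<psi> \<in> \<Psi> \<Longrightarrow> (\<psi> p - \<psi> q)\<^sup>2 \<le> sqdist \<Psi> p q"
  unfolding sqdist_def by (rule member_le_sum) auto

section \<open>A finite family of smooth functions as a metric on a compact set\<close>

context smooth_mfd
begin

text \<open>\<open>sqdist \<Psi>\<close> serves as a squared distance on the compact set \<open>K\<close>; it replaces an embedding
  into a Euclidean space and lets Gronwall's inequality be applied to trajectories without
  passing from chart to chart.\<close>
definition metrizes :: "('a \<Rightarrow> real) set \<Rightarrow> 'a set \<Rightarrow> bool" where
  "metrizes \<Psi> K \<longleftrightarrow> finite \<Psi> \<and> (\<forall>\<psi>\<in>\<Psi>. smooth_function M \<psi>) \<and>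
    (\<forall>p\<in>K. \<forall>q\<in>mpoints M. sqdist \<Psi> p q = 0 \<longrightarrow> p = q) \<and>
    (\<forall>f. loclip_fun M f \<longrightarrow> (\<exists>C. \<forall>p\<in>K. \<forall>q\<in>K. (f p - f q)\<^sup>2 \<le> C * sqdist \<Psi> p q))"

lemma metrizes_separates:
  "metrizes \<Psi> K \<Longrightarrow> p \<in> K \<Longrightarrow> q \<in> mpoints M \<Longrightarrow> sqdist \<Psi> p q = 0 \<Longrightarrow> p = q"
  unfolding metrizes_def by blast

lemma sqdist_continuous:
  assumes "\<And>\<psi>. \<psi> \<in> \<Psi> \<Longrightarrow> smooth_function M \<psi>"
  shows "continuous_map (prod_topology (mtop M) (mtop M)) euclideanreal (\<lambda>z. sqdist \<Psi> (fst z) (snd z))"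
proof -
  have "continuous_map (prod_topology (mtop M) (mtop M)) euclideanreal (\<lambda>z. \<psi> (fst z))"
    "continuous_map (prod_topology (mtop M) (mtop M)) euclideanreal (\<lambda>z. \<psi> (snd z))" if "\<psi> \<in> \<Psi>" for \<psi>
    using continuous_map_compose[OF continuous_map_fst smooth_function_continuous[OF assms[OF that]]]
      continuous_map_compose[OF continuous_map_snd smooth_function_continuous[OF assms[OF that]]]
    by (simp_all add: o_def)
  then show ?thesis unfolding sqdist_def
    by (cases "finite \<Psi>") (auto intro!: continuous_map_sum continuous_map_real_pow continuous_map_diff)
qed

text \<open>The family consists of the bumps of finitely many chart balls covering \<open>K\<close>
  and of the chart coordinates multiplied by these bumps. Where a bump is 1 the coordinates can be
  read off, which separates points and controls Lipschitz functions near the diagonal. Away from the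
  diagonal \<open>sqdist\<close> is bounded below, and compactness of \<open>K \<times> K\<close>
  joins the two estimates.\<close>

lemma metrizes_exists:
  assumes K: "compactin (mtop M) K"
  obtains \<Psi> where "metrizes \<Psi> K"
proof -
  define ok where "ok p i r \<longleftrightarrow> i \<in> mindex M \<and> p \<in> mdom M i \<and> r > 0 \<and>
      cball (mchart M i p) (2 * r) \<subseteq> mrange M i" for p i r
  have "\<exists>i r. ok p i r" if pK: "p \<in> K" for p
  proof -
    have "p \<in> mpoints M" using K pK compactin_subset_topspace by blast
    then obtain i r where "i \<in> mindex M" "p \<in> mdom M i" "r > 0" "cball (mchart M i p) r \<subseteq> mrange M i"
      by (rule chart_ball[OF openin_topspace])
    then have "ok p i (r/2)" by (simp add: ok_def)
    then show ?thesis by blast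
  qed
  then obtain I R where ok: "\<And>p. p \<in> K \<Longrightarrow> ok p (I p) (R p)" by metis
  define V where "V p = {q \<in> mdom M (I p). mchart M (I p) q \<in> ball (mchart M (I p) p) (R p)}" for p
  have V: "openin (mtop M) (V p)" "p \<in> V p" if "p \<in> K" for p
    using ok[OF that] openin_chart_ball by (auto simp: V_def ok_def)
  obtain F where F: "finite F" "F \<subseteq> V ` K" "K \<subseteq> \<Union>F"
    using compactinD[OF K, of "V ` K"] V by (metis (no_types, lifting) UN_I imageE subsetI)
  obtain P where P: "P \<subseteq> K" "finite P" "K \<subseteq> (\<Union>p\<in>P. V p)"
    using finite_subset_image[OF F(1,2)] F(3) by metis
  \<comment> \<open>The value \<open>c = 0\<close> encodes the bump itself; it cannot clash with a
    coordinate direction because \<open>0\<close> is not in \<open>Basis\<close>.\<close>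
  define h where "h p c = (\<lambda>y. bump (mchart M (I p) p) (R p) y * (if c = 0 then 1 else y \<bullet> c))" for p and c :: 'e
  define \<Psi> where "\<Psi> = (\<lambda>(p, c). from_chart (I p) (h p c)) ` (P \<times> insert 0 Basis)"
  have fin: "finite \<Psi>" using P(2) by (simp add: \<Psi>_def)
  have sm: "smooth_function M \<psi>" if "\<psi> \<in> \<Psi>" for \<psi>
  proof -
    obtain p c where pc: "p \<in> P" "\<psi> = from_chart (I p) (h p c)" using \<open>\<psi> \<in> \<Psi>\<close> by (auto simp: \<Psi>_def)
    have o: "ok p (I p) (R p)" using ok P pc by blast
    have "smooth_on UNIV (\<lambda>y. y \<bullet> c)"
      by (intro smooth_on_inner smooth_on_const smooth_on_bounded_linear bounded_linear_ident) auto
    then have h: "smooth_on UNIV (h p c)" unfolding h_def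
      by (cases "c = 0") (simp_all add: smooth_on_bump smooth_on_mult)
    show ?thesis unfolding pc(2)
    proof (rule smooth_from_chart[OF _ smooth_on_subset[OF h] compact_cball])
      show "I p \<in> mindex M" "cball (mchart M (I p) p) (2 * R p) \<subseteq> mrange M (I p)" using o by (auto simp: ok_def)
      show "h p c x = 0" if "x \<in> mrange M (I p) - cball (mchart M (I p) p) (2 * R p)" for x
      proof -
        have "bump (mchart M (I p) p) (R p) x = 0"
          by (rule bump_0) (use that o in \<open>auto simp: ok_def\<close>)
        then show ?thesis by (simp add: h_def)
      qed
    qed auto
  qed
  have val: "from_chart (I p) (h p c) q = (if c = 0 then 1 else mchart M (I p) q \<bullet> c)"
    if "p \<in> P" "q \<in> V p" for p c q
  proof -
    have o: "ok p (I p) (R p)" using ok P that by blast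
    have "bump (mchart M (I p) p) (R p) (mchart M (I p) q) = 1"
      by (rule bump_1) (use that o in \<open>auto simp: ok_def V_def\<close>)
    then show ?thesis using that by (simp add: from_chart_def h_def V_def)
  qed
  have sep: "p = q" if pK: "p \<in> K" and q: "q \<in> mpoints M" and 0: "sqdist \<Psi> p q = 0" for p q
  proof -
    have eq: "\<psi> p = \<psi> q" if "\<psi> \<in> \<Psi>" for \<psi>
      using 0 fin that by (simp add: sqdist_def sum_nonneg_eq_0_iff)
    obtain a where a: "a \<in> P" "p \<in> V a" using P pK by blast
    have i: "I a \<in> mindex M" and pd: "p \<in> mdom M (I a)" using ok a P by (auto simp: ok_def V_def)
    have "from_chart (I a) (h a c) q = from_chart (I a) (h a c) p" if "c \<in> insert 0 Basis" for c
      using eq[of "from_chart (I a) (h a c)"] a(1) that by (force simp: \<Psi>_def)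
    then have *: "from_chart (I a) (h a c) q = (if c = 0 then 1 else mchart M (I a) p \<bullet> c)"
      if "c \<in> insert 0 Basis" for c using val[OF a] that by simp
    \<comment> \<open>A point outside the chart would have value 0. The bump component forces the
      value 1, so \<open>q\<close> lies in the same chart and its bump factor drops out of the
      coordinate components.\<close>
    from *[of 0] have q1: "q \<in> mdom M (I a)" and q2: "bump (mchart M (I a) a) (R a) (mchart M (I a) q) = 1"
      by (auto simp: from_chart_def h_def split: if_splits)
    have "mchart M (I a) q \<bullet> c = mchart M (I a) p \<bullet> c" if c: "c \<in> Basis" for c
    proof -
      have "c \<noteq> 0" using c nonzero_Basis by blast
      then show ?thesis using *[of c] c q1 q2 by (simp add: from_chart_def h_def)
    qed
    then have "mchart M (I a) q = mchart M (I a) p" by (rule euclidean_eqI)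
    then show ?thesis using mparam_mchart'[OF i] q1 pd by metis
  qed
  have lip: "\<exists>C. \<forall>p\<in>K. \<forall>q\<in>K. (f p - f q)\<^sup>2 \<le> C * sqdist \<Psi> p q" if f: "loclip_fun M f" for f
  proof -
    have fc: "continuous_map (mtop M) euclideanreal f" by (rule loclip_fun_continuous[OF f])
    have "\<exists>C. \<forall>z\<in>K \<times> K. (f (fst z) - f (snd z))\<^sup>2 \<le> C * sqdist \<Psi> (fst z) (snd z)"
    proof (rule compactin_uniform[of "prod_topology (mtop M) (mtop M)"])
      show "compactin (prod_topology (mtop M) (mtop M)) (K \<times> K)" using K by (simp add: compactin_Times)
      show "(f (fst y) - f (snd y))\<^sup>2 \<le> D * sqdist \<Psi> (fst y) (snd y)"
        if "(f (fst y) - f (snd y))\<^sup>2 \<le> C * sqdist \<Psi> (fst y) (snd y)" "C \<le> D" for y C D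
        using that mult_right_mono[OF that(2) sqdist_nonneg, of \<Psi> "fst y" "snd y"] by linarith
      fix z assume z: "z \<in> K \<times> K"
      then have zM: "fst z \<in> mpoints M" "snd z \<in> mpoints M" using K compactin_subset_topspace by fastforce+
      show "\<exists>W C. openin (prod_topology (mtop M) (mtop M)) W \<and> z \<in> W \<and>
          (\<forall>y\<in>W. (f (fst y) - f (snd y))\<^sup>2 \<le> C * sqdist \<Psi> (fst y) (snd y))"
      proof (cases "fst z = snd z")
        case False
        let ?X = "prod_topology (mtop M) (mtop M)"
        \<comment> \<open>Off the diagonal: near \<open>z\<close> the distance exceeds
          \<open>e / 2\<close> while the difference of values stays below \<open>b\<close>, so the
          constant \<open>2 * b\<^sup>2 / e\<close> works.\<close>
        define e where "e = sqdist \<Psi> (fst z) (snd z)"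
        have e: "e > 0" using sep[of "fst z" "snd z"] False z zM sqdist_nonneg[of \<Psi> "fst z" "snd z"]
          unfolding e_def by force
        define W1 where "W1 = {y \<in> topspace ?X. sqdist \<Psi> (fst y) (snd y) \<in> {e/2<..}}"
        define b where "b = \<bar>f (fst z) - f (snd z)\<bar> + 1"
        define W2 where "W2 = {y \<in> topspace ?X. \<bar>f (fst y) - f (snd y)\<bar> \<in> {..<b}}"
        have "openin ?X W1" unfolding W1_def
          by (rule openin_continuous_map_preimage[OF sqdist_continuous[OF sm]]) auto
        moreover have "continuous_map ?X euclideanreal (\<lambda>y. \<bar>f (fst y) - f (snd y)\<bar>)"
          using continuous_map_compose[OF continuous_map_fst fc] continuous_map_compose[OF continuous_map_snd fc]
          by (intro continuous_map_real_abs continuous_map_diff) (auto simp: o_def)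
        then have "openin ?X W2" unfolding W2_def
          by (rule openin_continuous_map_preimage) auto
        moreover have "z \<in> W1 \<inter> W2" using e zM by (cases z) (auto simp: W1_def W2_def e_def b_def)
        moreover have "(f (fst y) - f (snd y))\<^sup>2 \<le> (2 * b\<^sup>2 / e) * sqdist \<Psi> (fst y) (snd y)" if "y \<in> W1 \<inter> W2" for y
        proof -
          have "(f (fst y) - f (snd y))\<^sup>2 \<le> b\<^sup>2"
            using that by (intro abs_le_square_iff[THEN iffD1]) (auto simp: W2_def b_def)
          also have "\<dots> = (2 * b\<^sup>2 / e) * (e / 2)" using e by simp
          also have "\<dots> \<le> (2 * b\<^sup>2 / e) * sqdist \<Psi> (fst y) (snd y)"
            using that e by (intro mult_left_mono) (auto simp: W1_def)
          finally show ?thesis .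
        qed
        ultimately show ?thesis by (intro exI[of _ "W1 \<inter> W2"]) blast
      next
        case True
        obtain a where a: "a \<in> P" "fst z \<in> V a" using P z by fastforce
        have i: "I a \<in> mindex M" and pd: "fst z \<in> mdom M (I a)" using ok a P by (auto simp: ok_def V_def)
        let ?x = "mchart M (I a) (fst z)"
        have "loclip_on (mrange M (I a)) (f \<circ> mparam M (I a))" using f i by (simp add: loclip_fun_def)
        then obtain \<rho> L where \<rho>: "\<rho> > 0" "L > 0" "L-lipschitz_on (cball ?x \<rho>) (f \<circ> mparam M (I a))"
          using loclip_onE[OF _ mchart_in[OF i pd]] by metis
        define A where "A = V a \<inter> {q \<in> mdom M (I a). mchart M (I a) q \<in> ball ?x \<rho>}"
        have "openin (mtop M) A" unfolding A_def using V P a openin_chart_ball[OF i] by blast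
        moreover have "fst z \<in> A" using a(2) pd \<rho> by (simp add: A_def)
        moreover have "(f p - f q)\<^sup>2 \<le> (L\<^sup>2 * real DIM('e)) * sqdist \<Psi> p q" if pq: "p \<in> A" "q \<in> A" for p q
        proof -
          let ?p = "mchart M (I a) p" and ?q = "mchart M (I a) q"
          have d: "p \<in> mdom M (I a)" "q \<in> mdom M (I a)" "?p \<in> cball ?x \<rho>" "?q \<in> cball ?x \<rho>" using pq by (auto simp: A_def)
          have "\<bar>f p - f q\<bar> \<le> L * dist ?p ?q"
            using lipschitz_onD[OF \<rho>(3) d(3,4)] mparam_mchart'[OF i] d(1,2) by (simp add: dist_real_def)
          then have "(f p - f q)\<^sup>2 \<le> (L * dist ?p ?q)\<^sup>2" using \<rho> by (intro abs_le_square_iff[THEN iffD1]) auto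
          also have "\<dots> = L\<^sup>2 * (norm (?p - ?q))\<^sup>2" by (simp add: power_mult_distrib dist_norm)
          finally have 1: "(f p - f q)\<^sup>2 \<le> L\<^sup>2 * (norm (?p - ?q))\<^sup>2" .
          have "(norm (?p - ?q))\<^sup>2 = (\<Sum>b\<in>Basis. ((?p - ?q) \<bullet> b)\<^sup>2)"
            unfolding power2_norm_eq_inner by (subst euclidean_inner) (simp add: power2_eq_square)
          also have "\<dots> \<le> (\<Sum>b\<in>(Basis::'e set). sqdist \<Psi> p q)"
          proof (rule sum_mono)
            fix b :: 'e assume b: "b \<in> Basis"
            have "b \<noteq> 0" using b nonzero_Basis by blast
            moreover have "from_chart (I a) (h a b) \<in> \<Psi>" using a(1) b by (force simp: \<Psi>_def)
            ultimately show "((?p - ?q) \<bullet> b)\<^sup>2 \<le> sqdist \<Psi> p q"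
              using sqdist_member[OF fin, of "from_chart (I a) (h a b)" p q] val[OF a(1), of p b] val[OF a(1), of q b] pq
              by (simp add: inner_diff_left A_def)
          qed
          finally have "L\<^sup>2 * (norm (?p - ?q))\<^sup>2 \<le> L\<^sup>2 * (real DIM('e) * sqdist \<Psi> p q)"
            by (intro mult_left_mono) auto
          then show ?thesis using 1 by (simp add: mult.assoc)
        qed
        ultimately show ?thesis using True
          by (intro exI[of _ "A \<times> A"] exI[of _ "L\<^sup>2 * real DIM('e)"])
            (cases z, auto simp: openin_prod_Times_iff)
      qed
    qed
    then show ?thesis by force
  qed
  show thesis by (rule that[of \<Psi>]) (use fin sm sep lip in \<open>auto simp: metrizes_def\<close>)
qed

end

section \<open>Restriction, congruence and time translation of trajectories\<close>

lemma trajectory_subset: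
  assumes "trajectory M G T \<gamma>" "T' \<subseteq> T"
  shows "trajectory M G T' \<gamma>"
  unfolding trajectory_def
proof (intro conjI ballI impI)
  show "continuous_map (top_of_set T') (mtop M) \<gamma>"
    using assms continuous_map_from_subtopology_mono[of euclidean T "mtop M" \<gamma> T']
    by (simp add: trajectory_def)
  fix t i assume "t \<in> T'" "i \<in> mindex M" "\<gamma> t \<in> mdom M i"
  then show "((\<lambda>s. mchart M i (\<gamma> s)) has_vector_derivative sgrad M (time_slice G t) i (\<gamma> t)) (at t within T')"
    using assms by (intro has_vector_derivative_within_subset[OF _ assms(2)]) (auto simp: trajectory_def)
qed

lemma trajectory_cong:
  assumes "trajectory M G T \<gamma>" "\<And>t. t \<in> T \<Longrightarrow> \<gamma> t = \<gamma>' t"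
  shows "trajectory M G T \<gamma>'"
  unfolding trajectory_def
proof (intro conjI ballI impI)
  show "continuous_map (top_of_set T) (mtop M) \<gamma>'"
    by (rule continuous_map_eq[of _ _ \<gamma>]) (use assms in \<open>auto simp: trajectory_def\<close>)
  fix t i assume t: "t \<in> T" "i \<in> mindex M" "\<gamma>' t \<in> mdom M i"
  then have "((\<lambda>s. mchart M i (\<gamma> s)) has_vector_derivative sgrad M (time_slice G t) i (\<gamma> t)) (at t within T)"
    using assms by (auto simp: trajectory_def)
  then show "((\<lambda>s. mchart M i (\<gamma>' s)) has_vector_derivative sgrad M (time_slice G t) i (\<gamma>' t)) (at t within T)"
    using has_vector_derivative_transform[of t T "\<lambda>s. mchart M i (\<gamma>' s)" "\<lambda>s. mchart M i (\<gamma> s)"] assms(2) t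
    by simp
qed

lemma trajectory_continuous: "trajectory M G T \<gamma> \<Longrightarrow> continuous_map (top_of_set T) (mtop M) \<gamma>"
  by (simp add: trajectory_def)

lemma trajectory_point: "trajectory M G T \<gamma> \<Longrightarrow> t \<in> T \<Longrightarrow> \<gamma> t \<in> mpoints M"
  using continuous_map_image_subset_topspace[OF trajectory_continuous] by fastforce

lemma trajectory_compact_image:
  assumes "trajectory M G {a..b} \<gamma>"
  shows "compactin (mtop M) (\<gamma> ` {a..b})"
  by (rule image_compactin[OF _ trajectory_continuous[OF assms]]) (simp add: compactin_subtopology)

text \<open>Time translation preserves trajectories because \<open>H \<circ> fst\<close> gives the
  same vector field at all times.\<close>

lemma trajectory_shift:
  assumes "trajectory M (H \<circ> fst) T \<gamma>"
  shows "trajectory M (H \<circ> fst) ((\<lambda>t. t - c) ` T) (\<lambda>t. \<gamma> (t + c))"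
  unfolding trajectory_def
proof (intro conjI ballI impI)
  have "continuous_map (top_of_set ((\<lambda>t. t - c) ` T)) (top_of_set T) (\<lambda>t. t + c)"
    by (auto intro!: continuous_intros)
  then show "continuous_map (top_of_set ((\<lambda>t. t - c) ` T)) (mtop M) (\<lambda>t. \<gamma> (t + c))"
    using continuous_map_compose[of _ "top_of_set T" "\<lambda>t. t + c" "mtop M" \<gamma>] assms
    by (simp add: trajectory_def o_def del: continuous_map_in_subtopology continuous_map_subtopology_eu)
  fix t i assume t: "t \<in> (\<lambda>t. t - c) ` T" "i \<in> mindex M" "\<gamma> (t + c) \<in> mdom M i"
  then have "((\<lambda>s. mchart M i (\<gamma> s)) has_vector_derivative sgrad M H i (\<gamma> (t + c))) (at (t + c) within T)"
    using assms by (auto simp: trajectory_def time_slice_def o_def)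
  moreover have "(\<lambda>t. t + c) ` (\<lambda>t. t - c) ` T = T" by (simp add: image_image)
  ultimately have "((\<lambda>s. mchart M i (\<gamma> s)) \<circ> (\<lambda>t. t + c) has_vector_derivative 1 *\<^sub>R sgrad M H i (\<gamma> (t + c)))
      (at t within (\<lambda>t. t - c) ` T)"
    by (intro vector_diff_chain_within) (simp_all add: has_vector_derivative_add_const)
  then show "((\<lambda>s. mchart M i (\<gamma> (s + c))) has_vector_derivative
      sgrad M (time_slice (H \<circ> fst) t) i (\<gamma> (t + c))) (at t within (\<lambda>t. t - c) ` T)"
    by (simp add: o_def time_slice_def)
qed

section \<open>Gronwall's inequality and uniqueness\<close>

context sympl_mfd
begin

text \<open>Along two trajectories \<open>sqdist\<close> has a derivative whose terms are products
  of differences of test functions and differences of their brackets with \<open>H\<close>. By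
  \<open>2 * x * y \<le> x\<^sup>2 + y\<^sup>2\<close> and the Lipschitz property of the brackets it
  is bounded in absolute value by a multiple of \<open>sqdist\<close> itself, which gives the
  estimate in both time directions.\<close>

lemma gronwall:
  assumes H: "smooth_function M H" and \<Psi>: "metrizes \<Psi> K"
  obtains C where "C \<ge> 0" "\<And>a b \<gamma> \<gamma>' s t. trajectory M (H \<circ> fst) {a..b} \<gamma> \<Longrightarrow> trajectory M (H \<circ> fst) {a..b} \<gamma>' \<Longrightarrow>
      \<gamma> ` {a..b} \<subseteq> K \<Longrightarrow> \<gamma>' ` {a..b} \<subseteq> K \<Longrightarrow> s \<in> {a..b} \<Longrightarrow> t \<in> {a..b} \<Longrightarrow>
      sqdist \<Psi> (\<gamma> t) (\<gamma>' t) \<le> exp (C * \<bar>t - s\<bar>) * sqdist \<Psi> (\<gamma> s) (\<gamma>' s)"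
proof -
  have fin: "finite \<Psi>" and sm: "\<And>\<psi>. \<psi> \<in> \<Psi> \<Longrightarrow> smooth_function M \<psi>"
    using \<Psi> by (auto simp: metrizes_def)
  define L where "L \<psi> = poisson M \<psi> H" for \<psi>
  have "\<exists>C. \<forall>p\<in>K. \<forall>q\<in>K. (L \<psi> p - L \<psi> q)\<^sup>2 \<le> C * sqdist \<Psi> p q" if "\<psi> \<in> \<Psi>" for \<psi>
    using \<Psi> poisson_loclip[OF H sm[OF that]] by (simp add: metrizes_def L_def)
  then obtain D where D: "\<And>\<psi> p q. \<psi> \<in> \<Psi> \<Longrightarrow> p \<in> K \<Longrightarrow> q \<in> K \<Longrightarrow> (L \<psi> p - L \<psi> q)\<^sup>2 \<le> D \<psi> * sqdist \<Psi> p q"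
    by metis
  \<comment> \<open>The \<open>1\<close> pays for the squared differences of the test functions, the
    sum for the squared differences of their brackets.\<close>
  define C where "C = 1 + (\<Sum>\<psi>\<in>\<Psi>. \<bar>D \<psi>\<bar>)"
  show thesis
  proof (rule that[of C])
    show "C \<ge> 0" by (simp add: C_def sum_nonneg)
    fix a b \<gamma> \<gamma>' s t
    assume tr: "trajectory M (H \<circ> fst) {a..b} \<gamma>" "trajectory M (H \<circ> fst) {a..b} \<gamma>'"
      and K: "\<gamma> ` {a..b} \<subseteq> K" "\<gamma>' ` {a..b} \<subseteq> K" and st: "s \<in> {a..b}" "t \<in> {a..b}"
    define \<phi> where "\<phi> t = sqdist \<Psi> (\<gamma> t) (\<gamma>' t)" for t
    define d where "d t = (\<Sum>\<psi>\<in>\<Psi>. 2 * (\<psi> (\<gamma> t) - \<psi> (\<gamma>' t)) * (L \<psi> (\<gamma> t) - L \<psi> (\<gamma>' t)))" for t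
    have \<phi>d: "(\<phi> has_real_derivative d t) (at t within {a..b})" if "t \<in> {a..b}" for t
    proof -
      have "((\<lambda>t. (\<psi> (\<gamma> t) - \<psi> (\<gamma>' t))\<^sup>2) has_real_derivative
          2 * (\<psi> (\<gamma> t) - \<psi> (\<gamma>' t)) * (L \<psi> (\<gamma> t) - L \<psi> (\<gamma>' t))) (at t within {a..b})" if "\<psi> \<in> \<Psi>" for \<psi>
        using trajectory_derivative[OF H tr(1) \<open>t \<in> {a..b}\<close> sm[OF that]]
          trajectory_derivative[OF H tr(2) \<open>t \<in> {a..b}\<close> sm[OF that]]
        by (auto intro!: derivative_eq_intros simp: L_def)
      then show ?thesis unfolding \<phi>_def sqdist_def d_def by (intro DERIV_sum) auto
    qed
    have dbound: "\<bar>d t\<bar> \<le> C * \<phi> t" if t: "t \<in> {a..b}" for t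
    proof -
      have "\<bar>d t\<bar> \<le> (\<Sum>\<psi>\<in>\<Psi>. (\<psi> (\<gamma> t) - \<psi> (\<gamma>' t))\<^sup>2 + (L \<psi> (\<gamma> t) - L \<psi> (\<gamma>' t))\<^sup>2)"
        unfolding d_def
      proof (rule order_trans[OF sum_abs sum_mono])
        fix \<psi>
        have "\<bar>2 * x * y\<bar> \<le> x\<^sup>2 + y\<^sup>2" for x y :: real
          using zero_le_power2[of "x - y"] zero_le_power2[of "x + y"]
          by (simp add: power2_eq_square algebra_simps abs_le_iff)
        then show "\<bar>2 * (\<psi> (\<gamma> t) - \<psi> (\<gamma>' t)) * (L \<psi> (\<gamma> t) - L \<psi> (\<gamma>' t))\<bar>
            \<le> (\<psi> (\<gamma> t) - \<psi> (\<gamma>' t))\<^sup>2 + (L \<psi> (\<gamma> t) - L \<psi> (\<gamma>' t))\<^sup>2" .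
      qed
      also have "\<dots> = \<phi> t + (\<Sum>\<psi>\<in>\<Psi>. (L \<psi> (\<gamma> t) - L \<psi> (\<gamma>' t))\<^sup>2)"
        by (simp add: sum.distrib \<phi>_def sqdist_def)
      also have "(\<Sum>\<psi>\<in>\<Psi>. (L \<psi> (\<gamma> t) - L \<psi> (\<gamma>' t))\<^sup>2) \<le> (\<Sum>\<psi>\<in>\<Psi>. \<bar>D \<psi>\<bar> * \<phi> t)"
      proof (rule sum_mono)
        fix \<psi> assume "\<psi> \<in> \<Psi>"
        then have "(L \<psi> (\<gamma> t) - L \<psi> (\<gamma>' t))\<^sup>2 \<le> D \<psi> * \<phi> t" unfolding \<phi>_def using D K t by blast
        also have "\<dots> \<le> \<bar>D \<psi>\<bar> * \<phi> t" by (intro mult_right_mono) (auto simp: \<phi>_def sqdist_nonneg)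
        finally show "(L \<psi> (\<gamma> t) - L \<psi> (\<gamma>' t))\<^sup>2 \<le> \<bar>D \<psi>\<bar> * \<phi> t" .
      qed
      finally show ?thesis by (simp add: C_def algebra_simps sum_distrib_left)
    qed
    have at: "(\<phi> has_real_derivative d x) (at x)" if "a < x" "x < b" for x
      using \<phi>d[of x] that by (simp add: at_within_Icc_at)
    have cont: "continuous_on {a..b} \<phi>"
      using \<phi>d by (meson DERIV_continuous continuous_on_eq_continuous_within)
    \<comment> \<open>The first monotonicity bounds \<open>\<phi>\<close> forward in time, the
      second backward.\<close>
    have mono: "exp (- C * y) * \<phi> y \<le> exp (- C * x) * \<phi> x" "exp (C * x) * \<phi> x \<le> exp (C * y) * \<phi> y"
      if xy: "x \<in> {a..b}" "y \<in> {a..b}" "x \<le> y" for x y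
    proof -
      have sub: "{x..y} \<subseteq> {a..b}" using xy by auto
      show "exp (- C * y) * \<phi> y \<le> exp (- C * x) * \<phi> x"
      proof (rule DERIV_nonpos_imp_decreasing_open[OF xy(3)])
        fix z assume z: "x < z" "z < y"
        have "((\<lambda>z. exp (- C * z) * \<phi> z) has_real_derivative exp (- C * z) * (d z - C * \<phi> z)) (at z)"
          using at[of z] z xy by (auto intro!: derivative_eq_intros simp: algebra_simps)
        moreover have "exp (- C * z) * (d z - C * \<phi> z) \<le> 0"
          using dbound[of z] z xy by (intro mult_nonneg_nonpos) auto
        ultimately show "\<exists>w. ((\<lambda>z. exp (- C * z) * \<phi> z) has_real_derivative w) (at z) \<and> w \<le> 0" by blast
      qed (intro continuous_intros continuous_on_subset[OF cont sub])
      show "exp (C * x) * \<phi> x \<le> exp (C * y) * \<phi> y"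
      proof (rule DERIV_nonneg_imp_increasing_open[OF xy(3)])
        fix z assume z: "x < z" "z < y"
        have "((\<lambda>z. exp (C * z) * \<phi> z) has_real_derivative exp (C * z) * (d z + C * \<phi> z)) (at z)"
          using at[of z] z xy by (auto intro!: derivative_eq_intros simp: algebra_simps)
        moreover have "exp (C * z) * (d z + C * \<phi> z) \<ge> 0"
          using dbound[of z] z xy by (intro mult_nonneg_nonneg) auto
        ultimately show "\<exists>w. ((\<lambda>z. exp (C * z) * \<phi> z) has_real_derivative w) (at z) \<and> w \<ge> 0" by blast
      qed (intro continuous_intros continuous_on_subset[OF cont sub])
    qed
    have e: "exp (C * x) * (exp (- C * y) * z) = exp (C * (x - y)) * z" for x y z
      by (simp add: right_diff_distrib exp_diff exp_minus divide_inverse)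
    have e': "exp (- C * x) * (exp (C * y) * z) = exp (C * (y - x)) * z" for x y z
      by (simp add: right_diff_distrib exp_diff exp_minus divide_inverse)
    have "\<phi> t \<le> exp (C * \<bar>t - s\<bar>) * \<phi> s"
    proof (cases "s \<le> t")
      case True
      have "exp (C * t) * (exp (- C * t) * \<phi> t) \<le> exp (C * t) * (exp (- C * s) * \<phi> s)"
        using mono(1)[OF st True] by (intro mult_left_mono) auto
      then have "\<phi> t \<le> exp (C * (t - s)) * \<phi> s" unfolding e by simp
      then show ?thesis using True by simp
    next
      case False
      have "exp (- C * t) * (exp (C * t) * \<phi> t) \<le> exp (- C * t) * (exp (C * s) * \<phi> s)"
        using mono(2)[OF st(2,1)] False by (intro mult_left_mono) auto
      then have "\<phi> t \<le> exp (C * (s - t)) * \<phi> s" unfolding e' by simp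
      then show ?thesis using False by simp
    qed
    then show "sqdist \<Psi> (\<gamma> t) (\<gamma>' t) \<le> exp (C * \<bar>t - s\<bar>) * sqdist \<Psi> (\<gamma> s) (\<gamma>' s)"
      by (simp add: \<phi>_def)
  qed
qed

text \<open>Both arcs have compact image, so a single metric covers them, and
  \<open>gronwall\<close> propagates the distance 0 from time \<open>s\<close> to time
  \<open>t\<close>.\<close>

lemma trajectory_unique:
  assumes H: "smooth_function M H"
    and tr: "trajectory M (H \<circ> fst) {a..b} \<gamma>" "trajectory M (H \<circ> fst) {a..b} \<gamma>'"
    and eq: "\<gamma> s = \<gamma>' s" "s \<in> {a..b}" and t: "t \<in> {a..b}"
  shows "\<gamma> t = \<gamma>' t"
proof -
  define K where "K = \<gamma> ` {a..b} \<union> \<gamma>' ` {a..b}"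
  have "compactin (mtop M) K" unfolding K_def
    by (intro compactin_Un trajectory_compact_image[OF tr(1)] trajectory_compact_image[OF tr(2)])
  then obtain \<Psi> where \<Psi>: "metrizes \<Psi> K" by (rule metrizes_exists)
  obtain C where "\<And>a b \<gamma> \<gamma>' s t. trajectory M (H \<circ> fst) {a..b} \<gamma> \<Longrightarrow> trajectory M (H \<circ> fst) {a..b} \<gamma>' \<Longrightarrow>
      \<gamma> ` {a..b} \<subseteq> K \<Longrightarrow> \<gamma>' ` {a..b} \<subseteq> K \<Longrightarrow> s \<in> {a..b} \<Longrightarrow> t \<in> {a..b} \<Longrightarrow>
      sqdist \<Psi> (\<gamma> t) (\<gamma>' t) \<le> exp (C * \<bar>t - s\<bar>) * sqdist \<Psi> (\<gamma> s) (\<gamma>' s)"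
    using gronwall[OF H \<Psi>] by metis
  from this[OF tr _ _ eq(2) t] have "sqdist \<Psi> (\<gamma> t) (\<gamma>' t) \<le> 0"
    by (simp add: K_def eq(1))
  then have "sqdist \<Psi> (\<gamma> t) (\<gamma>' t) = 0" by (rule order_antisym[OF _ sqdist_nonneg])
  then show ?thesis by (intro metrizes_separates[OF \<Psi> _ trajectory_point[OF tr(2) t]]) (use t in \<open>auto simp: K_def\<close>)
qed

end

section \<open>Mollification\<close>

text \<open>All derivatives fall on the kernel, so \<open>u\<close> may be merely continuous and the
  induction varies \<open>\<rho>\<close> only. Integrating over a fixed box is what makes
  differentiation under the integral sign applicable.\<close>

lemma Ck_on_convolution:
  fixes \<rho> u :: "'e::euclidean_space \<Rightarrow> real"
  assumes U: "open U" "convex U" and u: "continuous_on UNIV u"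
    and \<rho>: "smooth_on UNIV \<rho>"
  shows "Ck_on k U (\<lambda>x. integral (cbox c d) (\<lambda>y. \<rho> (x - y) * u y))"
  using \<rho>
proof (induction k arbitrary: \<rho>)
  case 0
  have \<rho>c: "continuous_on UNIV \<rho>" by (rule smooth_on_continuous[OF 0])
  have "continuous_on (U \<times> cbox c d) (\<lambda>z. \<rho> (fst z - snd z) * u (snd z))"
    by (intro continuous_intros continuous_on_compose2[OF \<rho>c] continuous_on_compose2[OF u]) auto
  then show ?case using integral_continuous_on_param[of U c d "\<lambda>x y. \<rho> (x - y) * u y"]
    by (simp add: case_prod_beta)
next
  case (Suc k)
  have \<rho>c: "continuous_on UNIV \<rho>" by (rule smooth_on_continuous[OF Suc.prems])
  define D where "D x = Blinfun (frechet_derivative \<rho> (at x))" for x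
  have \<rho>d: "(\<rho> has_derivative frechet_derivative \<rho> (at x)) (at x)" for x
    by (rule smooth_on_has_derivative[OF Suc.prems]) simp
  have D: "blinfun_apply (D x) = frechet_derivative \<rho> (at x)" for x
    unfolding D_def by (rule bounded_linear_Blinfun_apply[OF has_derivative_bounded_linear[OF \<rho>d]])
  have Dc: "continuous_on UNIV D"
    by (rule continuous_on_blinfun_componentwise)
      (simp add: D smooth_on_continuous[OF smooth_on_frechet_derivative[OF Suc.prems]])
  have F: "continuous_on (U \<times> cbox c d) (\<lambda>(x, y). u y *\<^sub>R D (x - y))"
    unfolding case_prod_beta
    by (intro continuous_intros continuous_on_compose2[OF Dc] continuous_on_compose2[OF u]) auto
  show ?case
  proof (rule Ck_on_SucI[OF U(1)])
    fix x assume x: "x \<in> U"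
    have "((\<lambda>x. integral (cbox c d) (\<lambda>y. \<rho> (x - y) * u y)) has_derivative
        integral (cbox c d) (\<lambda>y. u y *\<^sub>R D (x - y))) (at x within U)"
    proof (rule leibniz_rule[OF _ _ F x U(2)])
      show "((\<lambda>x. \<rho> (x - y) * u y) has_derivative blinfun_apply (u y *\<^sub>R D (x - y))) (at x within U)" for x y
      proof -
        have "((\<lambda>x. x - y) has_derivative (\<lambda>v. v)) (at x within U)" by (auto intro!: derivative_eq_intros)
        then have "((\<lambda>x. \<rho> (x - y)) has_derivative (\<lambda>v. frechet_derivative \<rho> (at (x - y)) v)) (at x within U)"
          by (rule has_derivative_compose[where g = \<rho>, OF _ \<rho>d])
        then have "((\<lambda>x. \<rho> (x - y) * u y) has_derivative
            (\<lambda>v. frechet_derivative \<rho> (at (x - y)) v * u y)) (at x within U)"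
          by (rule has_derivative_mult_left)
        moreover have "blinfun_apply (u y *\<^sub>R D (x - y)) = (\<lambda>v. frechet_derivative \<rho> (at (x - y)) v * u y)"
          by (auto simp: D blinfun.scaleR_left)
        ultimately show ?thesis by (simp only:)
      qed
      show "(\<lambda>y. \<rho> (x - y) * u y) integrable_on cbox c d" for x
        by (intro integrable_continuous continuous_intros continuous_on_compose2[OF \<rho>c]
            continuous_on_compose2[OF u]) auto
    qed
    then show "((\<lambda>x. integral (cbox c d) (\<lambda>y. \<rho> (x - y) * u y)) has_derivative
        blinfun_apply (integral (cbox c d) (\<lambda>y. u y *\<^sub>R D (x - y)))) (at x)"
      by (simp only: at_within_open[OF x U(1)])
  next
    fix v
    have "blinfun_apply (integral (cbox c d) (\<lambda>y. u y *\<^sub>R D (x - y))) v =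
        integral (cbox c d) (\<lambda>y. frechet_derivative \<rho> (at (x - y)) v * u y)" for x
    proof -
      have "(\<lambda>y. u y *\<^sub>R D (x - y)) integrable_on cbox c d"
        by (intro integrable_continuous continuous_intros continuous_on_compose2[OF Dc]
            continuous_on_compose2[OF u]) auto
      then show ?thesis
        by (simp add: blinfun_apply_integral D blinfun.scaleR_left mult.commute)
    qed
    then show "Ck_on k U (\<lambda>x. blinfun_apply (integral (cbox c d) (\<lambda>y. u y *\<^sub>R D (x - y))) v)"
      using Suc.IH[OF smooth_on_frechet_derivative[OF Suc.prems, of v]] by simp
  qed
qed

text \<open>Differentiation wants the variable \<open>x\<close> in the kernel, estimates want it in
  \<open>u\<close>. The substitution \<open>y = x - z\<close> exchanges the two as soon as the box
  \<open>cbox c d\<close> contains \<open>x - z\<close> for all \<open>z\<close> in a box that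
  carries the kernel.\<close>

lemma convolution_flip:
  fixes \<rho> u :: "'e::euclidean_space \<Rightarrow> real"
  assumes \<rho>c: "continuous_on UNIV \<rho>" and uc: "continuous_on UNIV u"
    and supp: "\<And>z. z \<notin> cbox a b \<Longrightarrow> \<rho> z = 0" and cov: "\<And>z. z \<in> cbox a b \<Longrightarrow> x - z \<in> cbox c d"
  shows "integral (cbox c d) (\<lambda>y. \<rho> (x - y) * u y) = integral (cbox a b) (\<lambda>z. \<rho> z * u (x - z))"
proof -
  have "(\<lambda>y. \<rho> (x - y) * u y) integrable_on cbox c d"
    by (intro integrable_continuous continuous_intros continuous_on_compose2[OF \<rho>c]
        continuous_on_compose2[OF uc]) auto
  then have "((\<lambda>y. \<rho> (x - y) * u y) has_integral integral (cbox c d) (\<lambda>y. \<rho> (x - y) * u y)) (cbox c d)"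
    by (rule integrable_integral)
  from has_integral_affinity[OF this, of "- 1" x]
  have "((\<lambda>z. \<rho> z * u (x - z)) has_integral integral (cbox c d) (\<lambda>y. \<rho> (x - y) * u y))
      ((\<lambda>y. x - y) ` cbox c d)" by simp
  then have 1: "((\<lambda>z. \<rho> z * u (x - z)) has_integral integral (cbox c d) (\<lambda>y. \<rho> (x - y) * u y)) UNIV"
  proof (rule has_integral_on_superset)
    fix z assume "z \<notin> (\<lambda>y. x - y) ` cbox c d"
    then have "x - z \<notin> cbox c d" by force
    then show "\<rho> z * u (x - z) = 0" using supp cov by (cases "z \<in> cbox a b") auto
  qed simp
  have "(\<lambda>z. \<rho> z * u (x - z)) integrable_on cbox a b"
    by (intro integrable_continuous continuous_intros continuous_on_subset[OF \<rho>c]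
        continuous_on_compose2[OF uc]) auto
  then have "((\<lambda>z. \<rho> z * u (x - z)) has_integral integral (cbox a b) (\<lambda>z. \<rho> z * u (x - z))) (cbox a b)"
    by (rule integrable_integral)
  then have "((\<lambda>z. \<rho> z * u (x - z)) has_integral integral (cbox a b) (\<lambda>z. \<rho> z * u (x - z))) UNIV"
    by (rule has_integral_on_superset) (auto simp: supp)
  then show ?thesis using 1 has_integral_unique by blast
qed

lemma mollifier_kernel:
  assumes "\<epsilon> > 0"
  obtains \<rho> :: "'e::euclidean_space \<Rightarrow> real" and b where "smooth_on UNIV \<rho>" "\<And>z. \<rho> z \<ge> 0"
    "\<And>z. z \<notin> cball 0 \<epsilon> \<Longrightarrow> \<rho> z = 0" "cball 0 \<epsilon> \<subseteq> cbox (-b) b" "integral (cbox (-b) b) \<rho> = 1"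
proof -
  obtain b :: 'e where b: "cball 0 \<epsilon> \<subseteq> cbox (-b) b"
    using bounded_subset_cbox_symmetric[OF bounded_cball] by blast
  \<comment> \<open>A bump of radius \<open>\<epsilon> / 2\<close> vanishes outside radius
    \<open>\<epsilon>\<close>. Being continuous, nonnegative and 1 at the origin it has positive
    integral, by which it is divided below.\<close>
  define \<rho>0 where "\<rho>0 = bump (0::'e) (\<epsilon>/2)"
  define I where "I = integral (cbox (-b) b) \<rho>0"
  have c: "continuous_on UNIV \<rho>0" unfolding \<rho>0_def by (rule smooth_on_continuous[OF smooth_on_bump])
  have z: "\<rho>0 z = 0" if "z \<notin> cball 0 \<epsilon>" for z
    unfolding \<rho>0_def by (rule bump_0) (use assms that in auto)
  have "I \<noteq> 0"
  proof
    assume "I = 0"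
    have "\<rho>0 0 = 0"
    proof (rule integral_cbox_eq_0_iff[THEN iffD1, rule_format, of "-b" b \<rho>0])
      show "continuous_on (cbox (-b) b) \<rho>0" using c continuous_on_subset by blast
      show "box (-b) b \<noteq> {}"
      proof -
        have "ball 0 \<epsilon> \<subseteq> interior (cbox (-b) b)"
          using interior_mono[OF b] by (simp add: interior_cball)
        then have "0 \<in> box (-b) b" using assms by (auto simp: interior_cbox)
        then show ?thesis by blast
      qed
      show "integral (cbox (-b) b) \<rho>0 = 0" using \<open>I = 0\<close> by (simp add: I_def)
      show "0 \<in> cbox (-b) b" using b assms by auto
    qed (auto simp: \<rho>0_def bump_bounds)
    moreover have "\<rho>0 0 = 1" unfolding \<rho>0_def by (rule bump_1) (use assms in auto)
    ultimately show False by simp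
  qed
  moreover have "I \<ge> 0" unfolding I_def
    by (rule integral_nonneg) (auto simp: \<rho>0_def bump_bounds intro!: integrable_continuous
        continuous_on_subset[OF c[unfolded \<rho>0_def]])
  ultimately have I: "I > 0" by simp
  show thesis
  proof (rule that[of "\<lambda>z. \<rho>0 z * (1 / I)" b])
    show "smooth_on UNIV (\<lambda>z. \<rho>0 z * (1 / I))"
      unfolding \<rho>0_def by (intro smooth_on_mult smooth_on_bump smooth_on_const) auto
    show "integral (cbox (-b) b) (\<lambda>z. \<rho>0 z * (1 / I)) = 1"
      using I by (simp only: integral_mult_left) (simp add: I_def)
  qed (use I z b in \<open>auto simp: \<rho>0_def bump_bounds\<close>)
qed

text \<open>The last clause does not require \<open>u\<close> to be differentiable: a one-sided growth bound along \<open>V\<close>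
  survives the averaging.\<close>
lemma mollify:
  fixes u :: "'e::euclidean_space \<Rightarrow> real"
  assumes u: "K-lipschitz_on UNIV u" and \<epsilon>: "\<epsilon> > 0"
  obtains w where "smooth_on (ball a R) w" "\<And>x. x \<in> ball a R \<Longrightarrow> \<bar>w x - u x\<bar> \<le> K * \<epsilon>"
    "\<And>x V c. x \<in> ball a R \<Longrightarrow>
      (\<And>y \<delta>. y \<in> cball x \<epsilon> \<Longrightarrow> \<delta> > 0 \<Longrightarrow> \<forall>\<^sub>F h in at_right 0. u (y + h *\<^sub>R V) - u y \<le> (c + \<delta>) * h) \<Longrightarrow>
      frechet_derivative w (at x) V \<le> c"
proof -
  obtain \<rho> :: "'e \<Rightarrow> real" and b where \<rho>: "smooth_on UNIV \<rho>" "\<And>z. \<rho> z \<ge> 0" "\<And>z. z \<notin> cball 0 \<epsilon> \<Longrightarrow> \<rho> z = 0"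
    and b: "cball 0 \<epsilon> \<subseteq> cbox (-b) b" and int1: "integral (cbox (-b) b) \<rho> = 1"
    using mollifier_kernel[OF \<epsilon>] by metis
  have \<rho>c: "continuous_on UNIV \<rho>" by (rule smooth_on_continuous[OF \<rho>(1)])
  have uc: "continuous_on UNIV u" by (rule lipschitz_on_continuous_on[OF u])
  have K: "K \<ge> 0" by (rule lipschitz_on_nonneg[OF u])
  have uL: "\<bar>u x - u y\<bar> \<le> K * norm (x - y)" for x y
    using lipschitz_onD[OF u, of x y] by (simp add: dist_norm)
  let ?B = "cbox (-b) b"
  have ci: "f integrable_on ?B" if "continuous_on UNIV f" for f :: "'e \<Rightarrow> real"
    by (rule integrable_continuous[OF continuous_on_subset[OF that]]) simp
  \<comment> \<open>Provides one integration box that satisfies the hypothesis of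
    \<open>convolution_flip\<close> for all \<open>x\<close> in the ball at once.\<close>
  have bou: "bounded ((\<lambda>(x, z). x - z) ` (cball a R \<times> ?B))"
    by (rule compact_imp_bounded, rule compact_continuous_image)
      (auto intro!: continuous_intros compact_Times simp: case_prod_beta)
  obtain d where d: "(\<lambda>(x, z). x - z) ` (cball a R \<times> ?B) \<subseteq> cbox (-d) d"
    using bounded_subset_cbox_symmetric[OF bou] by blast
  define w where "w x = integral (cbox (-d) d) (\<lambda>y. \<rho> (x - y) * u y)" for x
  have wA: "w x = integral ?B (\<lambda>z. \<rho> z * u (x - z))" if x: "x \<in> ball a R" for x
    unfolding w_def
  proof (rule convolution_flip[OF \<rho>c uc])
    show "\<rho> z = 0" if "z \<notin> ?B" for z using that b \<rho>(3) by blast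
    show "x - z \<in> cbox (-d) d" if "z \<in> ?B" for z using d that x by force
  qed
  have sm: "smooth_on (ball a R) w"
    unfolding smooth_on_def w_def using Ck_on_convolution[OF open_ball convex_ball uc \<rho>(1)] by blast
  show thesis
  proof (rule that[OF sm])
    fix x assume x: "x \<in> ball a R"
    have c1: "continuous_on UNIV (\<lambda>z. \<rho> z * u (x - z))" "continuous_on UNIV (\<lambda>z. \<rho> z * u x)"
      by (intro continuous_intros \<rho>c continuous_on_compose2[OF uc] | simp)+
    have "w x - u x = integral ?B (\<lambda>z. \<rho> z * u (x - z)) - integral ?B (\<lambda>z. \<rho> z * u x)"
      by (simp add: wA[OF x] int1)
    also have "\<dots> = integral ?B (\<lambda>z. \<rho> z * u (x - z) - \<rho> z * u x)"
      by (rule integral_diff[symmetric]) (intro ci c1)+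
    finally have e: "w x - u x = integral ?B (\<lambda>z. \<rho> z * u (x - z) - \<rho> z * u x)" .
    have "norm (integral ?B (\<lambda>z. \<rho> z * u (x - z) - \<rho> z * u x)) \<le> integral ?B (\<lambda>z. \<rho> z * (K * \<epsilon>))"
    proof (rule integral_norm_bound_integral)
      show "(\<lambda>z. \<rho> z * u (x - z) - \<rho> z * u x) integrable_on ?B" by (intro ci continuous_on_diff c1)
      show "(\<lambda>z. \<rho> z * (K * \<epsilon>)) integrable_on ?B" by (intro ci continuous_intros \<rho>c)
      fix z
      show "norm (\<rho> z * u (x - z) - \<rho> z * u x) \<le> \<rho> z * (K * \<epsilon>)"
      proof (cases "z \<in> cball 0 \<epsilon>")
        case True
        have "\<bar>u (x - z) - u x\<bar> \<le> K * norm z" using uL[of "x - z" x] by simp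
        also have "\<dots> \<le> K * \<epsilon>" using True K by (intro mult_left_mono) auto
        finally have "\<rho> z * \<bar>u (x - z) - u x\<bar> \<le> \<rho> z * (K * \<epsilon>)" by (rule mult_left_mono) (rule \<rho>(2))
        moreover have "norm (\<rho> z * u (x - z) - \<rho> z * u x) = \<rho> z * \<bar>u (x - z) - u x\<bar>"
          using \<rho>(2)[of z] by (simp add: right_diff_distrib[symmetric] abs_mult)
        ultimately show ?thesis by simp
      qed (simp add: \<rho>(3))
    qed
    also have "\<dots> = K * \<epsilon>" by (simp add: int1)
    finally show "\<bar>w x - u x\<bar> \<le> K * \<epsilon>" using e by simp
  next
    fix x V c
    assume x: "x \<in> ball a R"
      and up: "\<And>y \<delta>. y \<in> cball x \<epsilon> \<Longrightarrow> \<delta> > 0 \<Longrightarrow> \<forall>\<^sub>F h in at_right 0. u (y + h *\<^sub>R V) - u y \<le> (c + \<delta>) * h"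
    define h where "h n = inverse (real (Suc n))" for n
    have h0: "h n > 0" for n by (simp add: h_def)
    have hr: "filterlim h (at_right 0) sequentially"
      unfolding h_def filterlim_at
      using LIMSEQ_inverse_real_of_nat by (auto intro!: always_eventually)
    define q where "q n z = (u (x - z + h n *\<^sub>R V) - u (x - z)) / h n - c" for n z
    have qc: "continuous_on UNIV (q n)" for n
      unfolding q_def by (intro continuous_intros continuous_on_compose2[OF uc]) (use h0[of n] in auto)
    have qb: "\<bar>q n z\<bar> \<le> K * norm V + \<bar>c\<bar>" for n z
    proof -
      have "\<bar>u (x - z + h n *\<^sub>R V) - u (x - z)\<bar> \<le> K * (h n * norm V)"
        using uL[of "x - z + h n *\<^sub>R V" "x - z"] h0[of n] by simp
      then have "\<bar>(u (x - z + h n *\<^sub>R V) - u (x - z)) / h n\<bar> \<le> K * norm V"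
        using h0[of n] by (simp add: abs_divide field_simps)
      then show ?thesis unfolding q_def by linarith
    qed
    \<comment> \<open>The hypothesis bounds the excess \<open>q n z\<close> from above only, so just
      its positive part is known to tend to 0. The Lipschitz bound on \<open>u\<close> dominates it,
      and the limit passes under the integral.\<close>
    define r where "r n z = \<rho> z * max (q n z) 0" for n z
    have rc: "continuous_on UNIV (r n)" for n
      unfolding r_def by (intro continuous_intros \<rho>c qc)
    have lim: "(\<lambda>n. integral ?B (r n)) \<longlonglongrightarrow> integral ?B (\<lambda>z. 0)"
    proof (rule dominated_convergence(2))
      show "r n integrable_on ?B" for n by (rule ci[OF rc])
      show "(\<lambda>z. \<rho> z * (K * norm V + \<bar>c\<bar>)) integrable_on ?B" by (intro ci continuous_intros \<rho>c)
      show "norm (r n z) \<le> \<rho> z * (K * norm V + \<bar>c\<bar>)" for n z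
      proof -
        have "\<bar>max (q n z) 0\<bar> \<le> K * norm V + \<bar>c\<bar>" using qb[of n z] by linarith
        then show ?thesis using \<rho>(2)[of z] by (simp add: r_def abs_mult mult_left_mono)
      qed
      fix z
      show "(\<lambda>n. r n z) \<longlonglongrightarrow> 0"
      proof (cases "z \<in> cball 0 \<epsilon>")
        case True
        have "(\<lambda>n. max (q n z) 0) \<longlonglongrightarrow> 0"
          unfolding tendsto_iff
        proof (intro allI impI)
          fix e :: real assume e: "e > 0"
          have "\<forall>\<^sub>F h in at_right 0. u (x - z + h *\<^sub>R V) - u (x - z) \<le> (c + e/2) * h"
            by (rule up) (use True e in \<open>auto simp: dist_norm\<close>)
          then have "\<forall>\<^sub>F n in sequentially. u (x - z + h n *\<^sub>R V) - u (x - z) \<le> (c + e/2) * h n"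
            using hr unfolding filterlim_iff by blast
          then show "\<forall>\<^sub>F n in sequentially. dist (max (q n z) 0) 0 < e"
          proof eventually_elim
            case (elim n)
            have "(u (x - z + h n *\<^sub>R V) - u (x - z)) / h n \<le> c + e/2"
              using elim h0[of n] by (simp add: pos_divide_le_eq)
            then show ?case using e by (simp add: q_def dist_real_def)
          qed
        qed
        from tendsto_mult_left[OF this, of "\<rho> z"] show ?thesis by (simp add: r_def)
      qed (simp add: r_def \<rho>(3))
    qed
    have inb: "\<forall>\<^sub>F n in sequentially. x + h n *\<^sub>R V \<in> ball a R"
    proof -
      have "(\<lambda>n. x + h n *\<^sub>R V) \<longlonglongrightarrow> x + 0 *\<^sub>R V"
        by (intro tendsto_intros) (use LIMSEQ_inverse_real_of_nat in \<open>simp add: h_def\<close>)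
      then show ?thesis using topological_tendstoD[OF _ open_ball] x by fastforce
    qed
    have le: "\<forall>\<^sub>F n in sequentially. (w (x + h n *\<^sub>R V) - w x) / h n - c \<le> integral ?B (r n)"
      using inb
    proof eventually_elim
      case (elim n)
      have c1: "continuous_on UNIV (\<lambda>z. \<rho> z * u (x - z))" "continuous_on UNIV (\<lambda>z. \<rho> z * u (x + h n *\<^sub>R V - z))"
        "continuous_on UNIV (\<lambda>z. \<rho> z * c)"
        by (intro continuous_intros \<rho>c continuous_on_compose2[OF uc] | simp)+
      have "(w (x + h n *\<^sub>R V) - w x) / h n - c =
        (integral ?B (\<lambda>z. \<rho> z * u (x + h n *\<^sub>R V - z)) - integral ?B (\<lambda>z. \<rho> z * u (x - z))) * (1 / h n)
          - integral ?B (\<lambda>z. \<rho> z * c)"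
        by (simp add: wA[OF x] wA[OF elim] int1)
      also have "\<dots> = integral ?B (\<lambda>z. (\<rho> z * u (x + h n *\<^sub>R V - z) - \<rho> z * u (x - z)) * (1 / h n) - \<rho> z * c)"
        by (subst integral_diff[OF ci[OF c1(2)] ci[OF c1(1)], symmetric],
            subst integral_mult_left[symmetric], rule integral_diff[symmetric])
          (intro ci continuous_intros c1)+
      also have "\<dots> = integral ?B (\<lambda>z. \<rho> z * q n z)"
        using h0[of n] by (intro integral_cong) (simp add: q_def field_simps)
      also have "\<dots> \<le> integral ?B (r n)"
        by (rule integral_le) (auto intro!: ci continuous_intros \<rho>c qc rc simp: r_def mult_left_mono \<rho>(2))
      finally show ?case .
    qed
    have wd: "(w has_derivative frechet_derivative w (at x)) (at x)"
      by (rule smooth_on_has_derivative[OF sm x])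
    have "(\<lambda>n. (w (x + h n *\<^sub>R V) - w x) / h n) \<longlonglongrightarrow> frechet_derivative w (at x) V"
    proof -
      have lin: "linear (frechet_derivative w (at x))" using wd has_derivative_linear by blast
      have "((\<lambda>s. x + s *\<^sub>R V) has_derivative (\<lambda>s. s *\<^sub>R V)) (at 0)" by (auto intro!: derivative_eq_intros)
      moreover have "(w has_derivative frechet_derivative w (at x)) (at (x + 0 *\<^sub>R V))" using wd by simp
      ultimately have "((\<lambda>s. w (x + s *\<^sub>R V)) has_derivative (\<lambda>s. frechet_derivative w (at x) (s *\<^sub>R V))) (at 0)"
        by (rule has_derivative_compose)
      then have "((\<lambda>s. w (x + s *\<^sub>R V)) has_real_derivative frechet_derivative w (at x) V) (at 0)"
        unfolding has_field_derivative_def by (simp add: linear_scale[OF lin] mult.commute[of _ "frechet_derivative w (at x) V"])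
      then have "((\<lambda>s. (w (x + s *\<^sub>R V) - w x) / s) \<longlongrightarrow> frechet_derivative w (at x) V) (at 0)"
        by (simp add: has_field_derivative_iff)
      moreover have "filterlim h (at 0) sequentially"
        using hr filterlim_mono[of h "at_right 0" sequentially "at 0" sequentially] at_le by blast
      ultimately show ?thesis by (rule filterlim_compose)
    qed
    then have "(\<lambda>n. (w (x + h n *\<^sub>R V) - w x) / h n - c) \<longlonglongrightarrow> frechet_derivative w (at x) V - c"
      by (intro tendsto_intros)
    from tendsto_le[OF _ lim this le] have "frechet_derivative w (at x) V - c \<le> 0" by simp
    then show "frechet_derivative w (at x) V \<le> c" by simp
  qed
qed

section \<open>Local existence for ordinary differential equations\<close>

text \<open>Picard iteration. Composing \<open>v\<close> with the nearest-point projection onto the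
  ball makes it Lipschitz and bounded on the whole space, so the integral operator acts on all
  bounded continuous functions; the fixed point moves by at most \<open>r/2\<close> and hence only
  sees the original \<open>v\<close>. The time \<open>h\<close> is the same for all starting points
  in the half ball.\<close>

lemma local_ode:
  fixes v :: "'e::euclidean_space \<Rightarrow> 'e"
  assumes r: "r > 0" and v: "L-lipschitz_on (cball a r) v"
  obtains h where "h > 0" "\<And>x0. x0 \<in> cball a (r/2) \<Longrightarrow> \<exists>x. x 0 = x0 \<and>
    (\<forall>t\<in>{-h..h}. x t \<in> cball a r \<and> (x has_vector_derivative v (x t)) (at t within {-h..h}))"
proof -
  define P where "P = closest_point (cball a r)"
  have P: "P x \<in> cball a r" "dist (P x) (P y) \<le> dist x y" for x y
    unfolding P_def using r
    by (intro closest_point_in_set closest_point_lipschitz; auto)+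
  have PP: "P x = x" if "x \<in> cball a r" for x using that by (simp add: P_def closest_point_self)
  define V where "V x = v (P x)" for x
  have L: "L \<ge> 0" by (rule lipschitz_on_nonneg[OF v])
  have VL: "norm (V x - V y) \<le> L * dist x y" for x y
  proof -
    have "norm (V x - V y) \<le> L * dist (P x) (P y)"
      using lipschitz_onD[OF v P(1) P(1)] by (simp add: V_def dist_norm)
    also have "\<dots> \<le> L * dist x y" using P(2) L by (intro mult_left_mono)
    finally show ?thesis .
  qed
  then have "L-lipschitz_on UNIV V" using L by (intro lipschitz_onI) (auto simp: dist_norm)
  then have Vc: "continuous_on UNIV V" by (rule lipschitz_on_continuous_on)
  have "bounded (v ` cball a r)"
    using compact_continuous_image[OF lipschitz_on_continuous_on[OF v]] compact_imp_bounded compact_cball by blast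
  then obtain B where B: "\<And>x. x \<in> cball a r \<Longrightarrow> norm (v x) \<le> B"
    unfolding bounded_iff by (metis imageI)
  then have VB: "norm (V x) \<le> B" for x using P by (simp add: V_def)
  have B0: "B \<ge> 0" using VB[of a] norm_ge_zero[of "V a"] by linarith
  \<comment> \<open>The first bound makes the integral operator a contraction with factor
    \<open>1/2\<close>, the second limits the displacement to \<open>r/2\<close>; the added ones
    keep the denominators positive.\<close>
  define h where "h = min (1 / (2 * (L + 1))) (r / (2 * (B + 1)))"
  have h: "h > 0" using L B0 r by (simp add: h_def)
  have hL: "h * L \<le> 1/2"
  proof -
    have "h * L \<le> (1 / (2 * (L + 1))) * L" using L by (intro mult_right_mono) (auto simp: h_def)
    also have "\<dots> \<le> 1/2" using L by (simp add: field_simps)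
    finally show ?thesis .
  qed
  have hB: "h * B \<le> r/2"
  proof -
    have "h * B \<le> (r / (2 * (B + 1))) * B" using B0 by (intro mult_right_mono) (auto simp: h_def)
    also have "\<dots> \<le> r/2" using B0 r by (simp add: field_simps)
    finally show ?thesis .
  qed
  \<comment> \<open>The signed integral from \<open>0\<close> to \<open>t\<close>, expressed through
    integrals starting at \<open>-h\<close> so that one formula covers both signs of
    \<open>t\<close>.\<close>
  define J where "J F t = integral {-h..t} F - integral {-h..0} F" for F :: "real \<Rightarrow> 'e" and t
  have Jb: "norm (J F t) \<le> C * h" if F: "continuous_on {-h..h} F" "\<And>s. norm (F s) \<le> C" and t: "t \<in> {-h..h}" for F C t
  proof -
    have C: "C \<ge> 0" using order_trans[OF norm_ge_zero F(2)[of 0]] .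
    have i: "F integrable_on {-h..h}" using F(1) by (rule integrable_continuous_real)
    show ?thesis
    proof (cases "t \<ge> 0")
      case True
      have "F integrable_on {-h..t}" by (rule integrable_subinterval_real[OF i]) (use t in auto)
      then have "J F t = integral {0..t} F"
        unfolding J_def using Henstock_Kurzweil_Integration.integral_combine[of "-h" 0 t F] h True by (simp add: algebra_simps)
      moreover have "norm (integral {0..t} F) \<le> C * (t - 0)"
        by (rule integral_bound[OF True continuous_on_subset[OF F(1)]]) (use F(2) t h in auto)
      moreover have "C * t \<le> C * h" using C t by (intro mult_left_mono) auto
      ultimately show ?thesis by simp
    next
      case False
      have "F integrable_on {-h..0}" by (rule integrable_subinterval_real[OF i]) (use h in auto)
      then have "J F t = - integral {t..0} F"
        unfolding J_def using Henstock_Kurzweil_Integration.integral_combine[of "-h" t 0 F] t False by (simp add: algebra_simps)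
      moreover have "norm (integral {t..0} F) \<le> C * (0 - t)"
        by (rule integral_bound[OF _ continuous_on_subset[OF F(1)]]) (use F(2) t h False in auto)
      moreover have "C * (- t) \<le> C * h" using C t by (intro mult_left_mono) auto
      ultimately show ?thesis by simp
    qed
  qed
  \<comment> \<open>Clamping the time to \<open>[-h, h]\<close> extends the iterates to bounded
    continuous functions on the whole line, as the complete space of bounded continuous functions
    demands.\<close>
  define cl where "cl t = max (-h) (min h t)" for t
  have cl: "cl t \<in> {-h..h}" for t using h by (auto simp: cl_def)
  have clt: "cl t = t" if "t \<in> {-h..h}" for t using that by (auto simp: cl_def)
  have clc: "continuous_on UNIV cl" unfolding cl_def by (intro continuous_intros)
  show thesis
  proof (rule that[OF h])
    fix x0 assume x0: "x0 \<in> cball a (r/2)"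
    define G where "G f t = x0 + J (\<lambda>s. V (apply_bcontfun f s)) (cl t)" for f :: "real \<Rightarrow>\<^sub>C 'e" and t
    have Fc: "continuous_on T (\<lambda>s. V (apply_bcontfun f s))" for f :: "real \<Rightarrow>\<^sub>C 'e" and T
      by (rule continuous_on_compose2[OF Vc]) auto
    have Gb: "G f \<in> bcontfun" for f
    proof (rule bcontfun_normI)
      have "continuous_on {-h..h} (\<lambda>t. integral {-h..t} (\<lambda>s. V (apply_bcontfun f s)))"
        by (rule indefinite_integral_continuous_1[OF integrable_continuous_real[OF Fc]])
      then have "continuous_on {-h..h} (J (\<lambda>s. V (apply_bcontfun f s)))"
        unfolding J_def by (intro continuous_intros)
      then show "continuous_on UNIV (G f)" unfolding G_def
        by (intro continuous_intros continuous_on_compose2[OF _ clc]) (use cl in auto)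
      show "norm (G f t) \<le> norm x0 + B * h" for t
        unfolding G_def by (rule norm_triangle_le) (use Jb[OF Fc VB cl] in auto)
    qed
    have "dist (Bcontfun (G f)) (Bcontfun (G g)) \<le> 1/2 * dist f g" for f g
    proof (rule dist_bound)
      fix t
      have "dist (G f t) (G g t) = norm (J (\<lambda>s. V (apply_bcontfun f s) - V (apply_bcontfun g s)) (cl t))"
      proof -
        have ii: "(\<lambda>s. V (apply_bcontfun f s)) integrable_on {-h..t'}" for f :: "real \<Rightarrow>\<^sub>C 'e" and t'
          by (rule integrable_continuous_real[OF Fc])
        show ?thesis by (simp add: G_def dist_norm J_def integral_diff[OF ii ii] algebra_simps)
      qed
      also have "\<dots> \<le> (L * dist f g) * h"
      proof (rule Jb[OF _ _ cl])
        show "continuous_on {-h..h} (\<lambda>s. V (apply_bcontfun f s) - V (apply_bcontfun g s))"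
          by (intro continuous_on_diff Fc)
        fix s
        have "norm (V (apply_bcontfun f s) - V (apply_bcontfun g s)) \<le> L * dist (apply_bcontfun f s) (apply_bcontfun g s)"
          by (rule VL)
        also have "\<dots> \<le> L * dist f g" using L dist_bounded by (intro mult_left_mono)
        finally show "norm (V (apply_bcontfun f s) - V (apply_bcontfun g s)) \<le> L * dist f g" .
      qed
      also have "\<dots> = (h * L) * dist f g" by simp
      also have "\<dots> \<le> 1/2 * dist f g" using hL by (intro mult_right_mono) auto
      finally show "dist (apply_bcontfun (Bcontfun (G f)) t) (apply_bcontfun (Bcontfun (G g)) t) \<le> 1/2 * dist f g"
        by (simp add: Bcontfun_inverse Gb)
    qed
    then have "\<exists>!f. Bcontfun (G f) = f" by (intro banach_fix_type[of "1/2"]) auto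
    then obtain f where f: "Bcontfun (G f) = f" by blast
    then have fG: "apply_bcontfun f t = G f t" for t using Bcontfun_inverse[OF Gb, of f] by metis
    have fJ: "apply_bcontfun f t = x0 + J (\<lambda>s. V (apply_bcontfun f s)) (cl t)" for t
      by (subst fG) (simp only: G_def)
    have in_ball: "apply_bcontfun f t \<in> cball a r" for t
    proof -
      have "norm (J (\<lambda>s. V (apply_bcontfun f s)) (cl t)) \<le> B * h" by (rule Jb[OF Fc VB cl])
      then have "dist x0 (apply_bcontfun f t) \<le> r/2" using hB by (subst fJ) (simp add: dist_norm mult.commute[of B])
      then show ?thesis using x0 dist_triangle[of a "apply_bcontfun f t" x0] by (simp add: dist_commute)
    qed
    show "\<exists>x. x 0 = x0 \<and> (\<forall>t\<in>{-h..h}. x t \<in> cball a r \<and> (x has_vector_derivative v (x t)) (at t within {-h..h}))"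
    proof (intro exI[of _ "apply_bcontfun f"] conjI ballI in_ball)
      show "apply_bcontfun f 0 = x0" using h by (subst fJ) (simp add: clt J_def)
      fix t assume t: "t \<in> {-h..h}"
      have "((\<lambda>t. integral {-h..t} (\<lambda>s. V (apply_bcontfun f s))) has_vector_derivative V (apply_bcontfun f t)) (at t within {-h..h})"
        by (rule integral_has_vector_derivative[OF Fc t])
      then have "((\<lambda>t. (x0 - integral {-h..0} (\<lambda>s. V (apply_bcontfun f s))) + integral {-h..t} (\<lambda>s. V (apply_bcontfun f s)))
          has_vector_derivative 0 + V (apply_bcontfun f t)) (at t within {-h..h})"
        by (intro has_vector_derivative_add has_vector_derivative_const)
      moreover have "apply_bcontfun f s = (x0 - integral {-h..0} (\<lambda>s. V (apply_bcontfun f s))) +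
          integral {-h..s} (\<lambda>s. V (apply_bcontfun f s))" if "s \<in> {-h..h}" for s
        using that by (subst fJ) (simp add: clt J_def)
      ultimately have "(apply_bcontfun f has_vector_derivative 0 + V (apply_bcontfun f t)) (at t within {-h..h})"
        by (rule has_vector_derivative_transform[OF t, rotated])
      then show "(apply_bcontfun f has_vector_derivative v (apply_bcontfun f t)) (at t within {-h..h})"
        using PP[OF in_ball[of t]] by (simp add: V_def)
    qed
  qed
qed

section \<open>Existence of trajectories\<close>

lemma has_vector_derivative_Un:
  assumes "(f has_vector_derivative v) (at x within S)" "(f has_vector_derivative v) (at x within T)"
  shows "(f has_vector_derivative v) (at x within (S \<union> T))"
  using assms by (simp add: has_vector_derivative_def has_derivative_within Lim_within_Un)

text \<open>The filter \<open>at x within S\<close> is trivial here, so every vector qualifies. When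
  arcs are glued, a time belonging to one arc only can then be treated like the common end
  point.\<close>

lemma has_vector_derivative_off_closed:
  assumes "closed S" "x \<notin> S"
  shows "(f has_vector_derivative v) (at x within S)"
proof -
  have "at x within S = bot" using assms by (simp add: at_within_eq_bot_iff Diff_insert0)
  then show ?thesis
    unfolding has_vector_derivative_def has_derivative_within
    by (simp add: bounded_linear_scaleR_left)
qed

text \<open>At \<open>b\<close> both arcs have the velocity prescribed by the field at their common
  point, and equal derivatives within two sets give the derivative within the union.\<close>

lemma trajectory_glue:
  assumes 1: "trajectory M G {a..b} \<gamma>" and 2: "trajectory M G {b..c} \<gamma>'" and b: "\<gamma> b = \<gamma>' b"
    and ab: "a \<le> b" "b \<le> c"
  shows "trajectory M G {a..c} (\<lambda>t. if t \<le> b then \<gamma> t else \<gamma>' t)" (is "trajectory M G _ ?g")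
  unfolding trajectory_def
proof (intro conjI ballI impI)
  show "continuous_map (top_of_set {a..c}) (mtop M) ?g"
  proof (rule continuous_map_cases_le)
    have "{x \<in> topspace (top_of_set {a..c}). x \<le> b} = {a..b}" "{x \<in> topspace (top_of_set {a..c}). b \<le> x} = {b..c}"
      using ab by auto
    moreover have "subtopology (top_of_set {a..c}) {a..b} = top_of_set {a..b}"
      "subtopology (top_of_set {a..c}) {b..c} = top_of_set {b..c}"
      using ab by (simp_all add: subtopology_subtopology Int_absorb1)
    ultimately show "continuous_map (subtopology (top_of_set {a..c}) {x \<in> topspace (top_of_set {a..c}). x \<le> b}) (mtop M) \<gamma>"
      "continuous_map (subtopology (top_of_set {a..c}) {x \<in> topspace (top_of_set {a..c}). b \<le> x}) (mtop M) \<gamma>'"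
      using trajectory_continuous[OF 1] trajectory_continuous[OF 2] by simp_all
  qed (use b in auto)
  fix t i assume t: "t \<in> {a..c}" and i: "i \<in> mindex M" "?g t \<in> mdom M i"
  let ?v = "sgrad M (time_slice G t) i (?g t)"
  have "((\<lambda>s. mchart M i (?g s)) has_vector_derivative ?v) (at t within {a..b})"
  proof (cases "t \<le> b")
    case True
    then have tab: "t \<in> {a..b}" using t by auto
    have "((\<lambda>s. mchart M i (\<gamma> s)) has_vector_derivative ?v) (at t within {a..b})"
      using 1 i tab True by (auto simp: trajectory_def)
    then show ?thesis
      by (rule has_vector_derivative_transform[OF tab, rotated]) simp
  qed (simp add: has_vector_derivative_off_closed)
  moreover have "((\<lambda>s. mchart M i (?g s)) has_vector_derivative ?v) (at t within {b..c})"
  proof (cases "t \<ge> b")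
    case True
    then have tbc: "t \<in> {b..c}" using t by auto
    have g: "?g s = \<gamma>' s" if "s \<in> {b..c}" for s using that b by auto
    have "((\<lambda>s. mchart M i (\<gamma>' s)) has_vector_derivative ?v) (at t within {b..c})"
      using 2 i tbc g[OF tbc] unfolding trajectory_def by simp
    then show ?thesis
      by (rule has_vector_derivative_transform[OF tbc, rotated]) (rule arg_cong[OF g])
  qed (simp add: has_vector_derivative_off_closed)
  ultimately have "((\<lambda>s. mchart M i (?g s)) has_vector_derivative ?v) (at t within ({a..b} \<union> {b..c}))"
    by (rule has_vector_derivative_Un)
  moreover have "{a..b} \<union> {b..c} = {a..c}" using ab by auto
  ultimately show "((\<lambda>s. mchart M i (?g s)) has_vector_derivative ?v) (at t within {a..c})" by simp
qed

lemma trajectory_shift_Icc: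
  assumes "trajectory M (H \<circ> fst) {a..b} \<gamma>"
  shows "trajectory M (H \<circ> fst) {a + c..b + c} (\<lambda>t. \<gamma> (t - c))"
proof -
  have "(\<lambda>t. t - (- c)) ` {a..b} = {a + c..b + c}" by simp
  then show ?thesis using trajectory_shift[OF assms, of "- c"] by simp
qed

lemma trajectory_UNIV:
  assumes tr: "\<And>n::nat. trajectory M G {- (real n * \<epsilon>)..real n * \<epsilon>} \<gamma>" and \<epsilon>: "\<epsilon> > 0"
  shows "trajectory M G UNIV \<gamma>"
proof -
  have ex: "\<exists>n::nat. t \<in> {- (real n * \<epsilon>)<..<real n * \<epsilon>}" for t
  proof -
    obtain n :: nat where "\<bar>t\<bar> / \<epsilon> < real n" using reals_Archimedean2 by blast
    then show ?thesis using \<epsilon> by (intro exI[of _ n]) (auto simp: field_simps)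
  qed
  show ?thesis
    unfolding trajectory_def
  proof (intro conjI ballI impI)
    show "continuous_map (top_of_set UNIV) (mtop M) \<gamma>"
      unfolding continuous_map
    proof (intro conjI allI impI)
      show "\<gamma> ` topspace (top_of_set UNIV) \<subseteq> mpoints M"
      proof clarsimp
        fix t
        obtain n :: nat where "t \<in> {- (real n * \<epsilon>)<..<real n * \<epsilon>}" using ex by blast
        then show "\<gamma> t \<in> mpoints M" using trajectory_point[OF tr[of n], of t] by simp
      qed
      fix U assume U: "openin (mtop M) U"
      have "open ({t \<in> {- (real n * \<epsilon>)..real n * \<epsilon>}. \<gamma> t \<in> U} \<inter> {- (real n * \<epsilon>)<..<real n * \<epsilon>})" for n :: nat
      proof -
        have "openin (top_of_set {- (real n * \<epsilon>)..real n * \<epsilon>}) {t \<in> {- (real n * \<epsilon>)..real n * \<epsilon>}. \<gamma> t \<in> U}"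
          using trajectory_continuous[OF tr[of n]] U by (auto simp: continuous_map)
        then obtain V where "open V" "{t \<in> {- (real n * \<epsilon>)..real n * \<epsilon>}. \<gamma> t \<in> U} = {- (real n * \<epsilon>)..real n * \<epsilon>} \<inter> V"
          by (auto simp: openin_open)
        then have "{t \<in> {- (real n * \<epsilon>)..real n * \<epsilon>}. \<gamma> t \<in> U} \<inter> {- (real n * \<epsilon>)<..<real n * \<epsilon>}
            = V \<inter> {- (real n * \<epsilon>)<..<real n * \<epsilon>}"
          using greaterThanLessThan_subseteq_atLeastAtMost_iff[of "- (real n * \<epsilon>)" "real n * \<epsilon>"] by blast
        then show ?thesis using \<open>open V\<close> by (simp add: open_Int)
      qed
      moreover have "{t \<in> topspace (top_of_set UNIV). \<gamma> t \<in> U} =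
          (\<Union>n::nat. {t \<in> {- (real n * \<epsilon>)..real n * \<epsilon>}. \<gamma> t \<in> U} \<inter> {- (real n * \<epsilon>)<..<real n * \<epsilon>})"
      proof (intro equalityI subsetI)
        fix t assume t: "t \<in> {t \<in> topspace (top_of_set UNIV). \<gamma> t \<in> U}"
        obtain n :: nat where "t \<in> {- (real n * \<epsilon>)<..<real n * \<epsilon>}" using ex by blast
        then show "t \<in> (\<Union>n::nat. {t \<in> {- (real n * \<epsilon>)..real n * \<epsilon>}. \<gamma> t \<in> U} \<inter> {- (real n * \<epsilon>)<..<real n * \<epsilon>})"
          using t by (intro UN_I[of n]) auto
      qed auto
      ultimately show "openin (top_of_set UNIV) {t \<in> topspace (top_of_set UNIV). \<gamma> t \<in> U}"
        by (simp add: open_UN)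
    qed
    fix t i assume i: "i \<in> mindex M" "\<gamma> t \<in> mdom M i"
    obtain n :: nat where n: "t \<in> {- (real n * \<epsilon>)<..<real n * \<epsilon>}" using ex by blast
    then have "((\<lambda>s. mchart M i (\<gamma> s)) has_vector_derivative sgrad M (time_slice G t) i (\<gamma> t))
        (at t within {- (real n * \<epsilon>)..real n * \<epsilon>})"
      using tr[of n] i by (auto simp: trajectory_def)
    then show "((\<lambda>s. mchart M i (\<gamma> s)) has_vector_derivative sgrad M (time_slice G t) i (\<gamma> t)) (at t within UNIV)"
      using n by (simp add: at_within_Icc_at)
  qed
qed

context sympl_mfd
begin

text \<open>\<open>trajectory\<close> asks for the differential equation in every chart. One chart
  suffices because \<open>sgrad\<close> transforms with the derivative of the transition
  map.\<close>

lemma trajectory_in_chart: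
  assumes H: "smooth_function M H" and i: "i \<in> mindex M"
    and x: "\<And>t. t \<in> T \<Longrightarrow> x t \<in> mrange M i"
    and xd: "\<And>t. t \<in> T \<Longrightarrow> (x has_vector_derivative sgrad M H i (mparam M i (x t))) (at t within T)"
  shows "trajectory M (H \<circ> fst) T (\<lambda>t. mparam M i (x t))"
  unfolding trajectory_def
proof (intro conjI ballI impI)
  have "continuous_on T x"
    using xd has_vector_derivative_continuous continuous_on_eq_continuous_within by blast
  then have "continuous_map (top_of_set T) (top_of_set (mrange M i)) x" using x by auto
  from continuous_map_compose[OF this continuous_mparam[OF i]] show "continuous_map (top_of_set T) (mtop M) (\<lambda>t. mparam M i (x t))"
    unfolding o_def .
  fix t j assume t: "t \<in> T" and j: "j \<in> mindex M" "mparam M i (x t) \<in> mdom M j"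
  let ?p = "mparam M i (x t)"
  have p: "?p \<in> mdom M i \<inter> mdom M j" using mparam_in[OF i x[OF t]] j by simp
  have xp: "mchart M i ?p = x t" by (rule mchart_mparam[OF i x[OF t]])
  have d: "(transition M i j has_derivative frechet_derivative (transition M i j) (at (x t))) (at (x t) within x ` T)"
    using transition_derivative[OF M i j(1) p] unfolding xp by (rule has_derivative_at_withinI)
  have "(transition M i j \<circ> x has_vector_derivative
      frechet_derivative (transition M i j) (at (x t)) (sgrad M H i ?p)) (at t within T)"
    by (rule vector_derivative_diff_chain_within[OF xd[OF t] d])
  moreover have "sgrad M H j ?p = frechet_derivative (transition M i j) (at (x t)) (sgrad M H i ?p)"
    using sgrad_transition[OF S i j(1) p H] unfolding xp .
  ultimately show "((\<lambda>s. mchart M j (mparam M i (x s))) has_vector_derivative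
      sgrad M (time_slice (H \<circ> fst) t) j (mparam M i (x t))) (at t within T)"
    by (simp add: transition_def o_def time_slice_def)
qed

lemma local_trajectories:
  assumes H: "smooth_function M H" and p: "p \<in> mpoints M"
  obtains W \<epsilon> where "openin (mtop M) W" "p \<in> W" "\<epsilon> > 0"
    "\<And>q. q \<in> W \<Longrightarrow> \<exists>\<gamma>. trajectory M (H \<circ> fst) {-\<epsilon>..\<epsilon>} \<gamma> \<and> \<gamma> 0 = q"
proof -
  obtain i where i: "i \<in> mindex M" "p \<in> mdom M i" using chart_exists[OF p] by blast
  let ?v = "\<lambda>x. sgrad M H i (mparam M i x)"
  obtain r L where r: "r > 0" "cball (mchart M i p) r \<subseteq> mrange M i" "L-lipschitz_on (cball (mchart M i p) r) ?v"
    using loclip_onE[OF sgrad_loclip[OF H i(1)] mchart_in[OF i]] by metis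
  obtain h where h: "h > 0" and ode: "\<And>x0. x0 \<in> cball (mchart M i p) (r/2) \<Longrightarrow> \<exists>x. x 0 = x0 \<and>
      (\<forall>t\<in>{-h..h}. x t \<in> cball (mchart M i p) r \<and> (x has_vector_derivative ?v (x t)) (at t within {-h..h}))"
    using local_ode[OF r(1,3)] by blast
  show thesis
  proof (rule that[OF openin_chart_ball[OF i(1), of "mchart M i p" "r/2"] _ h])
    show "p \<in> {q \<in> mdom M i. mchart M i q \<in> ball (mchart M i p) (r/2)}" using i r by simp
    fix q assume q: "q \<in> {q \<in> mdom M i. mchart M i q \<in> ball (mchart M i p) (r/2)}"
    then obtain x where x: "x 0 = mchart M i q"
      "\<And>t. t \<in> {-h..h} \<Longrightarrow> x t \<in> cball (mchart M i p) r"
      "\<And>t. t \<in> {-h..h} \<Longrightarrow> (x has_vector_derivative ?v (x t)) (at t within {-h..h})"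
      using ode[of "mchart M i q"] by auto
    have "trajectory M (H \<circ> fst) {-h..h} (\<lambda>t. mparam M i (x t))"
      by (rule trajectory_in_chart[OF H i(1)]) (use x r in auto)
    moreover have "mparam M i (x 0) = q" using q x(1) mparam_mchart'[OF i(1)] by simp
    ultimately show "\<exists>\<gamma>. trajectory M (H \<circ> fst) {-h..h} \<gamma> \<and> \<gamma> 0 = q" by blast
  qed
qed

lemma constant_trajectory:
  assumes "\<And>i. i \<in> mindex M \<Longrightarrow> p \<in> mdom M i \<Longrightarrow> sgrad M H i p = 0" "p \<in> mpoints M"
  shows "trajectory M (H \<circ> fst) T (\<lambda>t. p)"
  using assms by (auto simp: trajectory_def time_slice_def o_def)

lemma sgrad_zero:
  assumes "smooth_function M H" "openin (mtop M) O'" "p \<in> O'" "\<And>q. q \<in> O' \<Longrightarrow> H q = c"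
    "i \<in> mindex M" "p \<in> mdom M i"
  shows "sgrad M H i p = 0"
  by (rule sgrad_eq_zero[OF assms(5,6,1)])
    (simp add: dcoord_cong[OF assms(2,3), of H "\<lambda>_. c", OF assms(4-6)] dcoord_const)

lemma trajectory_extend_right:
  assumes tr: "trajectory M (H \<circ> fst) {a..b} \<gamma>" "a \<le> b" "\<epsilon> > 0"
    and ex: "\<And>q. q \<in> mpoints M \<Longrightarrow> \<exists>\<gamma>. trajectory M (H \<circ> fst) {-\<epsilon>..\<epsilon>} \<gamma> \<and> \<gamma> 0 = q"
  shows "\<exists>\<gamma>'. trajectory M (H \<circ> fst) {a..b + \<epsilon>} \<gamma>' \<and> (\<forall>t\<in>{a..b}. \<gamma>' t = \<gamma> t)"
proof -
  have "\<gamma> b \<in> mpoints M" using trajectory_point[OF tr(1)] tr(2) by simp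
  then obtain \<sigma> where \<sigma>: "trajectory M (H \<circ> fst) {-\<epsilon>..\<epsilon>} \<sigma>" "\<sigma> 0 = \<gamma> b" using ex by blast
  have \<sigma>': "trajectory M (H \<circ> fst) {b..b + \<epsilon>} (\<lambda>t. \<sigma> (t - b))"
    by (rule trajectory_subset[OF trajectory_shift_Icc[OF \<sigma>(1), of b]]) (use tr(3) in auto)
  have "trajectory M (H \<circ> fst) {a..b + \<epsilon>} (\<lambda>t. if t \<le> b then \<gamma> t else \<sigma> (t - b))"
    by (rule trajectory_glue[OF tr(1) \<sigma>']) (use tr(2,3) \<sigma>(2) in auto)
  then show ?thesis by (intro exI[of _ "\<lambda>t. if t \<le> b then \<gamma> t else \<sigma> (t - b)"]) auto
qed

lemma trajectory_extend_left:
  assumes tr: "trajectory M (H \<circ> fst) {a..b} \<gamma>" "a \<le> b" "\<epsilon> > 0"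
    and ex: "\<And>q. q \<in> mpoints M \<Longrightarrow> \<exists>\<gamma>. trajectory M (H \<circ> fst) {-\<epsilon>..\<epsilon>} \<gamma> \<and> \<gamma> 0 = q"
  shows "\<exists>\<gamma>'. trajectory M (H \<circ> fst) {a - \<epsilon>..b} \<gamma>' \<and> (\<forall>t\<in>{a..b}. \<gamma>' t = \<gamma> t)"
proof -
  have "\<gamma> a \<in> mpoints M" using trajectory_point[OF tr(1)] tr(2) by simp
  then obtain \<sigma> where \<sigma>: "trajectory M (H \<circ> fst) {-\<epsilon>..\<epsilon>} \<sigma>" "\<sigma> 0 = \<gamma> a" using ex by blast
  have \<sigma>': "trajectory M (H \<circ> fst) {a - \<epsilon>..a} (\<lambda>t. \<sigma> (t - a))"
    by (rule trajectory_subset[OF trajectory_shift_Icc[OF \<sigma>(1), of a]]) (use tr(3) in auto)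
  have "trajectory M (H \<circ> fst) {a - \<epsilon>..b} (\<lambda>t. if t \<le> a then \<sigma> (t - a) else \<gamma> t)"
    by (rule trajectory_glue[OF \<sigma>' tr(1)]) (use tr(2,3) \<sigma>(2) in auto)
  then show ?thesis
    by (intro exI[of _ "\<lambda>t. if t \<le> a then \<sigma> (t - a) else \<gamma> t"]) (use \<sigma>(2) in auto)
qed

text \<open>A time \<open>\<epsilon>\<close> available at every point allows any arc to be prolonged
  by \<open>\<epsilon>\<close> at both ends. Dependent choice produces coherent prolongations, and
  the curve is their union.\<close>

lemma global_trajectories:
  assumes \<epsilon>: "\<epsilon> > 0"
    and ex: "\<And>q. q \<in> mpoints M \<Longrightarrow> \<exists>\<gamma>. trajectory M (H \<circ> fst) {-\<epsilon>..\<epsilon>} \<gamma> \<and> \<gamma> 0 = q"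
    and p: "p \<in> mpoints M"
  shows "\<exists>\<gamma>. trajectory M (H \<circ> fst) UNIV \<gamma> \<and> \<gamma> 0 = p"
proof -
  define a where "a n = real (Suc n) * \<epsilon>" for n
  have a: "a n > 0" "a (Suc n) = a n + \<epsilon>" for n
  proof -
    show "a n > 0" using \<epsilon> by (simp add: a_def)
    show "a (Suc n) = a n + \<epsilon>" by (simp add: a_def distrib_right)
  qed
  have "\<exists>f. \<forall>n. (trajectory M (H \<circ> fst) {-a n..a n} (f n) \<and> f n 0 = p) \<and> (\<forall>t\<in>{-a n..a n}. f (Suc n) t = f n t)"
  proof (rule dependent_nat_choice)
    show "\<exists>\<gamma>. trajectory M (H \<circ> fst) {-a 0..a 0} \<gamma> \<and> \<gamma> 0 = p" using ex[OF p] by (simp add: a_def)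
    fix \<gamma> n assume \<gamma>: "trajectory M (H \<circ> fst) {-a n..a n} \<gamma> \<and> \<gamma> 0 = p"
    have an: "- a n \<le> a n" using a(1)[of n] by simp
    obtain \<gamma>1 where 1: "trajectory M (H \<circ> fst) {-a n..a n + \<epsilon>} \<gamma>1" "\<And>t. t \<in> {-a n..a n} \<Longrightarrow> \<gamma>1 t = \<gamma> t"
      using trajectory_extend_right[OF conjunct1[OF \<gamma>] an \<epsilon> ex] by blast
    have an': "- a n \<le> a n + \<epsilon>" using an \<epsilon> by simp
    obtain \<gamma>2 where 2: "trajectory M (H \<circ> fst) {-a n - \<epsilon>..a n + \<epsilon>} \<gamma>2" "\<And>t. t \<in> {-a n..a n + \<epsilon>} \<Longrightarrow> \<gamma>2 t = \<gamma>1 t"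
      using trajectory_extend_left[OF 1(1) an' \<epsilon> ex] by blast
    have "\<gamma>2 t = \<gamma> t" if "t \<in> {-a n..a n}" for t using 1(2)[OF that] 2(2)[of t] that \<epsilon> by auto
    moreover have "trajectory M (H \<circ> fst) {-a (Suc n)..a (Suc n)} \<gamma>2" using 2(1) by (simp add: a(2))
    ultimately show "\<exists>\<gamma>'. (trajectory M (H \<circ> fst) {-a (Suc n)..a (Suc n)} \<gamma>' \<and> \<gamma>' 0 = p) \<and>
        (\<forall>t\<in>{-a n..a n}. \<gamma>' t = \<gamma> t)"
      using \<gamma> a(1)[of n] by (intro exI[of _ \<gamma>2]) auto
  qed
  then obtain f where f: "\<And>n. trajectory M (H \<circ> fst) {-a n..a n} (f n)" "\<And>n. f n 0 = p"
    "\<And>n t. t \<in> {-a n..a n} \<Longrightarrow> f (Suc n) t = f n t" by blast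
  have amono: "a n \<le> a m" if "n \<le> m" for n m using that \<epsilon> by (simp add: a_def)
  have fm: "f m t = f n t" if "n \<le> m" "t \<in> {-a n..a n}" for n m t
    using that(1)
  proof (induction m rule: dec_induct)
    case (step k)
    then show ?case using f(3)[of t k] amono[of n k] that(2) by auto
  qed simp
  \<comment> \<open>The index is a stage whose interval certainly contains \<open>t\<close>; all
    stages defined at \<open>t\<close> agree there.\<close>
  define \<gamma> where "\<gamma> t = f (nat \<lceil>\<bar>t\<bar> / \<epsilon>\<rceil>) t" for t
  have g: "\<gamma> t = f n t" if t: "t \<in> {- a n..a n}" for n t
  proof -
    define m where "m = nat \<lceil>\<bar>t\<bar> / \<epsilon>\<rceil>"
    have "\<bar>t\<bar> / \<epsilon> \<le> real m" unfolding m_def by linarith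
    then have "\<bar>t\<bar> \<le> a m" using \<epsilon> by (simp add: a_def field_simps)
    then have "t \<in> {- a m..a m}" by auto
    then show ?thesis unfolding \<gamma>_def m_def[symmetric]
      using fm[of m n t] fm[of n m t] t by (cases "m \<le> n") auto
  qed
  have "trajectory M (H \<circ> fst) UNIV \<gamma>"
  proof (rule trajectory_UNIV[OF _ \<epsilon>])
    fix n :: nat
    have "{- (real n * \<epsilon>)..real n * \<epsilon>} \<subseteq> {-a n..a n}" using \<epsilon> by (auto simp: a_def algebra_simps)
    moreover have "trajectory M (H \<circ> fst) {-a n..a n} \<gamma>"
      by (rule trajectory_cong[OF f(1)[of n]]) (simp add: g)
    ultimately show "trajectory M (H \<circ> fst) {- (real n * \<epsilon>)..real n * \<epsilon>} \<gamma>"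
      using trajectory_subset by blast
  qed
  moreover have "\<gamma> 0 = p" using g[of 0 0] f(2) a(1)[of 0] by simp
  ultimately show ?thesis by blast
qed

text \<open>On the support the existence time is bounded below by compactness; outside it the field
  vanishes and constant curves are trajectories. The resulting uniform time feeds
  \<open>global_trajectories\<close>.\<close>

lemma compactly_supported_complete:
  assumes G: "smooth_function M G" "compactly_supported M G" and p: "p \<in> mpoints M"
  shows "\<exists>\<gamma>. trajectory M (G \<circ> fst) UNIV \<gamma> \<and> \<gamma> 0 = p"
proof -
  obtain K where K: "compactin (mtop M) K" "\<And>q. q \<in> mpoints M - K \<Longrightarrow> G q = 0"
    using G(2) by (auto simp: compactly_supported_def)
  \<comment> \<open>The existence time is stored as its reciprocal \<open>C\<close>, so that the
    property persists when \<open>C\<close> grows, as \<open>compactin_uniform\<close>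
    requires.\<close>
  define Q where "Q q C \<longleftrightarrow> C > 0 \<and> (\<exists>\<gamma>. trajectory M (G \<circ> fst) {-(1/C)..1/C} \<gamma> \<and> \<gamma> 0 = q)" for q and C :: real
  have mono: "Q q D" if "Q q C" "C \<le> D" for q C D
  proof -
    have "C > 0" using that(1) by (simp add: Q_def)
    moreover obtain \<gamma> where "trajectory M (G \<circ> fst) {-(1/C)..1/C} \<gamma>" "\<gamma> 0 = q"
      using \<open>Q q C\<close> unfolding Q_def by blast
    ultimately have \<gamma>: "C > 0" "trajectory M (G \<circ> fst) {-(1/C)..1/C} \<gamma>" "\<gamma> 0 = q" by blast+
    have "1 / D \<le> 1 / C" using \<gamma>(1) that(2) by (simp add: frac_le)
    then have "trajectory M (G \<circ> fst) {-(1/D)..1/D} \<gamma>"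
      by (intro trajectory_subset[OF \<gamma>(2)]) auto
    then show ?thesis using \<gamma> that(2) by (auto simp: Q_def)
  qed
  have "\<exists>C. \<forall>q\<in>K. Q q C"
  proof (rule compactin_uniform[OF K(1) _ mono])
    fix z assume "z \<in> K"
    then have "z \<in> mpoints M" using K(1) compactin_subset_topspace by blast
    then obtain W \<epsilon> where "openin (mtop M) W" "z \<in> W" "\<epsilon> > 0"
      "\<And>q. q \<in> W \<Longrightarrow> \<exists>\<gamma>. trajectory M (G \<circ> fst) {-\<epsilon>..\<epsilon>} \<gamma> \<and> \<gamma> 0 = q"
      by (rule local_trajectories[OF G(1)]) blast
    then show "\<exists>W C. openin (mtop M) W \<and> z \<in> W \<and> (\<forall>y\<in>W. Q y C)"
      by (intro exI[of _ W] exI[of _ "1/\<epsilon>"]) (simp add: Q_def)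
  qed
  then obtain C where C: "\<And>q. q \<in> K \<Longrightarrow> Q q C" by blast
  define \<epsilon> where "\<epsilon> = 1 / max C 1"
  have "\<exists>\<gamma>. trajectory M (G \<circ> fst) {-\<epsilon>..\<epsilon>} \<gamma> \<and> \<gamma> 0 = q" if q: "q \<in> mpoints M" for q
  proof (cases "q \<in> K")
    case True
    then have "Q q (max C 1)" using C mono by (meson max.cobounded1)
    then show ?thesis by (simp add: Q_def \<epsilon>_def)
  next
    case False
    have "openin (mtop M) (mpoints M - K)" using compactin_closedin[OF K(1)] by blast
    then have "sgrad M G i q = 0" if "i \<in> mindex M" "q \<in> mdom M i" for i
      using sgrad_zero[OF G(1), of "mpoints M - K" q 0] False q K(2) that by blast
    then have "trajectory M (G \<circ> fst) {-\<epsilon>..\<epsilon>} (\<lambda>t. q)" by (rule constant_trajectory[OF _ q])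
    then show ?thesis by blast
  qed
  then show ?thesis by (intro global_trajectories[OF _ _ p, of \<epsilon>]) (auto simp: \<epsilon>_def)
qed

end

section \<open>The flow of a complete Hamiltonian\<close>

locale complete_flow = sympl_mfd M
  for M :: "('i, 'a, 'e::euclidean_space, 'm) sympl_scheme" +
  fixes H :: "'a \<Rightarrow> real"
  assumes H: "smooth_function M H"
    and complete: "\<And>p. p \<in> mpoints M \<Longrightarrow> \<exists>\<gamma>. trajectory M (H \<circ> fst) UNIV \<gamma> \<and> \<gamma> 0 = p"
begin

definition flow :: "real \<Rightarrow> 'a \<Rightarrow> 'a" where
  "flow t p = (SOME \<gamma>. trajectory M (H \<circ> fst) UNIV \<gamma> \<and> \<gamma> 0 = p) t"

lemma flow_trajectory: "p \<in> mpoints M \<Longrightarrow> trajectory M (H \<circ> fst) UNIV (\<lambda>t. flow t p)"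
  and flow_0: "p \<in> mpoints M \<Longrightarrow> flow 0 p = p"
  using someI_ex[OF complete, of p] by (auto simp: flow_def)

lemma flow_trajectory_Icc: "p \<in> mpoints M \<Longrightarrow> trajectory M (H \<circ> fst) {a..b} (\<lambda>t. flow t p)"
  by (rule trajectory_subset[OF flow_trajectory]) auto

lemma flow_point: "p \<in> mpoints M \<Longrightarrow> flow t p \<in> mpoints M"
  using trajectory_point[OF flow_trajectory] by blast

lemma flow_unique:
  assumes tr: "trajectory M (H \<circ> fst) {a..b} \<gamma>" and 0: "a \<le> 0" "0 \<le> b" and t: "t \<in> {a..b}"
  shows "\<gamma> t = flow t (\<gamma> 0)"
proof -
  have p: "\<gamma> 0 \<in> mpoints M" using trajectory_point[OF tr] 0 by simp
  show ?thesis
    by (rule trajectory_unique[OF H tr flow_trajectory_Icc[OF p], of 0]) (use 0 t flow_0[OF p] in auto)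
qed

lemma flow_add:
  assumes p: "p \<in> mpoints M"
  shows "flow (s + t) p = flow s (flow t p)"
proof -
  have "trajectory M (H \<circ> fst) {- \<bar>s\<bar> + t + - t..\<bar>s\<bar> + t + - t} (\<lambda>r. flow (r - - t) p)"
    by (rule trajectory_shift_Icc[OF flow_trajectory_Icc[OF p]])
  then have "trajectory M (H \<circ> fst) {- \<bar>s\<bar>..\<bar>s\<bar>} (\<lambda>r. flow (r + t) p)" by simp
  moreover have "s \<in> {- \<bar>s\<bar>..\<bar>s\<bar>}" unfolding atLeastAtMost_iff by linarith
  ultimately have "flow (s + t) p = flow s (flow (0 + t) p)" by (intro flow_unique[of "- \<bar>s\<bar>" "\<bar>s\<bar>"]) auto
  then show ?thesis by simp
qed

lemma flow_inverse: "p \<in> mpoints M \<Longrightarrow> flow (- t) (flow t p) = p"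
  using flow_add[of p "- t" t] flow_0 by simp

lemma flow_continuous: "p \<in> mpoints M \<Longrightarrow> continuous_map euclideanreal (mtop M) (\<lambda>t. flow t p)"
  using trajectory_continuous[OF flow_trajectory] by simp

text \<open>A chord may begin at any time; the field is autonomous, so it can be moved to start at
  0, where uniqueness identifies it with an orbit of the flow.\<close>

lemma chord_iff_flow:
  "has_chord M (H \<circ> fst) X0 X1 L \<longleftrightarrow>
    (\<exists>p\<in>X0 \<inter> mpoints M. \<exists>t>0. flow t p \<in> X1 \<and> ereal t \<le> L)"
proof
  assume "has_chord M (H \<circ> fst) X0 X1 L"
  then obtain t0 t1 \<gamma> where c: "t0 < t1" "trajectory M (H \<circ> fst) {t0..t1} \<gamma>" "\<gamma> t0 \<in> X0" "\<gamma> t1 \<in> X1"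
    "ereal (t1 - t0) \<le> L" by (auto simp: has_chord_def)
  have "trajectory M (H \<circ> fst) {t0 + - t0..t1 + - t0} (\<lambda>r. \<gamma> (r - - t0))"
    by (rule trajectory_shift_Icc[OF c(2)])
  then have tr: "trajectory M (H \<circ> fst) {0..t1 - t0} (\<lambda>r. \<gamma> (r + t0))" by simp
  have "\<gamma> t1 = flow (t1 - t0) (\<gamma> t0)" using flow_unique[OF tr, of "t1 - t0"] c(1) by simp
  moreover have "\<gamma> t0 \<in> mpoints M" using trajectory_point[OF c(2)] c(1) by simp
  ultimately show "\<exists>p\<in>X0 \<inter> mpoints M. \<exists>t>0. flow t p \<in> X1 \<and> ereal t \<le> L"
    using c by (intro bexI[of _ "\<gamma> t0"] exI[of _ "t1 - t0"]) auto
next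
  assume "\<exists>p\<in>X0 \<inter> mpoints M. \<exists>t>0. flow t p \<in> X1 \<and> ereal t \<le> L"
  then obtain p t where p: "p \<in> X0" "p \<in> mpoints M" "t > 0" "flow t p \<in> X1" "ereal t \<le> L" by blast
  then show "has_chord M (H \<circ> fst) X0 X1 L" unfolding has_chord_def
    using flow_trajectory_Icc[OF p(2), of 0 t] flow_0[OF p(2)]
    by (intro exI[of _ 0] exI[of _ t] exI[of _ "\<lambda>t. flow t p"]) auto
qed

text \<open>Inside \<open>K\<close>, small \<open>sqdist\<close> from \<open>I\<close> forces
  membership in \<open>N\<close>: on the compact set \<open>I \<times> (K - N)\<close> the function
  \<open>sqdist\<close> is positive because it separates points, so it has a positive
  minimum.\<close>

lemma sqdist_small_in_open:
  assumes K: "compactin (mtop M) K" and \<Psi>: "metrizes \<Psi> K" and I: "compactin (mtop M) I" "I \<subseteq> K" "I \<subseteq> N"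
    and N: "openin (mtop M) N"
  obtains \<eta> where "\<eta> > 0" "\<And>y z. y \<in> I \<Longrightarrow> z \<in> K - N \<Longrightarrow> \<eta> \<le> sqdist \<Psi> y z"
proof (cases "I \<times> (K - N) = {}")
  case True
  then show thesis using that[of 1] by auto
next
  case False
  let ?X = "prod_topology (mtop M) (mtop M)"
  have "closedin (mtop M) (mpoints M - N)" using N by blast
  from closed_Int_compactin[OF this K] have "compactin (mtop M) ((mpoints M - N) \<inter> K)" .
  moreover have "(mpoints M - N) \<inter> K = K - N" using compactin_subset_topspace[OF K] by blast
  ultimately have "compactin (mtop M) (K - N)" by simp
  then have c: "compactin ?X (I \<times> (K - N))" using I(1) by (simp add: compactin_Times)
  have sc: "continuous_map ?X euclideanreal (\<lambda>z. sqdist \<Psi> (fst z) (snd z))"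
    by (rule sqdist_continuous) (use \<Psi> in \<open>simp add: metrizes_def\<close>)
  have cc: "compact ((\<lambda>z. sqdist \<Psi> (fst z) (snd z)) ` (I \<times> (K - N)))"
    using image_compactin[OF c sc] by simp
  obtain m where m: "m \<in> (\<lambda>z. sqdist \<Psi> (fst z) (snd z)) ` (I \<times> (K - N))"
    "\<And>m'. m' \<in> (\<lambda>z. sqdist \<Psi> (fst z) (snd z)) ` (I \<times> (K - N)) \<Longrightarrow> m \<le> m'"
    using compact_attains_inf[OF cc] False by blast
  then obtain z where z: "z \<in> I \<times> (K - N)"
    "\<And>z'. z' \<in> I \<times> (K - N) \<Longrightarrow> sqdist \<Psi> (fst z) (snd z) \<le> sqdist \<Psi> (fst z') (snd z')"
    by (metis (no_types, lifting) image_iff)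
  have "sqdist \<Psi> (fst z) (snd z) \<noteq> 0"
  proof
    assume "sqdist \<Psi> (fst z) (snd z) = 0"
    moreover have "fst z \<in> K" "snd z \<in> mpoints M" using z(1) I(2) compactin_subset_topspace[OF K] by auto
    ultimately have "fst z = snd z" using metrizes_separates[OF \<Psi>] by blast
    then show False using z(1) I(3) by auto
  qed
  then have "sqdist \<Psi> (fst z) (snd z) > 0" using sqdist_nonneg[of \<Psi> "fst z" "snd z"] by simp
  then show thesis using z(2) by (intro that[of "sqdist \<Psi> (fst z) (snd z)"]) force+
qed

lemma sqdist_continuous_snd:
  assumes "metrizes \<Psi> K" "p \<in> mpoints M"
  shows "continuous_map (mtop M) euclideanreal (sqdist \<Psi> p)"
proof -
  have "continuous_map (prod_topology (mtop M) (mtop M)) euclideanreal (\<lambda>z. sqdist \<Psi> (fst z) (snd z))"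
    by (rule sqdist_continuous) (use assms(1) in \<open>simp add: metrizes_def\<close>)
  moreover have "continuous_map (mtop M) (prod_topology (mtop M) (mtop M)) (\<lambda>q. (p, q))"
    using assms(2) by (intro continuous_map_pairedI) simp_all
  ultimately show ?thesis
    using continuous_map_compose[of "mtop M" "prod_topology (mtop M) (mtop M)" "\<lambda>q. (p, q)"
      euclideanreal "\<lambda>z. sqdist \<Psi> (fst z) (snd z)"] by (simp add: o_def)
qed

text \<open>Trajectories starting near \<open>p\<close> cannot leave a compact neighbourhood of the trajectory
  segment of \<open>p\<close>: at the first exit time Gronwall's inequality would still apply.\<close>
lemma flow_tube:
  assumes p: "p \<in> mpoints M" and T: "T > 0"
  obtains U K \<Psi> C where "openin (mtop M) U" "p \<in> U" "compactin (mtop M) K" "metrizes \<Psi> K" "C \<ge> 0"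
    "\<And>q t. q \<in> U \<Longrightarrow> t \<in> {-T..T} \<Longrightarrow> flow t q \<in> K"
    "\<And>q q' t. q \<in> U \<Longrightarrow> q' \<in> U \<Longrightarrow> t \<in> {-T..T} \<Longrightarrow>
      sqdist \<Psi> (flow t q) (flow t q') \<le> C * sqdist \<Psi> q q'"
proof -
  define I where "I = (\<lambda>t. flow t p) ` {-T..T}"
  have I: "compactin (mtop M) I" unfolding I_def
    by (rule trajectory_compact_image[OF flow_trajectory_Icc[OF p]])
  obtain W K where W: "openin (mtop M) W" "compactin (mtop M) K" "I \<subseteq> W" "W \<subseteq> K"
    using compact_neighbourhood[OF I] by metis
  obtain \<Psi> where \<Psi>: "metrizes \<Psi> K" using metrizes_exists[OF W(2)] by blast
  obtain C where C: "C \<ge> 0" "\<And>a b \<gamma> \<gamma>' s t. trajectory M (H \<circ> fst) {a..b} \<gamma> \<Longrightarrow> trajectory M (H \<circ> fst) {a..b} \<gamma>' \<Longrightarrow>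
      \<gamma> ` {a..b} \<subseteq> K \<Longrightarrow> \<gamma>' ` {a..b} \<subseteq> K \<Longrightarrow> s \<in> {a..b} \<Longrightarrow> t \<in> {a..b} \<Longrightarrow>
      sqdist \<Psi> (\<gamma> t) (\<gamma>' t) \<le> exp (C * \<bar>t - s\<bar>) * sqdist \<Psi> (\<gamma> s) (\<gamma>' s)"
    using gronwall[OF H \<Psi>] by metis
  have IK: "I \<subseteq> K" using W by blast
  obtain \<eta> where \<eta>: "\<eta> > 0" "\<And>y z. y \<in> I \<Longrightarrow> z \<in> K - W \<Longrightarrow> \<eta> \<le> sqdist \<Psi> y z"
    using sqdist_small_in_open[OF W(2) \<Psi> I IK W(3,1)] by metis
  \<comment> \<open>Gronwall's inequality magnifies \<open>sqdist\<close> by at most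
    \<open>exp (C * T)\<close> within time \<open>T\<close>, so starting points this close remain
    within \<open>\<eta>\<close> of the segment.\<close>
  define U where "U = W \<inter> {q \<in> mpoints M. sqdist \<Psi> p q \<in> {..<\<eta> * exp (- (C * T))}}"
  have U: "openin (mtop M) U" unfolding U_def
    by (intro openin_Int W openin_continuous_map_preimage[OF sqdist_continuous_snd[OF \<Psi> p]]) simp
  have pI: "flow t p \<in> I" if "t \<in> {-T..T}" for t using that by (auto simp: I_def)
  have pW: "p \<in> W" using pI[of 0] flow_0[OF p] T W(3) by auto
  have pU: "p \<in> U" using pW p \<eta>(1) by (simp add: U_def)
  have dist: "sqdist \<Psi> (flow t q) (flow t q') \<le> exp (C * T) * sqdist \<Psi> q q'"
    if "q \<in> mpoints M" "q' \<in> mpoints M" "0 \<le> \<tau>" "\<tau> \<le> T" "\<bar>t\<bar> = \<tau>"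
      "\<And>s. s \<in> {min 0 t..max 0 t} \<Longrightarrow> flow s q \<in> K" "\<And>s. s \<in> {min 0 t..max 0 t} \<Longrightarrow> flow s q' \<in> K"
    for q q' \<tau> t
  proof -
    have "sqdist \<Psi> (flow t q) (flow t q') \<le> exp (C * \<bar>t - 0\<bar>) * sqdist \<Psi> (flow 0 q) (flow 0 q')"
      by (rule C(2)[OF flow_trajectory_Icc[OF that(1), of "min 0 t" "max 0 t"] flow_trajectory_Icc[OF that(2)]])
        (use that in auto)
    also have "\<dots> \<le> exp (C * T) * sqdist \<Psi> q q'"
      using that C(1) by (simp add: flow_0 mult_left_mono mult_right_mono sqdist_nonneg)
    finally show ?thesis .
  qed
  \<comment> \<open>The sign \<open>\<sigma>\<close> runs the same first-exit argument forward and
    backward in time.\<close>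
  have stay: "flow (\<sigma> * t) q \<in> W" if qU: "q \<in> U" and \<sigma>: "\<sigma> = 1 \<or> \<sigma> = -1" and t: "t \<in> {0..T}" for q \<sigma> t
  proof (rule ccontr)
    assume out: "flow (\<sigma> * t) q \<notin> W"
    have q: "q \<in> mpoints M" "q \<in> W" and small: "sqdist \<Psi> p q < \<eta> * exp (- (C * T))" using qU by (auto simp: U_def)
    have cont: "continuous_map euclideanreal (mtop M) (\<lambda>s. flow (\<sigma> * s) q)"
      using continuous_map_compose[of euclideanreal euclideanreal "\<lambda>s. \<sigma> * s", OF _ flow_continuous[OF q(1)]]
      by (simp add: o_def continuous_on_mult_left)
    define A where "A = {0..T} \<inter> {s. flow (\<sigma> * s) q \<notin> W}"
    have "open {s \<in> topspace euclideanreal. flow (\<sigma> * s) q \<in> W}"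
      using openin_continuous_map_preimage[OF cont W(1)] by simp
    then have "closed {s. flow (\<sigma> * s) q \<notin> W}" by (simp add: closed_def Collect_neg_eq[symmetric])
    then have "compact A" unfolding A_def by (intro compact_Int_closed) auto
    moreover have "A \<noteq> {}" using out t by (auto simp: A_def)
    ultimately obtain \<tau> where \<tau>: "\<tau> \<in> A" "\<And>s. s \<in> A \<Longrightarrow> \<tau> \<le> s" using compact_attains_inf by metis
    have \<tau>T: "0 \<le> \<tau>" "\<tau> \<le> T" "flow (\<sigma> * \<tau>) q \<notin> W" using \<tau>(1) by (auto simp: A_def)
    have "\<tau> \<noteq> 0" using \<tau>T(3) q flow_0 by auto
    then have \<tau>0: "\<tau> > 0" using \<tau>T by simp
    have bef: "flow (\<sigma> * s) q \<in> W" if "0 \<le> s" "s < \<tau>" for s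
      using \<tau>(2)[of s] that \<tau>T by (auto simp: A_def)
    have "closedin euclideanreal {s \<in> topspace euclideanreal. flow (\<sigma> * s) q \<in> K}"
      by (rule closedin_continuous_map_preimage[OF cont compactin_closedin[OF W(2)]])
    then have clK: "closed {s. flow (\<sigma> * s) q \<in> K}" by simp
    \<comment> \<open>At the exit time itself the orbit has left \<open>W\<close>. It is still in
      \<open>K\<close> because \<open>K\<close> is closed, so the Gronwall estimate, valid only
      inside \<open>K\<close>, may be used there.\<close>
    have "{0..<\<tau>} \<subseteq> {s. flow (\<sigma> * s) q \<in> K}" using bef W(4) by auto
    then have "closure {0..<\<tau>} \<subseteq> {s. flow (\<sigma> * s) q \<in> K}" using clK by (rule closure_minimal)
    then have inK: "flow (\<sigma> * s) q \<in> K" if "s \<in> {0..\<tau>}" for s using that \<tau>0 by auto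
    have bck: "\<exists>r\<in>{0..\<tau>}. s = \<sigma> * r" if "s \<in> {min 0 (\<sigma> * \<tau>)..max 0 (\<sigma> * \<tau>)}" for s
      using that \<sigma> \<tau>T by (intro bexI[of _ "\<sigma> * s"]) auto
    have "sqdist \<Psi> (flow (\<sigma> * \<tau>) p) (flow (\<sigma> * \<tau>) q) \<le> exp (C * T) * sqdist \<Psi> p q"
    proof (rule dist[OF p q(1) \<tau>T(1,2)])
      show "\<bar>\<sigma> * \<tau>\<bar> = \<tau>" using \<sigma> \<tau>T by auto
      fix s assume "s \<in> {min 0 (\<sigma> * \<tau>)..max 0 (\<sigma> * \<tau>)}"
      then obtain r where r: "r \<in> {0..\<tau>}" "s = \<sigma> * r" using bck by blast
      show "flow s q \<in> K" using inK r by simp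
      have "s \<in> {-T..T}" using r \<sigma> \<tau>T by auto
      then show "flow s p \<in> K" using pI IK by blast
    qed
    also have "\<dots> < exp (C * T) * (\<eta> * exp (- (C * T)))" using small by simp
    also have "\<dots> = \<eta>" by (simp add: exp_minus)
    finally have "sqdist \<Psi> (flow (\<sigma> * \<tau>) p) (flow (\<sigma> * \<tau>) q) < \<eta>" .
    moreover have "flow (\<sigma> * \<tau>) p \<in> I" by (rule pI) (use \<sigma> \<tau>T in auto)
    moreover have "flow (\<sigma> * \<tau>) q \<in> K - W" using inK[of \<tau>] \<tau>T by auto
    ultimately show False using \<eta>(2) by fastforce
  qed
  have inK: "flow t q \<in> K" if "q \<in> U" "t \<in> {-T..T}" for q t
  proof (cases "t \<ge> 0")
    case True
    then show ?thesis using stay[OF that(1), of 1 t] that(2) W(4) by auto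
  next
    case False
    then show ?thesis using stay[OF that(1), of "-1" "-t"] that(2) W(4) by auto
  qed
  show thesis
  proof (rule that[OF U pU W(2) \<Psi>, of "exp (C * T)"])
    fix q q' t assume q: "q \<in> U" "q' \<in> U" "t \<in> {-T..T}"
    show "sqdist \<Psi> (flow t q) (flow t q') \<le> exp (C * T) * sqdist \<Psi> q q'"
    proof (rule dist[of q q' "\<bar>t\<bar>" t])
      fix s assume "s \<in> {min 0 t..max 0 t}"
      then have "s \<in> {-T..T}" using q(3) T by (auto simp: min_def max_def split: if_splits)
      then show "flow s q \<in> K" "flow s q' \<in> K" using inK q by blast+
    qed (use q in \<open>auto simp: U_def\<close>)
  qed (use inK in auto)
qed

section \<open>Compactness and continuity properties of the flow\<close>

lemma flow_compact_image:
  assumes C: "compactin (mtop M) C" and T: "T > 0"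
  obtains K where "compactin (mtop M) K" "\<And>p t. p \<in> C \<Longrightarrow> t \<in> {-T..T} \<Longrightarrow> flow t p \<in> K"
proof -
  have "\<exists>U K. openin (mtop M) U \<and> p \<in> U \<and> compactin (mtop M) K \<and> (\<forall>q\<in>U. \<forall>t\<in>{-T..T}. flow t q \<in> K)"
    if "p \<in> C" for p
  proof -
    have "p \<in> mpoints M" using \<open>p \<in> C\<close> C compactin_subset_topspace by blast
    from flow_tube[OF this T] show ?thesis by metis
  qed
  then obtain U K where U: "\<And>p. p \<in> C \<Longrightarrow> openin (mtop M) (U p)" "\<And>p. p \<in> C \<Longrightarrow> p \<in> U p"
    and K: "\<And>p. p \<in> C \<Longrightarrow> compactin (mtop M) (K p)"
      "\<And>p q t. p \<in> C \<Longrightarrow> q \<in> U p \<Longrightarrow> t \<in> {-T..T} \<Longrightarrow> flow t q \<in> K p" by metis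
  obtain F where F: "finite F" "F \<subseteq> U ` C" "C \<subseteq> \<Union>F"
    using compactinD[OF C, of "U ` C"] U by (metis (no_types, lifting) UN_I imageE subsetI)
  obtain P where P: "P \<subseteq> C" "finite P" "C \<subseteq> (\<Union>p\<in>P. U p)"
    using finite_subset_image[OF F(1,2)] F(3) by metis
  show thesis
  proof (rule that)
    show "compactin (mtop M) (\<Union>p\<in>P. K p)"
      by (rule compactin_Union) (use P K in auto)
    fix p t assume pt: "p \<in> C" "t \<in> {-T..T}"
    then obtain q where "q \<in> P" "p \<in> U q" using P by blast
    then show "flow t p \<in> (\<Union>p\<in>P. K p)" using K(2)[of q p t] pt P by blast
  qed
qed

text \<open>Compare \<open>flow t q\<close> with \<open>flow t p\<close> by the Lipschitz bound of
  the tube, and \<open>flow t p\<close> with \<open>flow t0 p\<close> by continuity of a single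
  orbit. The triangle inequality for squared distances doubles both terms, whence the quarters of
  \<open>\<eta>\<close>; using \<open>C + 1\<close> in place of \<open>C\<close> keeps a denominator
  positive.\<close>

lemma flow_jointly_continuous:
  "continuous_map (prod_topology euclideanreal (mtop M)) (mtop M) (\<lambda>z. flow (fst z) (snd z))"
  unfolding continuous_map
proof (intro conjI allI impI)
  show "(\<lambda>z. flow (fst z) (snd z)) ` topspace (prod_topology euclideanreal (mtop M)) \<subseteq> mpoints M"
    using flow_point by auto
  fix N assume N: "openin (mtop M) N"
  let ?X = "prod_topology euclideanreal (mtop M)"
  show "openin ?X {z \<in> topspace ?X. flow (fst z) (snd z) \<in> N}"
  proof (subst openin_subopen, intro ballI)
    fix z assume z: "z \<in> {z \<in> topspace ?X. flow (fst z) (snd z) \<in> N}"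
    obtain t0 p where zp: "z = (t0, p)" by (cases z)
    have p: "p \<in> mpoints M" and yN: "flow t0 p \<in> N" using z zp by auto
    define T where "T = \<bar>t0\<bar> + 1"
    have T0: "T > 0" by (simp add: T_def)
    obtain U K \<Psi> C where U: "openin (mtop M) U" "p \<in> U" and K: "compactin (mtop M) K" "metrizes \<Psi> K" and C: "C \<ge> 0"
      and inK: "\<And>q t. q \<in> U \<Longrightarrow> t \<in> {-T..T} \<Longrightarrow> flow t q \<in> K"
      and d: "\<And>q q' t. q \<in> U \<Longrightarrow> q' \<in> U \<Longrightarrow> t \<in> {-T..T} \<Longrightarrow> sqdist \<Psi> (flow t q) (flow t q') \<le> C * sqdist \<Psi> q q'"
      using flow_tube[OF p T0] by metis
    have t0T: "t0 \<in> {-T..T}" by (auto simp: T_def)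
    have y: "flow t0 p \<in> K" by (rule inK[OF U(2) t0T])
    have sing: "compactin (mtop M) {flow t0 p}" "{flow t0 p} \<subseteq> K" "{flow t0 p} \<subseteq> N"
      using flow_point[OF p] y yN by simp_all
    obtain \<eta> where \<eta>: "\<eta> > 0" "\<And>z. z \<in> K - N \<Longrightarrow> \<eta> \<le> sqdist \<Psi> (flow t0 p) z"
      using sqdist_small_in_open[OF K sing N] by (metis singletonI)
    define A where "A = {t \<in> topspace euclideanreal. sqdist \<Psi> (flow t0 p) (flow t p) \<in> {..<\<eta>/4}} \<inter> {-T<..<T}"
    define B where "B = U \<inter> {q \<in> mpoints M. sqdist \<Psi> p q \<in> {..<\<eta> / (4 * (C + 1))}}"
    have "continuous_map euclideanreal euclideanreal (\<lambda>t. sqdist \<Psi> (flow t0 p) (flow t p))"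
      using continuous_map_compose[OF flow_continuous[OF p] sqdist_continuous_snd[OF K(2) flow_point[OF p]]]
      by (simp add: o_def)
    then have "openin euclideanreal {t \<in> topspace euclideanreal. sqdist \<Psi> (flow t0 p) (flow t p) \<in> {..<\<eta>/4}}"
      by (rule openin_continuous_map_preimage) simp
    then have A: "open A" unfolding A_def by auto
    have B: "openin (mtop M) B" unfolding B_def
      by (intro openin_Int U openin_continuous_map_preimage[OF sqdist_continuous_snd[OF K(2) p]]) simp
    have "t0 \<in> A" using \<eta>(1) by (auto simp: A_def T_def)
    moreover have "p \<in> B" using U(2) p \<eta>(1) C by (simp add: B_def)
    moreover have "flow t q \<in> N" if t: "t \<in> A" and q: "q \<in> B" for t q
    proof (rule ccontr)
      assume n: "flow t q \<notin> N"
      have tT: "t \<in> {-T..T}" using t by (auto simp: A_def)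
      have qU: "q \<in> U" using q by (simp add: B_def)
      have "\<eta> \<le> sqdist \<Psi> (flow t0 p) (flow t q)" using \<eta>(2) inK[OF qU tT] n by blast
      also have "\<dots> \<le> 2 * sqdist \<Psi> (flow t0 p) (flow t p) + 2 * sqdist \<Psi> (flow t p) (flow t q)"
        by (rule sqdist_triangle)
      also have "\<dots> < 2 * (\<eta>/4) + 2 * (\<eta>/4)"
      proof -
        have "sqdist \<Psi> (flow t p) (flow t q) \<le> C * sqdist \<Psi> p q" by (rule d[OF U(2) qU tT])
        also have "\<dots> \<le> (C + 1) * sqdist \<Psi> p q" by (intro mult_right_mono sqdist_nonneg) simp
        also have "\<dots> < (C + 1) * (\<eta> / (4 * (C + 1)))"
          using q C by (intro mult_strict_left_mono) (auto simp: B_def)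
        also have "\<dots> = \<eta>/4"
        proof -
          have "k * (\<eta> / (4 * k)) = \<eta>/4" if "k \<noteq> 0" for k using that by simp
          from this[of "C + 1"] show ?thesis using C by simp
        qed
        finally show ?thesis using t by (simp add: A_def)
      qed
      finally show False by simp
    qed
    ultimately show "\<exists>V. openin ?X V \<and> z \<in> V \<and> V \<subseteq> {z \<in> topspace ?X. flow (fst z) (snd z) \<in> N}"
      using A B zp openin_subset[OF B]
      by (intro exI[of _ "A \<times> B"]) (auto simp: openin_prod_Times_iff)
  qed
qed

lemma flow_image_compact:
  assumes "compactin (mtop M) C"
  shows "compactin (mtop M) ((\<lambda>z. flow (fst z) (snd z)) ` ({a..b} \<times> C))"
  by (rule image_compactin[OF _ flow_jointly_continuous]) (use assms in \<open>simp add: compactin_Times\<close>)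

text \<open>The times up to \<open>T + 1\<close> at which an orbit from \<open>X0\<close> meets
  \<open>X1\<close> form a compact set \<open>S\<close>, the projection of a compact set of pairs.
  As \<open>T\<close> is not in \<open>S\<close>, neither is a neighbourhood of \<open>T\<close>;
  time 0 is excluded by disjointness.\<close>

lemma no_chord_extend:
  assumes X: "compactin (mtop M) X0" "compactin (mtop M) X1" "X0 \<inter> X1 = {}" and T: "T > 0"
    and no: "\<And>p t. p \<in> X0 \<Longrightarrow> 0 < t \<Longrightarrow> t \<le> T \<Longrightarrow> flow t p \<notin> X1"
  obtains T' where "T' > T" "\<And>p t. p \<in> X0 \<Longrightarrow> 0 \<le> t \<Longrightarrow> t \<le> T' \<Longrightarrow> flow t p \<notin> X1"
proof -
  let ?X = "prod_topology euclideanreal (mtop M)"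
  define S where "S = fst ` (({0..T + 1} \<times> X0) \<inter> {z \<in> topspace ?X. flow (fst z) (snd z) \<in> X1})"
  have "closedin ?X {z \<in> topspace ?X. flow (fst z) (snd z) \<in> X1}"
    by (rule closedin_continuous_map_preimage[OF flow_jointly_continuous compactin_closedin[OF X(2)]])
  moreover have "compactin ?X ({0..T + 1} \<times> X0)" using X(1) by (simp add: compactin_Times)
  ultimately have "compactin ?X ({z \<in> topspace ?X. flow (fst z) (snd z) \<in> X1} \<inter> ({0..T + 1} \<times> X0))"
    by (rule closed_Int_compactin)
  from image_compactin[OF this continuous_map_fst] have "compact S" by (simp add: S_def Int_commute)
  then have "closed S" by (rule compact_imp_closed)
  have X0: "X0 \<subseteq> mpoints M" using X(1) compactin_subset_topspace by blast
  have S: "t \<in> S" if "p \<in> X0" "0 \<le> t" "t \<le> T + 1" "flow t p \<in> X1" for p t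
    unfolding S_def using that X0 by (intro image_eqI[of _ _ "(t, p)"]) auto
  have "T \<notin> S" using no T by (auto simp: S_def)
  then obtain e where e: "e > 0" "ball T e \<subseteq> - S" using \<open>closed S\<close> open_contains_ball[of "- S"] by auto
  show thesis
  proof (rule that[of "T + min (e/2) 1"])
    show "T + min (e/2) 1 > T" using e by simp
    fix p t assume pt: "p \<in> X0" "0 \<le> t" "t \<le> T + min (e/2) 1"
    consider "t = 0" | "0 < t" "t \<le> T" | "T < t" using pt by linarith
    then show "flow t p \<notin> X1"
    proof cases
      case 1
      moreover have "flow 0 p = p" by (rule flow_0) (use pt(1) X0 in blast)
      ultimately show ?thesis using X(3) pt(1) by auto
    next
      case 3
      then have "t \<in> ball T e" using pt e(1) by (auto simp: dist_real_def)
      then have "t \<notin> S" using e(2) by blast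
      moreover have "t \<le> T + 1" using pt(3) by linarith
      ultimately show ?thesis using S[OF pt(1,2)] by blast
    qed (use no pt in auto)
  qed
qed

end

section \<open>Smoothing Lipschitz functions along a vector field\<close>

context smooth_mfd
begin

lemma smooth_function_inverse:
  assumes "smooth_function M f" "\<And>p. p \<in> mpoints M \<Longrightarrow> f p \<noteq> 0"
  shows "smooth_function M (\<lambda>p. inverse (f p))"
  unfolding smooth_function_def
proof
  fix i assume i: "i \<in> mindex M"
  have "smooth_on (mrange M i) (f \<circ> mparam M i)" using assms(1) i by (simp add: smooth_function_def)
  from smooth_on_inverse[OF open_mrange[OF i] _ this]
  have "smooth_on (mrange M i) (\<lambda>x. inverse ((f \<circ> mparam M i) x))"
    using assms(2) mparam_points[OF i] by simp
  then show "smooth_on (mrange M i) ((\<lambda>p. inverse (f p)) \<circ> mparam M i)" by (simp add: o_def)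
qed

end

context sympl_mfd
begin

lemma trajectory_chart_limit:
  assumes tr: "trajectory M (H \<circ> fst) UNIV \<gamma>" and i: "i \<in> mindex M" "\<gamma> 0 \<in> mdom M i" and d: "\<delta> > 0"
  shows "\<forall>\<^sub>F h in at_right 0. \<gamma> h \<in> mdom M i \<and>
    norm (mchart M i (\<gamma> h) - mchart M i (\<gamma> 0) - h *\<^sub>R sgrad M H i (\<gamma> 0)) \<le> \<delta> * h"
proof -
  have "open {t \<in> topspace euclideanreal. \<gamma> t \<in> mdom M i}"
    using openin_continuous_map_preimage[OF _ openin_mdom[OF i(1)], of euclideanreal \<gamma>]
      trajectory_continuous[OF tr] by simp
  then have 1: "\<forall>\<^sub>F h in at_right 0. \<gamma> h \<in> mdom M i"
    using i(2) eventually_at_topological by (auto intro!: exI[of _ "{t. \<gamma> t \<in> mdom M i}"] simp: eventually_at_topological)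
  let ?\<phi> = "\<lambda>t. mchart M i (\<gamma> t)" and ?v = "sgrad M H i (\<gamma> 0)"
  have "(?\<phi> has_vector_derivative ?v) (at 0)"
    using tr i by (simp add: trajectory_def time_slice_def o_def)
  then have "(?\<phi> has_derivative (\<lambda>h. h *\<^sub>R ?v)) (at 0 within {0<..})"
    by (simp add: has_vector_derivative_def has_derivative_at_withinI)
  then have "\<forall>e>0. \<exists>d>0. \<forall>y\<in>{0<..}. norm (y - 0) < d \<longrightarrow> norm (?\<phi> y - ?\<phi> 0 - (y - 0) *\<^sub>R ?v) \<le> e * norm (y - 0)"
    by (simp add: has_derivative_within_alt)
  then obtain d where d: "d > 0" "\<And>y. y > 0 \<Longrightarrow> norm y < d \<Longrightarrow> norm (?\<phi> y - ?\<phi> 0 - y *\<^sub>R ?v) \<le> \<delta> * norm y"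
    using \<open>\<delta> > 0\<close> by fastforce
  have 2: "\<forall>\<^sub>F h in at_right 0. norm (?\<phi> h - ?\<phi> 0 - h *\<^sub>R ?v) \<le> \<delta> * h"
    unfolding eventually_at_right_field using d by (intro exI[of _ d]) auto
  show ?thesis using 1 2 by eventually_elim simp
qed

text \<open>In a chart the mollification of \<open>w\<close> at scale \<open>\<epsilon>\<close> is differentiated in the direction of the
  vector field at the base point, whereas the growth of \<open>w\<close> is controlled along the field at nearby
  points; as \<open>w\<close> is Lipschitz, the difference is of the order of the oscillation of the field.\<close>
lemma local_smoothing:
  assumes H: "smooth_function M H" and w: "loclip_fun M w"
    and growth: "\<And>p. p \<in> mpoints M \<Longrightarrow>
      \<exists>\<gamma>. trajectory M (H \<circ> fst) UNIV \<gamma> \<and> \<gamma> 0 = p \<and> (\<forall>h\<ge>0. w (\<gamma> h) \<le> w p + c * h)"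
    and p: "p \<in> mpoints M"
  obtains V \<xi> C where "openin (mtop M) V" "p \<in> V" "smooth_function M \<xi>" "\<And>q. 0 \<le> \<xi> q" "\<And>q. \<xi> q \<le> 1"
    "\<And>q. q \<in> V \<Longrightarrow> \<xi> q = 1" "compactin (mtop M) C" "\<And>q. q \<notin> C \<Longrightarrow> \<xi> q = 0"
    "\<And>\<delta>. \<delta> > 0 \<Longrightarrow> \<exists>W. smooth_function M W \<and> (\<forall>q\<in>C. \<bar>W q - w q\<bar> \<le> \<delta> \<and> poisson M W H q \<le> c + \<delta>)"
proof -
  obtain i where i: "i \<in> mindex M" "p \<in> mdom M i" using chart_exists[OF p] by blast
  define x where "x = mchart M i p"
  have x: "x \<in> mrange M i" unfolding x_def by (rule mchart_in[OF i])
  have "loclip_on (mrange M i) (w \<circ> mparam M i)" using w i by (simp add: loclip_fun_def)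
  then obtain r L where r: "r > 0" "cball x r \<subseteq> mrange M i" "L > 0" and L: "L-lipschitz_on (cball x r) (w \<circ> mparam M i)"
    using loclip_onE[OF _ x] by metis
  let ?v = "\<lambda>y. sgrad M H i (mparam M i y)"
  have "continuous_on (cball x r) ?v"
    using loclip_on_continuous[OF sgrad_loclip[OF H i(1)]] r(2) continuous_on_subset by blast
  then have uc: "uniformly_continuous_on (cball x r) ?v"
    by (rule compact_uniformly_continuous) simp
  define \<xi> where "\<xi> = from_chart i (bump x (r/8))"
  define C where "C = mparam M i ` cball x (2 * (r/8))"
  have sub: "cball x (2 * (r/8)) \<subseteq> mrange M i" using r by (intro order_trans[OF subset_cball r(2)]) auto
  note cut = chart_cutoff[OF i(1) _ sub]
  have r8: "r/8 > 0" using r by simp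
  show thesis
  proof (rule that[of "{q \<in> mdom M i. mchart M i q \<in> ball x (r/8)}" \<xi> C])
    show "openin (mtop M) {q \<in> mdom M i. mchart M i q \<in> ball x (r/8)}" by (rule openin_chart_ball[OF i(1)])
    show "p \<in> {q \<in> mdom M i. mchart M i q \<in> ball x (r/8)}" using i(2) r(1) by (simp add: x_def)
    show "smooth_function M \<xi>" unfolding \<xi>_def by (rule cut(1)[OF r8])
    show "0 \<le> \<xi> q" "\<xi> q \<le> 1" for q unfolding \<xi>_def by (rule cut(2)[OF r8], rule cut(3)[OF r8])
    show "\<xi> q = 1" if "q \<in> {q \<in> mdom M i. mchart M i q \<in> ball x (r/8)}" for q
      unfolding \<xi>_def by (rule cut(4)[OF r8]) (use that in auto)
    show "compactin (mtop M) C" unfolding C_def by (rule compact_param_image[OF i(1) compact_cball sub])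
    show "\<xi> q = 0" if "q \<notin> C" for q
      using that unfolding \<xi>_def C_def by (rule cut(5)[OF r8])
    fix \<delta> :: real assume \<delta>: "\<delta> > 0"
    obtain \<epsilon>1 where \<epsilon>1: "\<epsilon>1 > 0" "\<And>y z. y \<in> cball x r \<Longrightarrow> z \<in> cball x r \<Longrightarrow> dist z y < \<epsilon>1 \<Longrightarrow> dist (?v z) (?v y) < \<delta> / L"
      using uc \<delta> r(3) unfolding uniformly_continuous_on_def by (metis divide_pos_pos)
    \<comment> \<open>The three demands: the field varies by less than \<open>\<delta> / L\<close>
      over distance \<open>\<epsilon>\<close>, averaging at points within \<open>r/4\<close> of
      \<open>x\<close> stays inside the ball of radius \<open>r\<close>, and the uniform error
      \<open>L * \<epsilon>\<close> of mollification is at most \<open>\<delta>\<close>.\<close>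
    define \<epsilon> where "\<epsilon> = min (\<epsilon>1 / 2) (min (r/8) (\<delta> / L))"
    have \<epsilon>: "\<epsilon> > 0" "\<epsilon> < \<epsilon>1" "\<epsilon> \<le> r/8" "L * \<epsilon> \<le> \<delta>"
    proof -
      show "\<epsilon> > 0" "\<epsilon> < \<epsilon>1" using \<epsilon>1(1) r \<delta> by (auto simp: \<epsilon>_def)
      show "\<epsilon> \<le> r/8" unfolding \<epsilon>_def by linarith
      have "L * \<epsilon> \<le> L * (\<delta> / L)" using r(3) by (intro mult_left_mono) (auto simp: \<epsilon>_def)
      then show "L * \<epsilon> \<le> \<delta>" using r(3) by simp
    qed
    \<comment> \<open>The projection does not increase distances, so composing with it extends the
      chart expression of \<open>w\<close> to the whole space with the same Lipschitz constant, as
      \<open>mollify\<close> requires.\<close>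
    define P where "P = closest_point (cball x r)"
    have P: "P y \<in> cball x r" "dist (P y) (P z) \<le> dist y z" for y z
      unfolding P_def using r by (intro closest_point_in_set closest_point_lipschitz; auto)+
    have PP: "P y = y" if "y \<in> cball x r" for y using that by (simp add: P_def closest_point_self)
    define u where "u y = w (mparam M i (P y))" for y
    have u_in: "u y = w (mparam M i y)" if "y \<in> cball x r" for y using PP[OF that] by (simp add: u_def)
    have uL: "L-lipschitz_on UNIV u"
    proof (rule lipschitz_onI)
      fix y z
      have "dist (u y) (u z) \<le> L * dist (P y) (P z)"
        using lipschitz_onD[OF L P(1) P(1), of y z] by (simp add: u_def)
      also have "\<dots> \<le> L * dist y z" using P(2) r(3) by (intro mult_left_mono) auto
      finally show "dist (u y) (u z) \<le> L * dist y z" .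
    qed (use r in simp)
    obtain m where m: "smooth_on (ball x r) m" "\<And>y. y \<in> ball x r \<Longrightarrow> \<bar>m y - u y\<bar> \<le> L * \<epsilon>"
      and m3: "\<And>y V c. y \<in> ball x r \<Longrightarrow>
        \<forall>z\<in>cball y \<epsilon>. \<forall>\<eta>>0. \<forall>\<^sub>F h in at_right 0. u (z + h *\<^sub>R V) - u z \<le> (c + \<eta>) * h \<Longrightarrow>
        frechet_derivative m (at y) V \<le> c"
    proof (rule mollify[OF uL \<epsilon>(1), of x r])
      fix m
      assume 1: "smooth_on (ball x r) m" and 2: "\<And>y. y \<in> ball x r \<Longrightarrow> \<bar>m y - u y\<bar> \<le> L * \<epsilon>"
        and 3: "\<And>y V c. y \<in> ball x r \<Longrightarrow>
          (\<And>z \<eta>. z \<in> cball y \<epsilon> \<Longrightarrow> \<eta> > 0 \<Longrightarrow> \<forall>\<^sub>F h in at_right 0. u (z + h *\<^sub>R V) - u z \<le> (c + \<eta>) * h) \<Longrightarrow>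
          frechet_derivative m (at y) V \<le> c"
      show thesis
      proof (rule that[OF 1 2])
        fix y V c
        assume "y \<in> ball x r"
          "\<forall>z\<in>cball y \<epsilon>. \<forall>\<eta>>0. \<forall>\<^sub>F h in at_right 0. u (z + h *\<^sub>R V) - u z \<le> (c + \<eta>) * h"
        then show "frechet_derivative m (at y) V \<le> c" by (intro 3) simp_all
      qed
    qed
    \<comment> \<open>The radii are nested: \<open>C\<close> reaches to \<open>r/4\<close>, the
      cut-off function equals the mollification up to \<open>3 * r / 8\<close>, and it vanishes
      beyond \<open>3 * r / 4\<close>, inside the chart.\<close>
    define g where "g y = bump x (3 * r / 8) y * m y" for y
    have g0: "g y = 0" if "y \<notin> cball x (3 * r / 4)" for y
    proof -
      have "bump x (3 * r / 8) y = 0" by (rule bump_0) (use that r in auto)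
      then show ?thesis by (simp add: g_def)
    qed
    have gs: "smooth_on (mrange M i) g"
    proof (rule smooth_on_local)
      fix y assume "y \<in> mrange M i"
      show "\<exists>U. open U \<and> y \<in> U \<and> smooth_on U g"
      proof (cases "y \<in> ball x r")
        case True
        have "smooth_on (ball x r) g" unfolding g_def
          by (intro smooth_on_mult m open_ball smooth_on_subset[OF smooth_on_bump subset_UNIV])
        then show ?thesis using True by blast
      next
        case False
        have "smooth_on (- cball x (3 * r / 4)) g"
          by (rule smooth_on_cong[THEN iffD2, OF _ _ smooth_on_const[of _ 0]]) (auto simp: g0)
        moreover have "y \<in> - cball x (3 * r / 4)" using False r by auto
        ultimately show ?thesis by (intro exI[of _ "- cball x (3 * r / 4)"]) auto
      qed
    qed
    have sub34: "cball x (3 * r / 4) \<subseteq> mrange M i" using r by (intro order_trans[OF subset_cball r(2)]) auto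
    define W where "W = from_chart i g"
    have Ws: "smooth_function M W" unfolding W_def
      by (rule smooth_from_chart[OF i(1) gs compact_cball sub34]) (use g0 in auto)
    have Wm: "(W \<circ> mparam M i) y = m y" if y: "y \<in> ball x (3 * r / 8)" for y
    proof -
      have "y \<in> cball x r" using y r by auto
      then have yr: "y \<in> mrange M i" using r by blast
      have "bump x (3 * r / 8) y = 1" by (rule bump_1) (use y r in auto)
      then show ?thesis using mparam_in[OF i(1) yr] mchart_mparam[OF i(1) yr] by (simp add: W_def from_chart_def g_def)
    qed
    show "\<exists>W. smooth_function M W \<and> (\<forall>q\<in>C. \<bar>W q - w q\<bar> \<le> \<delta> \<and> poisson M W H q \<le> c + \<delta>)"
    proof (intro exI[of _ W] conjI ballI Ws)
      fix q assume "q \<in> C"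
      then obtain y where y: "q = mparam M i y" "y \<in> cball x (r/4)" by (auto simp: C_def)
      have yr: "y \<in> cball x r" "y \<in> ball x r" "y \<in> ball x (3 * r / 8)" "y \<in> mrange M i"
        using y(2) r by auto
      have qd: "q \<in> mdom M i" "mchart M i q = y" using y(1) mparam_in[OF i(1) yr(4)] mchart_mparam[OF i(1) yr(4)] by auto
      have "W q = m y" using Wm[OF yr(3)] y(1) by simp
      moreover have "u y = w q" using u_in[OF yr(1)] y(1) by simp
      ultimately show "\<bar>W q - w q\<bar> \<le> \<delta>" using m(2)[OF yr(2)] \<epsilon>(4) by simp
      have "dcoord M W i q = frechet_derivative m (at y)"
        unfolding dcoord_def qd(2) by (rule frechet_derivative_cong_open[OF open_ball yr(3) Wm])
      then have "poisson M W H q = frechet_derivative m (at y) (?v y)"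
        using poisson_eq[OF i(1) qd(1) Ws H] y(1) by simp
      also have "\<dots> \<le> c + \<delta>"
      proof (rule m3[OF yr(2)], intro ballI allI impI)
        fix z and \<eta> :: real assume z: "z \<in> cball y \<epsilon>" and \<eta>: "\<eta> > 0"
        have "dist x z \<le> dist x y + dist y z" by (rule dist_triangle)
        then have zb: "z \<in> ball x r" "z \<in> cball x r" using z y(2) \<epsilon>(3) r(1) by auto
        then have zr: "z \<in> mrange M i" using r(2) by blast
        define q' where "q' = mparam M i z"
        have q': "q' \<in> mdom M i" "mchart M i q' = z" "q' \<in> mpoints M"
          using mparam_in[OF i(1) zr] mchart_mparam[OF i(1) zr] mparam_points[OF i(1) zr] by (auto simp: q'_def)
        obtain \<gamma> where \<gamma>: "trajectory M (H \<circ> fst) UNIV \<gamma>" "\<gamma> 0 = q'" "\<And>h. h \<ge> 0 \<Longrightarrow> w (\<gamma> h) \<le> w q' + c * h"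
          using growth[OF q'(3)] by blast
        have "\<forall>\<^sub>F h in at_right 0. \<gamma> h \<in> mdom M i \<and> norm (mchart M i (\<gamma> h) - z - h *\<^sub>R ?v z) \<le> (\<eta> / L) * h"
          using trajectory_chart_limit[OF \<gamma>(1) i(1), of "\<eta> / L"] \<gamma>(2) q' \<eta> r(3) by (simp add: q'_def)
        moreover have "\<forall>\<^sub>F h in at_right 0. z + h *\<^sub>R ?v y \<in> ball x r"
        proof -
          have "((\<lambda>h. z + h *\<^sub>R ?v y) \<longlongrightarrow> z + 0 *\<^sub>R ?v y) (at_right 0)" by (intro tendsto_intros)
          then show ?thesis using topological_tendstoD[OF _ open_ball] zb(1) by fastforce
        qed
        moreover have "\<forall>\<^sub>F h in at_right 0. h * (norm (?v z) + \<eta> / L) < r - dist x z"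
        proof -
          have "((\<lambda>h. h * (norm (?v z) + \<eta> / L)) \<longlongrightarrow> 0 * (norm (?v z) + \<eta> / L)) (at_right 0)" by (intro tendsto_intros)
          then show ?thesis by (rule order_tendstoD(2)) (use zb(1) in simp)
        qed
        moreover have "\<forall>\<^sub>F h in at_right (0::real). h > 0" by (simp add: eventually_at_right_less)
        ultimately show "\<forall>\<^sub>F h in at_right 0. u (z + h *\<^sub>R ?v y) - u z \<le> (c + \<delta> + \<eta>) * h"
        proof eventually_elim
          case (elim h)
          define y' where "y' = mchart M i (\<gamma> h)"
          have n: "norm (y' - z - h *\<^sub>R ?v z) \<le> (\<eta> / L) * h" and h: "h > 0" using elim by (auto simp: y'_def)
          have "norm (y' - z) \<le> norm (y' - z - h *\<^sub>R ?v z) + norm (h *\<^sub>R ?v z)"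
            by (metis diff_add_cancel norm_triangle_ineq)
          also have "\<dots> \<le> h * (norm (?v z) + \<eta> / L)" using n h by (simp add: algebra_simps)
          finally have "dist x y' < r" using elim(3) dist_triangle[of x y' z] by (simp add: dist_norm norm_minus_commute)
          then have y'b: "y' \<in> cball x r" by simp
          have uy': "u y' = w (\<gamma> h)"
            using u_in[OF y'b] mparam_mchart'[OF i(1)] elim(1) by (simp add: y'_def)
          have "u y' - u z \<le> c * h" using \<gamma>(3)[of h] h u_in[OF zb(2)] uy' by (simp add: q'_def)
          \<comment> \<open>The orbit moves \<open>z\<close> to \<open>y'\<close>, where
            \<open>w\<close> has grown by at most \<open>c * h\<close>. Replacing \<open>y'\<close>
            by \<open>z + h *\<^sub>R ?v y\<close> costs \<open>L\<close> times a distance made up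
            of \<open>h * (\<delta> / L)\<close>, from the variation of the field, and
            \<open>(\<eta> / L) * h\<close>, from the first-order error of the orbit.\<close>
          moreover have "u (z + h *\<^sub>R ?v y) - u y' \<le> (\<delta> + \<eta>) * h"
          proof -
            have "u (z + h *\<^sub>R ?v y) - u y' \<le> L * norm (z + h *\<^sub>R ?v y - y')"
              using lipschitz_onD[OF uL, of "z + h *\<^sub>R ?v y" y'] by (simp add: dist_norm)
            also have "z + h *\<^sub>R ?v y - y' = h *\<^sub>R (?v y - ?v z) - (y' - z - h *\<^sub>R ?v z)"
              by (simp add: algebra_simps)
            also have "L * norm \<dots> \<le> L * (h * (\<delta> / L) + (\<eta> / L) * h)"
            proof (rule mult_left_mono)
              have "dist z y < \<epsilon>1" using z \<epsilon>(2) by (simp add: dist_commute)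
              then have "norm (?v y - ?v z) \<le> \<delta> / L"
                using \<epsilon>1(2)[OF yr(1) zb(2)] by (simp add: dist_norm norm_minus_commute)
              then have "h * norm (?v y - ?v z) \<le> h * (\<delta> / L)" by (rule mult_left_mono) (use h in simp)
              then have "norm (h *\<^sub>R (?v y - ?v z)) \<le> h * (\<delta> / L)" using h by simp
              then show "norm (h *\<^sub>R (?v y - ?v z) - (y' - z - h *\<^sub>R ?v z)) \<le> h * (\<delta> / L) + (\<eta> / L) * h"
                by (rule order_trans[OF norm_triangle_ineq4 add_mono[OF _ n]])
            qed (use r in simp)
            also have "\<dots> = (\<delta> + \<eta>) * h" using r(3) by (simp add: field_simps)
            finally show ?thesis .
          qed
          ultimately show ?case by (simp add: algebra_simps)
        qed
      qed
      finally show "poisson M W H q \<le> c + \<delta>" .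
    qed
  qed
qed

text \<open>Local approximations \<open>Wf p\<close> are glued by functions \<open>\<eta> p\<close>.
  The bracket of the sum contains the dangerous terms \<open>{\<eta> p, H} * Wf p\<close>; since the
  brackets of the \<open>\<eta> p\<close> add up to 0 wherever \<open>w\<close> is nonzero,
  \<open>Wf p\<close> may be replaced there by the small difference \<open>Wf p - w\<close>.\<close>

lemma smoothing:
  assumes H: "smooth_function M H" and w: "loclip_fun M w" and c: "c \<ge> 0"
    and growth: "\<And>p. p \<in> mpoints M \<Longrightarrow>
      \<exists>\<gamma>. trajectory M (H \<circ> fst) UNIV \<gamma> \<and> \<gamma> 0 = p \<and> (\<forall>h\<ge>0. w (\<gamma> h) \<le> w p + c * h)"
    and K: "compactin (mtop M) K" and wK: "\<And>p. p \<in> mpoints M - K \<Longrightarrow> w p = 0" and e: "e > 0"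
  obtains F where "smooth_function M F" "compactly_supported M F"
    "\<And>p. p \<in> mpoints M \<Longrightarrow> \<bar>F p - w p\<bar> \<le> e" "\<And>p. p \<in> mpoints M \<Longrightarrow> poisson M F H p \<le> c + e"
proof -
  define good where "good p V \<xi> C \<longleftrightarrow> openin (mtop M) V \<and> p \<in> V \<and> smooth_function M \<xi> \<and> (\<forall>q. 0 \<le> \<xi> q) \<and>
      (\<forall>q\<in>V. \<xi> q = 1) \<and> compactin (mtop M) C \<and> (\<forall>q. q \<notin> C \<longrightarrow> \<xi> q = 0) \<and>
      (\<forall>\<delta>>0. \<exists>W. smooth_function M W \<and> (\<forall>q\<in>C. \<bar>W q - w q\<bar> \<le> \<delta> \<and> poisson M W H q \<le> c + \<delta>))"
    for p V and \<xi> :: "'a \<Rightarrow> real" and C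
  have "\<exists>V \<xi> C. good p V \<xi> C" if pK: "p \<in> K" for p
  proof -
    have "p \<in> mpoints M" using pK K compactin_subset_topspace by blast
    from local_smoothing[OF H w growth this] show ?thesis unfolding good_def by metis
  qed
  then obtain V \<xi> C where good: "\<And>p. p \<in> K \<Longrightarrow> good p (V p) (\<xi> p) (C p)" by metis
  have V: "openin (mtop M) (V p)" "p \<in> V p" if "p \<in> K" for p
    using good[OF that] by (auto simp: good_def)
  have \<xi>: "smooth_function M (\<xi> p)" "0 \<le> \<xi> p q" "q \<in> V p \<Longrightarrow> \<xi> p q = 1" if "p \<in> K" for p q
    using good[OF that] by (auto simp: good_def)
  have C: "compactin (mtop M) (C p)" "q \<notin> C p \<Longrightarrow> \<xi> p q = 0" if "p \<in> K" for p q
    using good[OF that] by (auto simp: good_def)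
  have W: "\<exists>W. smooth_function M W \<and> (\<forall>q\<in>C p. \<bar>W q - w q\<bar> \<le> \<delta> \<and> poisson M W H q \<le> c + \<delta>)"
    if "p \<in> K" "\<delta> > 0" for p \<delta>
    using good[OF that(1)] that(2) by (auto simp: good_def)
  obtain Fa where Fa: "finite Fa" "Fa \<subseteq> V ` K" "K \<subseteq> \<Union>Fa"
    using compactinD[OF K, of "V ` K"] V by (metis (no_types, lifting) UN_I imageE subsetI)
  obtain P where P: "P \<subseteq> K" "finite P" "K \<subseteq> (\<Union>p\<in>P. V p)"
    using finite_subset_image[OF Fa(1,2)] Fa(3) by metis
  have PK: "p \<in> K" if "p \<in> P" for p using P(1) that by blast
  have oV: "openin (mtop M) (\<Union>p\<in>P. V p)" using V(1) PK by (intro openin_Union) auto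
  obtain \<zeta> Z where \<zeta>: "smooth_function M \<zeta>" "\<And>p. 0 \<le> \<zeta> p" "\<And>p. \<zeta> p \<le> 1"
    and Z: "openin (mtop M) Z" "K \<subseteq> Z" "\<And>p. p \<in> Z \<Longrightarrow> \<zeta> p = 1"
    and \<zeta>0: "\<And>p. p \<notin> (\<Union>p\<in>P. V p) \<Longrightarrow> \<zeta> p = 0"
  proof (rule cutoff_exists[OF K oV P(3)])
    fix f W K'
    assume a: "smooth_function M f" "\<And>p. 0 \<le> f p" "\<And>p. f p \<le> 1" "openin (mtop M) W" "K \<subseteq> W"
      "W \<subseteq> (\<Union>p\<in>P. V p)" "\<And>p. p \<in> W \<Longrightarrow> f p = 1" "compactin (mtop M) K'" "K' \<subseteq> (\<Union>p\<in>P. V p)"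
      "\<And>p. p \<notin> K' \<Longrightarrow> f p = 0"
    show thesis by (rule that[OF a(1-5,7)]) (use a(9,10) in blast)+
  qed
  \<comment> \<open>The term \<open>1 - \<zeta> q\<close> makes the denominator at least 1 on the
    whole manifold and vanishes on the neighbourhood \<open>Z\<close> of \<open>K\<close>, where the
    quotients therefore sum to 1.\<close>
  define s where "s q = (\<Sum>p\<in>P. \<xi> p q) + (1 - \<zeta> q)" for q
  have s1: "s q \<ge> 1" for q
  proof (cases "q \<in> (\<Union>p\<in>P. V p)")
    case True
    then obtain p where p: "p \<in> P" "q \<in> V p" by blast
    have "\<xi> p q \<le> (\<Sum>p\<in>P. \<xi> p q)" using p P(2) \<xi>(2) PK by (intro member_le_sum) auto
    then show ?thesis using \<xi>(3)[OF PK[OF p(1)] p(2)] \<zeta>(3)[of q] by (simp add: s_def)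
  next
    case False
    have "(\<Sum>p\<in>P. \<xi> p q) \<ge> 0" using \<xi>(2) PK by (intro sum_nonneg) auto
    then show ?thesis using \<zeta>0[OF False] by (simp add: s_def)
  qed
  have ss: "smooth_function M s" unfolding s_def
    by (intro smooth_function_add smooth_function_diff smooth_function_sum smooth_function_const \<zeta>(1) \<xi>(1) PK)
  define \<eta> where "\<eta> p q = \<xi> p q * inverse (s q)" for p q
  have \<eta>s: "smooth_function M (\<eta> p)" if "p \<in> P" for p
    unfolding \<eta>_def
  proof (intro smooth_function_mult \<xi>(1) PK that smooth_function_inverse ss)
    show "s q \<noteq> 0" for q using s1[of q] by auto
  qed
  have \<eta>0: "\<eta> p q \<ge> 0" if "p \<in> P" for p q using \<xi>(2)[OF PK[OF that], of q] s1[of q] by (simp add: \<eta>_def)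
  have \<eta>C: "\<eta> p q = 0" if "p \<in> P" "q \<notin> C p" for p q using C(2)[OF PK[OF that(1)] that(2)] by (simp add: \<eta>_def)
  have \<eta>sum: "(\<Sum>p\<in>P. \<eta> p q) = 1 - (1 - \<zeta> q) * inverse (s q)" for q
  proof -
    have "(\<Sum>p\<in>P. \<eta> p q) = (s q - (1 - \<zeta> q)) * inverse (s q)" by (simp add: \<eta>_def s_def sum_distrib_right)
    also have "\<dots> = 1 - (1 - \<zeta> q) * inverse (s q)" using s1[of q] by (simp add: left_diff_distrib)
    finally show ?thesis .
  qed
  have \<eta>sum1: "(\<Sum>p\<in>P. \<eta> p q) \<le> 1" for q unfolding \<eta>sum using \<zeta>(3)[of q] s1[of q] by simp
  have \<eta>sumZ: "(\<Sum>p\<in>P. \<eta> p q) = 1" if "q \<in> Z" for q unfolding \<eta>sum using Z(3)[OF that] by simp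
  define D where "D p = poisson M (\<eta> p) H" for p
  have D0: "D p q = 0" if p: "p \<in> P" and q: "q \<in> mpoints M - C p" for p q
  proof -
    have "openin (mtop M) (mpoints M - C p)" using compactin_closedin[OF C(1)[OF PK[OF p]]] by blast
    then have "poisson M (\<eta> p) H q = poisson M (\<lambda>q. 0) H q"
      by (rule poisson_cong[OF _ q]) (use p \<eta>C in \<open>auto intro: \<eta>s H smooth_function_const\<close>)
    then show ?thesis using poisson_const[OF H] q by (simp add: D_def)
  qed
  have "\<exists>A. \<forall>q\<in>C p. \<bar>D p q\<bar> \<le> A" if p: "p \<in> P" for p
  proof -
    have "continuous_map (mtop M) euclideanreal (D p)"
      unfolding D_def by (rule loclip_fun_continuous[OF poisson_loclip[OF H \<eta>s[OF p]]])
    from image_compactin[OF C(1)[OF PK[OF p]] this] have "bounded (D p ` C p)"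
      by (simp add: compact_imp_bounded)
    then show ?thesis by (simp add: bounded_iff)
  qed
  then obtain A where A: "\<And>p q. p \<in> P \<Longrightarrow> q \<in> C p \<Longrightarrow> \<bar>D p q\<bar> \<le> A p" by metis
  define B where "B = (\<Sum>p\<in>P. \<bar>A p\<bar>)"
  have B: "B \<ge> 0" by (simp add: B_def sum_nonneg)
  \<comment> \<open>Chosen so that the local bracket error \<open>\<delta>\<close> and the gluing
    error \<open>B * \<delta>\<close> together make exactly \<open>e\<close>.\<close>
  define \<delta> where "\<delta> = e / (1 + B)"
  have \<delta>: "\<delta> > 0" "\<delta> \<le> e" "\<delta> + B * \<delta> = e"
  proof -
    show "\<delta> > 0" using e B by (simp add: \<delta>_def)
    have "(1 + B) * \<delta> = e" using B by (simp add: \<delta>_def)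
    then show "\<delta> + B * \<delta> = e" by (simp add: distrib_right)
    then show "\<delta> \<le> e" using mult_nonneg_nonneg[of B \<delta>] B \<open>\<delta> > 0\<close> by linarith
  qed
  obtain Wf where Wf: "\<And>p. p \<in> P \<Longrightarrow> smooth_function M (Wf p)"
    "\<And>p q. p \<in> P \<Longrightarrow> q \<in> C p \<Longrightarrow> \<bar>Wf p q - w q\<bar> \<le> \<delta>"
    "\<And>p q. p \<in> P \<Longrightarrow> q \<in> C p \<Longrightarrow> poisson M (Wf p) H q \<le> c + \<delta>"
    using W[OF PK \<delta>(1)] by metis
  define F where "F q = (\<Sum>p\<in>P. \<eta> p q * Wf p q)" for q
  show thesis
  proof (rule that[of F])
    show "smooth_function M F" unfolding F_def
      by (intro smooth_function_sum smooth_function_mult \<eta>s Wf(1))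
    show "compactly_supported M F" unfolding compactly_supported_def
    proof (intro exI[of _ "\<Union>p\<in>P. C p"] conjI ballI)
      show "compactin (mtop M) (\<Union>p\<in>P. C p)" by (rule compactin_Union) (use P(2) C(1) PK in auto)
      show "F q = 0" if "q \<in> mpoints M - (\<Union>p\<in>P. C p)" for q
        unfolding F_def using that \<eta>C by (intro sum.neutral) auto
    qed
    fix q assume q: "q \<in> mpoints M"
    have wcase: "w q = 0 \<or> q \<in> Z" using wK Z(2) q by blast
    have "F q - w q = (\<Sum>p\<in>P. \<eta> p q * (Wf p q - w q))"
    proof -
      have "(\<Sum>p\<in>P. \<eta> p q * (Wf p q - w q)) = F q - (\<Sum>p\<in>P. \<eta> p q) * w q"
        by (simp add: F_def right_diff_distrib sum_subtractf sum_distrib_right)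
      then show ?thesis using wcase \<eta>sumZ by auto
    qed
    also have "\<bar>\<dots>\<bar> \<le> (\<Sum>p\<in>P. \<eta> p q * \<delta>)"
    proof (rule order_trans[OF sum_abs sum_mono])
      fix p assume p: "p \<in> P"
      show "\<bar>\<eta> p q * (Wf p q - w q)\<bar> \<le> \<eta> p q * \<delta>"
      proof (cases "q \<in> C p")
        case True
        then show ?thesis using Wf(2)[OF p] \<eta>0[OF p] by (simp add: abs_mult mult_left_mono)
      qed (simp add: \<eta>C[OF p])
    qed
    also have "\<dots> = (\<Sum>p\<in>P. \<eta> p q) * \<delta>" by (simp add: sum_distrib_right)
    also have "\<dots> \<le> 1 * \<delta>" using \<eta>sum1 \<delta>(1) by (intro mult_right_mono) auto
    finally show "\<bar>F q - w q\<bar> \<le> e" using \<delta>(2) by simp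
    have "poisson M F H q = (\<Sum>p\<in>P. poisson M (\<lambda>q. \<eta> p q * Wf p q) H q)"
      unfolding F_def by (rule poisson_sum[OF H q P(2)]) (intro smooth_function_mult \<eta>s Wf(1))
    also have "\<dots> = (\<Sum>p\<in>P. \<eta> p q * poisson M (Wf p) H q + D p q * Wf p q)"
      by (rule sum.cong) (auto simp: D_def poisson_mult[OF H q \<eta>s Wf(1)])
    also have "\<dots> = (\<Sum>p\<in>P. \<eta> p q * poisson M (Wf p) H q) + (\<Sum>p\<in>P. D p q * (Wf p q - w q))"
    proof -
      \<comment> \<open>On \<open>Z\<close> the functions \<open>\<eta> p\<close> sum to a constant,
        whose bracket is 0; elsewhere \<open>w\<close> vanishes.\<close>
      have "(\<Sum>p\<in>P. D p q) * w q = 0"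
      proof (cases "q \<in> Z")
        case True
        have "(\<Sum>p\<in>P. D p q) = poisson M (\<lambda>q. \<Sum>p\<in>P. \<eta> p q) H q"
          unfolding D_def by (rule poisson_sum[OF H q P(2) \<eta>s, symmetric])
        also have "\<dots> = poisson M (\<lambda>q. 1) H q"
          by (rule poisson_cong[OF Z(1) True]) (auto intro: smooth_function_sum \<eta>s smooth_function_const H simp: \<eta>sumZ)
        also have "\<dots> = 0" by (rule poisson_const[OF H q])
        finally show ?thesis by simp
      qed (use wcase in auto)
      then have "(\<Sum>p\<in>P. D p q * (Wf p q - w q)) = (\<Sum>p\<in>P. D p q * Wf p q)"
        by (simp add: right_diff_distrib sum_subtractf sum_distrib_right)
      then show ?thesis by (simp add: sum.distrib)
    qed
    also have "\<dots> \<le> (\<Sum>p\<in>P. \<eta> p q * (c + \<delta>)) + (\<Sum>p\<in>P. \<bar>A p\<bar> * \<delta>)"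
    proof (intro add_mono sum_mono)
      fix p assume p: "p \<in> P"
      show "\<eta> p q * poisson M (Wf p) H q \<le> \<eta> p q * (c + \<delta>)"
      proof (cases "q \<in> C p")
        case True
        then show ?thesis using Wf(3)[OF p] \<eta>0[OF p] by (intro mult_left_mono) auto
      qed (simp add: \<eta>C[OF p])
      show "D p q * (Wf p q - w q) \<le> \<bar>A p\<bar> * \<delta>"
      proof (cases "q \<in> C p")
        case True
        have "D p q * (Wf p q - w q) \<le> \<bar>D p q\<bar> * \<bar>Wf p q - w q\<bar>" by (metis abs_ge_self abs_mult)
        also have "\<dots> \<le> \<bar>A p\<bar> * \<delta>"
          using A[OF p True] Wf(2)[OF p True] by (intro mult_mono) auto
        finally show ?thesis .
      next
        case False
        then show ?thesis using D0[OF p] q \<delta>(1) by simp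
      qed
    qed
    also have "(\<Sum>p\<in>P. \<eta> p q * (c + \<delta>)) = (\<Sum>p\<in>P. \<eta> p q) * (c + \<delta>)" by (simp add: sum_distrib_right)
    also have "(\<Sum>p\<in>P. \<eta> p q) * (c + \<delta>) + (\<Sum>p\<in>P. \<bar>A p\<bar> * \<delta>) \<le> 1 * (c + \<delta>) + B * \<delta>"
      using \<eta>sum1 c \<delta>(1) by (intro add_mono mult_right_mono) (auto simp: B_def sum_distrib_right)
    also have "\<dots> = c + e" using \<delta>(3) by simp
    finally show "poisson M F H q \<le> c + e" .
  qed
qed

end

section \<open>Bounds for the Poisson bracket invariant\<close>

lemma (in smooth_mfd) metrizes_bound:
  "metrizes \<Psi> K \<Longrightarrow> loclip_fun M f \<Longrightarrow> \<exists>C. \<forall>p\<in>K. \<forall>q\<in>K. (f p - f q)\<^sup>2 \<le> C * sqdist \<Psi> p q"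
  by (simp add: metrizes_def)

context complete_flow
begin

text \<open>The term \<open>- s / T\<close> charges for waiting, which gives the growth rate
  \<open>1 / T\<close>. The function is 0 on \<open>X0\<close> because \<open>f\<close> vanishes on
  the reachable set \<open>R\<close>, at least 1 on \<open>X1\<close> by taking
  \<open>s = 0\<close>, and supported in the set of points flowing into the support of
  \<open>f\<close>. It is Lipschitz as a supremum of functions that are Lipschitz uniformly in
  \<open>s\<close>.\<close>

lemma hitting_function:
  assumes X0: "compactin (mtop M) X0" and X1: "compactin (mtop M) X1" and T: "T > 0"
    and no: "\<And>p t. p \<in> X0 \<Longrightarrow> 0 \<le> t \<Longrightarrow> t \<le> T \<Longrightarrow> flow t p \<notin> X1"
  obtains w K where "loclip_fun M w" "compactin (mtop M) K" "\<And>p. p \<in> mpoints M - K \<Longrightarrow> w p = 0"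
    "\<And>p. p \<in> X0 \<Longrightarrow> w p = 0" "\<And>p. p \<in> X1 \<Longrightarrow> w p \<ge> 1"
    "\<And>p h. p \<in> mpoints M \<Longrightarrow> h \<ge> 0 \<Longrightarrow> w (flow h p) \<le> w p + 1 / T * h"
proof -
  have X0M: "X0 \<subseteq> mpoints M" and X1M: "X1 \<subseteq> mpoints M" using X0 X1 compactin_subset_topspace by blast+
  define R where "R = (\<lambda>z. flow (fst z) (snd z)) ` ({0..T} \<times> X0)"
  have "closedin (mtop M) R" unfolding R_def by (rule compactin_closedin[OF flow_image_compact[OF X0]])
  then have O: "openin (mtop M) (mpoints M - R)" by blast
  have X1O: "X1 \<subseteq> mpoints M - R" using X1M no by (auto simp: R_def)
  obtain f W Kf where f: "smooth_function M f" "\<And>p. 0 \<le> f p" "\<And>p. f p \<le> 1"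
    "X1 \<subseteq> W" "\<And>p. p \<in> W \<Longrightarrow> f p = 1" "compactin (mtop M) Kf" "Kf \<subseteq> mpoints M - R" "\<And>p. p \<notin> Kf \<Longrightarrow> f p = 0"
    by (rule cutoff_exists[OF X1 O X1O]) blast
  define k where "k p s = max 0 (f (flow s p) - s / T)" for p s
  define w where "w p = (SUP s\<in>{0..T}. k p s)" for p
  have k1: "k p s \<le> 1" "0 \<le> k p s" if "s \<in> {0..T}" for p s
  proof -
    have "s / T \<ge> 0" using that T by simp
    then show "k p s \<le> 1" using f(3)[of "flow s p"] unfolding k_def by linarith
  qed (simp add: k_def)
  have up: "k p s \<le> w p" if "s \<in> {0..T}" for p s
    unfolding w_def by (rule cSUP_upper[OF that bdd_aboveI2]) (rule k1)
  have least: "w p \<le> b" if "\<And>s. s \<in> {0..T} \<Longrightarrow> k p s \<le> b" for p b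
    unfolding w_def by (rule cSUP_least) (use that T in auto)
  have w0: "w p \<ge> 0" for p using up[of 0 p] k1(2)[of 0 p] T by simp
  obtain K where K: "compactin (mtop M) K" "\<And>p t. p \<in> Kf \<Longrightarrow> t \<in> {-T..T} \<Longrightarrow> flow t p \<in> K"
    using flow_compact_image[OF f(6) T] by metis
  show thesis
  proof (rule that[of w K])
    show "compactin (mtop M) K" by (rule K(1))
    fix p
    show "w p = 0" if p: "p \<in> mpoints M - K"
    proof (rule order_antisym[OF least w0])
      fix s assume s: "s \<in> {0..T}"
      have "flow s p \<notin> Kf"
      proof
        assume "flow s p \<in> Kf"
        then have "flow (- s) (flow s p) \<in> K" using K(2) s by auto
        then show False using flow_inverse[of p s] p by simp
      qed
      then show "k p s \<le> 0" using f(8) s T by (simp add: k_def)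
    qed
    show "w p = 0" if p: "p \<in> X0"
    proof (rule order_antisym[OF least w0])
      fix s assume s: "s \<in> {0..T}"
      have "flow s p \<in> R" using s p by (auto simp: R_def intro!: image_eqI[of _ _ "(s, p)"])
      then have "f (flow s p) = 0" using f(7,8) by blast
      then show "k p s \<le> 0" using s T by (simp add: k_def)
    qed
    show "w p \<ge> 1" if p: "p \<in> X1"
    proof -
      have "flow 0 p = p" by (rule flow_0) (use p X1M in blast)
      moreover have "f p = 1" by (rule f(5)) (use p f(4) in blast)
      ultimately have "f (flow 0 p) = 1" by simp
      then have "k p 0 = 1" by (simp add: k_def)
      then show ?thesis using up[of 0 p] T by simp
    qed
    fix h :: real assume p: "p \<in> mpoints M" and h: "h \<ge> 0"
    show "w (flow h p) \<le> w p + 1 / T * h"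
    proof (rule least)
      fix s assume s: "s \<in> {0..T}"
      have fl: "flow s (flow h p) = flow (s + h) p" by (rule flow_add[OF p, symmetric])
      have hT: "0 \<le> 1 / T * h" using h T by simp
      show "k (flow h p) s \<le> w p + 1 / T * h"
      \<comment> \<open>If \<open>s + h\<close> is still an admissible waiting time, the value is
        already accounted for in \<open>w p\<close> up to the charge for \<open>h\<close>. Otherwise
        \<open>f \<le> 1 \<le> (s + h) / T\<close>, so the value is at most the charge for
        \<open>h\<close>.\<close>
      proof (cases "s + h \<le> T")
        case True
        have "f (flow (s + h) p) - (s + h) / T \<le> k p (s + h)" by (simp add: k_def)
        also have "\<dots> \<le> w p" by (rule up) (use True s h in auto)
        finally have "f (flow s (flow h p)) - s / T \<le> w p + 1 / T * h"
          unfolding fl by (simp add: add_divide_distrib)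
        then show ?thesis using w0[of p] hT by (simp add: k_def)
      next
        case False
        then have "1 \<le> (s + h) / T" using T by simp
        then have "f (flow s (flow h p)) - s / T \<le> 1 / T * h"
          using f(3)[of "flow s (flow h p)"] by (simp add: add_divide_distrib)
        then show ?thesis using w0[of p] hT by (simp add: k_def)
      qed
    qed
  next
    show "loclip_fun M w" unfolding loclip_fun_def
    proof
      fix i assume i: "i \<in> mindex M"
      show "loclip_on (mrange M i) (w \<circ> mparam M i)" unfolding loclip_on_def
      proof
        fix x assume x: "x \<in> mrange M i"
        obtain U K2 \<Psi> C where U: "openin (mtop M) U" "mparam M i x \<in> U" and K2: "metrizes \<Psi> K2" and C: "C \<ge> 0"
          and inK: "\<And>q t. q \<in> U \<Longrightarrow> t \<in> {-T..T} \<Longrightarrow> flow t q \<in> K2"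
          and d: "\<And>q q' t. q \<in> U \<Longrightarrow> q' \<in> U \<Longrightarrow> t \<in> {-T..T} \<Longrightarrow> sqdist \<Psi> (flow t q) (flow t q') \<le> C * sqdist \<Psi> q q'"
          using flow_tube[OF mparam_points[OF i x] T] by metis
        obtain C1 where C1: "\<And>p q. p \<in> K2 \<Longrightarrow> q \<in> K2 \<Longrightarrow> (f p - f q)\<^sup>2 \<le> C1 * sqdist \<Psi> p q"
          using metrizes_bound[OF K2 smooth_function_loclip[OF f(1)]] by blast
        have fin: "finite \<Psi>" and sm: "\<And>\<psi>. \<psi> \<in> \<Psi> \<Longrightarrow> smooth_function M \<psi>" using K2 by (auto simp: metrizes_def)
        have ll: "loclip_on (mrange M i) (\<psi> \<circ> mparam M i)" if "\<psi> \<in> \<Psi>" for \<psi>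
          using smooth_function_loclip[OF sm[OF that]] i by (simp add: loclip_fun_def)
        obtain r1 L where r1: "r1 > 0" "cball x r1 \<subseteq> mrange M i" "L > 0"
          and L: "\<And>\<psi>. \<psi> \<in> \<Psi> \<Longrightarrow> L-lipschitz_on (cball x r1) (\<psi> \<circ> mparam M i)"
          using loclip_family[of \<Psi> "mrange M i" "\<lambda>\<psi>. \<psi> \<circ> mparam M i", OF fin ll x open_mrange[OF i]] by metis
        have "open {y \<in> mrange M i. mparam M i y \<in> U}" by (rule open_param_preimage[OF i U(1)])
        moreover have "x \<in> {y \<in> mrange M i. mparam M i y \<in> U}" using x U(2) by simp
        ultimately obtain r2 where r2: "r2 > 0" "cball x r2 \<subseteq> {y \<in> mrange M i. mparam M i y \<in> U}"
          using open_contains_cball by blast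
        define r where "r = min r1 r2"
        \<comment> \<open>The product of the constants of \<open>f\<close> with respect to
          \<open>sqdist\<close>, of the flow, and of the test functions in the chart. It bounds
          squared differences, so the Lipschitz constant is its square root.\<close>
        define A2 where "A2 = \<bar>C1\<bar> * (C * (real (card \<Psi>) * L\<^sup>2))"
        have A2: "A2 \<ge> 0" using C by (simp add: A2_def)
        have key: "w (mparam M i y) \<le> w (mparam M i z) + sqrt A2 * dist y z"
          if yz: "y \<in> cball x r" "z \<in> cball x r" for y z
        proof (rule least)
          let ?p = "mparam M i y" and ?q = "mparam M i z"
          fix s assume s: "s \<in> {0..T}"
          have sT: "s \<in> {-T..T}" using s by auto
          have pq: "?p \<in> U" "?q \<in> U" using yz r2(2) by (auto simp: r_def)
          have y1: "y \<in> cball x r1" "z \<in> cball x r1" using yz by (auto simp: r_def)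
          have "sqdist \<Psi> ?p ?q \<le> (\<Sum>\<psi>\<in>\<Psi>. L\<^sup>2 * (dist y z)\<^sup>2)"
            unfolding sqdist_def
          proof (rule sum_mono)
            fix \<psi> assume "\<psi> \<in> \<Psi>"
            from lipschitz_onD[OF L[OF this] y1] have "\<bar>\<psi> ?p - \<psi> ?q\<bar> \<le> L * dist y z" by (simp add: dist_real_def)
            then have "(\<psi> ?p - \<psi> ?q)\<^sup>2 \<le> (L * dist y z)\<^sup>2"
              using r1(3) by (intro abs_le_square_iff[THEN iffD1]) auto
            then show "(\<psi> ?p - \<psi> ?q)\<^sup>2 \<le> L\<^sup>2 * (dist y z)\<^sup>2" by (simp add: power_mult_distrib)
          qed
          then have s1: "sqdist \<Psi> ?p ?q \<le> (real (card \<Psi>) * L\<^sup>2) * (dist y z)\<^sup>2" by simp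
          have "(f (flow s ?p) - f (flow s ?q))\<^sup>2 \<le> C1 * sqdist \<Psi> (flow s ?p) (flow s ?q)"
            by (rule C1[OF inK[OF pq(1) sT] inK[OF pq(2) sT]])
          also have "\<dots> \<le> \<bar>C1\<bar> * sqdist \<Psi> (flow s ?p) (flow s ?q)"
            by (intro mult_right_mono sqdist_nonneg) simp
          also have "\<dots> \<le> \<bar>C1\<bar> * (C * ((real (card \<Psi>) * L\<^sup>2) * (dist y z)\<^sup>2))"
            by (rule mult_left_mono[OF order_trans[OF d[OF pq sT] mult_left_mono[OF s1 C]]]) simp
          also have "\<dots> = (sqrt A2 * dist y z)\<^sup>2" using A2 by (simp add: A2_def power_mult_distrib mult.assoc)
          finally have "\<bar>f (flow s ?p) - f (flow s ?q)\<bar> \<le> \<bar>sqrt A2 * dist y z\<bar>"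
            by (rule abs_le_square_iff[THEN iffD2])
          then have "\<bar>f (flow s ?p) - f (flow s ?q)\<bar> \<le> sqrt A2 * dist y z" using A2 by simp
          then have "k ?p s \<le> k ?q s + sqrt A2 * dist y z" unfolding k_def by linarith
          then show "k ?p s \<le> w ?q + sqrt A2 * dist y z" using up[OF s, of ?q] by linarith
        qed
        have "(sqrt A2)-lipschitz_on (cball x r) (w \<circ> mparam M i)"
        proof (rule lipschitz_onI)
          fix y z assume yz: "y \<in> cball x r" "z \<in> cball x r"
          show "dist ((w \<circ> mparam M i) y) ((w \<circ> mparam M i) z) \<le> sqrt A2 * dist y z"
            using key[OF yz] key[OF yz(2,1)] by (simp add: dist_real_def abs_le_iff dist_commute)
        qed (use A2 in simp)
        moreover have "cball x r \<subseteq> mrange M i" "r > 0" using r1 r2 by (auto simp: r_def)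
        ultimately show "\<exists>r>0. \<exists>L. cball x r \<subseteq> mrange M i \<and> L-lipschitz_on (cball x r) (w \<circ> mparam M i)" by blast
      qed
    qed
  qed
qed

text \<open>Smoothing moves the values by up to \<open>e\<close>, so \<open>F1\<close> is at most
  \<open>e\<close> on \<open>X0\<close> and at least \<open>1 - e\<close> on \<open>X1\<close>.
  Subtracting \<open>e\<close> near these sets and dividing by \<open>1 - 2 * e\<close> restores
  both conditions; the rate \<open>1 / T'\<close> rises slightly, but stays below
  \<open>1 / T\<close> for small \<open>e\<close>.\<close>

lemma slow_function:
  assumes X0: "compactin (mtop M) X0" and X1: "compactin (mtop M) X1" and disj: "X0 \<inter> X1 = {}" and T: "T > 0"
    and no: "\<And>p t. p \<in> X0 \<Longrightarrow> 0 < t \<Longrightarrow> t \<le> T \<Longrightarrow> flow t p \<notin> X1"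
  obtains F c where "smooth_function M F" "compactly_supported M F" "\<And>p. p \<in> X0 \<Longrightarrow> F p \<le> 0"
    "\<And>p. p \<in> X1 \<Longrightarrow> F p \<ge> 1" "0 \<le> c" "c < 1 / T" "\<And>p. p \<in> mpoints M \<Longrightarrow> poisson M F H p \<le> c"
proof -
  obtain T' where T': "T' > T" "\<And>p t. p \<in> X0 \<Longrightarrow> 0 \<le> t \<Longrightarrow> t \<le> T' \<Longrightarrow> flow t p \<notin> X1"
    using no_chord_extend[OF X0 X1 disj T no] by metis
  have T'0: "T' > 0" using T T' by simp
  obtain w K where w: "loclip_fun M w" "compactin (mtop M) K" "\<And>p. p \<in> mpoints M - K \<Longrightarrow> w p = 0"
    "\<And>p. p \<in> X0 \<Longrightarrow> w p = 0" "\<And>p. p \<in> X1 \<Longrightarrow> w p \<ge> 1"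
    and wg: "\<And>p h. p \<in> mpoints M \<Longrightarrow> h \<ge> 0 \<Longrightarrow> w (flow h p) \<le> w p + 1 / T' * h"
    by (rule hitting_function[OF X0 X1 T'0 T'(2)], assumption, assumption, assumption, rule that, (assumption | blast)+)
  have XU: "compactin (mtop M) (X0 \<union> X1)" using X0 X1 by (rule compactin_Un)
  have XM: "X0 \<union> X1 \<subseteq> mpoints M" using XU compactin_subset_topspace by blast
  \<comment> \<open>A cutoff takes the place of the constant 1 in the correction, so that
    \<open>F\<close> keeps compact support; its bracket with \<open>H\<close> is bounded by
    \<open>\<bar>B\<bar>\<close>.\<close>
  obtain \<zeta> Wz Kz where \<zeta>: "smooth_function M \<zeta>" "X0 \<union> X1 \<subseteq> Wz" "\<And>p. p \<in> Wz \<Longrightarrow> \<zeta> p = 1"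
    "compactin (mtop M) Kz" "\<And>p. p \<notin> Kz \<Longrightarrow> \<zeta> p = 0"
    by (rule cutoff_exists[OF XU openin_topspace XM]) blast
  have z1: "\<zeta> p = 1" if "p \<in> X0 \<union> X1" for p using \<zeta>(2,3) that by blast
  have "continuous_map (mtop M) euclideanreal (poisson M \<zeta> H)"
    by (rule loclip_fun_continuous[OF poisson_loclip[OF H \<zeta>(1)]])
  from image_compactin[OF \<zeta>(4) this] have "bounded (poisson M \<zeta> H ` Kz)" by (simp add: compact_imp_bounded)
  then obtain B where B: "\<And>p. p \<in> Kz \<Longrightarrow> \<bar>poisson M \<zeta> H p\<bar> \<le> B" unfolding bounded_iff by (metis imageI real_norm_def)
  have oz: "openin (mtop M) (mpoints M - Kz)" using compactin_closedin[OF \<zeta>(4)] by blast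
  have B': "\<bar>poisson M \<zeta> H p\<bar> \<le> \<bar>B\<bar>" if p: "p \<in> mpoints M" for p
  proof (cases "p \<in> Kz")
    case True
    then show ?thesis using B by fastforce
  next
    case False
    have "poisson M \<zeta> H p = poisson M (\<lambda>p. 0) H p"
      by (rule poisson_cong[OF oz]) (use p False \<zeta>(5) in \<open>auto intro: \<zeta>(1) H smooth_function_const\<close>)
    then show ?thesis using poisson_const[OF H p] by simp
  qed
  \<comment> \<open>The final rate as a function of \<open>e\<close>; its limit
    \<open>1 / T'\<close> lies strictly below \<open>1 / T\<close>, which selects
    \<open>e\<close>.\<close>
  have "((\<lambda>e. (1 / T' + e + e * \<bar>B\<bar>) / (1 - 2 * e)) \<longlongrightarrow> (1 / T' + 0 + 0 * \<bar>B\<bar>) / (1 - 2 * 0)) (at_right 0)"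
    by (intro tendsto_intros) auto
  moreover have "(1 / T' + 0 + 0 * \<bar>B\<bar>) / (1 - 2 * 0) < 1 / T" using T T' by (simp add: frac_less2)
  ultimately have "\<forall>\<^sub>F e in at_right 0. (1 / T' + e + e * \<bar>B\<bar>) / (1 - 2 * e) < 1 / T"
    by (rule order_tendstoD(2))
  moreover have "\<forall>\<^sub>F e in at_right (0::real). e < 1/4"
    by (auto simp: eventually_at_right_field intro!: exI[of _ "1/4"])
  moreover have "\<forall>\<^sub>F e in at_right (0::real). e > 0" by (simp add: eventually_at_right_less)
  ultimately have "\<forall>\<^sub>F e in at_right 0. (1 / T' + e + e * \<bar>B\<bar>) / (1 - 2 * e) < 1 / T \<and> e < 1/4 \<and> e > 0"
    by eventually_elim simp
  then obtain e where e: "(1 / T' + e + e * \<bar>B\<bar>) / (1 - 2 * e) < 1 / T" "e < 1/4" "e > 0"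
    using eventually_happens[of _ "at_right (0::real)"] trivial_limit_at_right_real by blast
  have growth: "\<exists>\<gamma>. trajectory M (H \<circ> fst) UNIV \<gamma> \<and> \<gamma> 0 = p \<and> (\<forall>h\<ge>0. w (\<gamma> h) \<le> w p + 1 / T' * h)"
    if "p \<in> mpoints M" for p
    using flow_trajectory[OF that] flow_0[OF that] wg[OF that] by (intro exI[of _ "\<lambda>t. flow t p"]) simp
  have T1: "1 / T' \<ge> 0" using T'0 by simp
  obtain F1 where F1: "smooth_function M F1" "compactly_supported M F1"
    "\<And>p. p \<in> mpoints M \<Longrightarrow> \<bar>F1 p - w p\<bar> \<le> e" "\<And>p. p \<in> mpoints M \<Longrightarrow> poisson M F1 H p \<le> 1 / T' + e"
    by (rule smoothing[OF H w(1) T1 growth w(2,3) e(3)], assumption, assumption, rule that, (assumption | blast)+)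
  define F where "F p = (1 / (1 - 2 * e)) * (F1 p + (- e) * \<zeta> p)" for p
  define c where "c = (1 / T' + e + e * \<bar>B\<bar>) / (1 - 2 * e)"
  have sm: "smooth_function M (\<lambda>p. (- e) * \<zeta> p)" "smooth_function M (\<lambda>p. F1 p + (- e) * \<zeta> p)"
    by (intro smooth_function_add smooth_function_mult smooth_function_const F1(1) \<zeta>(1))+
  show thesis
  proof (rule that[of F c])
    show "smooth_function M F" unfolding F_def
      by (intro smooth_function_mult smooth_function_const sm)
    obtain K1 where K1: "compactin (mtop M) K1" "\<And>p. p \<in> mpoints M - K1 \<Longrightarrow> F1 p = 0"
      using F1(2) by (auto simp: compactly_supported_def)
    show "compactly_supported M F" unfolding compactly_supported_def
      by (rule exI[of _ "K1 \<union> Kz"]) (use compactin_Un[OF K1(1) \<zeta>(4)] K1(2) \<zeta>(5) in \<open>auto simp: F_def\<close>)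
    have e2: "1 - 2 * e > 0" using e by simp
    show "F p \<le> 0" if "p \<in> X0" for p
    proof -
      have "F1 p \<le> e" using F1(3)[of p] w(4)[OF that] XM that by auto
      then have "F1 p + (- e) * \<zeta> p \<le> 0" using z1[of p] that by simp
      then show ?thesis unfolding F_def using e2 by (intro mult_nonneg_nonpos) auto
    qed
    show "F p \<ge> 1" if "p \<in> X1" for p
    proof -
      have "F1 p \<ge> 1 - e" using F1(3)[of p] w(5)[OF that] XM that by force
      then have "1 - 2 * e \<le> F1 p + (- e) * \<zeta> p" using z1[of p] that by simp
      then show ?thesis unfolding F_def using e2 by (simp add: pos_le_divide_eq)
    qed
    show "0 \<le> c" using e T'0 e2 by (simp add: c_def)
    show "c < 1 / T" using e(1) by (simp add: c_def)
    fix p assume p: "p \<in> mpoints M"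
    have "poisson M F H p = (1 / (1 - 2 * e)) * (poisson M F1 H p + (- e) * poisson M \<zeta> H p)"
      unfolding F_def poisson_cmult[OF H p sm(2)] poisson_add[OF H p F1(1) sm(1)] poisson_cmult[OF H p \<zeta>(1)] ..
    also have "\<dots> \<le> (1 / (1 - 2 * e)) * ((1 / T' + e) + e * \<bar>B\<bar>)"
    proof (intro mult_left_mono add_mono F1(4)[OF p])
      have "(- e) * poisson M \<zeta> H p \<le> e * \<bar>poisson M \<zeta> H p\<bar>"
        using e(3) by (metis abs_ge_minus_self mult_left_mono less_imp_le mult_minus_left mult_minus_right)
      also have "\<dots> \<le> e * \<bar>B\<bar>" using B'[OF p] e(3) by (intro mult_left_mono) auto
      finally show "(- e) * poisson M \<zeta> H p \<le> e * \<bar>B\<bar>" .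
    qed (use e2 in simp)
    also have "\<dots> = c" by (simp add: c_def)
    finally show "poisson M F H p \<le> c" .
  qed
qed

end

section \<open>Comparing \<open>pb4_plus\<close> with chord times\<close>

context sympl_mfd
begin

lemma poisson_antisym:
  assumes "p \<in> mpoints M" "smooth_function M F" "smooth_function M G"
  shows "poisson M F G p = - poisson M G F p"
proof -
  obtain i where i: "i \<in> mindex M" "p \<in> mdom M i" using chart_exists[OF assms(1)] by blast
  show ?thesis
    unfolding poisson_chart[OF S i assms(2,3)] poisson_chart[OF S i assms(3,2)]
    by (rule sform_antisym[OF i(1) mchart_in[OF i]])
qed

lemma poisson_affine_right:
  assumes p: "p \<in> mpoints M" and F: "smooth_function M F" and G: "smooth_function M G"
  shows "poisson M F (\<lambda>p. a * G p + b) p = a * poisson M F G p"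
proof -
  have s: "smooth_function M (\<lambda>p. a * G p)" "smooth_function M (\<lambda>p. a * G p + b)"
    by (intro smooth_function_add smooth_function_mult smooth_function_const G)+
  have "poisson M (\<lambda>p. a * G p + b) F p = a * poisson M G F p"
    using poisson_add[OF F p s(1) smooth_function_const, of b] poisson_const[OF F p] poisson_cmult[OF F p G]
    by simp
  then show ?thesis using poisson_antisym[OF p F s(2)] poisson_antisym[OF p F G] by simp
qed

text \<open>\<open>G\<close> may have arbitrary support. It is multiplied by a cutoff equal to 1
  near the support of \<open>F\<close> and near \<open>Y0 \<union> Y1\<close>: there the bracket is
  unchanged, and elsewhere \<open>F\<close> vanishes locally, so the bracket is 0, which
  \<open>b\<close> must dominate.\<close>

lemma pb4_plus_le:
  assumes Y: "compactin (mtop M) Y0" "compactin (mtop M) Y1"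
    and F: "smooth_function M F" "compactly_supported M F" "\<And>p. p \<in> X0 \<Longrightarrow> F p \<le> 0" "\<And>p. p \<in> X1 \<Longrightarrow> F p \<ge> 1"
    and G: "smooth_function M G" "\<And>p. p \<in> Y0 \<Longrightarrow> G p \<le> 0" "\<And>p. p \<in> Y1 \<Longrightarrow> G p \<ge> 1"
    and b: "0 \<le> b" "\<And>p. p \<in> mpoints M \<Longrightarrow> poisson M F G p \<le> b"
  shows "pb4_plus M X0 X1 Y0 Y1 \<le> ereal b"
proof -
  obtain K where K: "compactin (mtop M) K" "\<And>p. p \<in> mpoints M - K \<Longrightarrow> F p = 0"
    using F(2) by (auto simp: compactly_supported_def)
  have C: "compactin (mtop M) (K \<union> (Y0 \<union> Y1))" using K(1) Y by (intro compactin_Un)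
  have CM: "K \<union> (Y0 \<union> Y1) \<subseteq> mpoints M" using C compactin_subset_topspace by blast
  obtain \<zeta> W Kz where \<zeta>: "smooth_function M \<zeta>" "openin (mtop M) W" "K \<union> (Y0 \<union> Y1) \<subseteq> W" "\<And>p. p \<in> W \<Longrightarrow> \<zeta> p = 1"
    "compactin (mtop M) Kz" "\<And>p. p \<notin> Kz \<Longrightarrow> \<zeta> p = 0"
    by (rule cutoff_exists[OF C openin_topspace CM]) blast
  define G' where "G' p = \<zeta> p * G p" for p
  have G's: "smooth_function M G'" unfolding G'_def by (intro smooth_function_mult \<zeta> G)
  have G'W: "G' p = G p" if "p \<in> W" for p using \<zeta>(4)[OF that] by (simp add: G'_def)
  have "(F, G') \<in> pb4_pairs M X0 X1 Y0 Y1"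
  proof -
    have "compactly_supported M G'" unfolding compactly_supported_def
      by (rule exI[of _ Kz]) (use \<zeta>(5,6) in \<open>auto simp: G'_def\<close>)
    moreover have "\<forall>p\<in>Y0. G' p \<le> 0" "\<forall>p\<in>Y1. G' p \<ge> 1" using G'W \<zeta>(3) G(2,3) by auto
    ultimately show ?thesis using F G's by (simp add: pb4_pairs_def)
  qed
  then have "pb4_plus M X0 X1 Y0 Y1 \<le> (SUP p\<in>mpoints M. ereal (poisson M F G' p))"
    unfolding pb4_plus_def by (rule INF_lower2) simp
  also have "\<dots> \<le> ereal b"
  proof (rule SUP_least)
    fix p assume p: "p \<in> mpoints M"
    show "ereal (poisson M F G' p) \<le> ereal b"
    proof (cases "p \<in> W")
      case True
      have "poisson M F G' p = poisson M F G p"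
        by (rule poisson_cong[OF \<zeta>(2) True]) (use G'W F G G's in auto)
      then show ?thesis using b(2)[OF p] by simp
    next
      case False
      have o: "openin (mtop M) (mpoints M - K)" using compactin_closedin[OF K(1)] by blast
      have "poisson M F G' p = poisson M (\<lambda>p. 0) G' p"
        by (rule poisson_cong[OF o]) (use p False \<zeta>(3) K(2) in \<open>auto intro: F(1) G's smooth_function_const\<close>)
      then show ?thesis using poisson_const[OF G's p] b(1) by simp
    qed
  qed
  finally show ?thesis .
qed

lemma pb4_plus_empty:
  assumes X: "compactin (mtop M) X0" "compactin (mtop M) X1" "X0 \<inter> X1 = {}"
    and Y: "compactin (mtop M) Y0" "compactin (mtop M) Y1" "Y0 = {} \<or> Y1 = {}"
  shows "pb4_plus M X0 X1 Y0 Y1 \<le> 0"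
proof -
  have o: "openin (mtop M) (mpoints M - X0)" using compactin_closedin[OF X(1)] by blast
  have X1: "X1 \<subseteq> mpoints M - X0" using X compactin_subset_topspace by blast
  obtain F W K where F: "smooth_function M F" "X1 \<subseteq> W" "\<And>p. p \<in> W \<Longrightarrow> F p = 1"
    "compactin (mtop M) K" "K \<subseteq> mpoints M - X0" "\<And>p. p \<notin> K \<Longrightarrow> F p = (0::real)"
    by (rule cutoff_exists[OF X(2) o X1]) blast
  have cF: "compactly_supported M F" unfolding compactly_supported_def using F(4,6) by blast
  have F0: "F p \<le> 0" if "p \<in> X0" for p using F(5,6) that by fastforce
  have F1: "F p \<ge> 1" if "p \<in> X1" for p using F(2,3) that by fastforce
  have "poisson M F (\<lambda>p. a) p = 0" if "p \<in> mpoints M" for p a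
    using poisson_affine_right[OF that F(1) smooth_function_const, of 0 a] by simp
  moreover have "(if Y0 = {} then 1 else 0) \<le> (0::real)" if "p \<in> Y0" for p using that by auto
  moreover have "(if Y0 = {} then 1 else 0) \<ge> (1::real)" if "p \<in> Y1" for p using that Y(3) by auto
  ultimately have "pb4_plus M X0 X1 Y0 Y1 \<le> ereal 0"
    by (intro pb4_plus_le[OF Y(1,2) F(1) cF F0 F1 smooth_function_const[of "if Y0 = {} then 1 else 0"]]) auto
  then show ?thesis by (simp add: zero_ereal_def)
qed

text \<open>A compactly supported \<open>F\<close> that is positive somewhere attains its maximum;
  if it takes only values at most 0, it attains its minimum. At such a point \<open>dF = 0\<close>,
  so every bracket vanishes there and the supremum is at least 0.\<close>

lemma pb4_plus_nonneg: "0 \<le> pb4_plus M X0 X1 Y0 Y1"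
  unfolding pb4_plus_def
proof (rule INF_greatest)
  fix FG assume "FG \<in> pb4_pairs M X0 X1 Y0 Y1"
  then obtain F G where FG: "FG = (F, G)" and F: "smooth_function M F" "compactly_supported M F" and G: "smooth_function M G"
    by (auto simp: pb4_pairs_def)
  obtain K where K: "compactin (mtop M) K" "\<And>p. p \<in> mpoints M - K \<Longrightarrow> F p = 0"
    using F(2) by (auto simp: compactly_supported_def)
  have Fc: "continuous_map (mtop M) euclideanreal F" by (rule smooth_function_continuous[OF F(1)])
  have crit: "\<exists>p\<in>mpoints M. (\<forall>q\<in>mpoints M. F q \<le> F p) \<or> (\<forall>q\<in>mpoints M. F p \<le> F q)"
  proof (cases "\<exists>p\<in>mpoints M. F p \<noteq> 0")
    case False
    moreover obtain p where "p \<in> mpoints M" using nonempty by blast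
    ultimately show ?thesis by (intro bexI[of _ p]) auto
  next
    case True
    then obtain p where p: "p \<in> mpoints M" "F p \<noteq> 0" by blast
    then have pK: "p \<in> K" using K by blast
    have KM: "K \<subseteq> mpoints M" using K(1) compactin_subset_topspace by blast
    have cc: "compact (F ` K)" using image_compactin[OF K(1) Fc] by simp
    show ?thesis
    proof (cases "F p > 0")
      case True
      obtain m where "m \<in> F ` K" "\<And>y. y \<in> F ` K \<Longrightarrow> y \<le> m" using compact_attains_sup[OF cc] pK by blast
      then obtain a where a: "a \<in> K" "\<And>y. y \<in> K \<Longrightarrow> F y \<le> F a" by blast
      have "F q \<le> F a" if "q \<in> mpoints M" for q
        using a(2)[of q] a(2)[OF pK] True K(2)[of q] that by (cases "q \<in> K") auto
      then show ?thesis using a(1) KM by blast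
    next
      case False
      obtain m where "m \<in> F ` K" "\<And>y. y \<in> F ` K \<Longrightarrow> m \<le> y" using compact_attains_inf[OF cc] pK by blast
      then obtain a where a: "a \<in> K" "\<And>y. y \<in> K \<Longrightarrow> F a \<le> F y" by blast
      have "F a \<le> F q" if "q \<in> mpoints M" for q
        using a(2)[of q] a(2)[OF pK] False p(2) K(2)[of q] that by (cases "q \<in> K") auto
      then show ?thesis using a(1) KM by blast
    qed
  qed
  then obtain p where p: "p \<in> mpoints M" "(\<forall>q\<in>mpoints M. F q \<le> F p) \<or> (\<forall>q\<in>mpoints M. F p \<le> F q)" by blast
  obtain i where i: "i \<in> mindex M" "p \<in> mdom M i" using chart_exists[OF p(1)] by blast
  have "dcoord M F i p = (\<lambda>v. 0)"
  proof (rule differential_zero_maxmin[OF mchart_in[OF i] open_mrange[OF i(1)] has_derivative_dcoord[OF i F(1)]])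
    show "(\<forall>y\<in>mrange M i. (F \<circ> mparam M i) y \<le> (F \<circ> mparam M i) (mchart M i p)) \<or>
        (\<forall>y\<in>mrange M i. (F \<circ> mparam M i) (mchart M i p) \<le> (F \<circ> mparam M i) y)"
      using p(2) mparam_points[OF i(1)] mparam_mchart'[OF i] by auto
  qed
  then have "poisson M F G p = 0" using poisson_eq[OF i F(1) G] by simp
  then have "0 \<le> (SUP p\<in>mpoints M. ereal (poisson M F G p))"
    by (intro SUP_upper2[OF p(1)]) simp
  then show "0 \<le> (case FG of (F, G) \<Rightarrow> SUP p\<in>mpoints M. ereal (poisson M F G p))" by (simp add: FG)
qed

lemma separation_real:
  assumes H: "continuous_map (mtop M) euclideanreal H" and Y: "compactin (mtop M) Y0" "compactin (mtop M) Y1"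
    and ne: "Y0 \<noteq> {}" "Y1 \<noteq> {}"
  obtains a b where "separation (H \<circ> fst) Y0 Y1 = ereal (b - a)" "\<And>y. y \<in> Y0 \<Longrightarrow> H y \<le> a" "\<And>y. y \<in> Y1 \<Longrightarrow> b \<le> H y"
proof -
  have c: "compact (H ` Y0)" "compact (H ` Y1)" using image_compactin[OF _ H] Y by auto
  obtain m where "m \<in> H ` Y0" "\<And>y. y \<in> H ` Y0 \<Longrightarrow> y \<le> m" using compact_attains_sup[OF c(1)] ne by blast
  then obtain y0 where y0: "y0 \<in> Y0" "\<And>y. y \<in> Y0 \<Longrightarrow> H y \<le> H y0" by blast
  obtain m where "m \<in> H ` Y1" "\<And>y. y \<in> H ` Y1 \<Longrightarrow> m \<le> y" using compact_attains_inf[OF c(2)] ne by blast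
  then obtain y1 where y1: "y1 \<in> Y1" "\<And>y. y \<in> Y1 \<Longrightarrow> H y1 \<le> H y" by blast
  have "(INF z\<in>Y1 \<times> (UNIV :: circle set). ereal ((H \<circ> fst) z)) = ereal (H y1)"
    by (rule antisym[OF INF_lower2[of "(y1, circ 0)"] INF_greatest]) (use y1 in auto)
  moreover have "(SUP z\<in>Y0 \<times> (UNIV :: circle set). ereal ((H \<circ> fst) z)) = ereal (H y0)"
    by (rule antisym[OF SUP_least SUP_upper2[of "(y0, circ 0)"]]) (use y0 in auto)
  ultimately have "separation (H \<circ> fst) Y0 Y1 = ereal (H y1 - H y0)" by (simp add: separation_def)
  then show thesis using that y0 y1 by blast
qed

text \<open>\<open>slow_function\<close> with time \<open>\<kappa> / \<Delta>\<close> gives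
  \<open>F\<close> with bracket at most \<open>c < \<Delta> / \<kappa>\<close>. Normalising
  \<open>H\<close> to \<open>(H - a) / \<Delta>\<close>, which is at most 0 on \<open>Y0\<close> and
  at least 1 on \<open>Y1\<close>, divides this by \<open>\<Delta>\<close>. The strictness decides
  the borderline value of \<open>\<kappa>\<close>.\<close>

lemma pb4_plus_less:
  assumes X: "compactin (mtop M) X0" "compactin (mtop M) X1" "X0 \<inter> X1 = {}"
    and Y: "compactin (mtop M) Y0" "compactin (mtop M) Y1"
    and H: "smooth_function M H"
    and complete: "\<And>p. p \<in> mpoints M \<Longrightarrow> \<exists>\<gamma>. trajectory M (H \<circ> fst) UNIV \<gamma> \<and> \<gamma> 0 = p"
    and \<kappa>: "\<kappa> > 0" and sep: "separation (H \<circ> fst) Y0 Y1 > 0"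
    and no: "\<not> has_chord M (H \<circ> fst) X0 X1 (ereal \<kappa> / separation (H \<circ> fst) Y0 Y1)"
  shows "pb4_plus M X0 X1 Y0 Y1 < ereal (1 / \<kappa>)"
proof (cases "Y0 = {} \<or> Y1 = {}")
  case True
  have "pb4_plus M X0 X1 Y0 Y1 \<le> 0" by (rule pb4_plus_empty[OF X Y True])
  also have "\<dots> < ereal (1 / \<kappa>)" using \<kappa> by simp
  finally show ?thesis .
next
  case False
  interpret complete_flow M H by unfold_locales (rule H, rule complete)
  obtain a b where ab: "separation (H \<circ> fst) Y0 Y1 = ereal (b - a)" "\<And>y. y \<in> Y0 \<Longrightarrow> H y \<le> a" "\<And>y. y \<in> Y1 \<Longrightarrow> b \<le> H y"
    using separation_real[OF smooth_function_continuous[OF H] Y] False by metis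
  define \<Delta> where "\<Delta> = b - a"
  have \<Delta>: "\<Delta> > 0" using sep by (simp add: ab(1) \<Delta>_def)
  have L: "ereal \<kappa> / separation (H \<circ> fst) Y0 Y1 = ereal (\<kappa> / \<Delta>)" using \<Delta> by (simp add: ab(1) \<Delta>_def)
  have X0M: "X0 \<subseteq> mpoints M" using X(1) compactin_subset_topspace by blast
  have nf: "\<And>p t. p \<in> X0 \<Longrightarrow> 0 < t \<Longrightarrow> t \<le> \<kappa> / \<Delta> \<Longrightarrow> flow t p \<notin> X1"
    using no X0M unfolding L chord_iff_flow by auto
  have T0: "\<kappa> / \<Delta> > 0" using \<kappa> \<Delta> by simp
  obtain F c where
    F: "smooth_function M F" "compactly_supported M F" "\<And>p. p \<in> X0 \<Longrightarrow> F p \<le> 0" "\<And>p. p \<in> X1 \<Longrightarrow> F p \<ge> 1"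
    and c: "0 \<le> c" "c < 1 / (\<kappa> / \<Delta>)" "\<And>p. p \<in> mpoints M \<Longrightarrow> poisson M F H p \<le> c"
    by (rule slow_function[OF X T0 nf], assumption, assumption, assumption, rule that, (assumption | blast)+)
  define G where "G p = (1 / \<Delta>) * H p + (- a / \<Delta>)" for p
  have "pb4_plus M X0 X1 Y0 Y1 \<le> ereal ((1 / \<Delta>) * c)"
  proof (rule pb4_plus_le[OF Y F])
    show "smooth_function M G" unfolding G_def
      by (intro smooth_function_add smooth_function_mult smooth_function_const H)
    show "G p \<le> 0" if "p \<in> Y0" for p using ab(2)[OF that] \<Delta> by (simp add: G_def divide_right_mono field_simps)
    show "G p \<ge> 1" if "p \<in> Y1" for p
    proof -
      have "\<Delta> \<le> H p - a" using ab(3)[OF that] by (simp add: \<Delta>_def)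
      moreover have "G p = (H p - a) / \<Delta>" by (simp add: G_def diff_divide_distrib)
      ultimately show ?thesis using \<Delta> by (simp add: pos_le_divide_eq)
    qed
    show "0 \<le> 1 / \<Delta> * c" using c(1) \<Delta> by simp
    show "poisson M F G p \<le> 1 / \<Delta> * c" if "p \<in> mpoints M" for p
      unfolding G_def poisson_affine_right[OF that F(1) H] using c(3)[OF that] \<Delta> by (intro mult_left_mono) auto
  qed auto
  also have "\<dots> < ereal (1 / \<kappa>)" using c(2) \<Delta> \<kappa> by (simp add: field_simps)
  finally show ?thesis .
qed

text \<open>The mean value theorem along the chord: \<open>F\<close> rises by at least 1 within time
  at most \<open>L\<close>, so at some moment its velocity, the bracket, is at least
  \<open>1 / L\<close>.\<close>

lemma chord_poisson:
  assumes F: "smooth_function M F" "\<And>p. p \<in> X0 \<Longrightarrow> F p \<le> 0" "\<And>p. p \<in> X1 \<Longrightarrow> F p \<ge> 1" and G: "smooth_function M G"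
    and L: "L > 0" and ch: "has_chord M (G \<circ> fst) X0 X1 (ereal L)"
  shows "\<exists>p\<in>mpoints M. 1 / L \<le> poisson M F G p"
proof -
  obtain t0 t1 \<gamma> where c: "t0 < t1" "trajectory M (G \<circ> fst) {t0..t1} \<gamma>" "\<gamma> t0 \<in> X0" "\<gamma> t1 \<in> X1" "t1 - t0 \<le> L"
    using ch by (auto simp: has_chord_def)
  have "\<exists>x\<in>{t0<..<t1}. F (\<gamma> t1) - F (\<gamma> t0) = poisson M F G (\<gamma> x) * (t1 - t0)"
  proof (rule mvt_simple[OF c(1)])
    fix x assume "t0 \<le> x" "x \<le> t1"
    then show "((\<lambda>t. F (\<gamma> t)) has_derivative (*) (poisson M F G (\<gamma> x))) (at x within {t0..t1})"
      using trajectory_derivative[OF G c(2) _ F(1), of x] by (simp add: has_field_derivative_def)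
  qed
  then obtain x where x: "x \<in> {t0<..<t1}" "F (\<gamma> t1) - F (\<gamma> t0) = poisson M F G (\<gamma> x) * (t1 - t0)" by blast
  have "1 \<le> poisson M F G (\<gamma> x) * (t1 - t0)" using F(2)[OF c(3)] F(3)[OF c(4)] x(2) by linarith
  then have "1 / (t1 - t0) \<le> poisson M F G (\<gamma> x)" using c(1) by (simp add: pos_divide_le_eq)
  moreover have "1 / L \<le> 1 / (t1 - t0)" using c(1,5) by (intro divide_left_mono) auto
  moreover have "\<gamma> x \<in> mpoints M" using trajectory_point[OF c(2)] x(1) by auto
  ultimately show ?thesis by (meson order_trans)
qed

end

section \<open>Products, the circle and its cotangent bundle\<close>

lemma second_countable_prod:
  assumes "second_countable X" "second_countable Y"
  shows "second_countable (prod_topology X Y)"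
proof -
  obtain A where A: "countable A" "\<And>V. V \<in> A \<Longrightarrow> openin X V"
    "\<And>U x. openin X U \<Longrightarrow> x \<in> U \<Longrightarrow> \<exists>V\<in>A. x \<in> V \<and> V \<subseteq> U"
    using assms(1) unfolding second_countable_def by metis
  obtain B where B: "countable B" "\<And>V. V \<in> B \<Longrightarrow> openin Y V"
    "\<And>U x. openin Y U \<Longrightarrow> x \<in> U \<Longrightarrow> \<exists>V\<in>B. x \<in> V \<and> V \<subseteq> U"
    using assms(2) unfolding second_countable_def by metis
  show ?thesis unfolding second_countable_def
  proof (intro exI[of _ "(\<lambda>(V, W). V \<times> W) ` (A \<times> B)"] conjI allI impI ballI)
    show "countable ((\<lambda>(V, W). V \<times> W) ` (A \<times> B))" using A(1) B(1) by simp
    show "openin (prod_topology X Y) V" if "V \<in> (\<lambda>(V, W). V \<times> W) ` (A \<times> B)" for V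
      using that A(2) B(2) by (auto simp: openin_prod_Times_iff)
    fix U z assume Uz: "openin (prod_topology X Y) U \<and> z \<in> U"
    obtain x y where z: "z = (x, y)" by (cases z)
    obtain V W where VW: "openin X V" "openin Y W" "x \<in> V" "y \<in> W" "V \<times> W \<subseteq> U"
      using Uz z unfolding openin_prod_topology_alt by metis
    obtain V' W' where "V' \<in> A" "x \<in> V'" "V' \<subseteq> V" "W' \<in> B" "y \<in> W'" "W' \<subseteq> W"
      using A(3)[OF VW(1,3)] B(3)[OF VW(2,4)] by blast
    then show "\<exists>V\<in>(\<lambda>(V, W). V \<times> W) ` (A \<times> B). z \<in> V \<and> V \<subseteq> U"
      using VW(5) z by (intro bexI[of _ "V' \<times> W'"]) auto
  qed
qed

lemma second_countable_euclidean: "second_countable (euclidean :: 'a::second_countable_topology topology)"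
proof -
  obtain B :: "'a set set" where B: "countable B" "topological_basis B" using ex_countable_basis by blast
  show ?thesis unfolding second_countable_def
  proof (intro exI[of _ B] conjI allI impI ballI)
    show "openin euclidean V" if "V \<in> B" for V using topological_basis_open[OF B(2) that] by simp
    fix U x assume "openin euclidean U \<and> (x::'a) \<in> U"
    then show "\<exists>V\<in>B. x \<in> V \<and> V \<subseteq> U" using topological_basisE[OF B(2), of U x] by (metis open_openin)
  qed (rule B(1))
qed

lemma mrange_prod: "mrange (prod_mfd M N) (i, j) = mrange M i \<times> mrange N j"
  by (auto simp: mrange_def prod_mfd_def image_iff)

lemma mdom_prod [simp]: "mdom (prod_mfd M N) (i, j) = mdom M i \<times> mdom N j"
  and mchart_prod [simp]: "mchart (prod_mfd M N) (i, j) z = (mchart M i (fst z), mchart N j (snd z))"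
  and mindex_prod [simp]: "mindex (prod_mfd M N) = mindex M \<times> mindex N"
  and mtop_prod [simp]: "mtop (prod_mfd M N) = prod_topology (mtop M) (mtop N)"
  by (simp_all add: prod_mfd_def map_prod_def case_prod_beta)

lemma (in smooth_mfd) chart_inj: "i \<in> mindex M \<Longrightarrow> inj_on (mchart M i) (mdom M i)"
  by (metis inj_on_inverseI mparam_mchart')

lemma mparam_prod:
  assumes "smooth_manifold M" "smooth_manifold N" "i \<in> mindex M" "j \<in> mindex N"
    and x: "x \<in> mrange M i" and y: "y \<in> mrange N j"
  shows "mparam (prod_mfd M N) (i, j) (x, y) = (mparam M i x, mparam N j y)"
proof -
  interpret M: smooth_mfd M by unfold_locales (rule assms)
  interpret N: smooth_mfd N by unfold_locales (rule assms)
  show ?thesis unfolding mparam_def[of "prod_mfd M N"]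
  proof (rule inv_into_f_eq)
    show "inj_on (mchart (prod_mfd M N) (i, j)) (mdom (prod_mfd M N) (i, j))"
      using M.chart_inj[OF assms(3)] N.chart_inj[OF assms(4)] by (auto simp: inj_on_def)
  qed (simp_all add: M.mparam_in[OF assms(3) x] N.mparam_in[OF assms(4) y]
      M.mchart_mparam[OF assms(3) x] N.mchart_mparam[OF assms(4) y])
qed

lemma transition_prod:
  assumes "smooth_manifold M" "smooth_manifold N" "i \<in> mindex M" "j \<in> mindex N"
    and "x \<in> mrange M i" "y \<in> mrange N j"
  shows "transition (prod_mfd M N) (i, j) (i', j') (x, y) = (transition M i i' x, transition N j j' y)"
  by (simp add: transition_def mparam_prod[OF assms])

lemma smooth_manifold_prod:
  fixes M :: "('i, 'a, 'e::euclidean_space, 'm) mfd_scheme" and N :: "('j, 'b, 'f::euclidean_space, 'n) mfd_scheme"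
  assumes M: "smooth_manifold M" and N: "smooth_manifold N"
  shows "smooth_manifold (prod_mfd M N)"
proof -
  interpret M: smooth_mfd M by unfold_locales (rule M)
  interpret N: smooth_mfd N by unfold_locales (rule N)
  have sc: "second_countable (prod_topology (mtop M) (mtop N))"
    by (rule second_countable_prod) (use M N in \<open>auto simp: smooth_manifold_def\<close>)
  show ?thesis unfolding smooth_manifold_def
  proof (intro conjI ballI)
    show "mpoints (prod_mfd M N) \<noteq> {}" using M.nonempty N.nonempty by simp
    show "Hausdorff_space (mtop (prod_mfd M N))" using M.Hausdorff N.Hausdorff by (simp add: Hausdorff_space_prod_topology)
    show "second_countable (mtop (prod_mfd M N))" using sc by simp
    show "(\<Union>ij\<in>mindex (prod_mfd M N). mdom (prod_mfd M N) ij) = mpoints (prod_mfd M N)"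
      using M.chart_cover N.chart_cover by fastforce
  next
    fix ij assume "ij \<in> mindex (prod_mfd M N)"
    then obtain i j where ij: "ij = (i, j)" and i: "i \<in> mindex M" and j: "j \<in> mindex N" by auto
    show "openin (mtop (prod_mfd M N)) (mdom (prod_mfd M N) ij)"
      using M.openin_mdom[OF i] N.openin_mdom[OF j] by (simp add: ij openin_prod_Times_iff)
    show "open (mrange (prod_mfd M N) ij)"
      using M.open_mrange[OF i] N.open_mrange[OF j] by (simp add: ij mrange_prod open_Times)
    obtain f where f: "homeomorphic_maps (subtopology (mtop M) (mdom M i)) (top_of_set (mrange M i)) (mchart M i) f"
      using M.chart_homeomorphic[OF i] homeomorphic_map_maps by blast
    obtain g where g: "homeomorphic_maps (subtopology (mtop N) (mdom N j)) (top_of_set (mrange N j)) (mchart N j) g"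
      using N.chart_homeomorphic[OF j] homeomorphic_map_maps by blast
    have "homeomorphic_maps (prod_topology (subtopology (mtop M) (mdom M i)) (subtopology (mtop N) (mdom N j)))
        (prod_topology (top_of_set (mrange M i)) (top_of_set (mrange N j)))
        (\<lambda>(x, y). (mchart M i x, mchart N j y)) (\<lambda>(x, y). (f x, g y))"
      by (rule homeomorphic_maps_prod[THEN iffD2]) (use f g in blast)
    then have "homeomorphic_map (prod_topology (subtopology (mtop M) (mdom M i)) (subtopology (mtop N) (mdom N j)))
        (prod_topology (top_of_set (mrange M i)) (top_of_set (mrange N j))) (\<lambda>(x, y). (mchart M i x, mchart N j y))"
      using homeomorphic_map_maps by blast
    moreover have "(\<lambda>(x, y). (mchart M i x, mchart N j y)) = mchart (prod_mfd M N) ij"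
      by (auto simp: ij prod_mfd_def)
    ultimately show "homeomorphic_map (subtopology (mtop (prod_mfd M N)) (mdom (prod_mfd M N) ij))
        (top_of_set (mrange (prod_mfd M N) ij)) (mchart (prod_mfd M N) ij)"
      by (simp only: ij mtop_prod mdom_prod mrange_prod subtopology_Times prod_topology_subtopology_eu)
  next
    fix ij kl assume "ij \<in> mindex (prod_mfd M N)" "kl \<in> mindex (prod_mfd M N)"
    then obtain i j k l where ij: "ij = (i, j)" and kl: "kl = (k, l)"
      and i: "i \<in> mindex M" and j: "j \<in> mindex N" and k: "k \<in> mindex M" and l: "l \<in> mindex N" by auto
    let ?A = "mchart M i ` (mdom M i \<inter> mdom M k)" and ?B = "mchart N j ` (mdom N j \<inter> mdom N l)"
    have AB: "mchart (prod_mfd M N) ij ` (mdom (prod_mfd M N) ij \<inter> mdom (prod_mfd M N) kl) = ?A \<times> ?B"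
    proof (intro equalityI subsetI)
      fix z assume "z \<in> ?A \<times> ?B"
      then obtain x y where "x \<in> mdom M i \<inter> mdom M k" "y \<in> mdom N j \<inter> mdom N l" "z = (mchart M i x, mchart N j y)"
        by blast
      then show "z \<in> mchart (prod_mfd M N) ij ` (mdom (prod_mfd M N) ij \<inter> mdom (prod_mfd M N) kl)"
        by (intro image_eqI[of _ _ "(x, y)"]) (auto simp: ij kl)
    qed (auto simp: ij kl)
    have A: "open ?A" by (rule open_overlap[OF M i k])
    have B: "open ?B" by (rule open_overlap[OF N j l])
    have sub: "?A \<subseteq> mrange M i" "?B \<subseteq> mrange N j" by (auto simp: mrange_def)
    have 1: "smooth_on (?A \<times> ?B) (\<lambda>z. transition M i k (fst z))"
      by (rule smooth_on_compose[OF _ _ M.transition_smooth[OF i k] smooth_on_bounded_linear[OF _ bounded_linear_fst]])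
        (use A B in \<open>auto simp: open_Times\<close>)
    have 2: "smooth_on (?A \<times> ?B) (\<lambda>z. transition N j l (snd z))"
      by (rule smooth_on_compose[OF _ _ N.transition_smooth[OF j l] smooth_on_bounded_linear[OF _ bounded_linear_snd]])
        (use A B in \<open>auto simp: open_Times\<close>)
    have "smooth_on (?A \<times> ?B) (\<lambda>z. (transition M i k (fst z), transition N j l (snd z)))"
      by (rule smooth_on_Pair[OF _ 1 2]) (use A B in \<open>simp add: open_Times\<close>)
    moreover have "transition (prod_mfd M N) ij kl z = (transition M i k (fst z), transition N j l (snd z))"
      if "z \<in> ?A \<times> ?B" for z
    proof -
      have "fst z \<in> mrange M i" "snd z \<in> mrange N j" using that sub mem_Times_iff by blast+
      then have "transition (prod_mfd M N) (i, j) (k, l) (fst z, snd z) = (transition M i k (fst z), transition N j l (snd z))"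
        by (rule transition_prod[OF M N i j])
      then show ?thesis by (simp only: ij kl prod.collapse)
    qed
    ultimately show "smooth_on (mchart (prod_mfd M N) ij ` (mdom (prod_mfd M N) ij \<inter> mdom (prod_mfd M N) kl))
        (transition (prod_mfd M N) ij kl)"
      unfolding AB by (rule smooth_on_cong[OF open_Times[OF A B], THEN iffD2, rotated])
  qed
qed

section \<open>The circle and the line as manifolds\<close>

lemma circ_eq_iff: "circ x = circ y \<longleftrightarrow> x - y \<in> \<int>"
  by (rule circle.abs_eq_iff)

lemma circ_cases: obtains x where "s = circ x"
  by (metis Quotient3_abs_rep Quotient3_circle)

lemma circ_add_int: "circ (x + of_int n) = circ x"
  by (simp add: circ_eq_iff)

lemma topspace_circle: "topspace circle_topology = UNIV"
proof -
  have "openin circle_topology UNIV" by (simp add: openin_circle_topology)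
  then show ?thesis using openin_subset by blast
qed

lemma continuous_circ: "continuous_map euclideanreal circle_topology circ"
  unfolding continuous_map by (auto simp: openin_circle_topology topspace_circle vimage_def)

text \<open>The preimage of the image is the union of the integer translates of
  \<open>U\<close>.\<close>

lemma open_circ_image:
  assumes "open U" shows "openin circle_topology (circ ` U)"
proof -
  have "circ -` circ ` U = (\<Union>n::int. (\<lambda>x. x + of_int n) ` U)"
  proof (intro equalityI subsetI)
    fix x assume "x \<in> circ -` circ ` U"
    then obtain u where u: "u \<in> U" "circ x = circ u" by auto
    then obtain n where "x - u = of_int n" by (auto simp: circ_eq_iff elim: Ints_cases)
    then have "x = u + of_int n" by simp
    then show "x \<in> (\<Union>n::int. (\<lambda>x. x + of_int n) ` U)" using u(1) by blast
  qed (auto simp: circ_add_int)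
  moreover have "(\<lambda>x. x + of_int n) ` U = (+) (of_int n) ` U" for n :: int
    by (auto simp: add.commute)
  then have "open (\<Union>n::int. (\<lambda>x. x + of_int n) ` U)"
    using open_translation[OF assms] by (intro open_UN) simp
  ultimately show ?thesis by (simp add: openin_circle_topology)
qed

lemma circ_inj_on: "inj_on circ {a - 1/2<..<a + 1/2}"
proof (rule inj_onI)
  fix x y assume xy: "x \<in> {a - 1/2<..<a + 1/2}" "y \<in> {a - 1/2<..<a + 1/2}" "circ x = circ y"
  then obtain n where n: "x - y = of_int n" by (auto simp: circ_eq_iff elim: Ints_cases)
  have "\<bar>x - y\<bar> < 1" using xy by auto
  then have "\<bar>real_of_int n\<bar> < 1" using n by simp
  then have "n = 0" by linarith
  then show "x = y" using n by simp
qed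

lemma mdom_circle [simp]: "mdom circle_mfd a = circ ` {a - 1/2<..<a + 1/2}"
  and mindex_circle [simp]: "mindex circle_mfd = UNIV"
  and mtop_circle [simp]: "mtop circle_mfd = circle_topology"
  by (simp_all add: circle_mfd_def)

lemma mchart_circle: "x \<in> {a - 1/2<..<a + 1/2} \<Longrightarrow> mchart circle_mfd a (circ x) = x"
  by (simp add: circle_mfd_def inv_into_f_f[OF circ_inj_on])

lemma mrange_circle: "mrange circle_mfd a = {a - 1/2<..<a + 1/2}"
  using mchart_circle by (force simp: mrange_def)

lemma mparam_circle:
  assumes "x \<in> {a - 1/2<..<a + 1/2}"
  shows "mparam circle_mfd a x = circ x"
  unfolding mparam_def
proof (rule inv_into_f_eq)
  show "inj_on (mchart circle_mfd a) (mdom circle_mfd a)"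
    using mchart_circle by (intro inj_onI) auto
qed (use assms mchart_circle in auto)

text \<open>The overlap of two arcs can have two components, on which the transition maps are
  translations by different integers; hence the local form.\<close>

lemma transition_circle_local:
  assumes x: "x \<in> mchart circle_mfd a ` (mdom circle_mfd a \<inter> mdom circle_mfd b)"
  obtains U n where "open U" "x \<in> U" "U \<subseteq> {a - 1/2<..<a + 1/2}"
    "\<And>y. y \<in> U \<Longrightarrow> transition circle_mfd a b y = y + of_int n"
proof -
  obtain q where q: "q \<in> mdom circle_mfd a" "q \<in> mdom circle_mfd b" "x = mchart circle_mfd a q"
    using x by blast
  then obtain t where t: "t \<in> {a - 1/2<..<a + 1/2}" "q = circ t" by auto
  then have t: "t \<in> {a - 1/2<..<a + 1/2}" "circ t \<in> mdom circle_mfd b" "x = t"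
    using q mchart_circle[of t a] by auto
  then obtain s where s: "s \<in> {b - 1/2<..<b + 1/2}" "circ t = circ s" by auto
  then obtain n where n: "s - t = of_int n" using circ_eq_iff[of s t] by (auto elim: Ints_cases)
  define U where "U = {a - 1/2<..<a + 1/2} \<inter> {b - 1/2 - of_int n<..<b + 1/2 - of_int n}"
  show thesis
  proof (rule that[of U n])
    show "open U" by (simp add: U_def open_Int)
    show "x \<in> U" using t s n by (auto simp: U_def)
    show "U \<subseteq> {a - 1/2<..<a + 1/2}" by (auto simp: U_def)
    fix y assume y: "y \<in> U"
    then have "mparam circle_mfd a y = circ (y + of_int n)" by (simp add: mparam_circle U_def circ_add_int)
    moreover have "mchart circle_mfd b (circ (y + of_int n)) = y + of_int n"
      by (rule mchart_circle) (use y in \<open>auto simp: U_def\<close>)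
    ultimately show "transition circle_mfd a b y = y + of_int n" by (simp add: transition_def)
  qed
qed

lemma Hausdorff_circle: "Hausdorff_space circle_topology"
  unfolding Hausdorff_space_def
proof (intro allI impI)
  fix s s' assume "s \<in> topspace circle_topology \<and> s' \<in> topspace circle_topology \<and> s \<noteq> s'"
  then have ne: "s \<noteq> s'" by blast
  obtain x y where xy: "s = circ x" "s' = circ y" using circ_cases by metis
  define d where "d = frac (x - y)"
  have "x - y \<notin> \<int>" using ne xy by (simp add: circ_eq_iff)
  then have d: "0 < d" "d < 1" using frac_lt_1[of "x - y"] frac_gt_0_iff[of "x - y"] by (auto simp: d_def)
  \<comment> \<open>\<open>2 * \<epsilon>\<close> is the distance from \<open>x - y\<close> to the
    nearest integer. A common point of the two arcs would produce the integer \<open>u - v\<close>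
    closer than that.\<close>
  define \<epsilon> where "\<epsilon> = min d (1 - d) / 2"
  have \<epsilon>: "\<epsilon> > 0" "2 * \<epsilon> \<le> d" "2 * \<epsilon> \<le> 1 - d" using d by (auto simp: \<epsilon>_def)
  have "disjnt (circ ` ball x \<epsilon>) (circ ` ball y \<epsilon>)"
  proof (rule ccontr)
    assume "\<not> disjnt (circ ` ball x \<epsilon>) (circ ` ball y \<epsilon>)"
    then obtain u v where uv: "u \<in> ball x \<epsilon>" "v \<in> ball y \<epsilon>" "circ u = circ v" by (auto simp: disjnt_def)
    then obtain n where n: "u - v = of_int n" by (auto simp: circ_eq_iff elim: Ints_cases)
    have "\<bar>(x - y) - (u - v)\<bar> < 2 * \<epsilon>" using uv by (auto simp: dist_real_def)
    moreover have "x - y = of_int \<lfloor>x - y\<rfloor> + d" by (simp add: d_def frac_def)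
    moreover define m where "m = \<lfloor>x - y\<rfloor> - n"
    ultimately have "\<bar>real_of_int m + d\<bar> < 2 * \<epsilon>" using n by simp
    then have "real_of_int m < real_of_int 0" "real_of_int (- 1) < real_of_int m" using \<epsilon> by simp_all
    then show False unfolding of_int_less_iff by linarith
  qed
  then show "\<exists>U V. openin circle_topology U \<and> openin circle_topology V \<and> s \<in> U \<and> s' \<in> V \<and> disjnt U V"
    using \<epsilon>(1) xy by (intro exI[of _ "circ ` ball x \<epsilon>"] exI[of _ "circ ` ball y \<epsilon>"]) (auto intro!: open_circ_image)
qed

lemma smooth_manifold_circle: "smooth_manifold circle_mfd"
  unfolding smooth_manifold_def
proof (intro conjI ballI)
  show "mpoints circle_mfd \<noteq> {}" by (simp add: topspace_circle)
  show "Hausdorff_space (mtop circle_mfd)" using Hausdorff_circle by simp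
  have om: "open_map euclideanreal circle_topology circ" using open_circ_image by (simp add: open_map_def)
  have "circ ` UNIV = UNIV" using circ_cases by blast
  then show "second_countable (mtop circle_mfd)"
    using second_countable_open_map_image[OF continuous_circ om] second_countable_euclidean
    by (simp add: topspace_circle)
  have "s \<in> (\<Union>a. circ ` {a - 1/2<..<a + 1/2})" for s
  proof -
    obtain x where "s = circ x" using circ_cases by blast
    then show ?thesis by (intro UN_I[of x]) auto
  qed
  then show "(\<Union>a\<in>mindex circle_mfd. mdom circle_mfd a) = mpoints circle_mfd" by (auto simp: topspace_circle)
next
  fix a :: real
  let ?I = "{a - 1/2<..<a + 1/2}"
  show "openin (mtop circle_mfd) (mdom circle_mfd a)" by (simp add: open_circ_image)
  show "open (mrange circle_mfd a)" by (simp add: mrange_circle)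
  have "homeomorphic_map (top_of_set ?I) (subtopology circle_topology (circ ` ?I)) circ"
  proof (rule bijective_open_imp_homeomorphic_map)
    show "continuous_map (top_of_set ?I) (subtopology circle_topology (circ ` ?I)) circ"
      using continuous_map_from_subtopology[OF continuous_circ, of ?I]
      by (auto simp: continuous_map_in_subtopology)
    show "open_map (top_of_set ?I) (subtopology circle_topology (circ ` ?I)) circ"
    proof (rule open_map_into_subtopology)
      show "open_map (top_of_set ?I) circle_topology circ"
        unfolding open_map_def
      proof (intro allI impI open_circ_image)
        show "open U" if "openin (top_of_set ?I) U" for U by (rule openin_open_trans[OF that]) simp
      qed
    qed auto
  qed (auto simp: topspace_circle circ_inj_on)
  then obtain g where g: "homeomorphic_maps (top_of_set ?I) (subtopology circle_topology (circ ` ?I)) circ g"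
    using homeomorphic_map_maps by blast
  then have "homeomorphic_map (subtopology circle_topology (circ ` ?I)) (top_of_set ?I) g"
    by (simp add: homeomorphic_maps_map)
  then have "homeomorphic_map (subtopology circle_topology (circ ` ?I)) (top_of_set ?I) (mchart circle_mfd a)"
  proof (rule homeomorphic_map_eq)
    fix s assume "s \<in> topspace (subtopology circle_topology (circ ` ?I))"
    then obtain x where x: "x \<in> ?I" "s = circ x" by auto
    then have "g s = x" using g by (simp add: homeomorphic_maps_map)
    then show "g s = mchart circle_mfd a s" using x mchart_circle by simp
  qed
  then show "homeomorphic_map (subtopology (mtop circle_mfd) (mdom circle_mfd a))
      (top_of_set (mrange circle_mfd a)) (mchart circle_mfd a)"
    by (simp add: mrange_circle)
next
  fix a b :: real
  show "smooth_on (mchart circle_mfd a ` (mdom circle_mfd a \<inter> mdom circle_mfd b)) (transition circle_mfd a b)"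
  proof (rule smooth_on_local)
    fix x assume "x \<in> mchart circle_mfd a ` (mdom circle_mfd a \<inter> mdom circle_mfd b)"
    then obtain U n where U: "open U" "x \<in> U" "\<And>y. y \<in> U \<Longrightarrow> transition circle_mfd a b y = y + of_int n"
      using transition_circle_local by metis
    have "smooth_on U (\<lambda>y. y + of_int n)"
      by (intro smooth_on_add smooth_on_const U(1) smooth_on_bounded_linear bounded_linear_ident)
    then have "smooth_on U (transition circle_mfd a b)"
      by (rule smooth_on_cong[OF U(1), THEN iffD2, rotated]) (rule U(3))
    then show "\<exists>U. open U \<and> x \<in> U \<and> smooth_on U (transition circle_mfd a b)" using U by blast
  qed
qed

lemma line_simps [simp]: "mtop line_mfd = euclidean" "mindex line_mfd = UNIV" "mdom line_mfd i = UNIV"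
  "mchart line_mfd i x = x" "mrange line_mfd i = UNIV" "mparam line_mfd i x = x" "transition line_mfd i j x = x"
proof -
  have c: "mchart line_mfd i = (\<lambda>x. x)" "mdom line_mfd i = UNIV" for i by (simp_all add: line_mfd_def)
  have "mparam line_mfd i y = y" for i y
    unfolding mparam_def c by (rule inv_into_f_eq) auto
  then show "mparam line_mfd i x = x" "transition line_mfd i j x = x" by (simp_all add: transition_def c)
qed (auto simp: line_mfd_def mrange_def)

lemma smooth_manifold_line: "smooth_manifold line_mfd"
proof -
  have 1: "mchart line_mfd i = (\<lambda>x. x)" "transition line_mfd i j = (\<lambda>x. x)" for i j by auto
  have "homeomorphic_map euclideanreal euclideanreal (\<lambda>x. x)"
    using homeomorphic_map_id[of euclideanreal euclideanreal] by (simp add: id_def)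
  then show ?thesis
    unfolding smooth_manifold_def
    by (auto simp: 1 second_countable_euclidean Hausdorff_space_euclidean
        intro!: smooth_on_bounded_linear bounded_linear_ident)
qed

text \<open>Carries the result for product manifolds over to the records extended by a 2-form, which
  have another type but the same underlying fields.\<close>

lemma smooth_manifold_transfer:
  assumes "smooth_manifold M" "mtop M' = mtop M" "mindex M' = mindex M" "mdom M' = mdom M" "mchart M' = mchart M"
  shows "smooth_manifold M'"
  using assms by (simp add: smooth_manifold_def mrange_def transition_def mparam_def)

section \<open>Products of symplectic manifolds\<close>

lemma prod_sympl_simps [simp]:
  "mtop (prod_sympl M N) = mtop (prod_mfd M N)"
  "mindex (prod_sympl M N) = mindex (prod_mfd M N)"
  "mdom (prod_sympl M N) = mdom (prod_mfd M N)"
  "mchart (prod_sympl M N) = mchart (prod_mfd M N)"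
  "mrange (prod_sympl M N) = mrange (prod_mfd M N)"
  "mparam (prod_sympl M N) = mparam (prod_mfd M N)"
  "transition (prod_sympl M N) = transition (prod_mfd M N)"
  by (auto simp: prod_sympl_def mfd.extend_def mrange_def mparam_def transition_def fun_eq_iff)

lemma sform_prod:
  "sform (prod_sympl M N) (i, j) z u v =
    sform M i (fst z) (fst u) (fst v) + sform N j (snd z) (snd u) (snd v)"
  by (simp add: prod_sympl_def mfd.extend_def case_prod_beta)

lemma cotangent_circle_simps [simp]:
  "mtop cotangent_circle = mtop (prod_mfd line_mfd circle_mfd)"
  "mindex cotangent_circle = mindex (prod_mfd line_mfd circle_mfd)"
  "mdom cotangent_circle = mdom (prod_mfd line_mfd circle_mfd)"
  "mchart cotangent_circle = mchart (prod_mfd line_mfd circle_mfd)"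
  "mrange cotangent_circle = mrange (prod_mfd line_mfd circle_mfd)"
  "mparam cotangent_circle = mparam (prod_mfd line_mfd circle_mfd)"
  "transition cotangent_circle = transition (prod_mfd line_mfd circle_mfd)"
  by (auto simp: cotangent_circle_def mfd.extend_def mrange_def mparam_def transition_def fun_eq_iff)

lemma sform_cotangent_circle:
  "sform cotangent_circle i z u v = fst u * snd v - fst v * snd u"
  by (simp add: cotangent_circle_def mfd.extend_def case_prod_beta)

lemma has_derivative_prod_fst_snd:
  assumes "(f has_derivative f') (at x)" "(g has_derivative g') (at y)"
  shows "((\<lambda>z. (f (fst z), g (snd z))) has_derivative (\<lambda>h. (f' (fst h), g' (snd h)))) (at (x, y))"
proof -
  have "((\<lambda>z. f (fst z)) has_derivative (\<lambda>h. f' (fst h))) (at (x, y))"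
    by (rule has_derivative_compose[OF has_derivative_fst[OF has_derivative_ident]]) (use assms in simp)
  moreover have "((\<lambda>z. g (snd z)) has_derivative (\<lambda>h. g' (snd h))) (at (x, y))"
    by (rule has_derivative_compose[OF has_derivative_snd[OF has_derivative_ident]]) (use assms in simp)
  ultimately show ?thesis by (rule has_derivative_Pair)
qed

lemma frechet_derivative_fst_plus_snd:
  fixes f :: "'e::euclidean_space \<Rightarrow> real" and g :: "'f::euclidean_space \<Rightarrow> real"
  assumes "f differentiable (at x)" "g differentiable (at y)"
  shows "frechet_derivative (\<lambda>z. f (fst z) + g (snd z)) (at (x, y)) h =
    frechet_derivative f (at x) (fst h) + frechet_derivative g (at y) (snd h)"
proof -
  let ?p = "\<lambda>z::real \<times> real. fst z + snd z"
  have "(?p has_derivative ?p) (at (f x, g y))"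
    by (intro bounded_linear_imp_has_derivative bounded_linear_add bounded_linear_fst bounded_linear_snd)
  then have "((\<lambda>z. ?p (f (fst z), g (snd z))) has_derivative
      (\<lambda>h. ?p (frechet_derivative f (at x) (fst h), frechet_derivative g (at y) (snd h)))) (at (x, y))"
    by (intro has_derivative_compose[OF has_derivative_prod_fst_snd])
      (use assms frechet_derivative_works in auto)
  then show ?thesis by (simp add: frechet_derivative_at[symmetric])
qed

lemma transition_prod_derivative:
  fixes M :: "('i, 'a, 'e::euclidean_space, 'm) mfd_scheme" and N :: "('j, 'b, 'f::euclidean_space, 'n) mfd_scheme"
  assumes M: "smooth_manifold M" and N: "smooth_manifold N"
    and i: "i \<in> mindex M" and j: "j \<in> mindex N" and k: "k \<in> mindex M" and l: "l \<in> mindex N"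
    and p: "p \<in> mdom M i \<inter> mdom M k" and q: "q \<in> mdom N j \<inter> mdom N l"
  shows "frechet_derivative (transition (prod_mfd M N) (i, j) (k, l)) (at (mchart M i p, mchart N j q)) h =
    (frechet_derivative (transition M i k) (at (mchart M i p)) (fst h),
     frechet_derivative (transition N j l) (at (mchart N j q)) (snd h))"
proof -
  interpret M: smooth_mfd M by unfold_locales (rule M)
  interpret N: smooth_mfd N by unfold_locales (rule N)
  have o: "open (mrange M i \<times> mrange N j)" by (intro open_Times M.open_mrange N.open_mrange i j)
  have "((\<lambda>z. (transition M i k (fst z), transition N j l (snd z))) has_derivative
    (\<lambda>h. (frechet_derivative (transition M i k) (at (mchart M i p)) (fst h),
     frechet_derivative (transition N j l) (at (mchart N j q)) (snd h)))) (at (mchart M i p, mchart N j q))"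
    by (rule has_derivative_prod_fst_snd[OF transition_derivative[OF M i k p] transition_derivative[OF N j l q]])
  then have "(transition (prod_mfd M N) (i, j) (k, l) has_derivative
    (\<lambda>h. (frechet_derivative (transition M i k) (at (mchart M i p)) (fst h),
     frechet_derivative (transition N j l) (at (mchart N j q)) (snd h)))) (at (mchart M i p, mchart N j q))"
    by (rule has_derivative_transform_within_open[OF _ o])
      (use p q in \<open>auto simp: transition_prod[OF M N i j] M.mchart_in[OF i] N.mchart_in[OF j]\<close>)
  then show ?thesis by (simp add: frechet_derivative_at[symmetric])
qed

lemma symplectic_manifold_prod:
  fixes M :: "('i, 'a, 'e::euclidean_space, 'm) sympl_scheme" and N :: "('j, 'b, 'f::euclidean_space, 'n) sympl_scheme"
  assumes M: "symplectic_manifold M" and N: "symplectic_manifold N"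
  shows "symplectic_manifold (prod_sympl M N)"
proof -
  interpret M: sympl_mfd M by unfold_locales (rule M)
  interpret N: sympl_mfd N by unfold_locales (rule N)
  have sM: "smooth_manifold M" and sN: "smooth_manifold N" by (rule M.M N.M)+
  have c1: "smooth_on (mrange M i \<times> mrange N j) (\<lambda>z. sform M i (fst z) u v)" if ij: "i \<in> mindex M" "j \<in> mindex N" for i j u v
    by (rule smooth_on_compose[OF _ _ M.sform_smooth[OF ij(1)] smooth_on_bounded_linear[OF _ bounded_linear_fst]])
      (use M.open_mrange[OF ij(1)] N.open_mrange[OF ij(2)] in \<open>auto simp: open_Times\<close>)
  have c2: "smooth_on (mrange M i \<times> mrange N j) (\<lambda>z. sform N j (snd z) u v)" if ij: "i \<in> mindex M" "j \<in> mindex N" for i j u v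
    by (rule smooth_on_compose[OF _ _ N.sform_smooth[OF ij(2)] smooth_on_bounded_linear[OF _ bounded_linear_snd]])
      (use M.open_mrange[OF ij(1)] N.open_mrange[OF ij(2)] in \<open>auto simp: open_Times\<close>)
  have twM: "two_form M" and twN: "two_form N" using M N by (simp_all add: symplectic_manifold_def)
  have tM: "sform M i (mchart M i p) u v = sform M k (mchart M k p)
      (frechet_derivative (transition M i k) (at (mchart M i p)) u) (frechet_derivative (transition M i k) (at (mchart M i p)) v)"
    if "i \<in> mindex M" "k \<in> mindex M" "p \<in> mdom M i \<inter> mdom M k" for i k p u v
    by (rule two_form_transition[OF twM that])
  have tN: "sform N i (mchart N i p) u v = sform N k (mchart N k p)
      (frechet_derivative (transition N i k) (at (mchart N i p)) u) (frechet_derivative (transition N i k) (at (mchart N i p)) v)"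
    if "i \<in> mindex N" "k \<in> mindex N" "p \<in> mdom N i \<inter> mdom N k" for i k p u v
    by (rule two_form_transition[OF twN that])
  have "smooth_manifold (prod_sympl M N)"
    by (rule smooth_manifold_transfer[OF smooth_manifold_prod[OF sM sN]]) simp_all
  moreover have "two_form (prod_sympl M N)"
    unfolding two_form_def Let_def
  proof (intro conjI ballI allI)
    fix ij z assume ij: "ij \<in> mindex (prod_sympl M N)" and z: "z \<in> mrange (prod_sympl M N) ij"
    obtain i j where ij': "ij = (i, j)" by (cases ij)
    have i: "i \<in> mindex M" "fst z \<in> mrange M i" and j: "j \<in> mindex N" "snd z \<in> mrange N j"
      using ij z by (auto simp: ij' mrange_prod)
    have bM: "linear (sform M i (fst z) u)" "linear (\<lambda>u. sform M i (fst z) u v)"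
      and bN: "linear (sform N j (snd z) u')" "linear (\<lambda>u. sform N j (snd z) u v')" for u v u' v'
      using M.sform_bilinear[OF i] N.sform_bilinear[OF j] by (auto simp: bilinear_def)
    show "bilinear (sform (prod_sympl M N) ij z)"
      unfolding bilinear_def ij' sform_prod
      using linear_compose_add[OF linear_compose[OF linear_fst bM(1)] linear_compose[OF linear_snd bN(1)]]
        linear_compose_add[OF linear_compose[OF linear_fst bM(2)] linear_compose[OF linear_snd bN(2)]]
      by (simp add: o_def ij' sform_prod[abs_def])
    show "sform (prod_sympl M N) ij z u u = 0" for u
      by (simp add: ij' sform_prod M.sform_alternating[OF i] N.sform_alternating[OF j])
  next
    fix ij u v assume "ij \<in> mindex (prod_sympl M N)"
    then obtain i j where ij: "ij = (i, j)" "i \<in> mindex M" "j \<in> mindex N" by auto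
    show "smooth_on (mrange (prod_sympl M N) ij) (\<lambda>z. sform (prod_sympl M N) ij z u v)"
      unfolding ij sform_prod prod_sympl_simps mrange_prod
      by (rule smooth_on_add[OF _ c1[OF ij(2,3)] c2[OF ij(2,3)]])
        (intro open_Times M.open_mrange N.open_mrange ij)
  next
    fix ij kl z u v
    assume ij: "ij \<in> mindex (prod_sympl M N)" and kl: "kl \<in> mindex (prod_sympl M N)"
      and z: "z \<in> mdom (prod_sympl M N) ij \<inter> mdom (prod_sympl M N) kl"
    obtain i j k l where ij': "ij = (i, j)" and kl': "kl = (k, l)" by (cases ij, cases kl)
    have i: "i \<in> mindex M" "k \<in> mindex M" "fst z \<in> mdom M i \<inter> mdom M k"
      and j: "j \<in> mindex N" "l \<in> mindex N" "snd z \<in> mdom N j \<inter> mdom N l"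
      using ij kl z by (auto simp: ij' kl')
    show "sform (prod_sympl M N) ij (mchart (prod_sympl M N) ij z) u v =
        sform (prod_sympl M N) kl (mchart (prod_sympl M N) kl z)
         (frechet_derivative (transition (prod_sympl M N) ij kl) (at (mchart (prod_sympl M N) ij z)) u)
         (frechet_derivative (transition (prod_sympl M N) ij kl) (at (mchart (prod_sympl M N) ij z)) v)"
      unfolding ij' kl' prod_sympl_simps mchart_prod sform_prod
        transition_prod_derivative[OF sM sN i(1) j(1) i(2) j(2) i(3) j(3)] fst_conv snd_conv
      by (simp only: tM[OF i, symmetric] tN[OF j, symmetric])
  qed
  moreover have "closed_form (prod_sympl M N)"
    unfolding closed_form_def
  proof (intro ballI allI)
    fix ij z u v w assume ij: "ij \<in> mindex (prod_sympl M N)" and z: "z \<in> mrange (prod_sympl M N) ij"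
    obtain i j where ij': "ij = (i, j)" by (cases ij)
    have i: "i \<in> mindex M" "fst z \<in> mrange M i" and j: "j \<in> mindex N" "snd z \<in> mrange N j"
      using ij z by (auto simp: ij' mrange_prod)
    have d: "frechet_derivative (\<lambda>y. sform (prod_sympl M N) ij y a b) (at z) c =
        frechet_derivative (\<lambda>y. sform M i y (fst a) (fst b)) (at (fst z)) (fst c) +
        frechet_derivative (\<lambda>y. sform N j y (snd a) (snd b)) (at (snd z)) (snd c)" for a b c
      using frechet_derivative_fst_plus_snd[OF smooth_on_differentiable[OF M.sform_smooth[OF i(1)] i(2)]
          smooth_on_differentiable[OF N.sform_smooth[OF j(1)] j(2)]]
      by (simp add: ij' sform_prod)
    have "closed_form M" "closed_form N" using M N by (auto simp: symplectic_manifold_def)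
    then have cM: "frechet_derivative (\<lambda>y. sform M i y (fst v) (fst w)) (at (fst z)) (fst u)
        + frechet_derivative (\<lambda>y. sform M i y (fst w) (fst u)) (at (fst z)) (fst v)
        + frechet_derivative (\<lambda>y. sform M i y (fst u) (fst v)) (at (fst z)) (fst w) = 0"
      and cN: "frechet_derivative (\<lambda>y. sform N j y (snd v) (snd w)) (at (snd z)) (snd u)
        + frechet_derivative (\<lambda>y. sform N j y (snd w) (snd u)) (at (snd z)) (snd v)
        + frechet_derivative (\<lambda>y. sform N j y (snd u) (snd v)) (at (snd z)) (snd w) = 0"
      using i j unfolding closed_form_def by blast+
    show "frechet_derivative (\<lambda>y. sform (prod_sympl M N) ij y v w) (at z) u
      + frechet_derivative (\<lambda>y. sform (prod_sympl M N) ij y w u) (at z) v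
      + frechet_derivative (\<lambda>y. sform (prod_sympl M N) ij y u v) (at z) w = 0"
      unfolding d using cM cN by linarith
  qed
  moreover have "nondegenerate_form (prod_sympl M N)"
    unfolding nondegenerate_form_def
  proof (intro ballI allI impI)
    fix ij z u assume ij: "ij \<in> mindex (prod_sympl M N)" and z: "z \<in> mrange (prod_sympl M N) ij"
      and 0: "\<forall>v. sform (prod_sympl M N) ij z u v = 0"
    obtain i j where ij': "ij = (i, j)" by (cases ij)
    have i: "i \<in> mindex M" "fst z \<in> mrange M i" and j: "j \<in> mindex N" "snd z \<in> mrange N j"
      using ij z by (auto simp: ij' mrange_prod)
    have l: "linear (sform M i (fst z) a)" "linear (sform N j (snd z) b)" for a b
      using M.sform_bilinear[OF i] N.sform_bilinear[OF j] by (auto simp: bilinear_def)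
    have "sform M i (fst z) (fst u) a = 0" for a
      using 0[rule_format, of "(a, 0)"] by (simp add: ij' sform_prod linear_0[OF l(2)])
    then have "fst u = 0" using M.sform_nondegenerate[OF i] by blast
    moreover have "sform N j (snd z) (snd u) b = 0" for b
      using 0[rule_format, of "(0, b)"] by (simp add: ij' sform_prod linear_0[OF l(1)])
    then have "snd u = 0" using N.sform_nondegenerate[OF j] by blast
    ultimately show "u = 0" by (simp add: prod_eq_iff)
  qed
  ultimately show ?thesis by (simp add: symplectic_manifold_def)
qed

text \<open>Transition maps are locally translations. A form with constant coefficients in the angle
  coordinate is therefore independent of the chart.\<close>

lemma transition_circle_derivative:
  assumes "x \<in> mdom circle_mfd a \<inter> mdom circle_mfd b"
  shows "frechet_derivative (transition circle_mfd a b) (at (mchart circle_mfd a x)) h = h"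
proof -
  obtain U n where U: "open U" "mchart circle_mfd a x \<in> U"
    "\<And>y. y \<in> U \<Longrightarrow> transition circle_mfd a b y = y + of_int n"
    using transition_circle_local[OF imageI[OF assms]] by metis
  have "((\<lambda>y. y + of_int n) has_derivative (\<lambda>h. h)) (at (mchart circle_mfd a x))"
    by (auto intro!: derivative_eq_intros)
  then have "(transition circle_mfd a b has_derivative (\<lambda>h. h)) (at (mchart circle_mfd a x))"
    by (rule has_derivative_transform_within_open[OF _ U(1,2)]) (simp add: U(3))
  then show ?thesis by (simp add: frechet_derivative_at[symmetric])
qed

lemma symplectic_manifold_cotangent_circle: "symplectic_manifold cotangent_circle"
proof -
  have sl: "smooth_manifold line_mfd" and sc: "smooth_manifold circle_mfd"
    by (rule smooth_manifold_line smooth_manifold_circle)+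
  have "smooth_manifold cotangent_circle"
    by (rule smooth_manifold_transfer[OF smooth_manifold_prod[OF sl sc]]) simp_all
  moreover have "two_form cotangent_circle"
    unfolding two_form_def Let_def
  proof (intro conjI ballI allI)
    fix i z
    show "bilinear (sform cotangent_circle i z)"
      unfolding bilinear_def sform_cotangent_circle[abs_def]
      by (intro conjI allI linearI) (simp_all add: algebra_simps)
    show "sform cotangent_circle i z u u = 0" for u by (simp add: sform_cotangent_circle)
  next
    show "smooth_on (mrange cotangent_circle i) (\<lambda>x. sform cotangent_circle i x u v)" for i u v
      unfolding sform_cotangent_circle by (rule smooth_on_const)
  next
    fix ij kl z u v
    assume "ij \<in> mindex cotangent_circle" "kl \<in> mindex cotangent_circle"
      and z: "z \<in> mdom cotangent_circle ij \<inter> mdom cotangent_circle kl"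
    obtain i j k l where ij: "ij = (i, j)" and kl: "kl = (k, l)" by (cases ij, cases kl)
    have z': "fst z \<in> mdom line_mfd i \<inter> mdom line_mfd k" "snd z \<in> mdom circle_mfd j \<inter> mdom circle_mfd l"
      using z by (simp_all add: ij kl mem_Times_iff del: mdom_circle)
    have t: "transition line_mfd i' k' = (\<lambda>x. x)" for i' k' by auto
    have "frechet_derivative (transition cotangent_circle ij kl) (at (mchart cotangent_circle ij z)) h = h" for h
      using transition_prod_derivative[OF sl sc _ _ _ _ z', of h] transition_circle_derivative[OF z'(2), of "snd h"]
      by (simp add: ij kl t)
    then show "sform cotangent_circle ij (mchart cotangent_circle ij z) u v =
       sform cotangent_circle kl (mchart cotangent_circle kl z)
        (frechet_derivative (transition cotangent_circle ij kl) (at (mchart cotangent_circle ij z)) u)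
        (frechet_derivative (transition cotangent_circle ij kl) (at (mchart cotangent_circle ij z)) v)"
      by (simp only: sform_cotangent_circle)
  qed
  moreover have "closed_form cotangent_circle"
    by (simp add: closed_form_def sform_cotangent_circle)
  moreover have "nondegenerate_form cotangent_circle"
    unfolding nondegenerate_form_def
  proof (intro ballI allI impI)
    fix i z u assume 0: "\<forall>v. sform cotangent_circle i z u v = 0"
    show "u = 0"
      using 0[rule_format, of "(0, 1)"] 0[rule_format, of "(1, 0)"] by (simp add: sform_cotangent_circle prod_eq_iff)
  qed
  ultimately show ?thesis by (simp add: symplectic_manifold_def)
qed

section \<open>Autonomous Hamiltonians\<close>

lemma (in smooth_mfd) smooth_function_comp_fst:
  fixes N :: "('j, 'b, 'f::euclidean_space, 'n) mfd_scheme"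
  assumes N: "smooth_manifold N" and F: "smooth_function M F"
  shows "smooth_function (prod_mfd M N) (F \<circ> fst)"
  unfolding smooth_function_def
proof
  interpret N: smooth_mfd N by unfold_locales (rule N)
  fix ij assume "ij \<in> mindex (prod_mfd M N)"
  then obtain i j where ij: "ij = (i, j)" and i: "i \<in> mindex M" and j: "j \<in> mindex N" by auto
  have o: "open (mrange M i \<times> mrange N j)" by (intro open_Times open_mrange N.open_mrange i j)
  have "smooth_on (mrange M i \<times> mrange N j) (\<lambda>z. (F \<circ> mparam M i) (fst z))"
    by (rule smooth_on_compose[OF o _ _ smooth_on_bounded_linear[OF o bounded_linear_fst], of "mrange M i"])
      (use F i in \<open>auto simp: smooth_function_def simp del: comp_apply\<close>)
  then show "smooth_on (mrange (prod_mfd M N) ij) ((F \<circ> fst) \<circ> mparam (prod_mfd M N) ij)"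
    unfolding ij mrange_prod
    by (rule smooth_on_cong[OF o, THEN iffD2, rotated]) (auto simp: mparam_prod[OF M N i j])
qed

lemma (in smooth_mfd) smooth_function_slice:
  fixes N :: "('j, 'b, 'f::euclidean_space, 'n) mfd_scheme"
  assumes N: "smooth_manifold N" and G: "smooth_function (prod_mfd M N) G" and q: "q \<in> mpoints N"
  shows "smooth_function M (\<lambda>p. G (p, q))"
  unfolding smooth_function_def
proof
  interpret N: smooth_mfd N by unfold_locales (rule N)
  fix i assume i: "i \<in> mindex M"
  obtain j where j: "j \<in> mindex N" "q \<in> mdom N j" using N.chart_exists[OF q] by blast
  have y: "mchart N j q \<in> mrange N j" by (rule N.mchart_in[OF j])
  have 1: "smooth_on (mrange M i) (\<lambda>x. (x, mchart N j q))"
    by (rule smooth_on_Pair[OF open_mrange[OF i] smooth_on_bounded_linear[OF open_mrange[OF i] bounded_linear_ident] smooth_on_const])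
  have 2: "smooth_on (mrange M i \<times> mrange N j) (G \<circ> mparam (prod_mfd M N) (i, j))"
    using G[unfolded smooth_function_def, rule_format, of "(i, j)"] i j by (simp add: mrange_prod)
  have "smooth_on (mrange M i) (\<lambda>x. (G \<circ> mparam (prod_mfd M N) (i, j)) (x, mchart N j q))"
    by (rule smooth_on_compose[OF open_mrange[OF i] _ 2 1]) (use y in auto)
  then show "smooth_on (mrange M i) ((\<lambda>p. G (p, q)) \<circ> mparam M i)"
    by (rule smooth_on_cong[OF open_mrange[OF i], THEN iffD2, rotated])
      (simp add: mparam_prod[OF M N i j(1) _ y] N.mparam_mchart'[OF j])
qed

lemma time_slice_comp_fst [simp]: "time_slice (H \<circ> fst) t = H"
  by (simp add: time_slice_def fun_eq_iff)

lemma has_chord_mono: "has_chord M G X0 X1 L \<Longrightarrow> L \<le> L' \<Longrightarrow> has_chord M G X0 X1 L'"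
  unfolding has_chord_def by (meson order_trans)

context sympl_mfd
begin

lemma smooth_time_slice: "hamiltonian M G \<Longrightarrow> smooth_function M (time_slice G t)"
  unfolding hamiltonian_def time_slice_def
  by (rule smooth_function_slice[OF smooth_manifold_circle]) (simp_all add: topspace_circle)

text \<open>An autonomous \<open>G\<close> need not be literally of the form
  \<open>H \<circ> fst\<close>, since its values off the manifold are arbitrary. The vector field
  sees only the values on \<open>mpoints M\<close>, so freezing the time at \<open>s\<close> changes
  no trajectory.\<close>

lemma trajectory_autonomous:
  assumes G: "autonomous M G"
  shows "trajectory M G T \<gamma> \<longleftrightarrow> trajectory M ((\<lambda>p. G (p, s)) \<circ> fst) T \<gamma>"
proof -
  have "sgrad M (time_slice G t) i p = sgrad M (\<lambda>p. G (p, s)) i p" if "i \<in> mindex M" "p \<in> mdom M i" for t i p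
  proof (rule sgrad_cong[OF openin_topspace _ _ that])
    show "p \<in> mpoints M" using that mdom_subset by blast
    show "time_slice G t q = G (q, s)" if "q \<in> mpoints M" for q
      using G that unfolding autonomous_def time_slice_def by blast
  qed
  then show ?thesis unfolding trajectory_def time_slice_comp_fst by simp
qed

lemma has_chord_autonomous:
  "autonomous M G \<Longrightarrow> has_chord M G X0 X1 L \<longleftrightarrow> has_chord M ((\<lambda>p. G (p, s)) \<circ> fst) X0 X1 L"
  unfolding has_chord_def using trajectory_autonomous by blast

lemma separation_autonomous:
  assumes G: "autonomous M G" and Y: "Y0 \<subseteq> mpoints M" "Y1 \<subseteq> mpoints M"
  shows "separation G Y0 Y1 = separation ((\<lambda>p. G (p, s)) \<circ> fst) Y0 Y1"
proof -
  have "ereal (G z) = ereal (((\<lambda>p. G (p, s)) \<circ> fst) z)" if "z \<in> Y0 \<times> UNIV \<or> z \<in> Y1 \<times> UNIV" for z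
  proof -
    have "fst z \<in> mpoints M" using that Y by auto
    then have "G (fst z, snd z) = G (fst z, s)" using G unfolding autonomous_def by blast
    then show ?thesis by simp
  qed
  then show ?thesis unfolding separation_def by (intro arg_cong2[where f = minus] INF_cong SUP_cong) blast+
qed

lemma pb4_plus_less_of_not_autonomously_interlinks:
  assumes X: "compactin (mtop M) X0" "compactin (mtop M) X1" "X0 \<inter> X1 = {}"
    and Y: "compactin (mtop M) Y0" "compactin (mtop M) Y1"
    and \<kappa>: "\<kappa> > 0" and no: "\<not> autonomously_interlinks M \<kappa> Y0 Y1 X0 X1"
  shows "pb4_plus M X0 X1 Y0 Y1 < ereal (1 / \<kappa>)"
proof -
  obtain G where G: "complete_hamiltonian M G" "autonomous M G" "separation G Y0 Y1 > 0"
    "\<not> has_chord M G X0 X1 (ereal \<kappa> / separation G Y0 Y1)"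
    using no by (auto simp: autonomously_interlinks_def)
  let ?H = "\<lambda>p. G (p, circ 0)"
  have Ys: "Y0 \<subseteq> mpoints M" "Y1 \<subseteq> mpoints M" using Y compactin_subset_topspace by blast+
  have H: "smooth_function M ?H"
    using smooth_time_slice[of G 0] G(1) by (simp add: complete_hamiltonian_def time_slice_def)
  have "\<exists>\<gamma>. trajectory M (?H \<circ> fst) UNIV \<gamma> \<and> \<gamma> 0 = p" if "p \<in> mpoints M" for p
    using G(1) that unfolding complete_hamiltonian_def trajectory_autonomous[OF G(2), of _ _ "circ 0"] by blast
  from pb4_plus_less[OF X Y H this \<kappa>] show ?thesis
    using G(3,4) unfolding separation_autonomous[OF G(2) Ys, of "circ 0"] has_chord_autonomous[OF G(2), of _ _ _ "circ 0"]
    by blast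
qed

lemma pb4_plus_ge_of_autonomously_interlinks:
  assumes \<kappa>: "\<kappa> > 0" and link: "autonomously_interlinks M \<kappa> Y0 Y1 X0 X1"
  shows "ereal (1 / \<kappa>) \<le> pb4_plus M X0 X1 Y0 Y1"
  unfolding pb4_plus_def
proof (rule INF_greatest)
  fix FG assume "FG \<in> pb4_pairs M X0 X1 Y0 Y1"
  then obtain F G where FG: "FG = (F, G)" and F: "smooth_function M F" "\<And>p. p \<in> X0 \<Longrightarrow> F p \<le> 0" "\<And>p. p \<in> X1 \<Longrightarrow> F p \<ge> 1"
    and G: "smooth_function M G" "compactly_supported M G" "\<And>p. p \<in> Y0 \<Longrightarrow> G p \<le> 0" "\<And>p. p \<in> Y1 \<Longrightarrow> G p \<ge> 1"
    by (auto simp: pb4_pairs_def)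
  have "complete_hamiltonian M (G \<circ> fst)"
    unfolding complete_hamiltonian_def
  proof (intro conjI allI ballI)
    show "hamiltonian M (G \<circ> fst)"
      unfolding hamiltonian_def by (rule smooth_function_comp_fst[OF smooth_manifold_circle G(1)])
    fix t0 :: real and p assume "p \<in> mpoints M"
    then obtain \<gamma> where \<gamma>: "trajectory M (G \<circ> fst) UNIV \<gamma>" "\<gamma> 0 = p"
      using compactly_supported_complete[OF G(1,2)] by blast
    have "(\<lambda>t. t - (- t0)) ` UNIV = UNIV" by (rule surjI[of _ "\<lambda>t. t - t0"]) simp
    then have "trajectory M (G \<circ> fst) UNIV (\<lambda>t. \<gamma> (t - t0))"
      using trajectory_shift[OF \<gamma>(1), of "- t0"] by simp
    then show "\<exists>\<gamma>. trajectory M (G \<circ> fst) UNIV \<gamma> \<and> \<gamma> t0 = p" using \<gamma>(2) by (intro exI[of _ "\<lambda>t. \<gamma> (t - t0)"]) simp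
  qed
  moreover have "autonomous M (G \<circ> fst)" by (simp add: autonomous_def)
  moreover have sep: "1 \<le> separation (G \<circ> fst) Y0 Y1"
  proof -
    have "1 \<le> (INF z\<in>Y1 \<times> (UNIV :: circle set). ereal ((G \<circ> fst) z))" by (rule INF_greatest) (use G(4) in auto)
    moreover have "(SUP z\<in>Y0 \<times> (UNIV :: circle set). ereal ((G \<circ> fst) z)) \<le> 0" by (rule SUP_least) (use G(3) in auto)
    ultimately have "1 - 0 \<le> separation (G \<circ> fst) Y0 Y1" unfolding separation_def by (rule ereal_minus_mono)
    then show ?thesis by simp
  qed
  moreover have "0 < separation (G \<circ> fst) Y0 Y1" by (rule less_le_trans[OF _ sep]) simp
  ultimately have "has_chord M (G \<circ> fst) X0 X1 (ereal \<kappa> / separation (G \<circ> fst) Y0 Y1)"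
    using link by (simp add: autonomously_interlinks_def)
  then have "has_chord M (G \<circ> fst) X0 X1 (ereal \<kappa>)"
  proof (rule has_chord_mono)
    \<comment> \<open>The separation can be infinite, when some \<open>Yi\<close> is empty; then the
      quotient is 0.\<close>
    show "ereal \<kappa> / separation (G \<circ> fst) Y0 Y1 \<le> ereal \<kappa>"
    proof (cases "separation (G \<circ> fst) Y0 Y1")
      case (real s)
      then have "1 \<le> s" using sep by simp
      then show ?thesis using \<kappa> real by (simp add: divide_le_eq)
    qed (use sep \<kappa> in auto)
  qed
  from chord_poisson[OF F G(1) \<kappa> this] obtain p where "p \<in> mpoints M" "1 / \<kappa> \<le> poisson M F G p" by blast
  then show "ereal (1 / \<kappa>) \<le> (case FG of (F, G) \<Rightarrow> SUP p\<in>mpoints M. ereal (poisson M F G p))"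
    unfolding FG by (auto intro: SUP_upper2)
qed

end

section \<open>The lift of a periodic Hamiltonian\<close>

lemma circ_rep_circle [simp]: "circ (rep_circle q) = q"
  by (rule Quotient3_abs_rep[OF Quotient3_circle])

lemma DERIV_circ_shift:
  assumes "circ s = circ t"
  shows "((\<lambda>s. f (circ s)) has_real_derivative D) (at s) \<longleftrightarrow> ((\<lambda>s. f (circ s)) has_real_derivative D) (at t)"
proof -
  obtain n where n: "s - t = of_int n" using assms by (auto simp: circ_eq_iff elim: Ints_cases)
  then have s: "s = t + of_int n" by simp
  show ?thesis unfolding s DERIV_shift by (simp add: circ_add_int)
qed

lemma compactin_circle: "compactin circle_topology UNIV"
proof -
  have "q \<in> circ ` {0..1}" for q
  proof -
    obtain x where "q = circ x" using circ_cases by blast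
    moreover have "circ x = circ (frac x)" by (simp add: circ_eq_iff frac_def)
    ultimately show ?thesis using frac_lt_1[of x] frac_ge_0[of x] by (intro image_eqI[of _ _ "frac x"]) auto
  qed
  then have "UNIV = circ ` {0..1}" by blast
  then show ?thesis using image_compactin[OF _ continuous_circ, of "{0..1}"] by simp
qed

text \<open>The representative chosen by \<open>rep_circle\<close> is arbitrary, but by periodicity
  the derivative is the same at every lift of the angle, as \<open>time_deriv_eqI\<close>
  confirms.\<close>

definition time_deriv :: "('a \<times> circle \<Rightarrow> real) \<Rightarrow> 'a \<times> circle \<Rightarrow> real" where
  "time_deriv G z = deriv (\<lambda>s. G (fst z, circ s)) (rep_circle (snd z))"

lemma time_deriv_eqI:
  assumes "((\<lambda>s. G (p, circ s)) has_real_derivative D) (at s)"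
  shows "time_deriv G (p, circ s) = D"
proof -
  have "((\<lambda>s. G (p, circ s)) has_real_derivative D) (at (rep_circle (circ s)))"
    using DERIV_circ_shift[of "rep_circle (circ s)" s "\<lambda>q. G (p, q)"] assms by simp
  then show ?thesis unfolding time_deriv_def fst_conv snd_conv by (rule DERIV_imp_deriv)
qed

text \<open>The angle moves with unit speed along the flow of \<open>r + G\<close> and thus takes the role of time, so
  that the flow projects to the trajectories of \<open>G\<close>.\<close>
definition lift :: "('a \<times> circle \<Rightarrow> real) \<Rightarrow> 'a \<times> (real \<times> circle) \<Rightarrow> real" where
  "lift G z = fst (snd z) + G (fst z, snd (snd z))"

text \<open>On a stabilized set \<open>r = 0\<close>, so \<open>lift G\<close> takes there exactly
  the values that \<open>G\<close> takes on the unstabilized set times the circle.\<close>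

lemma separation_lift: "separation (lift G \<circ> fst) (stabilization Y0) (stabilization Y1) = separation G Y0 Y1"
proof -
  have "(\<lambda>z. ereal ((lift G \<circ> fst) z)) ` (stabilization Y \<times> (UNIV :: circle set)) = (\<lambda>z. ereal (G z)) ` (Y \<times> UNIV)" for Y
  proof (intro equalityI subsetI)
    fix e assume "e \<in> (\<lambda>z. ereal (G z)) ` (Y \<times> UNIV)"
    then obtain p q where "p \<in> Y" "e = ereal (G (p, q))" by auto
    then show "e \<in> (\<lambda>z. ereal ((lift G \<circ> fst) z)) ` (stabilization Y \<times> (UNIV :: circle set))"
      by (intro image_eqI[of _ _ "((p, (0, q)), circ 0)"]) (auto simp: lift_def stabilization_def)
  qed (auto simp: lift_def stabilization_def)
  then show ?thesis by (simp add: separation_def)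
qed

locale periodic_hamiltonian = sympl_mfd M
  for M :: "('i, 'a, 'e::euclidean_space, 'm) sympl_scheme" +
  fixes G :: "'a \<times> circle \<Rightarrow> real"
  assumes G: "hamiltonian M G"
begin

abbreviation Mh where "Mh \<equiv> prod_sympl M cotangent_circle"
abbreviation N where "N \<equiv> prod_mfd M circle_mfd"

interpretation N: smooth_mfd N
  by (rule smooth_mfd.intro[OF smooth_manifold_prod[OF M smooth_manifold_circle]])

interpretation Mh: sympl_mfd Mh
  by (rule sympl_mfd.intro[OF symplectic_manifold_prod[OF S symplectic_manifold_cotangent_circle]])

abbreviation g where "g i a \<equiv> G \<circ> mparam N (i, a)"

lemma g_eq:
  assumes "i \<in> mindex M" "x \<in> mrange M i" "\<theta> \<in> mrange circle_mfd a"
  shows "g i a (x, \<theta>) = G (mparam M i x, circ \<theta>)"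
  using mparam_prod[OF M smooth_manifold_circle assms(1) _ assms(2,3)] assms(3)
  by (simp add: mparam_circle mrange_circle)

lemma smooth_g: "i \<in> mindex M \<Longrightarrow> smooth_on (mrange M i \<times> mrange circle_mfd a) (g i a)"
  using G[unfolded hamiltonian_def smooth_function_def, rule_format, of "(i, a)"] by (simp add: mrange_prod)

lemma open_g: "i \<in> mindex M \<Longrightarrow> open (mrange M i \<times> mrange circle_mfd a)"
  by (intro open_Times open_mrange) (simp_all add: mrange_circle)

lemma g_derivative:
  assumes "i \<in> mindex M" "x \<in> mrange M i" "\<theta> \<in> mrange circle_mfd a"
  shows "(g i a has_derivative frechet_derivative (g i a) (at (x, \<theta>))) (at (x, \<theta>))"
  by (rule smooth_on_has_derivative[OF smooth_g[OF assms(1)]]) (use assms in simp)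

lemma time_derivative_chart:
  assumes i: "i \<in> mindex M" and x: "x \<in> mrange M i" and \<theta>: "\<theta> \<in> mrange circle_mfd a"
  shows "((\<lambda>s. G (mparam M i x, circ s)) has_real_derivative frechet_derivative (g i a) (at (x, \<theta>)) (0, 1)) (at \<theta>)"
proof -
  have l: "linear (frechet_derivative (g i a) (at (x, \<theta>)))"
    using g_derivative[OF assms] has_derivative_linear by blast
  have "((\<lambda>s. g i a (x, s)) has_derivative (\<lambda>h. frechet_derivative (g i a) (at (x, \<theta>)) (0, h))) (at \<theta>)"
    by (rule has_derivative_compose[OF has_derivative_Pair[OF has_derivative_const has_derivative_ident] g_derivative[OF assms]])
  moreover have "(\<lambda>h. frechet_derivative (g i a) (at (x, \<theta>)) (0, h)) = (*) (frechet_derivative (g i a) (at (x, \<theta>)) (0, 1))"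
  proof
    show "frechet_derivative (g i a) (at (x, \<theta>)) (0, h) = frechet_derivative (g i a) (at (x, \<theta>)) (0, 1) * h" for h
      using linear_scale[OF l, of h "(0, 1)"] by simp
  qed
  ultimately have "((\<lambda>s. g i a (x, s)) has_real_derivative frechet_derivative (g i a) (at (x, \<theta>)) (0, 1)) (at \<theta>)"
    unfolding has_field_derivative_def by simp
  then show ?thesis
    by (rule has_field_derivative_transform_within_open[OF _ _ \<theta>]) (simp add: mrange_circle, rule g_eq[OF i x])
qed

lemma time_deriv_chart:
  assumes i: "i \<in> mindex M" and x: "x \<in> mrange M i" and \<theta>: "\<theta> \<in> mrange circle_mfd a"
  shows "time_deriv G (mparam M i x, circ \<theta>) = frechet_derivative (g i a) (at (x, \<theta>)) (0, 1)"
  by (rule time_deriv_eqI[OF time_derivative_chart[OF assms]])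

text \<open>Continuity allows the \<open>r\<close> component of lifted trajectories to be obtained
  by integration.\<close>

lemma continuous_time_deriv: "continuous_map (mtop N) euclideanreal (time_deriv G)"
proof (rule N.smooth_function_continuous)
  show "smooth_function N (time_deriv G)"
    unfolding smooth_function_def
  proof
    fix ia assume "ia \<in> mindex N"
    then obtain i a where ia: "ia = (i, a)" and i: "i \<in> mindex M" by auto
    show "smooth_on (mrange N ia) (time_deriv G \<circ> mparam N ia)"
      unfolding ia mrange_prod
      by (rule smooth_on_cong[OF open_g[OF i], THEN iffD2, rotated, OF smooth_on_frechet_derivative[OF smooth_g[OF i]]])
        (auto simp: mparam_prod[OF M smooth_manifold_circle i] mrange_circle mparam_circle time_deriv_chart[OF i])
  qed
qed

lemma mparam_Mh:
  assumes "i \<in> mindex M" "x \<in> mrange M i" "\<theta> \<in> mrange circle_mfd a"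
  shows "mparam Mh (i, (j, a)) (x, (r, \<theta>)) = (mparam M i x, (r, circ \<theta>))"
proof -
  have "mparam Mh (i, (j, a)) (x, (r, \<theta>)) = (mparam M i x, mparam cotangent_circle (j, a) (r, \<theta>))"
    unfolding prod_sympl_simps
    by (rule mparam_prod[OF M _ assms(1) _ assms(2)])
      (use symplectic_manifold_cotangent_circle assms in \<open>auto simp: symplectic_manifold_def mrange_prod\<close>)
  also have "mparam cotangent_circle (j, a) (r, \<theta>) = (r, circ \<theta>)"
    using mparam_prod[OF smooth_manifold_line smooth_manifold_circle _ _ _ assms(3), of j r] assms(3)
    by (simp add: mrange_circle mparam_circle)
  finally show ?thesis .
qed

lemma mrange_Mh: "mrange Mh (i, (j, a)) = mrange M i \<times> (UNIV \<times> mrange circle_mfd a)"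
  by (simp add: mrange_prod)

lemma lift_chart:
  assumes "i \<in> mindex M" "z \<in> mrange Mh (i, (j, a))"
  shows "(lift G \<circ> mparam Mh (i, (j, a))) z = fst (snd z) + g i a (fst z, snd (snd z))"
proof -
  obtain x r \<theta> where z: "z = (x, (r, \<theta>))" by (cases z) auto
  then have "x \<in> mrange M i" "\<theta> \<in> mrange circle_mfd a" using assms(2) unfolding mrange_Mh by auto
  then show ?thesis by (simp add: z mparam_Mh[OF assms(1)] g_eq[OF assms(1), unfolded comp_apply] lift_def del: prod_sympl_simps)
qed

lemma bounded_linear_base: "bounded_linear (\<lambda>z::'u::euclidean_space \<times> real \<times> real. (fst z, snd (snd z)))"
  by (rule bounded_linear_Pair[OF bounded_linear_fst bounded_linear_compose[OF bounded_linear_snd bounded_linear_snd]])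

lemma bounded_linear_fibre: "bounded_linear (\<lambda>z::'u::euclidean_space \<times> real \<times> real. fst (snd z))"
  by (rule bounded_linear_compose[OF bounded_linear_fst bounded_linear_snd])

lemma smooth_lift: "smooth_function Mh (lift G)"
  unfolding smooth_function_def
proof
  fix k assume k: "k \<in> mindex Mh"
  then obtain i j a where k': "k = (i, (j, a))" and i: "i \<in> mindex M" by auto
  have o: "open (mrange Mh k)" by (rule Mh.open_mrange[OF k])
  have "smooth_on (mrange Mh k) (\<lambda>z. g i a (fst z, snd (snd z)))"
    by (rule smooth_on_compose[OF o _ smooth_g[OF i] smooth_on_bounded_linear[OF o bounded_linear_base]])
      (auto simp only: k' mrange_Mh mem_Times_iff fst_conv snd_conv)
  then have "smooth_on (mrange Mh k) (\<lambda>z. fst (snd z) + g i a (fst z, snd (snd z)))"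
    by (rule smooth_on_add[OF o smooth_on_bounded_linear[OF o bounded_linear_fibre]])
  then show "smooth_on (mrange Mh k) (lift G \<circ> mparam Mh k)"
    by (rule smooth_on_cong[OF o, THEN iffD2, rotated]) (unfold k', rule lift_chart[OF i])
qed

text \<open>These are Hamilton's equations of \<open>r + G\<close> for
  \<open>dr \<and> d\<theta>\<close>: the angle has speed 1, \<open>r\<close> has speed minus the
  time derivative of \<open>G\<close>, and the component in \<open>M\<close> is the field of
  \<open>G\<close> at the time given by the angle. The vector satisfies the defining equation, and
  \<open>sgrad_unique\<close> identifies it.\<close>

lemma sgrad_lift:
  assumes i: "i \<in> mindex M" and p: "p \<in> mdom M i" and s: "circ s \<in> mdom circle_mfd a"
  shows "sgrad Mh (lift G) (i, (j, a)) (p, (r, circ s)) =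
    (sgrad M (time_slice G s) i p, (- time_deriv G (p, circ s), 1))"
proof -
  interpret C: smooth_mfd circle_mfd by (rule smooth_mfd.intro[OF smooth_manifold_circle])
  define x where "x = mchart M i p"
  define \<theta> where "\<theta> = mchart circle_mfd a (circ s)"
  define D where "D = frechet_derivative (g i a) (at (x, \<theta>))"
  let ?k = "(i, (j, a))" and ?z = "(p, (r, circ s))"
  have x: "x \<in> mrange M i" unfolding x_def by (rule mchart_in[OF i p])
  have \<theta>: "\<theta> \<in> mrange circle_mfd a" unfolding \<theta>_def by (rule C.mchart_in[OF _ s]) simp
  have xp: "mparam M i x = p" unfolding x_def by (rule mparam_mchart'[OF i p])
  have \<theta>s: "circ \<theta> = circ s"
    using C.mparam_mchart'[OF _ s] mparam_circle[of \<theta> a] \<theta> by (simp add: \<theta>_def mrange_circle)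
  have k: "?k \<in> mindex Mh" using i by simp
  have z: "?z \<in> mdom Mh ?k" using p s by simp
  have mz: "mchart Mh ?k ?z = (x, (r, \<theta>))" by (simp add: x_def \<theta>_def)
  have gD: "(g i a has_derivative D) (at (x, \<theta>))" unfolding D_def by (rule g_derivative[OF i x \<theta>])
  then have lD: "linear D" by (rule has_derivative_linear)
  have zr: "(x, (r, \<theta>)) \<in> mrange Mh ?k" unfolding mrange_Mh using x \<theta> by simp
  have "((\<lambda>z. g i a (fst z, snd (snd z))) has_derivative (\<lambda>v. D (fst v, snd (snd v)))) (at (x, (r, \<theta>)))"
    by (rule has_derivative_compose[OF bounded_linear_imp_has_derivative[OF bounded_linear_base]]) (simp only: fst_conv snd_conv, rule gD)
  then have "((\<lambda>z. fst (snd z) + g i a (fst z, snd (snd z))) has_derivative (\<lambda>v. fst (snd v) + D (fst v, snd (snd v)))) (at (x, (r, \<theta>)))"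
    by (rule has_derivative_add[OF bounded_linear_imp_has_derivative[OF bounded_linear_fibre]])
  then have "(lift G \<circ> mparam Mh ?k has_derivative (\<lambda>v. fst (snd v) + D (fst v, snd (snd v)))) (at (mchart Mh ?k ?z))"
    unfolding mz
    by (rule has_derivative_transform_within_open[OF _ Mh.open_mrange[OF k] zr]) (rule lift_chart[OF i, symmetric])
  then have dc: "dcoord Mh (lift G) ?k ?z = (\<lambda>v. fst (snd v) + D (fst v, snd (snd v)))"
    by (rule Mh.dcoord_unique)
  have "((\<lambda>x'. g i a (x', \<theta>)) has_derivative (\<lambda>v. D (v, 0))) (at x)"
    by (rule has_derivative_compose[OF has_derivative_Pair[OF has_derivative_ident has_derivative_const] gD])
  then have "(time_slice G s \<circ> mparam M i has_derivative (\<lambda>v. D (v, 0))) (at x)"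
    by (rule has_derivative_transform_within_open[OF _ open_mrange[OF i] x])
      (simp only: g_eq[OF i _ \<theta>, unfolded comp_apply] \<theta>s time_slice_def comp_apply)
  then have ds: "dcoord M (time_slice G s) i p = (\<lambda>v. D (v, 0))"
    unfolding x_def by (rule dcoord_unique)
  have td: "time_deriv G (p, circ s) = D (0, 1)"
    using time_deriv_chart[OF i x \<theta>] by (simp only: xp \<theta>s D_def)
  have split: "D (v, h) = D (v, 0) + h * D (0, 1)" for v h
    using linear_add[OF lD, of "(v, 0)" "(0, h)"] linear_scale[OF lD, of h "(0, 1)"] by simp
  have eq: "sform Mh ?k (mchart Mh ?k ?z) (sgrad M (time_slice G s) i p, (- time_deriv G (p, circ s), 1)) v
      = - dcoord Mh (lift G) ?k ?z v" for v
    unfolding mz dc sform_prod sform_cotangent_circle td fst_conv snd_conv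
    using sform_sgrad[OF i p smooth_time_slice[OF G], of s "fst v"] split[of "fst v" "snd (snd v)"]
    by (simp add: ds x_def)
  show ?thesis
    by (rule sgrad_unique[OF Mh.S k z smooth_lift, THEN iffD1, symmetric]) (rule allI, rule eq)
qed

lemma mchart_circ_derivative:
  assumes t: "circ t \<in> mdom circle_mfd a"
  shows "((\<lambda>s. mchart circle_mfd a (circ s)) has_vector_derivative 1) (at t)"
proof -
  obtain \<theta> where \<theta>: "\<theta> \<in> {a - 1/2<..<a + 1/2}" "circ t = circ \<theta>" using t by auto
  obtain n where n: "t - \<theta> = of_int n" using \<theta>(2) by (auto simp: circ_eq_iff elim: Ints_cases)
  let ?U = "{a - 1/2 + of_int n<..<a + 1/2 + of_int n}"
  have tU: "t \<in> ?U" using \<theta>(1) n by auto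
  have "((\<lambda>s. s - of_int n) has_vector_derivative 1) (at t)"
    by (auto intro!: derivative_eq_intros)
  then show ?thesis
  proof (rule has_vector_derivative_transform_within_open[OF _ _ tU])
    fix s assume "s \<in> ?U"
    then have "s - of_int n \<in> {a - 1/2<..<a + 1/2}" by auto
    then have "mchart circle_mfd a (circ (s - of_int n)) = s - of_int n" by (rule mchart_circle)
    then show "s - of_int n = mchart circle_mfd a (circ s)" using circ_add_int[of "s - of_int n" n] by simp
  qed simp
qed

lemma lift_trajectory:
  assumes tr: "trajectory M G T \<gamma>"
    and \<rho>: "\<And>t. t \<in> T \<Longrightarrow> (\<rho> has_vector_derivative - time_deriv G (\<gamma> t, circ t)) (at t within T)"
  shows "trajectory Mh (lift G \<circ> fst) T (\<lambda>t. (\<gamma> t, (\<rho> t, circ t)))"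
  unfolding trajectory_def time_slice_comp_fst
proof (intro conjI ballI impI)
  have "continuous_on T \<rho>"
    using \<rho> has_vector_derivative_continuous continuous_on_eq_continuous_within by blast
  then have "continuous_map (top_of_set T) euclideanreal \<rho>" by simp
  moreover have "continuous_map (top_of_set T) circle_topology circ"
    by (rule continuous_map_from_subtopology[OF continuous_circ])
  ultimately have "continuous_map (top_of_set T) (prod_topology (mtop M) (prod_topology euclideanreal circle_topology))
      (\<lambda>t. (\<gamma> t, (\<rho> t, circ t)))"
    by (intro continuous_map_pairedI trajectory_continuous[OF tr])
  then show "continuous_map (top_of_set T) (mtop Mh) (\<lambda>t. (\<gamma> t, (\<rho> t, circ t)))" by simp
  fix t k assume t: "t \<in> T" and k: "k \<in> mindex Mh" and z: "(\<gamma> t, (\<rho> t, circ t)) \<in> mdom Mh k"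
  obtain i j a where k': "k = (i, (j, a))" by (cases k) auto
  have i: "i \<in> mindex M" using k by (simp add: k')
  have p: "\<gamma> t \<in> mdom M i" and c: "circ t \<in> mdom circle_mfd a"
    using z by (simp_all add: k' mem_Times_iff del: mdom_circle)
  have 1: "((\<lambda>s. mchart M i (\<gamma> s)) has_vector_derivative sgrad M (time_slice G t) i (\<gamma> t)) (at t within T)"
    using tr t i p by (simp add: trajectory_def)
  have "((\<lambda>s. (mchart M i (\<gamma> s), (\<rho> s, mchart circle_mfd a (circ s)))) has_vector_derivative
      (sgrad M (time_slice G t) i (\<gamma> t), (- time_deriv G (\<gamma> t, circ t), 1))) (at t within T)"
    by (rule has_vector_derivative_Pair[OF 1 has_vector_derivative_Pair[OF \<rho>[OF t]
        has_vector_derivative_at_within[OF mchart_circ_derivative[OF c]]]])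
  then show "((\<lambda>s. mchart Mh k (\<gamma> s, (\<rho> s, circ s))) has_vector_derivative
      sgrad Mh (lift G) k (\<gamma> t, (\<rho> t, circ t))) (at t within T)"
    unfolding k' sgrad_lift[OF i p c] by simp
qed

text \<open>Completeness of \<open>G\<close> supplies the base curve, the angle is time itself, and
  \<open>r\<close> is an antiderivative of minus the time derivative along the curve. The shift by
  \<open>s\<close> reconciles the clocks: the lift is at its initial point at time 0, while the base
  curve is at \<open>p\<close> at time \<open>s\<close>, a representative of the initial
  angle.\<close>

lemma lift_trajectory_exists:
  assumes complete: "complete_hamiltonian M G" and p: "p \<in> mpoints M"
  obtains \<gamma> \<rho> where "trajectory M G UNIV \<gamma>" "\<gamma> s = p"
    "trajectory Mh (lift G \<circ> fst) UNIV (\<lambda>t. (\<gamma> (t + s), (\<rho> (t + s), circ (t + s))))" "\<rho> s = r"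
proof -
  obtain \<gamma> where \<gamma>: "trajectory M G UNIV \<gamma>" "\<gamma> s = p"
    using complete p unfolding complete_hamiltonian_def by blast
  define h where "h t = - time_deriv G (\<gamma> t, circ t)" for t
  have c: "continuous_map euclideanreal (mtop N) (\<lambda>t. (\<gamma> t, circ t))"
    using continuous_map_pairedI[OF trajectory_continuous[OF \<gamma>(1)] continuous_map_from_subtopology[OF continuous_circ]]
    by simp
  have "continuous_map euclideanreal euclideanreal (\<lambda>t. time_deriv G (\<gamma> t, circ t))"
    using continuous_map_compose[OF c continuous_time_deriv] by (simp add: o_def)
  then have "continuous_on UNIV h" unfolding h_def by (intro continuous_intros) simp
  then have "isCont h t" for t by (simp add: continuous_on_eq_continuous_at)
  then obtain F where F: "\<And>t. (F has_vector_derivative h t) (at t)"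
    using einterval_antiderivative[of "-\<infinity>" "\<infinity>" h] by auto
  define \<rho> where "\<rho> t = F t + (r - F s)" for t
  have "(\<rho> has_vector_derivative h t) (at t)" for t
    using has_vector_derivative_add[OF F has_vector_derivative_const] unfolding \<rho>_def by fastforce
  then have tr: "trajectory Mh (lift G \<circ> fst) UNIV (\<lambda>t. (\<gamma> t, (\<rho> t, circ t)))"
    unfolding h_def by (rule lift_trajectory[OF \<gamma>(1)])
  have "(\<lambda>t. t - s) ` UNIV = UNIV" by (rule surjI[of _ "\<lambda>t. t + s"]) simp
  then have "trajectory Mh (lift G \<circ> fst) UNIV (\<lambda>t. (\<gamma> (t + s), (\<rho> (t + s), circ (t + s))))"
    using trajectory_shift[OF tr, of s] by simp
  then show thesis by (rule that[OF \<gamma>]) (simp add: \<rho>_def)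
qed

text \<open>The lifted field does not depend on \<open>r\<close>, so the \<open>r\<close> component
  is a plain integral and cannot blow up in finite time.\<close>

lemma lift_complete:
  assumes complete: "complete_hamiltonian M G" and z: "z \<in> mpoints Mh"
  shows "\<exists>\<Gamma>. trajectory Mh (lift G \<circ> fst) UNIV \<Gamma> \<and> \<Gamma> 0 = z"
proof -
  obtain p r s where z': "z = (p, (r, circ s))" using circ_cases by (metis prod.exhaust)
  have p: "p \<in> mpoints M" using z by (simp add: z')
  obtain \<gamma> \<rho> where "trajectory M G UNIV \<gamma>" "\<gamma> s = p"
    "trajectory Mh (lift G \<circ> fst) UNIV (\<lambda>t. (\<gamma> (t + s), (\<rho> (t + s), circ (t + s))))" "\<rho> s = r"
    by (rule lift_trajectory_exists[OF complete p])
  then show ?thesis unfolding z' by (intro exI[of _ "\<lambda>t. (\<gamma> (t + s), (\<rho> (t + s), circ (t + s)))"]) simp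
qed

text \<open>By uniqueness for the lifted flow, the orbit starting at \<open>(p, (r, circ s))\<close>
  is the one built from the trajectory of \<open>G\<close> through \<open>p\<close> at time
  \<open>s\<close>. Its projection is a chord over \<open>[s, s + t]\<close>, of the same
  length.\<close>

lemma chord_of_lift_chord:
  assumes complete: "complete_hamiltonian M G"
    and ch: "has_chord Mh (lift G \<circ> fst) (stabilization X0) (stabilization X1) L"
  shows "has_chord M G X0 X1 L"
proof -
  interpret L: complete_flow Mh "lift G"
    by (rule complete_flow.intro[OF Mh.sympl_mfd_axioms complete_flow_axioms.intro[OF smooth_lift lift_complete[OF complete]]])
  obtain z t where z: "z \<in> stabilization X0 \<inter> mpoints Mh" "t > 0" "L.flow t z \<in> stabilization X1" "ereal t \<le> L"
    using ch unfolding L.chord_iff_flow by blast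
  obtain p r s where z': "z = (p, (r, circ s))" using circ_cases by (metis prod.exhaust)
  have p: "p \<in> X0" "p \<in> mpoints M" using z(1) by (auto simp: z' stabilization_def)
  obtain \<gamma> \<rho> where \<gamma>: "trajectory M G UNIV \<gamma>" "\<gamma> s = p"
    "trajectory Mh (lift G \<circ> fst) UNIV (\<lambda>t. (\<gamma> (t + s), (\<rho> (t + s), circ (t + s))))" "\<rho> s = r"
    by (rule lift_trajectory_exists[OF complete p(2)])
  have "(\<gamma> (t + s), (\<rho> (t + s), circ (t + s))) = L.flow t z"
    using L.flow_unique[OF trajectory_subset[OF \<gamma>(3)], of 0 t t] z(2) by (simp add: z' \<gamma>(2,4))
  then have "\<gamma> (s + t) \<in> X1" using z(3) by (metis (lifting) add.commute mem_Sigma_iff stabilization_def)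
  then show ?thesis
    unfolding has_chord_def using p(1) \<gamma>(2) z(2,4) trajectory_subset[OF \<gamma>(1)]
    by (intro exI[of _ s] exI[of _ "s + t"] exI[of _ \<gamma>]) auto
qed

end

lemma (in sympl_mfd) compactin_stabilization:
  "compactin (mtop M) X \<Longrightarrow> compactin (mtop (prod_sympl M cotangent_circle)) (stabilization X)"
  by (simp add: stabilization_def compactin_Times compactin_circle)

text \<open>\<open>pb4_plus_less\<close> is applied to the autonomous \<open>lift G\<close> on the
  stabilization: the separation is unchanged, and a short chord there would project to a forbidden
  chord of \<open>G\<close>.\<close>

lemma (in sympl_mfd) pb4_plus_less_of_not_interlinks:
  assumes X: "compactin (mtop M) X0" "compactin (mtop M) X1" "X0 \<inter> X1 = {}"
    and Y: "compactin (mtop M) Y0" "compactin (mtop M) Y1"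
    and \<kappa>: "\<kappa> > 0" and no: "\<not> interlinks M \<kappa> Y0 Y1 X0 X1"
  shows "pb4_plus (prod_sympl M cotangent_circle)
    (stabilization X0) (stabilization X1) (stabilization Y0) (stabilization Y1) < ereal (1 / \<kappa>)"
proof -
  obtain G where Gc: "complete_hamiltonian M G" "separation G Y0 Y1 > 0"
    "\<not> has_chord M G X0 X1 (ereal \<kappa> / separation G Y0 Y1)"
    using no by (auto simp: interlinks_def)
  interpret periodic_hamiltonian M G
    by (rule periodic_hamiltonian.intro[OF sympl_mfd_axioms periodic_hamiltonian_axioms.intro])
      (use Gc(1) in \<open>simp add: complete_hamiltonian_def\<close>)
  interpret Mh: sympl_mfd Mh
    by (rule sympl_mfd.intro[OF symplectic_manifold_prod[OF S symplectic_manifold_cotangent_circle]])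
  have "stabilization X0 \<inter> stabilization X1 = {}" using X(3) by (auto simp: stabilization_def)
  then show ?thesis
    by (rule Mh.pb4_plus_less[OF compactin_stabilization[OF X(1)] compactin_stabilization[OF X(2)] _
          compactin_stabilization[OF Y(1)] compactin_stabilization[OF Y(2)] smooth_lift lift_complete[OF Gc(1)] \<kappa>])
      (use Gc(2,3) chord_of_lift_chord[OF Gc(1)] in \<open>auto simp: separation_lift\<close>)
qed

section \<open>From thresholds to infima in the extended reals\<close>

lemma INF_le_inverse:
  fixes a :: ereal
  assumes a: "0 \<le> a" and P: "\<And>\<kappa>::real. \<kappa> > 0 \<Longrightarrow> ereal (1 / \<kappa>) \<le> a \<Longrightarrow> P \<kappa>"
  shows "(INF \<kappa>\<in>{\<kappa>. \<kappa> > 0 \<and> P \<kappa>}. ereal \<kappa>) \<le> 1 / a"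
proof (cases a)
  case (real r)
  show ?thesis
  proof (cases "r = 0")
    case True
    \<comment> \<open>Here \<open>1 / a\<close> is infinite, by the convention of the theorem and of
      \<open>ereal\<close> alike.\<close>
    then show ?thesis using real by (simp add: divide_ereal_def zero_ereal_def[symmetric])
  next
    case False
    then have "r > 0" using a real by simp
    then have "(INF \<kappa>\<in>{\<kappa>. \<kappa> > 0 \<and> P \<kappa>}. ereal \<kappa>) \<le> ereal (1 / r)" using P real by (intro INF_lower) auto
    then show ?thesis using real False by (simp add: one_ereal_def)
  qed
next
  case PInf
  \<comment> \<open>Now every positive \<open>\<kappa>\<close> qualifies, and the infimum of all of
    them is 0, the value of \<open>1 / a\<close>.\<close>
  have "(INF \<kappa>\<in>{\<kappa>. \<kappa> > 0 \<and> P \<kappa>}. ereal \<kappa>) \<le> 0"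
  proof (rule ereal_le_epsilon2)
    show "(INF \<kappa>\<in>{\<kappa>. \<kappa> > 0 \<and> P \<kappa>}. ereal \<kappa>) \<le> 0 + ereal e" if "e > 0" for e
      using P[OF that] that PInf by (simp add: INF_lower)
  qed
  then show ?thesis using PInf by simp
qed (use a in auto)

lemma inverse_le_INF:
  fixes a :: ereal
  assumes a: "0 \<le> a" and P: "\<And>\<kappa>::real. \<kappa> > 0 \<Longrightarrow> P \<kappa> \<Longrightarrow> ereal (1 / \<kappa>) \<le> a"
  shows "1 / a \<le> (INF \<kappa>\<in>{\<kappa>. \<kappa> > 0 \<and> P \<kappa>}. ereal \<kappa>)"
proof (rule INF_greatest)
  fix \<kappa> assume "\<kappa> \<in> {\<kappa>. \<kappa> > 0 \<and> P \<kappa>}"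
  then have \<kappa>: "\<kappa> > 0" "ereal (1 / \<kappa>) \<le> a" using P by auto
  show "1 / a \<le> ereal \<kappa>"
  proof (cases a)
    case (real r)
    then have r: "1 / \<kappa> \<le> r" using \<kappa> by simp
    then have "r > 0" using \<kappa>(1) by (smt (verit) divide_pos_pos)
    then show ?thesis using r \<kappa>(1) real by (simp add: one_ereal_def field_simps)
  qed (use \<kappa> in auto)
qed

theorem theorem1p11:
  fixes M :: "('i, 'a, 'e::euclidean_space) sympl"
    and X0 X1 Y0 Y1 :: "'a set"
  assumes "symplectic_manifold M" and "connected_space (mtop M)"
    and "compactin (mtop M) X0" and "compactin (mtop M) X1"
    and "compactin (mtop M) Y0" and "compactin (mtop M) Y1"
    and "X0 \<inter> X1 = {}" and "Y0 \<inter> Y1 = {}"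
  defines "pb \<equiv> pb4_plus M X0 X1 Y0 Y1"
    and "pb_stab \<equiv> pb4_plus (prod_sympl M cotangent_circle)
      (stabilization X0) (stabilization X1) (stabilization Y0) (stabilization Y1)"
  shows "1 / pb = kappa_bar_aut M X0 X1 Y0 Y1 \<and>
    kappa_bar_aut M X0 X1 Y0 Y1 \<le> kappa_bar M X0 X1 Y0 Y1 \<and>
    kappa_bar M X0 X1 Y0 Y1 \<le> 1 / pb_stab \<and>
    (\<forall>\<kappa>::real. pb_stab = ereal (1 / \<kappa>) \<and> pb_stab > 0 \<longrightarrow> interlinks M \<kappa> Y0 Y1 X0 X1) \<and>
    (\<forall>\<kappa>::real. pb = ereal (1 / \<kappa>) \<and> pb > 0 \<longrightarrow> autonomously_interlinks M \<kappa> Y0 Y1 X0 X1)"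
proof -
  interpret sympl_mfd M by (rule sympl_mfd.intro[OF assms(1)])
  interpret Mh: sympl_mfd "prod_sympl M cotangent_circle"
    by (rule sympl_mfd.intro[OF symplectic_manifold_prod[OF S symplectic_manifold_cotangent_circle]])
  have pb: "0 \<le> pb" unfolding pb_def by (rule pb4_plus_nonneg)
  have pbs: "0 \<le> pb_stab" unfolding pb_stab_def by (rule Mh.pb4_plus_nonneg)
  \<comment> \<open>The contrapositive of a strict inequality, so the case
    \<open>1 / \<kappa> = pb\<close> is included; the claims about the attained value of
    \<open>\<kappa>\<close> rest on this.\<close>
  have aut: "autonomously_interlinks M \<kappa> Y0 Y1 X0 X1" if "\<kappa> > 0" "ereal (1 / \<kappa>) \<le> pb" for \<kappa>
    using pb4_plus_less_of_not_autonomously_interlinks[OF assms(3,4,7,5,6) that(1)] that(2)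
    unfolding pb_def not_le[symmetric] by blast
  have aut': "ereal (1 / \<kappa>) \<le> pb" if "\<kappa> > 0" "autonomously_interlinks M \<kappa> Y0 Y1 X0 X1" for \<kappa>
    unfolding pb_def by (rule pb4_plus_ge_of_autonomously_interlinks[OF that])
  have stab: "interlinks M \<kappa> Y0 Y1 X0 X1" if "\<kappa> > 0" "ereal (1 / \<kappa>) \<le> pb_stab" for \<kappa>
    using pb4_plus_less_of_not_interlinks[OF assms(3,4,7,5,6) that(1)] that(2)
    unfolding pb_stab_def not_le[symmetric] by blast
  \<comment> \<open>The statement quantifies over all real \<open>\<kappa>\<close>; positivity of
    \<open>1 / \<kappa>\<close> forces \<open>\<kappa> > 0\<close>, the value 0 being excluded
    because \<open>1 / 0 = 0\<close> for reals.\<close>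
  have pos: "\<kappa> > 0" if "a = ereal (1 / \<kappa>)" "a > 0" for \<kappa> a
    using that by simp
  show ?thesis
  proof (intro conjI allI impI)
    show "1 / pb = kappa_bar_aut M X0 X1 Y0 Y1"
      unfolding kappa_bar_aut_def by (rule antisym[OF inverse_le_INF[OF pb aut'] INF_le_inverse[OF pb aut]])
    show "kappa_bar_aut M X0 X1 Y0 Y1 \<le> kappa_bar M X0 X1 Y0 Y1"
      unfolding kappa_bar_aut_def kappa_bar_def
      by (rule INF_superset_mono) (auto simp: interlinks_def autonomously_interlinks_def)
    show "kappa_bar M X0 X1 Y0 Y1 \<le> 1 / pb_stab"
      unfolding kappa_bar_def by (rule INF_le_inverse[OF pbs stab])
    show "interlinks M \<kappa> Y0 Y1 X0 X1" if "pb_stab = ereal (1 / \<kappa>) \<and> pb_stab > 0" for \<kappa>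
      by (rule stab[OF pos[OF conjunct1[OF that] conjunct2[OF that]] eq_refl[OF conjunct1[OF that, symmetric]]])
    show "autonomously_interlinks M \<kappa> Y0 Y1 X0 X1" if "pb = ereal (1 / \<kappa>) \<and> pb > 0" for \<kappa>
      by (rule aut[OF pos[OF conjunct1[OF that] conjunct2[OF that]] eq_refl[OF conjunct1[OF that, symmetric]]])
  qed
qed

end
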